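(* Consider the infinite-horizon symmetric Cobb–Douglas/Lévy economy described in the context, with social planner weights $\gamma^i=\frac1n$ for every $i=1,\dots,n$. Define $$\gamma(t):=\frac1A\Big[\Big(\frac{\alpha+\beta}{\alpha}\Big)\mathcal{E}_x(t)\inf_{0\le s\le t}\Big(\mathcal{E}_c^{\frac{\beta(1-\alpha)}{1-\alpha-\beta}}(s)\,\mathcal{E}_x^{\frac{\alpha\beta}{1-\alpha-\beta}}(s)\Big)\Big]^{-\frac1{1-\alpha}},\qquad\theta(t):=\sup_{0\le s\le t}\Big(\mathcal{E}_c^{-\frac{1-\alpha}{1-\alpha-\beta}}(s)\,\mathcal{E}_x^{-\frac{\alpha}{1-\alpha-\beta}}(s)\Big),$$ $$l_0:=\frac{nw_o}{E\big[\int_0^\infty\psi_x(t)\gamma(t)\,dt+\int_0^\infty\psi_c(t)\,d\theta(t)\big]},\qquad A:=E\Big[\int_0^\infty\delta e^{-ru}\inf_{0\le s\le u}\Big(\mathcal{E}_c(s)\,\mathcal{E}_x^{-\frac{\alpha}{1-\alpha}}(u-s)\Big)du\Big],$$ with $\delta:=\frac\beta\alpha\big(\frac{\alpha+\beta}\alpha\big)^{\frac1{\alpha-1}}$. Then the social planner's optimal solution is such that $$C_*(t)=l_0\theta(t),\qquad x^i_*(t)=\frac1nl_0\gamma(t),\quad i=1,\dots,n,$$ with Lagrange multiplier $$\lambda_*=\frac1{n^\alpha}A^{1-\alpha}l_0^{\alpha+\beta-1}.$$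
   Context: Economy. Horizon $T=\infty$, $n\ge1$ agents, filtered probability space $(\Omega,\mathcal{F},\{\mathcal{F}_t\},P)$ satisfying the usual conditions, constant discount rate $r$. All agents have the same initial wealth $w^i=w_o>0$ and utility $u^i(x,c)=\frac{x^\alpha c^\beta}{\alpha+\beta}$ with $\alpha,\beta\in(0,1)$, $\alpha+\beta<1$. Prices: $\psi_x(t)=e^{-rt}\mathcal{E}_x(t)$, $\mathcal{E}_x(t)=e^{Z_x(t)-\pi_x(1)t}$, and $\psi_c(t)=e^{-rt}\mathcal{E}_c(t)$, $\mathcal{E}_c(t)=e^{Z_c(t)-\pi_c(1)t}$, where $Z_x,Z_c$ are independent Lévy processes (with respect to $\{\mathcal{F}_t\}$) whose Laplace exponents $\pi_x(\xi):=\log E[e^{\xi Z_x(1)}]$, $\pi_c(\xi):=\log E[e^{\xi Z_c(1)}]$ are well defined for all $\xi\in\mathbb{R}$. The rate satisfies $$r>\max\Big\{0,\ \tfrac{\alpha}{1-\alpha}\pi_x(1),\ \tfrac{\alpha}{1-\alpha}\pi_x(1)+\pi_x\big(-\tfrac{2\alpha}{1-\alpha}\big),\ \hat\pi(2)+\tfrac{\alpha}{1-\alpha}\pi_x(1),\ \widetilde\pi(1)\Big\},$$ where $$\hat\pi(2)=\tfrac{2}{1-\alpha-\beta}\big[\beta\pi_c(1)+\tfrac{\alpha\beta}{1-\alpha}\pi_x(1)\big]+\pi_c\big(-\tfrac{2\beta}{1-\alpha-\beta}\big)+\pi_x\big(-\tfrac{2\alpha\beta}{(1-\alpha)(1-\alpha-\beta)}\big),$$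 $$\widetilde\pi(1)=\tfrac1{1-\alpha-\beta}\big[\beta\pi_c(1)+\alpha\pi_x(1)\big]+\pi_c\big(-\tfrac{\beta}{1-\alpha-\beta}\big)+\pi_x\big(-\tfrac{\alpha}{1-\alpha-\beta}\big).$$ Integrals $\int_0^\infty(\cdot)\,dC(t)$ against nondecreasing right-continuous $C$ include the point mass $C(0)$ at $t=0$ (convention $C(0-)=0$); the same for $d\theta$. Social planner problem: maximize $\sum_{i=1}^n\gamma^iE[\int_0^\infty e^{-rt}u^i(x^i(t),C(t))dt]$, $C:=\sum_iC^i$, over nonnegative optional $(x^1,\dots,x^n,C^1,\dots,C^n)$ with each $C^i$ right-continuous, nondecreasing, $C^i(0-)=0$, and $\sum_{i=1}^nE[\int_0^\infty\psi_x(t)x^i(t)dt+\int_0^\infty\psi_c(t)dC^i(t)]\le nw_o$. $C_*$ denotes the optimal aggregate contribution and $x^i_*$ the optimal consumptions. The Lagrange multiplier $\lambda_*>0$ is the one for which the first order conditions hold: the budget constraint binds; $E[\int_\tau^\infty e^{-rt}\sum_i\gamma^iu^i_c(x^i_*(t),C_*(t))dt|\mathcal{F}_\tau]\le\lambda_*\psi_c(\tau)$ a.s. for all stopping times $\tau$; $E[\int_0^\infty(E[\int_t^\infty e^{-rs}\sum_i\gamma^iu^i_c(x^i_*(s),C_*(s))ds|\mathcal{F}_t]-\lambda_*\psi_c(t))dC_*(t)]=0$; and $\gamma^ie^{-rt}u^i_x(x^i_*(t),C_*(t))=\lambda_*\psi_x(t)$ $P\otimes dt$-a.e. *)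

theory Defs
  imports "HOL-Probability.Probability"
begin

text \<open>Time is represented by type \<^typ>\<open>real\<close>, and only times \<open>t \<ge> 0\<close> matter: values of paths,
  processes and filtrations at negative times are never constrained and never used.
  Expectations and integrals of nonnegative quantities are \<^const>\<open>nn_integral\<close>s with values
  in \<^typ>\<open>ennreal\<close>, so that \<open>+\<infinity>\<close> is an admissible value.\<close>

section \<open>Filtrations and processes\<close>

definition filtered_space :: "'a measure \<Rightarrow> (real \<Rightarrow> 'a measure) \<Rightarrow> bool" where
  "filtered_space M F \<longleftrightarrow>
     prob_space M \<and>
     (\<forall>t\<ge>0. subalgebra M (F t)) \<and>
     (\<forall>s t. 0 \<le> s \<longrightarrow> s \<le> t \<longrightarrow> sets (F s) \<subseteq> sets (F t))"

definition usual_conditions :: "'a measure \<Rightarrow> (real \<Rightarrow> 'a measure) \<Rightarrow> bool" where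
  "usual_conditions M F \<longleftrightarrow>
     complete_measure M \<and>
     null_sets M \<subseteq> sets (F 0) \<and>
     (\<forall>t\<ge>0. sets (F t) = (\<Inter>s\<in>{t<..}. sets (F s)))"

definition cadlag :: "(real \<Rightarrow> real) \<Rightarrow> bool" where
  "cadlag f \<longleftrightarrow>
     (\<forall>t\<ge>0. continuous (at_right t) f) \<and>
     (\<forall>t>0. \<exists>l. (f \<longlongrightarrow> l) (at_left t))"

definition adapted :: "(real \<Rightarrow> 'a measure) \<Rightarrow> (real \<Rightarrow> 'a \<Rightarrow> real) \<Rightarrow> bool" where
  "adapted F X \<longleftrightarrow> (\<forall>t\<ge>0. X t \<in> borel_measurable (F t))"

definition cadlag_adapted ::
  "'a measure \<Rightarrow> (real \<Rightarrow> 'a measure) \<Rightarrow> (real \<Rightarrow> 'a \<Rightarrow> real) \<Rightarrow> bool" where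
  "cadlag_adapted M F X \<longleftrightarrow> adapted F X \<and> (\<forall>\<omega>\<in>space M. cadlag (\<lambda>t. X t \<omega>))"

text \<open>The \<open>\<sigma>\<close>-algebra on \<open>[0,\<infinity>) \<times> \<Omega>\<close> generated by the adapted processes with cadlag paths.\<close>

definition optional_algebra :: "'a measure \<Rightarrow> (real \<Rightarrow> 'a measure) \<Rightarrow> (real \<times> 'a) measure" where
  "optional_algebra M F =
     sigma ({0..} \<times> space M)
       {{(t, \<omega>). 0 \<le> t \<and> \<omega> \<in> space M \<and> X t \<omega> \<in> B} | X B.
          cadlag_adapted M F X \<and> B \<in> sets borel}"

definition optional :: "'a measure \<Rightarrow> (real \<Rightarrow> 'a measure) \<Rightarrow> (real \<Rightarrow> 'a \<Rightarrow> real) \<Rightarrow> bool" where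
  "optional M F X \<longleftrightarrow> (\<lambda>(t, \<omega>). X t \<omega>) \<in> borel_measurable (optional_algebra M F)"

text \<open>Stopping times may take the value \<open>\<infinity>\<close>, whence not the library's \<^const>\<open>stopping_time\<close>,
  whose values have the same type as the index of the filtration.\<close>

definition ext_stopping_time ::
  "'a measure \<Rightarrow> (real \<Rightarrow> 'a measure) \<Rightarrow> ('a \<Rightarrow> ennreal) \<Rightarrow> bool" where
  "ext_stopping_time M F \<tau> \<longleftrightarrow> (\<forall>t\<ge>0. {\<omega> \<in> space M. \<tau> \<omega> \<le> ennreal t} \<in> sets (F t))"

definition stopped_algebra ::
  "'a measure \<Rightarrow> (real \<Rightarrow> 'a measure) \<Rightarrow> ('a \<Rightarrow> ennreal) \<Rightarrow> 'a measure" where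
  "stopped_algebra M F \<tau> =
     sigma (space M) {A \<in> sets M. \<forall>t\<ge>0. {\<omega> \<in> A. \<tau> \<omega> \<le> ennreal t} \<in> sets (F t)}"

section \<open>Levy processes\<close>

definition levy_process ::
  "'a measure \<Rightarrow> (real \<Rightarrow> 'a measure) \<Rightarrow> (real \<Rightarrow> 'a \<Rightarrow> real) \<Rightarrow> bool" where
  "levy_process M F Z \<longleftrightarrow>
     adapted F Z \<and>
     (AE \<omega> in M. Z 0 \<omega> = 0 \<and> cadlag (\<lambda>t. Z t \<omega>)) \<and>
     (\<forall>s t. 0 \<le> s \<longrightarrow> s \<le> t \<longrightarrow>
        prob_space.indep_set M (sets (F s))
          {(\<lambda>\<omega>. Z t \<omega> - Z s \<omega>) -` B \<inter> space M | B. B \<in> sets borel} \<and>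
        distr M borel (\<lambda>\<omega>. Z t \<omega> - Z s \<omega>) = distr M borel (Z (t - s)))"

definition independent_processes ::
  "'a measure \<Rightarrow> (real \<Rightarrow> 'a \<Rightarrow> real) \<Rightarrow> (real \<Rightarrow> 'a \<Rightarrow> real) \<Rightarrow> bool" where
  "independent_processes M X Y \<longleftrightarrow>
     prob_space.indep_var M
       (\<Pi>\<^sub>M t\<in>{0..}. borel) (\<lambda>\<omega>. \<lambda>t\<in>{0..}. X t \<omega>)
       (\<Pi>\<^sub>M t\<in>{0..}. borel) (\<lambda>\<omega>. \<lambda>t\<in>{0..}. Y t \<omega>)"

definition exp_moments :: "'a measure \<Rightarrow> (real \<Rightarrow> 'a \<Rightarrow> real) \<Rightarrow> bool" where
  "exp_moments M Z \<longleftrightarrow> (\<forall>\<xi>::real. integrable M (\<lambda>\<omega>. exp (\<xi> * Z 1 \<omega>)))"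

definition laplace_exponent :: "'a measure \<Rightarrow> (real \<Rightarrow> 'a \<Rightarrow> real) \<Rightarrow> real \<Rightarrow> real" where
  "laplace_exponent M Z \<xi> = ln (\<integral>\<omega>. exp (\<xi> * Z 1 \<omega>) \<partial>M)"

section \<open>The social planner problem\<close>

text \<open>The measure \<open>dC\<close> of a nondecreasing right-continuous \<open>C\<close> on \<open>[0,\<infinity>)\<close> with \<open>C(0-) = 0\<close>:
  it has the point mass \<open>C(0)\<close> at \<open>0\<close> and does not charge \<open>(-\<infinity>,0)\<close>.\<close>

definition stieltjes :: "(real \<Rightarrow> real) \<Rightarrow> real measure" where
  "stieltjes C = interval_measure (\<lambda>t. if t < 0 then 0 else C t)"

definition aggregate :: "nat \<Rightarrow> (nat \<Rightarrow> real \<Rightarrow> 'a \<Rightarrow> real) \<Rightarrow> real \<Rightarrow> 'a \<Rightarrow> real" where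
  "aggregate n C t \<omega> = (\<Sum>i=1..n. C i t \<omega>)"

text \<open>Agents are numbered \<open>1..n\<close>; \<open>x i\<close> and \<open>C i\<close> are the private consumption and the cumulative
  contribution of agent \<open>i\<close>. The condition \<open>0 \<le> C i 0 \<omega>\<close> is monotonicity at time \<open>0\<close>,
  given \<open>C(0-) = 0\<close>.\<close>

definition admissible ::
  "'a measure \<Rightarrow> (real \<Rightarrow> 'a measure) \<Rightarrow> nat \<Rightarrow>
   (nat \<Rightarrow> real \<Rightarrow> 'a \<Rightarrow> real) \<Rightarrow> (nat \<Rightarrow> real \<Rightarrow> 'a \<Rightarrow> real) \<Rightarrow> bool" where
  "admissible M F n x C \<longleftrightarrow>
     (\<forall>i\<in>{1..n}.
        optional M F (x i) \<and> optional M F (C i) \<and>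
        (\<forall>\<omega>\<in>space M.
           (\<forall>t\<ge>0. 0 \<le> x i t \<omega>) \<and>
           0 \<le> C i 0 \<omega> \<and>
           mono_on {0..} (\<lambda>t. C i t \<omega>) \<and>
           (\<forall>t\<ge>0. continuous (at_right t) (\<lambda>s. C i s \<omega>))))"

definition cost ::
  "'a measure \<Rightarrow> nat \<Rightarrow> (real \<Rightarrow> 'a \<Rightarrow> real) \<Rightarrow> (real \<Rightarrow> 'a \<Rightarrow> real) \<Rightarrow>
   (nat \<Rightarrow> real \<Rightarrow> 'a \<Rightarrow> real) \<Rightarrow> (nat \<Rightarrow> real \<Rightarrow> 'a \<Rightarrow> real) \<Rightarrow> ennreal" where
  "cost M n \<psi>x \<psi>c x C =
     (\<Sum>i=1..n. \<integral>\<^sup>+\<omega>.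
        (\<integral>\<^sup>+t\<in>{0..}. ennreal (\<psi>x t \<omega> * x i t \<omega>) \<partial>lborel) +
        (\<integral>\<^sup>+t\<in>{0..}. ennreal (\<psi>c t \<omega>) \<partial>stieltjes (\<lambda>t. C i t \<omega>)) \<partial>M)"

definition feasible ::
  "'a measure \<Rightarrow> (real \<Rightarrow> 'a measure) \<Rightarrow> nat \<Rightarrow>
   (real \<Rightarrow> 'a \<Rightarrow> real) \<Rightarrow> (real \<Rightarrow> 'a \<Rightarrow> real) \<Rightarrow> real \<Rightarrow>
   (nat \<Rightarrow> real \<Rightarrow> 'a \<Rightarrow> real) \<Rightarrow> (nat \<Rightarrow> real \<Rightarrow> 'a \<Rightarrow> real) \<Rightarrow> bool" where
  "feasible M F n \<psi>x \<psi>c W x C \<longleftrightarrow>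
     admissible M F n x C \<and> cost M n \<psi>x \<psi>c x C \<le> ennreal W"

definition welfare ::
  "'a measure \<Rightarrow> nat \<Rightarrow> real \<Rightarrow> (nat \<Rightarrow> real \<Rightarrow> real \<Rightarrow> real) \<Rightarrow> (nat \<Rightarrow> real) \<Rightarrow>
   (nat \<Rightarrow> real \<Rightarrow> 'a \<Rightarrow> real) \<Rightarrow> (nat \<Rightarrow> real \<Rightarrow> 'a \<Rightarrow> real) \<Rightarrow> ennreal" where
  "welfare M n r u wt x C =
     (\<Sum>i=1..n. ennreal (wt i) *
        (\<integral>\<^sup>+\<omega>. (\<integral>\<^sup>+t\<in>{0..}.
           ennreal (exp (- r * t) * u i (x i t \<omega>) (aggregate n C t \<omega>)) \<partial>lborel) \<partial>M))"

definition planner_optimal ::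
  "'a measure \<Rightarrow> (real \<Rightarrow> 'a measure) \<Rightarrow> nat \<Rightarrow> real \<Rightarrow>
   (nat \<Rightarrow> real \<Rightarrow> real \<Rightarrow> real) \<Rightarrow> (nat \<Rightarrow> real) \<Rightarrow>
   (real \<Rightarrow> 'a \<Rightarrow> real) \<Rightarrow> (real \<Rightarrow> 'a \<Rightarrow> real) \<Rightarrow> real \<Rightarrow>
   (nat \<Rightarrow> real \<Rightarrow> 'a \<Rightarrow> real) \<Rightarrow> (nat \<Rightarrow> real \<Rightarrow> 'a \<Rightarrow> real) \<Rightarrow> bool" where
  "planner_optimal M F n r u wt \<psi>x \<psi>c W x C \<longleftrightarrow>
     feasible M F n \<psi>x \<psi>c W x C \<and>
     (\<forall>x' C'. feasible M F n \<psi>x \<psi>c W x' C' \<longrightarrow>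
        welfare M n r u wt x' C' \<le> welfare M n r u wt x C)"

section \<open>First order conditions and Lagrange multiplier\<close>

definition marginal_C ::
  "nat \<Rightarrow> real \<Rightarrow> (nat \<Rightarrow> real \<Rightarrow> real \<Rightarrow> real) \<Rightarrow> (nat \<Rightarrow> real) \<Rightarrow>
   (nat \<Rightarrow> real \<Rightarrow> 'a \<Rightarrow> real) \<Rightarrow> (nat \<Rightarrow> real \<Rightarrow> 'a \<Rightarrow> real) \<Rightarrow> real \<Rightarrow> 'a \<Rightarrow> real" where
  "marginal_C n r u wt x C t \<omega> =
     exp (- r * t) *
       (\<Sum>i=1..n. wt i * deriv (\<lambda>c. u i (x i t \<omega>) c) (aggregate n C t \<omega>))"

definition future_marginal ::
  "nat \<Rightarrow> real \<Rightarrow> (nat \<Rightarrow> real \<Rightarrow> real \<Rightarrow> real) \<Rightarrow> (nat \<Rightarrow> real) \<Rightarrow>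
   (nat \<Rightarrow> real \<Rightarrow> 'a \<Rightarrow> real) \<Rightarrow> (nat \<Rightarrow> real \<Rightarrow> 'a \<Rightarrow> real) \<Rightarrow> ennreal \<Rightarrow> 'a \<Rightarrow> ennreal" where
  "future_marginal n r u wt x C \<tau> \<omega> =
     (\<integral>\<^sup>+t\<in>{t. 0 \<le> t \<and> \<tau> \<le> ennreal t}. ennreal (marginal_C n r u wt x C t \<omega>) \<partial>lborel)"

text \<open>The four first order conditions, in this order: binding budget; the inequality at all
  stopping times (on \<open>\<tau> = \<infinity>\<close> both sides vanish); the flat-off condition; the pointwise
  condition for consumption. In the flat-off condition the process
  \<open>t \<mapsto> E[\<integral>\<^sub>t\<^sup>\<infinity> \<dots> ds | F\<^sub>t]\<close> is represented by its cadlag version \<open>\<Phi>\<close>, unique up to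
  indistinguishability, and the vanishing of the \<open>P \<otimes> dC\<close>-integral of \<open>\<Phi> - \<lambda> \<psi>\<^sub>c\<close> is spelled out
  as equality and finiteness of the integrals of its positive and negative parts.\<close>

definition first_order_conditions ::
  "'a measure \<Rightarrow> (real \<Rightarrow> 'a measure) \<Rightarrow> nat \<Rightarrow> real \<Rightarrow>
   (nat \<Rightarrow> real \<Rightarrow> real \<Rightarrow> real) \<Rightarrow> (nat \<Rightarrow> real) \<Rightarrow>
   (real \<Rightarrow> 'a \<Rightarrow> real) \<Rightarrow> (real \<Rightarrow> 'a \<Rightarrow> real) \<Rightarrow> real \<Rightarrow>
   (nat \<Rightarrow> real \<Rightarrow> 'a \<Rightarrow> real) \<Rightarrow> (nat \<Rightarrow> real \<Rightarrow> 'a \<Rightarrow> real) \<Rightarrow> real \<Rightarrow> bool" where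
  "first_order_conditions M F n r u wt \<psi>x \<psi>c W x C lam \<longleftrightarrow>
     cost M n \<psi>x \<psi>c x C = ennreal W \<and>
     (\<forall>\<tau>. ext_stopping_time M F \<tau> \<longrightarrow>
        (AE \<omega> in M. \<tau> \<omega> < \<infinity> \<longrightarrow>
           nn_cond_exp M (stopped_algebra M F \<tau>)
             (\<lambda>\<omega>'. future_marginal n r u wt x C (\<tau> \<omega>') \<omega>') \<omega>
           \<le> ennreal (lam * \<psi>c (enn2real (\<tau> \<omega>)) \<omega>))) \<and>
     (\<exists>\<Phi>. cadlag_adapted M F \<Phi> \<and>
        (\<forall>t\<ge>0. AE \<omega> in M. 0 \<le> \<Phi> t \<omega> \<and>
           ennreal (\<Phi> t \<omega>) =
             nn_cond_exp M (F t) (future_marginal n r u wt x C (ennreal t)) \<omega>) \<and>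
        (\<integral>\<^sup>+\<omega>. (\<integral>\<^sup>+t\<in>{0..}. ennreal (\<Phi> t \<omega> - lam * \<psi>c t \<omega>)
                 \<partial>stieltjes (\<lambda>t. aggregate n C t \<omega>)) \<partial>M)
        = (\<integral>\<^sup>+\<omega>. (\<integral>\<^sup>+t\<in>{0..}. ennreal (lam * \<psi>c t \<omega> - \<Phi> t \<omega>)
                 \<partial>stieltjes (\<lambda>t. aggregate n C t \<omega>)) \<partial>M) \<and>
        (\<integral>\<^sup>+\<omega>. (\<integral>\<^sup>+t\<in>{0..}. ennreal (lam * \<psi>c t \<omega> - \<Phi> t \<omega>)
                 \<partial>stieltjes (\<lambda>t. aggregate n C t \<omega>)) \<partial>M) < \<infinity>) \<and>
     (\<forall>i\<in>{1..n}. AE (\<omega>, t) in M \<Otimes>\<^sub>M lborel. 0 \<le> t \<longrightarrow>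
        wt i * exp (- r * t) * deriv (\<lambda>y. u i y (aggregate n C t \<omega>)) (x i t \<omega>)
        = lam * \<psi>x t \<omega>)"

definition cobb_douglas :: "real \<Rightarrow> real \<Rightarrow> real \<Rightarrow> real \<Rightarrow> real" where
  "cobb_douglas \<alpha> \<beta> x c = x powr \<alpha> * c powr \<beta> / (\<alpha> + \<beta>)"

end

theory Submission
  imports Defs "HOL-Real_Asymp.Real_Asymp"
begin

text \<open>Put \<open>X = log E\<^sub>x\<close>, \<open>Y = log E\<^sub>c\<close>, \<open>a = \<alpha>/(1-\<alpha>)\<close> and \<open>g = Y + aX\<close>. At the claimed optimum the marginal
  utility of the contribution is a constant times \<open>exp (-rt - aX(t) + inf\<^bsub>s\<le>t\<^esub> g(s))\<close>. By the strong Markov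
  property its conditional expected integral after a stopping time \<open>\<tau>\<close> is at most \<open>\<lambda>\<^sub>* \<psi>\<^sub>c(\<tau>)\<close>, with equality
  where \<open>g\<close> attains its running infimum; the constant is \<open>E[J]\<close>, which a time reversal of \<open>X\<close> identifies
  with \<open>A/\<delta>\<close>. The time change \<open>y \<mapsto> inf {t. C(t) \<ge> y}\<close> carries this inequality over to every contribution
  \<open>C\<close>, and \<open>\<theta>\<close> increases only where the infimum is attained. Since utility lies below its tangent at the
  claimed optimum, which is the weighted AM-GM inequality, this bounds the welfare of every feasible plan; the
  equality case gives uniqueness.\<close>

section \<open>Right-continuous paths\<close>

text \<open>The hypotheses describe the two processes one at a time: each has increments independent
  of the past, and the processes are independent of each other. The Markov property of the pair
  needs more, namely that the joint increment is independent of the past. This is derived first, and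
  it also makes \<open>g\<close> a Levy process. As only laws of increments and right continuity of
  paths are at hand, each distributional identity is proved for a walk on a dyadic grid and for
  exponentials cut off at a level \<open>L\<close>; the grid is refined by dominated convergence and
  \<open>L\<close> is released by monotone convergence.

  Both halves of the cost of the claimed plan are multiples of one integral \<open>Q\<close>, whose
  integrand couples \<open>X\<close> with the running infimum. The bound
  \<open>x * y \<le> x\<^sup>2 + y\<^sup>2\<close> separates the two at the price of doubled
  exponents; hence the 2 in \<open>\<pi>hat2\<close> and in the third bound on \<open>r\<close>. The
  moment of the infimum then follows from a maximal inequality for the exponential supermartingale
  of \<open>g\<close>. In that inequality a little room is lost, which the strict bounds on
  \<open>r\<close> provide.\<close>

definition dyadic_above :: "nat => real => real" where
  "dyadic_above k t = (real_of_int \<lfloor>2 ^ k * t\<rfloor> + 1) / 2 ^ k"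

text \<open>Strictly above, even when \<open>t\<close> is itself a grid point. The points therefore
  approach \<open>t\<close> through \<open>at_right t\<close>, and a stopping time rounded up in
  this way has a value that is known by the rounded time.\<close>

lemma dyadic_above_bounds: "t < dyadic_above k t" "dyadic_above k t \<le> t + (1 / 2) ^ k"
proof -
  have "2 ^ k * t < real_of_int \<lfloor>2 ^ k * t\<rfloor> + 1" "real_of_int \<lfloor>2 ^ k * t\<rfloor> \<le> 2 ^ k * t"
    by linarith+
  then show "t < dyadic_above k t" "dyadic_above k t \<le> t + (1 / 2) ^ k"
    by (auto simp: dyadic_above_def field_simps)
qed

lemma dyadic_above_tendsto: "filterlim (\<lambda>k. dyadic_above k t) (at_right t) sequentially"
proof -
  have *: "(\<lambda>k. t + (1 / 2) ^ k) \<longlonglongrightarrow> t + 0"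
    by (intro tendsto_add tendsto_const LIMSEQ_realpow_zero) auto
  have "(\<lambda>k. dyadic_above k t) \<longlonglongrightarrow> t"
    by (rule tendsto_sandwich[OF _ _ tendsto_const])
      (use * dyadic_above_bounds in \<open>auto simp: less_imp_le\<close>)
  then show ?thesis
    unfolding filterlim_at
    by (auto simp: dyadic_above_bounds less_imp_neq[OF dyadic_above_bounds(1), symmetric])
qed

lemma dyadic_above_tendsto_right_continuous:
  fixes f :: "real => real"
  assumes "continuous (at_right t) f"
  shows "(\<lambda>k. f (dyadic_above k t)) \<longlonglongrightarrow> f t"
  using assms dyadic_above_tendsto[of t] unfolding continuous_within
  by (rule filterlim_compose)

text \<open>For a fixed mesh the floor of \<open>2 ^ k * t\<close> selects one of countably many
  measurable maps, and right continuity passes to the limit in \<open>k\<close>. Continuity is asked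
  at every real time, which is why processes below either vanish at negative times or are clamped by
  \<open>max 0\<close>.\<close>

lemma right_continuous_jointly_measurable:
  fixes X :: "real => 'a => real"
  assumes m: "\<And>t. X t \<in> borel_measurable N"
    and rc: "\<And>w t. w \<in> space N ==> continuous (at_right t) (\<lambda>s. X s w)"
  shows "(\<lambda>(w, t). X t w) \<in> borel_measurable (N \<Otimes>\<^sub>M borel)"
proof (rule borel_measurable_LIMSEQ_real)
  fix z :: "'a \<times> real" assume "z \<in> space (N \<Otimes>\<^sub>M borel)"
  then show "(\<lambda>k. X (dyadic_above k (snd z)) (fst z)) \<longlonglongrightarrow> (case z of (w, t) => X t w)"
    by (cases z) (auto simp: space_pair_measure intro!: dyadic_above_tendsto_right_continuous rc)
next
  fix k :: nat
  have "(\<lambda>z. (\<lambda>i z. X ((real_of_int i + 1) / 2 ^ k) (fst z)) \<lfloor>(2::real) ^ k * snd z\<rfloor> z)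
     \<in> borel_measurable (N \<Otimes>\<^sub>M borel)"
    by (rule measurable_compose_countable) (use m in measurable)
  then show "(\<lambda>z. X (dyadic_above k (snd z)) (fst z)) \<in> borel_measurable (N \<Otimes>\<^sub>M borel)"
    by (simp add: dyadic_above_def)
qed

lemma right_continuous_measurable_at:
  fixes X :: "real => 'a => real"
  assumes m: "\<And>t. X t \<in> borel_measurable N"
    and rc: "\<And>w t. w \<in> space N ==> continuous (at_right t) (\<lambda>s. X s w)"
    and h: "h \<in> measurable N' N" and T: "T \<in> borel_measurable N'"
  shows "(\<lambda>z. X (T z) (h z)) \<in> borel_measurable N'"
proof -
  have "(\<lambda>z. (h z, T z)) \<in> measurable N' (N \<Otimes>\<^sub>M borel)"
    using h T by measurable
  from measurable_compose[OF this right_continuous_jointly_measurable[of X, OF m rc]]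
  show ?thesis by simp
qed

section \<open>Cadlag functions\<close>

lemma cadlag_right: "cadlag f ==> 0 \<le> t ==> continuous (at_right t) f"
  by (simp add: cadlag_def)

lemma cadlag_const: "cadlag (\<lambda>t. c)"
  by (auto simp: cadlag_def)

lemma cadlag_ident: "cadlag (\<lambda>t. t)"
  by (auto simp: cadlag_def intro!: exI tendsto_ident_at)

lemma cadlag_compose2:
  assumes h: "continuous_on UNIV (\<lambda>(x, y). h x y)" and f: "cadlag f" and g: "cadlag g"
  shows "cadlag (\<lambda>t. h (f t) (g t))"
proof -
  have lim: "((\<lambda>t. h (f t) (g t)) \<longlongrightarrow> h a b) F"
    if "(f \<longlongrightarrow> a) F" "(g \<longlongrightarrow> b) F" for a b F
    using continuous_on_tendsto_compose[OF h tendsto_Pair[OF that]] by simp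
  show ?thesis
    unfolding cadlag_def
  proof (intro conjI allI impI)
    fix t :: real assume "0 \<le> t"
    then show "continuous (at_right t) (\<lambda>t. h (f t) (g t))"
      using f g unfolding cadlag_def continuous_within by (intro lim) auto
  next
    fix t :: real assume "0 < t"
    with f g obtain a b where "(f \<longlongrightarrow> a) (at_left t)" "(g \<longlongrightarrow> b) (at_left t)"
      unfolding cadlag_def by blast
    from lim[OF this] show "\<exists>l. ((\<lambda>t. h (f t) (g t)) \<longlongrightarrow> l) (at_left t)" by blast
  qed
qed

lemma cadlag_compose:
  assumes "continuous_on UNIV h" and "cadlag f"
  shows "cadlag (\<lambda>t. h (f t))"
  by (rule cadlag_compose2[of "\<lambda>x y. h x" f f])
    (use assms in \<open>auto simp: case_prod_beta intro!: continuous_intros continuous_on_compose2[of UNIV h]\<close>)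

text \<open>Bisection: boundedness on the part of an interval inside \<open>{0..T}\<close> is
  inherited by the union of adjacent intervals, and it holds near each point because of the
  one-sided limits there.\<close>

lemma cadlag_bounded:
  assumes "cadlag f"
  shows "\<exists>B. \<forall>t\<in>{0..T}. \<bar>f t\<bar> \<le> B"
proof (cases "0 \<le> T")
  case True
  define P where "P a b \<longleftrightarrow> (\<exists>B. \<forall>t\<in>{a..b} \<inter> {0..T}. \<bar>f t\<bar> \<le> B)" for a b :: real
  have "P 0 T"
  proof (rule Bolzano[OF True])
    fix a b c assume "P a b" "P b c" "a \<le> b" "b \<le> c"
    then obtain B1 B2 where B: "\<forall>t\<in>{a..b} \<inter> {0..T}. \<bar>f t\<bar> \<le> B1" "\<forall>t\<in>{b..c} \<inter> {0..T}. \<bar>f t\<bar> \<le> B2"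
      unfolding P_def by blast
    have "\<forall>t\<in>{a..c} \<inter> {0..T}. \<bar>f t\<bar> \<le> max B1 B2"
    proof
      fix t assume t: "t \<in> {a..c} \<inter> {0..T}"
      show "\<bar>f t\<bar> \<le> max B1 B2"
      proof (cases "t \<le> b")
        case True
        with t B(1) have "\<bar>f t\<bar> \<le> B1" by auto
        then show ?thesis by simp
      next
        case False
        with t B(2) have "\<bar>f t\<bar> \<le> B2" by auto
        then show ?thesis by simp
      qed
    qed
    then show "P a c" unfolding P_def by blast
  next
    fix x assume x: "0 \<le> x" "x \<le> T"
    have "(f \<longlongrightarrow> f x) (at_right x)"
      using assms x unfolding cadlag_def continuous_within by simp
    then have "eventually (\<lambda>s. dist (f s) (f x) < 1) (at_right x)"
      by (rule tendstoD) simp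
    then obtain b where b: "b > x" "\<And>s. x < s ==> s < b ==> dist (f s) (f x) < 1"
      unfolding eventually_at_right_field by blast
    \<comment> \<open>At \<open>x = 0\<close> there is no left limit; the guard
      \<open>0 \<le> s\<close> makes any \<open>l\<close> acceptable.\<close>
    obtain l where l: "\<exists>a<x. \<forall>s. a < s --> s < x --> 0 \<le> s --> dist (f s) l < 1"
    proof (cases "x = 0")
      case True
      show ?thesis by (rule that[of 0]) (auto intro!: exI[of _ "x - 1"] simp: True)
    next
      case False
      with x assms obtain l where "(f \<longlongrightarrow> l) (at_left x)" unfolding cadlag_def by fastforce
      then have "eventually (\<lambda>s. dist (f s) l < 1) (at_left x)"
        by (rule tendstoD) simp
      then show ?thesis
        by (intro that[of l]) (auto simp: eventually_at_left_field)
    qed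
    then obtain a where a: "a < x" "\<And>s. a < s ==> s < x ==> 0 \<le> s ==> dist (f s) l < 1"
      by blast
    define B where "B = \<bar>f x\<bar> + \<bar>l\<bar> + 1"
    have bd: "\<bar>f s\<bar> \<le> B" if "a < s" "s < b" "0 \<le> s" for s
    proof -
      consider "s < x" | "s = x" | "s > x" by linarith
      then show ?thesis
        by cases (use a(2)[of s] b(2)[of s] that in \<open>auto simp: B_def dist_real_def\<close>)
    qed
    show "\<exists>d>0. \<forall>a b. a \<le> x \<and> x \<le> b \<and> b - a < d --> P a b"
    proof (intro exI conjI allI impI)
      show "0 < min (x - a) (b - x)" using a b by simp
      fix a' b' assume "a' \<le> x \<and> x \<le> b' \<and> b' - a' < min (x - a) (b - x)"
      then show "P a' b'" unfolding P_def by (intro exI[of _ B] ballI bd) auto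
    qed
  qed
  then show ?thesis unfolding P_def by simp
qed auto

lemma cadlag_bdd_below: "cadlag f ==> bdd_below (f ` {0..T})"
  using cadlag_bounded[of f T] by (auto simp: bdd_below_def abs_le_iff) (metis minus_le_iff)

text \<open>A rational \<open>p\<close> between the left limit and the value separates the path just
  before a jump from the path just after it; the sign \<open>s\<close> reduces downward jumps to
  upward ones. One \<open>p\<close> serves only countably many times, since a rational shortly after
  the jump determines it. The result is used in the time reversal, where a reversed path is
  continuous from the wrong side.\<close>

lemma cadlag_countable_jumps:
  fixes f :: "real => real"
  assumes "cadlag f"
  shows "countable {t. 0 < t \<and> \<not> continuous (at_left t) f}"
proof -
  define S where "S s p = {t. 0 < t \<and> (\<exists>e>0. (\<forall>x. t - e < x \<and> x < t --> s * f x < p) \<and>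
       (\<forall>x. t \<le> x \<and> x < t + e --> p < s * f x))}" for s p :: real
  have cS: "countable (S s p)" for s p
  proof -
    have "\<forall>t\<in>S s p. \<exists>q\<in>\<rat>. \<exists>e>0. t < q \<and> q < t + e \<and> (\<forall>x. t - e < x \<and> x < t --> s * f x < p) \<and>
       (\<forall>x. t \<le> x \<and> x < t + e --> p < s * f x)"
    proof
      fix t assume "t \<in> S s p"
      then obtain e where e: "e > 0" "\<forall>x. t - e < x \<and> x < t --> s * f x < p"
         "\<forall>x. t \<le> x \<and> x < t + e --> p < s * f x" unfolding S_def by blast
      obtain q where "q \<in> \<rat>" "t < q" "q < t + e" using Rats_dense_in_real[of t "t + e"] e by auto
      with e show "\<exists>q\<in>\<rat>. \<exists>e>0. t < q \<and> q < t + e \<and> (\<forall>x. t - e < x \<and> x < t --> s * f x < p) \<and>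
       (\<forall>x. t \<le> x \<and> x < t + e --> p < s * f x)" by blast
    qed
    then obtain q where q: "\<And>t. t \<in> S s p ==> q t \<in> \<rat> \<and> (\<exists>e>0. t < q t \<and> q t < t + e \<and>
       (\<forall>x. t - e < x \<and> x < t --> s * f x < p) \<and> (\<forall>x. t \<le> x \<and> x < t + e --> p < s * f x))"
      by metis
    have less: False if tt: "t \<in> S s p" "t' \<in> S s p" "q t = q t'" "t < t'" for t t'
    proof -
      obtain e where e: "e > 0" "t < q t" "q t < t + e" "\<forall>x. t \<le> x \<and> x < t + e --> p < s * f x"
        using q[OF tt(1)] by blast
      obtain e' where e': "e' > 0" "t' < q t'" "\<forall>x. t' - e' < x \<and> x < t' --> s * f x < p"
        using q[OF tt(2)] by blast
      \<comment> \<open>This point lies both just before \<open>t'\<close>, where the path is below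
        \<open>p\<close>, and between \<open>t\<close> and the common rational \<open>q t\<close>,
        where it is above.\<close>
      define x where "x = max t (t' - e' / 2)"
      have "s * f x < p" using e' tt by (auto simp: x_def)
      moreover have "p < s * f x" using e e' tt by (auto simp: x_def)
      ultimately show False by simp
    qed
    have "inj_on q (S s p)"
      by (rule inj_onI, rule ccontr) (metis less linorder_less_linear)
    moreover have "countable (q ` S s p)"
      by (rule countable_subset[OF _ countable_rat]) (use q in auto)
    ultimately show ?thesis using countable_image_inj_on by blast
  qed
  have "{t. 0 < t \<and> \<not> continuous (at_left t) f} \<subseteq> (\<Union>p\<in>\<rat>. S 1 p \<union> S (- 1) p)"
  proof
    fix t assume "t \<in> {t. 0 < t \<and> \<not> continuous (at_left t) f}"
    then have t: "0 < t" "\<not> (f \<longlongrightarrow> f t) (at_left t)" by (auto simp: continuous_within)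
    obtain l where l: "(f \<longlongrightarrow> l) (at_left t)" using assms t unfolding cadlag_def by blast
    have r: "(f \<longlongrightarrow> f t) (at_right t)" using assms t unfolding cadlag_def continuous_within by simp
    have ne: "l \<noteq> f t" using l t by auto
    have mem: "t \<in> S s p" if mm: "s * l < p" "p < s * f t" for s p
    proof -
      have "eventually (\<lambda>x. s * f x < p) (at_left t)"
        by (rule order_tendstoD(2)[OF tendsto_mult_left[OF l, of s] mm(1)])
      then obtain a where a: "a < t" "\<forall>x. a < x --> x < t --> s * f x < p"
        unfolding eventually_at_left_field by blast
      have "eventually (\<lambda>x. p < s * f x) (at_right t)"
        by (rule order_tendstoD(1)[OF tendsto_mult_left[OF r, of s] mm(2)])
      then obtain b where b: "b > t" "\<forall>x. t < x --> x < b --> p < s * f x"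
        unfolding eventually_at_right_field by blast
      show ?thesis unfolding S_def
      proof (intro CollectI conjI exI)
        show "0 < t" by fact
        show "0 < min (t - a) (b - t)" using a b by simp
        show "\<forall>x. t - min (t - a) (b - t) < x \<and> x < t --> s * f x < p" using a by auto
        show "\<forall>x. t \<le> x \<and> x < t + min (t - a) (b - t) --> p < s * f x"
          using b mm by (auto simp: order_le_less)
      qed
    qed
    consider "l < f t" | "f t < l" using ne by linarith
    then show "t \<in> (\<Union>p\<in>\<rat>. S 1 p \<union> S (- 1) p)"
    proof cases
      case 1
      then obtain p where "p \<in> \<rat>" "l < p" "p < f t" using Rats_dense_in_real by blast
      then show ?thesis using mem[of 1 p] by auto
    next
      case 2
      then obtain p where "p \<in> \<rat>" "f t < p" "p < l" using Rats_dense_in_real by blast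
      then show ?thesis using mem[of "-1" "-p"] by (auto intro!: bexI[of _ "-p"] Rats_minus_iff[THEN iffD2])
    qed
  qed
  moreover have "countable (\<Union>p\<in>\<rat>. S 1 p \<union> S (- 1) p)"
    using cS countable_rat by auto
  ultimately show ?thesis by (rule countable_subset)
qed

section \<open>Independent increments\<close>

text \<open>The identity map into the smaller \<sigma>-algebra is treated as a random variable.
  Independence of a \<sigma>-algebra then becomes a product law, and Fubini can integrate
  \<open>D\<close> out while the past is frozen.\<close>

lemma (in prob_space) indep_set_pair_distr:
  assumes sub: "subalgebra M G" and D: "D \<in> measurable M N"
    and ind: "indep_set (sets G) {D -` B \<inter> space M |B. B \<in> sets N}"
  shows "distr M (G \<Otimes>\<^sub>M N) (\<lambda>w. (w, D w)) = distr M G (\<lambda>w. w) \<Otimes>\<^sub>M distr M N D"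
proof -
  have id: "(\<lambda>w. w) \<in> measurable M G"
    using sub unfolding subalgebra_def by (auto simp: measurable_def)
  have spG: "space G = space M" using sub by (simp add: subalgebra_def)
  have idD: "(\<lambda>w. (w, D w)) \<in> measurable M (G \<Otimes>\<^sub>M N)"
    using id D by measurable
  interpret P: prob_space "distr M G (\<lambda>w. w)" by (rule prob_space_distr[OF id])
  interpret Q: prob_space "distr M N D" by (rule prob_space_distr[OF D])
  show ?thesis
  proof (rule pair_measure_eqI[symmetric])
    fix A B assume "A \<in> sets (distr M G (\<lambda>w. w))" "B \<in> sets (distr M N D)"
    then have A: "A \<in> sets G" and B: "B \<in> sets N" by auto
    have A': "A \<subseteq> space M" using sets.sets_into_space[OF A] spG by simp
    have "prob (A \<inter> (D -` B \<inter> space M)) = prob A * prob (D -` B \<inter> space M)"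
      using indep_setD[OF ind A] B by blast
    moreover have "(\<lambda>w. (w, D w)) -` (A \<times> B) \<inter> space M = A \<inter> (D -` B \<inter> space M)"
      "(\<lambda>w. w) -` A \<inter> space M = A" using A' by auto
    ultimately show "emeasure (distr M G (\<lambda>w. w)) A * emeasure (distr M N D) B
        = emeasure (distr M (G \<Otimes>\<^sub>M N) (\<lambda>w. (w, D w))) (A \<times> B)"
      using A B id D idD by (simp add: emeasure_distr emeasure_eq_measure ennreal_mult)
  qed (auto intro: P.sigma_finite_measure_axioms Q.sigma_finite_measure_axioms sets_pair_measure_cong)
qed

lemma (in prob_space) indep_set_nn_integral:
  fixes Y :: "'a => ennreal"
  assumes sub: "subalgebra M G" and D: "D \<in> measurable M N"
    and ind: "indep_set (sets G) {D -` B \<inter> space M |B. B \<in> sets N}"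
    and Y: "Y \<in> borel_measurable G" and W: "W \<in> measurable G S"
    and g: "g \<in> borel_measurable (S \<Otimes>\<^sub>M N)"
  shows "(\<integral>\<^sup>+w. Y w * g (W w, D w) \<partial>M) = (\<integral>\<^sup>+w. Y w * (\<integral>\<^sup>+z. g (W w, z) \<partial>distr M N D) \<partial>M)"
proof -
  have id: "(\<lambda>w. w) \<in> measurable M G"
    using sub unfolding subalgebra_def by (auto simp: measurable_def)
  interpret Q: prob_space "distr M N D" by (rule prob_space_distr[OF D])
  note [measurable] = Y W g D id
  have "(\<integral>\<^sup>+w. Y w * g (W w, D w) \<partial>M)
      = (\<integral>\<^sup>+p. Y (fst p) * g (W (fst p), snd p) \<partial>distr M (G \<Otimes>\<^sub>M N) (\<lambda>w. (w, D w)))"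
    by (subst nn_integral_distr) simp_all
  also have "\<dots> = (\<integral>\<^sup>+w. \<integral>\<^sup>+z. Y w * g (W w, z) \<partial>distr M N D \<partial>distr M G (\<lambda>w. w))"
    unfolding indep_set_pair_distr[OF sub D ind]
    by (subst Q.nn_integral_fst[symmetric]) simp_all
  also have "\<dots> = (\<integral>\<^sup>+w. Y w * (\<integral>\<^sup>+z. g (W w, z) \<partial>distr M N D) \<partial>distr M G (\<lambda>w. w))"
    by (intro nn_integral_cong nn_integral_cmult) simp
  also have "\<dots> = (\<integral>\<^sup>+w. Y w * (\<integral>\<^sup>+z. g (W w, z) \<partial>distr M N D) \<partial>M)"
    by (subst nn_integral_distr) simp_all
  finally show ?thesis .
qed

lemma (in prob_space) indep_set_expectation:
  fixes Y :: "'a => real"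
  assumes sub: "subalgebra M G" and D: "D \<in> measurable M N"
    and ind: "indep_set (sets G) {D -` B \<inter> space M |B. B \<in> sets N}"
    and Y: "Y \<in> borel_measurable G" and W: "W \<in> measurable G S"
    and g: "g \<in> borel_measurable (S \<Otimes>\<^sub>M N)"
    and Yb: "\<And>w. \<bar>Y w\<bar> \<le> 1" and gb: "\<And>p. \<bar>g p\<bar> \<le> 1"
  shows "expectation (\<lambda>w. Y w * g (W w, D w)) = expectation (\<lambda>w. Y w * (\<integral>z. g (W w, z) \<partial>distr M N D))"
proof -
  have id: "(\<lambda>w. w) \<in> measurable M G"
    using sub unfolding subalgebra_def by (auto simp: measurable_def)
  interpret Q: prob_space "distr M N D" by (rule prob_space_distr[OF D])
  interpret P: prob_space "distr M G (\<lambda>w. w)" by (rule prob_space_distr[OF id])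
  interpret PQ: pair_prob_space "distr M G (\<lambda>w. w)" "distr M N D" ..
  note [measurable] = Y W g D id
  have "expectation (\<lambda>w. Y w * g (W w, D w))
      = (\<integral>p. Y (fst p) * g (W (fst p), snd p) \<partial>distr M (G \<Otimes>\<^sub>M N) (\<lambda>w. (w, D w)))"
    by (subst integral_distr) simp_all
  also have "\<dots> = (\<integral>w. \<integral>z. Y w * g (W w, z) \<partial>distr M N D \<partial>distr M G (\<lambda>w. w))"
    unfolding indep_set_pair_distr[OF sub D ind]
  proof (subst PQ.integral_fst'[symmetric])
    show "integrable (distr M G (\<lambda>w. w) \<Otimes>\<^sub>M distr M N D) (\<lambda>p. Y (fst p) * g (W (fst p), snd p))"
    proof (rule PQ.integrable_const_bound[of _ 1])
      show "AE p in distr M G (\<lambda>w. w) \<Otimes>\<^sub>M distr M N D. norm (Y (fst p) * g (W (fst p), snd p)) \<le> 1"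
        using Yb gb by (intro AE_I2) (auto simp: abs_mult intro!: mult_le_one)
    qed simp
  qed simp
  also have "\<dots> = expectation (\<lambda>w. Y w * (\<integral>z. g (W w, z) \<partial>distr M N D))"
    by (subst integral_distr) simp_all
  finally show ?thesis .
qed

text \<open>Path properties are required for every outcome, not almost surely, and the process
  vanishes up to time 0, so that \<open>Z t\<close> is measurable for every real \<open>t\<close>.
  The modification with these properties is \<open>centered\<close>.\<close>

locale cadlag_levy = prob_space M for M :: "'a measure" +
  fixes F :: "real => 'a measure" and Z :: "real => 'a => real"
  assumes subalg: "0 \<le> t ==> subalgebra M (F t)"
    and filtration: "0 \<le> s ==> s \<le> t ==> sets (F s) \<subseteq> sets (F t)"
    and adap: "0 \<le> t ==> Z t \<in> borel_measurable (F t)"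
    and cad: "w \<in> space M ==> cadlag (\<lambda>t. Z t w)"
    and start: "w \<in> space M ==> t \<le> 0 ==> Z t w = 0"
    and increment_indep: "0 \<le> s ==> 0 \<le> h ==>
        indep_set (sets (F s)) {(\<lambda>w. Z (s + h) w - Z s w) -` B \<inter> space M |B. B \<in> sets borel}"
    and increment_distr: "0 \<le> s ==> 0 \<le> h ==> distr M borel (\<lambda>w. Z (s + h) w - Z s w) = distr M borel (Z h)"
begin

lemma space_F: "0 \<le> t ==> space (F t) = space M"
  using subalg by (simp add: subalgebra_def)

lemma measurable_F_mono:
  "X \<in> measurable (F s) N ==> 0 \<le> s ==> s \<le> t ==> X \<in> measurable (F t) N"
  using filtration[of s t] space_F[of s] space_F[of t] by (auto simp: measurable_def)

lemma measurable_F_M: "X \<in> measurable (F s) N ==> 0 \<le> s ==> X \<in> measurable M N"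
  using subalg[of s] by (auto simp: measurable_def subalgebra_def)

lemma adap_le: "s \<le> t ==> 0 \<le> t ==> Z s \<in> borel_measurable (F t)"
proof (cases "0 \<le> s")
  case False
  assume "0 \<le> t"
  then have "Z s w = 0" if "w \<in> space (F t)" for w using start[of w s] space_F that False by auto
  then show ?thesis by (subst measurable_cong[of _ _ "\<lambda>_. 0"]) auto
qed (rule measurable_F_mono[OF adap])

lemma meas_Z[measurable]: "Z t \<in> borel_measurable M"
  by (rule measurable_F_M[OF adap_le[of t "max 0 t"]]) auto

lemma right_cont: "w \<in> space M ==> continuous (at_right t) (\<lambda>s. Z s w)"
proof (cases "0 \<le> t")
  case False
  assume "w \<in> space M"
  then have "\<forall>\<^sub>F s in at_right t. Z s w = 0"
    unfolding eventually_at_right_field using start False by (intro exI[of _ 0]) auto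
  then have "((\<lambda>s. Z s w) \<longlongrightarrow> 0) (at_right t)" by (rule tendsto_eventually)
  then show ?thesis using start[of w t] \<open>w \<in> space M\<close> False by (simp add: continuous_within)
qed (rule cadlag_right[OF cad])

lemma meas_at:
  assumes "h \<in> measurable N M" "T \<in> borel_measurable N"
  shows "(\<lambda>z. Z (T z) (h z)) \<in> borel_measurable N"
  by (rule right_continuous_measurable_at[OF meas_Z right_cont assms])

lemma increment_expectation:
  assumes "0 \<le> t" "0 \<le> d" "Y \<in> borel_measurable (F t)" "W \<in> borel_measurable (F t)"
    "g \<in> borel_measurable borel" "\<And>w. \<bar>Y w\<bar> \<le> 1" "\<And>x. \<bar>g x\<bar> \<le> (1::real)"
  shows "expectation (\<lambda>w. Y w * g (W w + (Z (t + d) w - Z t w)))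
       = expectation (\<lambda>w. Y w * (\<integral>z. g (W w + z) \<partial>distr M borel (Z d)))"
proof -
  have [measurable]: "g \<in> borel_measurable borel" by fact
  have "(\<lambda>w. Z (t + d) w - Z t w) \<in> borel_measurable M" by measurable
  from indep_set_expectation[OF subalg[OF assms(1)] this increment_indep[OF assms(1,2)] assms(3,4), of "\<lambda>p. g (fst p + snd p)"]
  show ?thesis using assms(6,7) by (simp add: increment_distr[OF assms(1,2)])
qed

lemma increment_nn_integral:
  fixes Y :: "'a => ennreal"
  assumes "0 \<le> t" "0 \<le> d" "Y \<in> borel_measurable (F t)" "W \<in> borel_measurable (F t)"
    "g \<in> borel_measurable borel"
  shows "(\<integral>\<^sup>+w. Y w * g (W w + (Z (t + d) w - Z t w)) \<partial>M)
       = (\<integral>\<^sup>+w. Y w * (\<integral>\<^sup>+z. g (W w + z) \<partial>distr M borel (Z d)) \<partial>M)"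
proof -
  have [measurable]: "g \<in> borel_measurable borel" by fact
  have "(\<lambda>w. Z (t + d) w - Z t w) \<in> borel_measurable M" by measurable
  from indep_set_nn_integral[OF subalg[OF assms(1)] this increment_indep[OF assms(1,2)] assms(3,4), of "\<lambda>p. g (fst p + snd p)"]
  show ?thesis by (simp add: increment_distr[OF assms(1,2)])
qed

text \<open>Transition operator of the process, for elapsed time \<open>h\<close> and present value
  \<open>q\<close>.\<close>

definition trans :: "(real => real) => real => real => real" where
  "trans f h q = (\<integral>z. f (q + z) \<partial>distr M borel (Z h))"

end

text \<open>The test functions for which the martingale \<open>E[f(Z(s+h)-Z(s)) | F\<^sub>t]\<close> has small increments.\<close>

definition test_fun :: "real => (real => real) => bool" where
  "test_fun L f \<longleftrightarrow> f \<in> borel_measurable borel \<and> (\<forall>x. 0 \<le> f x \<and> f x \<le> 1) \<and>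
     (\<forall>x y. \<bar>f x - f y\<bar> \<le> min 1 (L * \<bar>x - y\<bar>))"

section \<open>Martingales of bounded Lipschitz functions of an increment\<close>

context cadlag_levy
begin

lemma prob_space_law: "prob_space (distr M borel (Z h))"
  by (rule prob_space_distr) simp

lemma trans_measurable[measurable]:
  assumes [measurable]: "f \<in> borel_measurable borel"
  shows "trans f h \<in> borel_measurable borel"
proof -
  interpret Q: prob_space "distr M borel (Z h)" by (rule prob_space_law)
  show ?thesis unfolding trans_def by measurable
qed

lemma test_fun_integrable:
  assumes "test_fun L f"
  shows "integrable (distr M borel (Z h)) (\<lambda>z. f (q + z))"
proof -
  interpret Q: prob_space "distr M borel (Z h)" by (rule prob_space_law)
  have [measurable]: "f \<in> borel_measurable borel" using assms by (simp add: test_fun_def)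
  show ?thesis
    by (rule Q.integrable_const_bound[of _ 1]) (use assms in \<open>auto simp: test_fun_def\<close>)
qed

text \<open>An average of translates keeps the bounds and the modulus of continuity, so the
  martingale is a function with the same constant \<open>L\<close> at all intermediate
  times.\<close>

lemma test_fun_trans:
  assumes f: "test_fun L f"
  shows "test_fun L (trans f h)"
proof -
  interpret Q: prob_space "distr M borel (Z h)" by (rule prob_space_law)
  have [measurable]: "f \<in> borel_measurable borel" using f by (simp add: test_fun_def)
  note i = test_fun_integrable[OF f, of h]
  show ?thesis unfolding test_fun_def
  proof (intro conjI allI)
    fix x y
    show "0 \<le> trans f h x" unfolding trans_def using f by (intro integral_nonneg_AE) (auto simp: test_fun_def)
    show "trans f h x \<le> 1" unfolding trans_def
      using f by (intro Q.integral_le_const i) (auto simp: test_fun_def)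
    have "\<bar>trans f h x - trans f h y\<bar> = \<bar>\<integral>z. f (x + z) - f (y + z) \<partial>distr M borel (Z h)\<bar>"
      unfolding trans_def by (simp add: i)
    also have "\<dots> \<le> (\<integral>z. \<bar>f (x + z) - f (y + z)\<bar> \<partial>distr M borel (Z h))"
      by (rule integral_abs_bound)
    also have "\<dots> \<le> min 1 (L * \<bar>x - y\<bar>)"
    proof (rule Q.integral_le_const)
      show "AE z in distr M borel (Z h). \<bar>f (x + z) - f (y + z)\<bar> \<le> min 1 (L * \<bar>x - y\<bar>)"
      proof (rule AE_I2)
        fix z
        have "\<bar>f (x + z) - f (y + z)\<bar> \<le> min 1 (L * \<bar>(x + z) - (y + z)\<bar>)"
          using f unfolding test_fun_def by blast
        then show "\<bar>f (x + z) - f (y + z)\<bar> \<le> min 1 (L * \<bar>x - y\<bar>)" by simp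
      qed
    qed (simp add: i)
    finally show "\<bar>trans f h x - trans f h y\<bar> \<le> min 1 (L * \<bar>x - y\<bar>)" .
  qed (simp)
qed

lemma trans_0:
  assumes [measurable]: "f \<in> borel_measurable borel"
  shows "trans f 0 q = f q"
  unfolding trans_def by (subst integral_distr) (auto simp: start prob_space cong: Bochner_Integration.integral_cong)

text \<open>Chapman-Kolmogorov equation: the increment over \<open>d + h\<close> is split at
  \<open>d\<close>.\<close>

lemma trans_trans:
  assumes f: "test_fun L f" and h: "0 \<le> d" "0 \<le> h"
  shows "trans (trans f h) d q = trans f (d + h) q"
proof -
  have [measurable]: "f \<in> borel_measurable borel" using f by (simp add: test_fun_def)
  have W: "(\<lambda>w. q + Z d w) \<in> borel_measurable (F d)" using adap[OF h(1)] by measurable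
  have "trans f (d + h) q = expectation (\<lambda>w. 1 * f ((q + Z d w) + (Z (d + h) w - Z d w)))"
    unfolding trans_def by (subst integral_distr) (simp_all add: add.assoc)
  also have "\<dots> = expectation (\<lambda>w. 1 * (\<integral>z. f ((q + Z d w) + z) \<partial>distr M borel (Z h)))"
    by (rule increment_expectation[OF h _ W]) (use f in \<open>auto simp: test_fun_def\<close>)
  also have "\<dots> = trans (trans f h) d q"
    unfolding trans_def[symmetric] unfolding trans_def[of "trans f h"]
    by (subst integral_distr) (simp_all)
  finally show ?thesis by simp
qed

text \<open>The martingale \<open>E[f(Z(s+h)-Z(s)) | F\<^sub>t]\<close> at time \<open>t = s + d\<close>.\<close>

definition mart :: "(real => real) => real => real => real => 'a => real" where
  "mart f s h d w = trans f (h - d) (Z (s + d) w - Z s w)"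

lemma mart_measurable:
  assumes f: "test_fun L f" and "0 \<le> s" "0 \<le> d"
  shows "mart f s h d \<in> borel_measurable (F (s + d))"
proof -
  have [measurable]: "f \<in> borel_measurable borel" using f by (simp add: test_fun_def)
  have [measurable]: "Z (s + d) \<in> borel_measurable (F (s + d))" "Z s \<in> borel_measurable (F (s + d))"
    using assms by (auto intro: adap_le)
  show ?thesis unfolding mart_def by measurable
qed

lemma mart_bounds:
  assumes f: "test_fun L f"
  shows "0 \<le> mart f s h d w" "mart f s h d w \<le> 1"
  using test_fun_trans[OF f, of "h - d"] by (auto simp: test_fun_def mart_def)

lemma mart_martingale:
  assumes f: "test_fun L f" and "0 \<le> s" "0 \<le> d" "d \<le> e" "e \<le> h"
    and Y: "Y \<in> borel_measurable (F (s + d))" "\<And>w. \<bar>Y w\<bar> \<le> 1"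
  shows "expectation (\<lambda>w. Y w * mart f s h e w) = expectation (\<lambda>w. Y w * mart f s h d w)"
proof -
  have [measurable]: "f \<in> borel_measurable borel" using f by (simp add: test_fun_def)
  have [measurable]: "Z (s + d) \<in> borel_measurable (F (s + d))" "Z s \<in> borel_measurable (F (s + d))"
    using assms by (auto intro: adap_le)
  note t = test_fun_trans[OF f, of "h - e"]
  have "expectation (\<lambda>w. Y w * mart f s h e w)
     = expectation (\<lambda>w. Y w * trans f (h - e) ((Z (s + d) w - Z s w) + (Z ((s + d) + (e - d)) w - Z (s + d) w)))"
    unfolding mart_def by simp
  also have "\<dots> = expectation (\<lambda>w. Y w * (\<integral>z. trans f (h - e) ((Z (s + d) w - Z s w) + z) \<partial>distr M borel (Z (e - d))))"
    using assms t by (intro increment_expectation Y) (auto simp: test_fun_def)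
  also have "\<dots> = expectation (\<lambda>w. Y w * trans f (h - d) (Z (s + d) w - Z s w))"
    using trans_trans[OF f, of "e - d" "h - e"] assms unfolding trans_def[of "trans f (h - e)"] by simp
  finally show ?thesis by (simp add: mart_def)
qed

text \<open>Mean size of an increment over a time \<open>d\<close>, capped at 1 so that no moment of
  \<open>Z d\<close> enters.\<close>

definition osc :: "real => real => real" where
  "osc L d = expectation (\<lambda>w. min 1 (L * \<bar>Z d w\<bar>))"

lemma osc_tendsto_0:
  assumes "0 < h" "0 \<le> L"
  shows "(\<lambda>n. osc L (h / real (Suc n))) \<longlonglongrightarrow> 0"
proof -
  have nn: "\<bar>min 1 (L * \<bar>x\<bar>)\<bar> \<le> 1" for x
    using mult_nonneg_nonneg[OF assms(2) abs_ge_zero[of x]] by (auto simp: min_def)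
  have "(\<lambda>n. expectation (\<lambda>w. min 1 (L * \<bar>Z (h / real (Suc n)) w\<bar>))) \<longlonglongrightarrow> expectation (\<lambda>w. 0)"
  proof (rule integral_dominated_convergence[of _ _ _ "\<lambda>_. 1"])
    show "AE w in M. (\<lambda>n. min 1 (L * \<bar>Z (h / real (Suc n)) w\<bar>)) \<longlonglongrightarrow> 0"
    proof (rule AE_I2)
      fix w assume w: "w \<in> space M"
      have "filterlim (\<lambda>n. h / real (Suc n)) (at_right 0) sequentially"
        unfolding filterlim_at
      proof
        show "\<forall>\<^sub>F n in sequentially. h / real (Suc n) \<in> {0<..} \<and> h / real (Suc n) \<noteq> 0" using assms by auto
        have "(\<lambda>n. h * (1 / real (Suc n))) \<longlonglongrightarrow> h * 0"
          by (intro tendsto_mult_left) (use LIMSEQ_inverse_real_of_nat in \<open>simp add: inverse_eq_divide\<close>)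
        then show "(\<lambda>n. h / real (Suc n)) \<longlonglongrightarrow> 0" by simp
      qed
      from filterlim_compose[OF right_cont[OF w, of 0, unfolded continuous_within] this]
      have "(\<lambda>n. Z (h / real (Suc n)) w) \<longlonglongrightarrow> 0" using start[OF w, of 0] by simp
      then have "(\<lambda>n. min 1 (L * \<bar>Z (h / real (Suc n)) w\<bar>)) \<longlonglongrightarrow> min 1 (L * \<bar>0\<bar>)"
        by (intro tendsto_intros)
      then show "(\<lambda>n. min 1 (L * \<bar>Z (h / real (Suc n)) w\<bar>)) \<longlonglongrightarrow> 0" by simp
    qed
  qed (use nn in auto)
  then show ?thesis by (simp add: osc_def)
qed


text \<open>The value at \<open>d\<close> is the average of the value at \<open>e\<close> over the
  increment in between. Their difference is thus at most the capped size of that increment plus its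
  mean, and each of the two contributes one \<open>osc\<close>. The square is dominated by the
  absolute value because both values lie in \<open>{0..1}\<close>.\<close>

lemma mart_increment:
  assumes f: "test_fun L f" and L: "0 \<le> L" and "0 \<le> s" "0 \<le> d" "d \<le> e" "e \<le> h"
  shows "expectation (\<lambda>w. (mart f s h e w - mart f s h d w)\<^sup>2) \<le> 2 * osc L (e - d)"
proof -
  let ?D = "distr M borel (Z (e - d))"
  interpret Q: prob_space ?D by (rule prob_space_law)
  have [measurable]: "f \<in> borel_measurable borel" using f by (simp add: test_fun_def)
  note t = test_fun_trans[OF f, of "h - e"]
  define \<rho> where "\<rho> x = min 1 (L * \<bar>x\<bar>)" for x :: real
  have [measurable]: "\<rho> \<in> borel_measurable borel" unfolding \<rho>_def by measurable
  have \<rho>: "0 \<le> \<rho> x" "\<rho> x \<le> 1" for x using L by (auto simp: \<rho>_def)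
  have osc: "osc L (e - d) = (\<integral>z. \<rho> z \<partial>?D)"
    by (subst integral_distr) (auto simp: osc_def \<rho>_def)
  have i\<rho>: "integrable (?D) \<rho>"
    by (rule Q.integrable_const_bound[of _ 1]) (use \<rho> in auto)
  have min_aux: "min 1 r \<le> min 1 p + min 1 q" if "r \<le> p + q" "0 \<le> p" "0 \<le> q" for p q r :: real
    using that by (auto simp: min_def)
  have inc: "\<bar>trans f (h - e) (q + z) - trans f (h - d) q\<bar> \<le> \<rho> z + osc L (e - d)" for q z
  proof -
    have "trans f (h - d) q = (\<integral>z'. trans f (h - e) (q + z') \<partial>?D)"
      using trans_trans[OF f, of "e - d" "h - e" q] assms by (simp add: trans_def[of "trans f (h - e)"])
    moreover have "(\<integral>z'. trans f (h - e) (q + z) \<partial>?D) = trans f (h - e) (q + z)"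
      using Q.prob_space by (subst Bochner_Integration.lebesgue_integral_const) simp
    ultimately have eq: "trans f (h - e) (q + z) - trans f (h - d) q
       = (\<integral>z'. trans f (h - e) (q + z) - trans f (h - e) (q + z') \<partial>?D)"
      by (subst Bochner_Integration.integral_diff[OF _ test_fun_integrable[OF t]]) simp_all
    have "\<bar>trans f (h - e) (q + z) - trans f (h - d) q\<bar> \<le> (\<integral>z'. \<bar>trans f (h - e) (q + z) - trans f (h - e) (q + z')\<bar> \<partial>?D)"
      unfolding eq by (rule integral_abs_bound)
    also have "\<dots> \<le> (\<integral>z'. \<rho> z + \<rho> z' \<partial>?D)"
    proof (rule integral_mono)
      fix z'
      have "\<bar>trans f (h - e) (q + z) - trans f (h - e) (q + z')\<bar> \<le> min 1 (L * \<bar>z - z'\<bar>)"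
        using t unfolding test_fun_def by (metis add_diff_cancel_left)
      also have "L * \<bar>z - z'\<bar> \<le> L * \<bar>z\<bar> + L * \<bar>z'\<bar>"
        using mult_left_mono[OF abs_triangle_ineq4[of z z'] L] by (simp add: distrib_left)
      then have "min 1 (L * \<bar>z - z'\<bar>) \<le> \<rho> z + \<rho> z'"
        unfolding \<rho>_def
        by (intro min_aux) (use L in auto)
      finally show "\<bar>trans f (h - e) (q + z) - trans f (h - e) (q + z')\<bar> \<le> \<rho> z + \<rho> z'" .
    qed (use i\<rho> test_fun_integrable[OF t, of "e - d" q] in auto)
    also have "\<dots> = \<rho> z + osc L (e - d)" using i\<rho> Q.prob_space by (simp add: osc)
    finally show ?thesis .
  qed
  have m1: "mart f s h e \<in> borel_measurable M" "mart f s h d \<in> borel_measurable M"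
    using assms by (auto intro!: measurable_F_M[OF mart_measurable[OF f]])
  note [measurable] = m1
  have iZ: "integrable M (\<lambda>w. \<rho> (Z (s + d + (e - d)) w - Z (s + d) w))"
    by (rule integrable_const_bound[of _ 1]) (use \<rho> in auto)
  have "expectation (\<lambda>w. (mart f s h e w - mart f s h d w)\<^sup>2)
      \<le> expectation (\<lambda>w. \<rho> (Z (s + d + (e - d)) w - Z (s + d) w) + osc L (e - d))"
  proof (rule integral_mono)
    have b: "\<bar>mart f s h e w - mart f s h d w\<bar> \<le> 1" for w
      using mart_bounds[OF f, of s h e w] mart_bounds[OF f, of s h d w] by auto
    then have b2: "(mart f s h e w - mart f s h d w)\<^sup>2 \<le> 1" for w by (simp add: abs_square_le_1)
    show "integrable M (\<lambda>w. (mart f s h e w - mart f s h d w)\<^sup>2)"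
      by (rule integrable_const_bound[of _ 1]) (use b2 in auto)
    show "integrable M (\<lambda>w. \<rho> (Z (s + d + (e - d)) w - Z (s + d) w) + osc L (e - d))"
      by (rule Bochner_Integration.integrable_add[OF iZ integrable_const])
    fix w
    have "(mart f s h e w - mart f s h d w)\<^sup>2 \<le> \<bar>mart f s h e w - mart f s h d w\<bar>"
      using mult_right_mono[OF b[of w] abs_ge_zero[of "mart f s h e w - mart f s h d w"]]
      by (simp only: power2_eq_square abs_mult_self_eq mult_1_left)
    also have "\<dots> \<le> \<rho> (Z (s + d + (e - d)) w - Z (s + d) w) + osc L (e - d)"
      using inc[of "Z (s + d) w - Z s w" "Z (s + d + (e - d)) w - Z (s + d) w"] by (simp add: mart_def)
    finally show "(mart f s h e w - mart f s h d w)\<^sup>2 \<le> \<rho> (Z (s + d + (e - d)) w - Z (s + d) w) + osc L (e - d)" .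
  qed
  also have "\<dots> = expectation (\<lambda>w. \<rho> (Z (s + d + (e - d)) w - Z (s + d) w)) + osc L (e - d)"
    by (subst Bochner_Integration.integral_add[OF iZ integrable_const]) (simp add: prob_space)
  also have "expectation (\<lambda>w. \<rho> (Z (s + d + (e - d)) w - Z (s + d) w)) = osc L (e - d)"
  proof -
    have "expectation (\<lambda>w. \<rho> (Z (s + d + (e - d)) w - Z (s + d) w))
       = (\<integral>z. \<rho> z \<partial>distr M borel (\<lambda>w. Z (s + d + (e - d)) w - Z (s + d) w))"
      by (subst integral_distr) auto
    also have "\<dots> = osc L (e - d)"
      using assms by (subst increment_distr) (auto simp: osc)
    finally show ?thesis .
  qed
  finally show ?thesis by simp
qed

lemma mart_orthogonal:
  assumes f: "test_fun L f" and "0 \<le> s" "0 \<le> d" "d \<le> e" "e \<le> h"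
    and Y: "Y \<in> borel_measurable (F (s + d))" "\<And>w. \<bar>Y w\<bar> \<le> 1"
  shows "expectation (\<lambda>w. Y w * (mart f s h e w - mart f s h d w)) = 0"
proof -
  have m1: "mart f s h e \<in> borel_measurable M" "mart f s h d \<in> borel_measurable M" "Y \<in> borel_measurable M"
    using assms by (auto intro!: measurable_F_M[OF mart_measurable[OF f]] measurable_F_M[OF Y(1)])
  note [measurable] = m1
  have i: "integrable M (\<lambda>w. Y w * mart f s h c w)" if "mart f s h c \<in> borel_measurable M" for c
    by (rule integrable_const_bound[of _ 1])
      (use Y(2) mart_bounds[OF f, of s h c] that in \<open>auto simp: abs_mult intro!: mult_le_one\<close>)
  have "expectation (\<lambda>w. Y w * (mart f s h e w - mart f s h d w))
      = expectation (\<lambda>w. Y w * mart f s h e w) - expectation (\<lambda>w. Y w * mart f s h d w)"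
    unfolding right_diff_distrib by (rule Bochner_Integration.integral_diff[OF i[OF m1(1)] i[OF m1(2)]])
  then show ?thesis using mart_martingale[OF assms] by linarith
qed

lemma mart_0: "0 \<le> s ==> mart f s h 0 w = trans f h 0"
  by (simp add: mart_def)

lemma mart_end: "test_fun L f ==> mart f s h h w = f (Z (s + h) w - Z s w)"
  by (simp add: mart_def trans_0 test_fun_def)

end

section \<open>Running infimum\<close>

definition running_inf :: "(real => real) => real => real" where
  "running_inf f t = (INF s\<in>{0..t}. f s)"

definition grid_min :: "(real => real) => real => nat => real" where
  "grid_min f u k = (MIN j\<in>{..2 ^ k}. f (u * real j / 2 ^ k))"

lemma grid_min_le: "j \<le> 2 ^ k ==> grid_min f u k \<le> f (u * real j / 2 ^ k)"
  unfolding grid_min_def by (rule Min_le) auto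

lemma grid_min_attained: "\<exists>j\<le>2 ^ k. grid_min f u k = f (u * real j / 2 ^ k)"
proof -
  have "grid_min f u k \<in> (\<lambda>j. f (u * real j / 2 ^ k)) ` {..2 ^ k}"
    unfolding grid_min_def by (rule Min_in) auto
  then show ?thesis by auto
qed

lemma decseq_grid_min: "decseq (grid_min f u)"
proof (rule decseq_SucI)
  fix k
  obtain j where "j \<le> 2 ^ k" "grid_min f u k = f (u * real j / 2 ^ k)"
    using grid_min_attained by blast
  then show "grid_min f u (Suc k) \<le> grid_min f u k"
    using grid_min_le[of "2 * j" "Suc k" f u] by simp
qed

lemma grid_point: "0 \<le> u ==> j \<le> 2 ^ k ==> u * real j / 2 ^ k \<in> {0..u}"
proof -
  assume *: "0 \<le> u" "j \<le> 2 ^ k"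
  then have "real j \<le> 2 ^ k" by (metis of_nat_le_iff of_nat_numeral of_nat_power)
  with * show ?thesis by (auto simp: divide_le_eq intro!: mult_left_mono)
qed

lemma running_inf_le: "bdd_below (f ` {0..t}) ==> 0 \<le> s ==> s \<le> t ==> running_inf f t \<le> f s"
  unfolding running_inf_def by (rule cINF_lower) auto

lemma running_inf_greatest: "0 \<le> t ==> (\<And>s. 0 \<le> s ==> s \<le> t ==> c \<le> f s) ==> c \<le> running_inf f t"
  unfolding running_inf_def by (rule cINF_greatest) auto

lemma running_inf_less:
  assumes "0 \<le> t" "running_inf f t < c"
  shows "\<exists>s. 0 \<le> s \<and> s \<le> t \<and> f s < c"
  using running_inf_greatest[of t c f] assms by (meson linorder_not_less)

lemma running_inf_le_grid_min:
  assumes "0 \<le> u" "bdd_below (f ` {0..u})"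
  shows "running_inf f u \<le> grid_min f u k"
proof -
  obtain j where "j \<le> 2 ^ k" "grid_min f u k = f (u * real j / 2 ^ k)"
    using grid_min_attained by blast
  then show ?thesis using running_inf_le[OF assms(2)] grid_point[OF assms(1), of j k] by auto
qed

text \<open>Grid minima are never below the infimum, so it is enough that each value of
  \<open>f\<close> is undercut, up to \<open>e\<close>, at some grid point. This weak form of
  approximation also covers paths that are continuous from the left at some points and from the
  right at others.\<close>

lemma grid_min_tendsto:
  assumes u: "0 \<le> u" and bd: "bdd_below (f ` {0..u})"
    and ap: "\<And>s e. 0 \<le> s ==> s \<le> u ==> 0 < e ==> \<exists>k j. j \<le> 2 ^ k \<and> f (u * real j / 2 ^ k) < f s + e"
  shows "grid_min f u \<longlonglongrightarrow> running_inf f u"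
proof (rule decreasing_tendsto)
  show "\<forall>\<^sub>F k in sequentially. running_inf f u \<le> grid_min f u k"
    using running_inf_le_grid_min[OF u bd] by auto
  fix x assume "running_inf f u < x"
  then obtain s where s: "0 \<le> s" "s \<le> u" "f s < x" using running_inf_less[OF u] by blast
  then obtain k j where k: "j \<le> 2 ^ k" "f (u * real j / 2 ^ k) < f s + (x - f s)"
    using ap[of s "x - f s"] by auto
  have "grid_min f u n < x" if "n \<ge> k" for n
    using grid_min_le[OF k(1), of f u] k(2) decseqD[OF decseq_grid_min that, of f u] by linarith
  then show "\<forall>\<^sub>F n in sequentially. grid_min f u n < x"
    unfolding eventually_sequentially by blast
qed

text \<open>The grid points used are \<open>u\<close> times the dyadic points above
  \<open>s / u\<close>; eventually these stay below 1 because \<open>s < u\<close>.\<close>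

lemma grid_approx_right:
  fixes f :: "real => real"
  assumes rc: "continuous (at_right s) f" and s: "0 \<le> s" "s < u" and e: "0 < e"
  shows "\<exists>k j. j \<le> 2 ^ k \<and> f (u * real j / 2 ^ k) < f s + e"
proof -
  have lim: "(\<lambda>k. dyadic_above k (s / u)) \<longlonglongrightarrow> s / u"
    by (rule filterlim_mono[OF dyadic_above_tendsto]) (auto simp: at_within_def inf.coboundedI1)
  have "filterlim (\<lambda>k. u * dyadic_above k (s / u)) (at_right s) sequentially"
  proof -
    have "(\<lambda>k. u * dyadic_above k (s / u)) \<longlonglongrightarrow> u * (s / u)"
      by (intro tendsto_mult_left lim)
    moreover have "s < u * dyadic_above k (s / u)" for k
      using mult_strict_left_mono[OF dyadic_above_bounds(1)[of "s / u" k], of u] s by simp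
    ultimately show ?thesis using s unfolding filterlim_at by (auto simp: less_imp_neq[symmetric])
  qed
  from filterlim_compose[OF rc[unfolded continuous_within] this]
  have l: "(\<lambda>k. f (u * dyadic_above k (s / u))) \<longlonglongrightarrow> f s" .
  have "\<forall>\<^sub>F k in sequentially. f (u * dyadic_above k (s / u)) < f s + e"
    by (rule order_tendstoD(2)[OF l]) (use e in simp)
  moreover have "\<forall>\<^sub>F k in sequentially. dyadic_above k (s / u) < 1"
    by (rule order_tendstoD(2)[OF lim]) (use s in auto)
  ultimately have "\<forall>\<^sub>F k in sequentially. f (u * dyadic_above k (s / u)) < f s + e \<and> dyadic_above k (s / u) < 1"
    by eventually_elim auto
  then obtain k where k: "f (u * dyadic_above k (s / u)) < f s + e" "dyadic_above k (s / u) < 1"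
    using eventually_happens'[OF sequentially_bot] by blast
  define j where "j = nat (\<lfloor>2 ^ k * (s / u)\<rfloor> + 1)"
  have "0 \<le> \<lfloor>2 ^ k * (s / u)\<rfloor>" using s by simp
  then have j: "real j = real_of_int \<lfloor>2 ^ k * (s / u)\<rfloor> + 1" by (simp add: j_def)
  then have d: "dyadic_above k (s / u) = real j / 2 ^ k" by (simp add: dyadic_above_def)
  with k(2) have "real j < 2 ^ k" by simp
  then have "j \<le> 2 ^ k" by (metis less_imp_le of_nat_less_iff of_nat_numeral of_nat_power)
  then show ?thesis using k(1) d by (metis times_divide_eq_right)
qed

text \<open>Reflection at \<open>u\<close>: the map \<open>s \<mapsto> u - s\<close> preserves the
  grid and exchanges left and right.\<close>

lemma grid_approx_left:
  fixes f :: "real => real"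
  assumes lc: "continuous (at_left s) f" and s: "0 < s" "s \<le> u" and e: "0 < e"
  shows "\<exists>k j. j \<le> 2 ^ k \<and> f (u * real j / 2 ^ k) < f s + e"
proof -
  have "continuous (at_right (u - s)) (\<lambda>x. f (u - x))"
  proof -
    have "filterlim (\<lambda>x. u - x) (at_left s) (at_right (u - s))"
      unfolding filterlim_at
    proof
      show "\<forall>\<^sub>F x in at_right (u - s). u - x \<in> {..<s} \<and> u - x \<noteq> s"
        by (auto simp: eventually_at_right_field intro!: exI[of _ "u - s + 1"])
      have "((\<lambda>x. u - x) \<longlongrightarrow> u - (u - s)) (at_right (u - s))" by (intro tendsto_intros)
      then show "((\<lambda>x. u - x) \<longlongrightarrow> s) (at_right (u - s))" by simp
    qed
    from filterlim_compose[OF lc[unfolded continuous_within] this]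
    show ?thesis unfolding continuous_within by simp
  qed
  from grid_approx_right[OF this, of u e] s e obtain k j where
    k: "j \<le> 2 ^ k" "f (u - u * real j / 2 ^ k) < f s + e" by auto
  have "u - u * real j / 2 ^ k = u * real (2 ^ k - j) / 2 ^ k"
    using k(1) by (simp add: of_nat_diff field_simps)
  then show ?thesis using k by (intro exI[of _ k] exI[of _ "2 ^ k - j"]) auto
qed

lemma grid_approx_end:
  fixes f :: "real => real"
  shows "0 < e ==> \<exists>k j. j \<le> 2 ^ k \<and> f (u * real j / 2 ^ k) < f u + e"
  by (intro exI[of _ 0] exI[of _ 1]) auto

lemma grid_approx_start:
  fixes f :: "real => real"
  shows "0 < e ==> \<exists>k j. j \<le> 2 ^ k \<and> f (u * real j / 2 ^ k) < f 0 + e"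
  by (intro exI[of _ 0] exI[of _ 0]) auto

lemma cadlag_grid_min_tendsto:
  assumes "cadlag f" "0 \<le> u"
  shows "grid_min f u \<longlonglongrightarrow> running_inf f u"
proof (rule grid_min_tendsto)
  fix s e :: real assume "0 \<le> s" "s \<le> u" "0 < e"
  then show "\<exists>k j. j \<le> 2 ^ k \<and> f (u * real j / 2 ^ k) < f s + e"
    using grid_approx_right[OF cadlag_right[OF assms(1)], of s u e] grid_approx_end[of e f u]
    by (cases "s = u") auto
qed (use assms cadlag_bdd_below in auto)

text \<open>In the variable \<open>s\<close> the first summand is right continuous and the second,
  being reversed, is left continuous. Where one of them is continuous from the other side as well,
  the sum is continuous from one side, which suffices for the grid approximation. The end points 0
  and \<open>u\<close> belong to the grid.\<close>

lemma cadlag_reversed_grid_min_tendsto: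
  assumes f: "cadlag f" and k: "cadlag k" and u: "0 \<le> u"
    and j: "\<And>s. 0 < s ==> s < u ==> continuous (at_left s) f \<or> continuous (at_left (u - s)) k"
  shows "grid_min (\<lambda>s. f s + k (u - s)) u \<longlonglongrightarrow> running_inf (\<lambda>s. f s + k (u - s)) u"
    and "bdd_below ((\<lambda>s. f s + k (u - s)) ` {0..u})"
proof -
  obtain B1 B2 where B: "\<forall>t\<in>{0..u}. \<bar>f t\<bar> \<le> B1" "\<forall>t\<in>{0..u}. \<bar>k t\<bar> \<le> B2"
    using cadlag_bounded[OF f] cadlag_bounded[OF k] by meson
  have "- B1 - B2 \<le> f s + k (u - s)" if "s \<in> {0..u}" for s
    using B(1)[rule_format, of s] B(2)[rule_format, of "u - s"] that by auto
  then show bd: "bdd_below ((\<lambda>s. f s + k (u - s)) ` {0..u})" by (intro bdd_belowI2) auto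
  have rev: "filterlim (\<lambda>x. u - x) (at_left (u - s)) (at_right s)"
            "filterlim (\<lambda>x. u - x) (at_right (u - s)) (at_left s)" for s
  proof -
    have "((\<lambda>x. u - x) \<longlongrightarrow> u - s) (at s)" by (intro tendsto_intros)
    then have *: "((\<lambda>x. u - x) \<longlongrightarrow> u - s) (at_right s)" "((\<lambda>x. u - x) \<longlongrightarrow> u - s) (at_left s)"
      using filterlim_at_split by blast+
    show "filterlim (\<lambda>x. u - x) (at_left (u - s)) (at_right s)" unfolding filterlim_at
      using * by (auto simp: eventually_at_right_field intro!: exI[of _ "s + 1"])
    show "filterlim (\<lambda>x. u - x) (at_right (u - s)) (at_left s)" unfolding filterlim_at
      using * by (auto simp: eventually_at_left_field intro!: exI[of _ "s - 1"])
  qed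
  show "grid_min (\<lambda>s. f s + k (u - s)) u \<longlonglongrightarrow> running_inf (\<lambda>s. f s + k (u - s)) u"
  proof (rule grid_min_tendsto[OF u bd])
    fix s e :: real assume s: "0 \<le> s" "s \<le> u" "0 < e"
    let ?h = "\<lambda>s. f s + k (u - s)"
    consider "s = 0" | "s = u" | "0 < s" "s < u" "continuous (at_left s) f"
      | "0 < s" "s < u" "continuous (at_left (u - s)) k" using j[of s] s by fastforce
    then show "\<exists>k' j. j \<le> 2 ^ k' \<and> ?h (u * real j / 2 ^ k') < ?h s + e"
    proof cases
      case 1 then show ?thesis using grid_approx_start[of e ?h u] s by auto
    next
      case 2 then show ?thesis using grid_approx_end[of e ?h u] s by auto
    next
      case 3
      have "continuous (at_left s) ?h" unfolding continuous_within
        using 3(3) filterlim_compose[OF cadlag_right[OF k, of "u - s", unfolded continuous_within] rev(2)] 3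
        by (intro tendsto_add) (auto simp: continuous_within)
      then show ?thesis using grid_approx_left[of s ?h u e] 3 s by auto
    next
      case 4
      have "continuous (at_right s) ?h" unfolding continuous_within
        using cadlag_right[OF f, of s] filterlim_compose[OF 4(3)[unfolded continuous_within] rev(1)] 4
        by (intro tendsto_add) (auto simp: continuous_within)
      then show ?thesis using grid_approx_right[of s ?h u e] 4 s by auto
    qed
  qed
qed

lemma running_inf_antimono:
  assumes "cadlag f" "0 \<le> s" "s \<le> t"
  shows "running_inf f t \<le> running_inf f s"
  using assms by (intro running_inf_greatest running_inf_le cadlag_bdd_below) auto

lemma running_inf_split:
  assumes f: "cadlag f" and t: "0 \<le> t" "0 \<le> u"
  shows "running_inf f (t + u) = min (running_inf f t) (running_inf (\<lambda>v. f (t + v)) u)"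
proof (rule antisym)
  have bd: "bdd_below ((\<lambda>v. f (t + v)) ` {0..u})"
    by (rule bdd_below_mono[OF cadlag_bdd_below[OF f, of "t + u"]]) (use t in auto)
  have "running_inf f (t + u) \<le> running_inf (\<lambda>v. f (t + v)) u"
    using t by (intro running_inf_greatest running_inf_le cadlag_bdd_below[OF f]) auto
  then show "running_inf f (t + u) \<le> min (running_inf f t) (running_inf (\<lambda>v. f (t + v)) u)"
    using running_inf_antimono[OF f, of t "t + u"] t by auto
  show "min (running_inf f t) (running_inf (\<lambda>v. f (t + v)) u) \<le> running_inf f (t + u)"
  proof (rule running_inf_greatest)
    fix s assume s: "0 \<le> s" "s \<le> t + u"
    show "min (running_inf f t) (running_inf (\<lambda>v. f (t + v)) u) \<le> f s"
    proof (cases "s \<le> t")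
      case True
      then show ?thesis using running_inf_le[OF cadlag_bdd_below[OF f], of s t] s by auto
    next
      case False
      then show ?thesis using running_inf_le[OF bd, of "s - t"] s by auto
    qed
  qed (use t in auto)
qed

text \<open>Shortly after \<open>t\<close> the path stays above any given \<open>c < f t\<close>, so
  the infimum cannot drop at once; left limits exist by monotonicity.\<close>

lemma cadlag_running_inf:
  assumes f: "cadlag f"
  shows "cadlag (running_inf f)"
  unfolding cadlag_def
proof (intro conjI allI impI)
  fix t :: real assume t: "0 \<le> t"
  show "continuous (at_right t) (running_inf f)"
    unfolding continuous_within
  proof (rule increasing_tendsto)
    show "\<forall>\<^sub>F x in at_right t. running_inf f x \<le> running_inf f t"
      using running_inf_antimono[OF f t] by (auto simp: eventually_at_right_field intro!: exI[of _ "t + 1"])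
    fix x assume x: "x < running_inf f t"
    define c where "c = (x + running_inf f t) / 2"
    have c: "x < c" "c < running_inf f t" using x by (auto simp: c_def)
    have "c < f t" using running_inf_le[OF cadlag_bdd_below[OF f], of t t] c t by auto
    then have "\<forall>\<^sub>F s in at_right t. c < f s"
      using cadlag_right[OF f t] unfolding continuous_within by (rule order_tendstoD(1)[rotated])
    then obtain b where b: "b > t" "\<And>s. t < s ==> s < b ==> c < f s"
      unfolding eventually_at_right_field by blast
    have "x < running_inf f s" if "t < s" "s < b" for s
    proof -
      have "c \<le> running_inf f s"
      proof (rule running_inf_greatest)
        fix v assume v: "0 \<le> v" "v \<le> s"
        show "c \<le> f v"
          using running_inf_le[OF cadlag_bdd_below[OF f, of t], of v] v c b(2)[of v] that
          by (cases "v \<le> t") auto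
      qed (use t that in auto)
      with c show ?thesis by simp
    qed
    then show "\<forall>\<^sub>F s in at_right t. x < running_inf f s"
      using b unfolding eventually_at_right_field by blast
  qed
next
  fix t :: real assume t: "0 < t"
  define l where "l = (INF s\<in>{0..<t}. running_inf f s)"
  have bd: "bdd_below (running_inf f ` {0..<t})"
    using running_inf_antimono[OF f, of _ t] by (intro bdd_belowI2[of _ "running_inf f t"]) auto
  have "(running_inf f \<longlongrightarrow> l) (at_left t)"
  proof (rule decreasing_tendsto)
    show "\<forall>\<^sub>F x in at_left t. l \<le> running_inf f x"
      unfolding eventually_at_left_field l_def
      by (intro exI[of _ 0] conjI t allI impI cINF_lower bd) auto
    fix x assume "l < x"
    then obtain s where s: "0 \<le> s" "s < t" "running_inf f s < x"
      unfolding l_def using t bd by (subst (asm) cINF_less_iff) auto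
    then have "running_inf f v < x" if "s < v" "v < t" for v
      using running_inf_antimono[OF f, of s v] that by auto
    then show "\<forall>\<^sub>F v in at_left t. running_inf f v < x"
      unfolding eventually_at_left_field using s by blast
  qed
  then show "\<exists>l. (running_inf f \<longlongrightarrow> l) (at_left t)" by blast
qed

lemma running_inf_add_const:
  assumes "cadlag f" "0 \<le> t"
  shows "running_inf (\<lambda>s. f s + c) t = running_inf f t + c"
proof (rule antisym)
  have bd: "bdd_below ((\<lambda>s. f s + c) ` {0..t})"
    using cadlag_bdd_below[OF assms(1), of t] by (auto simp: bdd_below_def) (metis add_right_mono)
  have "running_inf (\<lambda>s. f s + c) t - c \<le> running_inf f t"
  proof (rule running_inf_greatest[OF assms(2)])
    fix s assume "0 \<le> s" "s \<le> t"
    from running_inf_le[OF bd this] show "running_inf (\<lambda>s. f s + c) t - c \<le> f s" by simp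
  qed
  then show "running_inf (\<lambda>s. f s + c) t \<le> running_inf f t + c" by simp
  show "running_inf f t + c \<le> running_inf (\<lambda>s. f s + c) t"
    using assms by (intro running_inf_greatest add_right_mono running_inf_le cadlag_bdd_below) auto
qed

section \<open>Two independent Levy processes\<close>

text \<open>The mixed moments factorise by \<open>ind\<close>, and the factor that comes from
  \<open>u\<close> vanishes off the diagonal.\<close>

lemma (in prob_space) expectation_orthogonal_products:
  fixes u v :: "nat => 'a => real"
  assumes m: "\<And>j. j < N ==> u j \<in> borel_measurable M" "\<And>j. j < N ==> v j \<in> borel_measurable M"
    and b: "\<And>j w. j < N ==> \<bar>u j w\<bar> \<le> 1" "\<And>j w. j < N ==> \<bar>v j w\<bar> \<le> 1"
    and orth: "\<And>j k. j < k ==> k < N ==> expectation (\<lambda>w. u j w * u k w) = 0"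
    and ind: "\<And>j k. j < N ==> k < N ==> expectation (\<lambda>w. (u j w * u k w) * (v j w * v k w))
        = expectation (\<lambda>w. u j w * u k w) * expectation (\<lambda>w. v j w * v k w)"
  shows "expectation (\<lambda>w. (\<Sum>j<N. u j w * v j w)\<^sup>2)
       = (\<Sum>j<N. expectation (\<lambda>w. (u j w)\<^sup>2) * expectation (\<lambda>w. (v j w)\<^sup>2))"
proof -
  have i: "integrable M (\<lambda>w. (u j w * u k w) * (v j w * v k w))" if "j < N" "k < N" for j k
    using that m by (intro integrable_const_bound[of _ 1] AE_I2) (auto simp: abs_mult intro!: mult_le_one b)
  have "expectation (\<lambda>w. (\<Sum>j<N. u j w * v j w)\<^sup>2)
      = expectation (\<lambda>w. \<Sum>j<N. \<Sum>k<N. (u j w * u k w) * (v j w * v k w))"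
    by (simp add: power2_eq_square sum_product mult_ac)
  also have "\<dots> = (\<Sum>j<N. \<Sum>k<N. expectation (\<lambda>w. (u j w * u k w) * (v j w * v k w)))"
    by (subst Bochner_Integration.integral_sum) (auto intro!: sum.cong Bochner_Integration.integral_sum i)
  also have "\<dots> = (\<Sum>j<N. \<Sum>k<N. if k = j then expectation (\<lambda>w. (u j w)\<^sup>2) * expectation (\<lambda>w. (v j w)\<^sup>2) else 0)"
  proof (intro sum.cong refl)
    fix j k assume jk: "j \<in> {..<N}" "k \<in> {..<N}"
    have "expectation (\<lambda>w. u j w * u k w) = 0" if "k \<noteq> j"
      using orth[of j k] orth[of k j] that jk by (cases "j < k") (auto simp: mult.commute)
    then show "expectation (\<lambda>w. (u j w * u k w) * (v j w * v k w))
       = (if k = j then expectation (\<lambda>w. (u j w)\<^sup>2) * expectation (\<lambda>w. (v j w)\<^sup>2) else 0)"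
      using ind[of j k] jk by (auto simp: power2_eq_square)
  qed
  also have "\<dots> = (\<Sum>j<N. expectation (\<lambda>w. (u j w)\<^sup>2) * expectation (\<lambda>w. (v j w)\<^sup>2))"
    by (simp add: sum.delta')
  finally show ?thesis .
qed

locale levy_pair = X: cadlag_levy M F X + Y: cadlag_levy M F Y
  for M :: "'a measure" and F X Y +
  assumes processes_indep: "independent_processes M X Y"
begin

lemma indep_functionals:
  assumes "G \<in> borel_measurable (\<Pi>\<^sub>M t\<in>{0..}. borel)" "H \<in> borel_measurable (\<Pi>\<^sub>M t\<in>{0..}. borel)"
    and "\<And>p. \<bar>G p\<bar> \<le> (1::real)" "\<And>p. \<bar>H p\<bar> \<le> (1::real)"
  shows "X.expectation (\<lambda>w. G (\<lambda>t\<in>{0..}. X t w) * H (\<lambda>t\<in>{0..}. Y t w))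
     = X.expectation (\<lambda>w. G (\<lambda>t\<in>{0..}. X t w)) * X.expectation (\<lambda>w. H (\<lambda>t\<in>{0..}. Y t w))"
proof -
  have "X.indep_var borel (\<lambda>w. G (\<lambda>t\<in>{0..}. X t w)) borel (\<lambda>w. H (\<lambda>t\<in>{0..}. Y t w))"
    using X.indep_var_compose[OF processes_indep[unfolded independent_processes_def] assms(1,2)]
    by (simp add: comp_def)
  moreover have "(\<lambda>w. \<lambda>t\<in>{0..}. X t w) \<in> measurable M (\<Pi>\<^sub>M t\<in>{0..}. borel)"
    "(\<lambda>w. \<lambda>t\<in>{0..}. Y t w) \<in> measurable M (\<Pi>\<^sub>M t\<in>{0..}. borel)"
    by (auto intro!: measurable_restrict)
  note m = measurable_compose[OF this(1) assms(1)] measurable_compose[OF this(2) assms(2)]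
  have "integrable M (\<lambda>w. G (\<lambda>t\<in>{0..}. X t w))" "integrable M (\<lambda>w. H (\<lambda>t\<in>{0..}. Y t w))"
    using assms m by (auto intro!: X.integrable_const_bound[of _ 1])
  ultimately show ?thesis by (rule X.indep_var_lebesgue_integral)
qed

text \<open>Only the marginal increments are assumed to be independent of the past. The discrete product
  rule for the two martingales leaves the covariation sum, which vanishes in \<open>L\<^sup>2\<close> as the mesh
  tends to zero because the two processes are independent of each other.\<close>

lemma joint_increment_test:
  assumes s: "0 \<le> s" and h: "0 < h" and B: "B \<in> sets (F s)" and L: "0 \<le> L"
    and f: "test_fun L f" and k: "test_fun L k"
  shows "X.expectation (\<lambda>w. indicator B w * (f (X (s + h) w - X s w) * k (Y (s + h) w - Y s w)))
     = X.prob B * (X.trans f h 0 * Y.trans k h 0)"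
proof -
  define U where "U = X.mart f s h"
  define V where "V = Y.mart k s h"
  define b :: "'a => real" where "b = indicator B"
  have b01: "\<bar>b w\<bar> \<le> 1" for w by (simp add: b_def indicator_def)
  have bm: "b \<in> borel_measurable (F t)" if "s \<le> t" for t
    unfolding b_def using B X.filtration[OF s that] by (auto intro!: borel_measurable_indicator)
  have Ub: "0 \<le> U d w" "U d w \<le> 1" and Vb: "0 \<le> V d w" "V d w \<le> 1" for d w
    using X.mart_bounds[OF f] Y.mart_bounds[OF k] by (auto simp: U_def V_def)
  have Um: "U d \<in> borel_measurable (F (s + e))" "V d \<in> borel_measurable (F (s + e))" if "0 \<le> d" "d \<le> e" for d e
    using that s by (auto simp: U_def V_def intro!: X.measurable_F_mono[OF X.mart_measurable[OF f, of s d]]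
        X.measurable_F_mono[OF Y.mart_measurable[OF k, of s d]])
  have UM: "U d \<in> borel_measurable M" "V d \<in> borel_measurable M" if "0 \<le> d" for d
    using X.measurable_F_M[OF Um(1)] X.measurable_F_M[OF Um(2)] that s by (auto intro: add_nonneg_nonneg)
  have bM: "b \<in> borel_measurable M" using X.measurable_F_M[OF bm[OF order_refl] s] .
  have int1: "integrable M g" if "g \<in> borel_measurable M" "\<And>w. \<bar>g w\<bar> \<le> 1" for g :: "'a => real"
    using that by (intro X.integrable_const_bound[of _ 1]) auto
  \<comment> \<open>Here \<open>b\<close> is the indicator of an event of the past, and
    \<open>U\<close>, \<open>V\<close> run from constants at time 0 to the two test functions at
    time \<open>h\<close>. The mean of \<open>b U V\<close> is shown not to change, up to an error
    governed by the mesh \<open>h / real (Suc n)\<close>.\<close>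
  have est: "(X.expectation (\<lambda>w. b w * (U h w * V h w)) - X.expectation (\<lambda>w. b w * (U 0 w * V 0 w)))\<^sup>2
      \<le> 2 * X.osc L (h / real (Suc n))" for n
  proof -
    define N where "N = Suc n"
    define \<delta> where "\<delta> = h / real N"
    define d where "d j = real j * \<delta>" for j
    have dm: "i \<le> j ==> d i \<le> d j" for i j
      using h by (auto simp: d_def \<delta>_def N_def intro!: divide_right_mono mult_right_mono)
    have dN: "d N = h" by (simp add: d_def \<delta>_def N_def)
    have d: "0 \<le> d j" "d j \<le> d (Suc j)" "j \<le> N ==> d j \<le> h" "d (Suc j) - d j = \<delta>" "d N = h" "d 0 = 0" for j
      using dm[of j N] dm[of 0 j] dm[of j "Suc j"] dN h by (auto simp: d_def algebra_simps)
    define u where "u j w = U (d (Suc j)) w - U (d j) w" for j w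
    define v where "v j w = V (d (Suc j)) w - V (d j) w" for j w
    have uvM: "u j \<in> borel_measurable M" "v j \<in> borel_measurable M" for j
      unfolding u_def v_def using UM[OF d(1)[of j]] UM[OF d(1)[of "Suc j"]] by measurable
    have ub: "\<bar>u j w\<bar> \<le> 1" "\<bar>v j w\<bar> \<le> 1" for j w
      using Ub[of "d j" w] Ub[of "d (Suc j)" w] Vb[of "d j" w] Vb[of "d (Suc j)" w] by (auto simp: u_def v_def)
    have um: "u j \<in> borel_measurable (F (s + d k))" "v j \<in> borel_measurable (F (s + d k))" if "j < k" for j k
    proof -
      have "d j \<le> d k" "d (Suc j) \<le> d k" using dm that by auto
      note m[measurable] = Um[OF d(1)[of j] this(1)] Um[OF d(1)[of "Suc j"] this(2)]
      show "u j \<in> borel_measurable (F (s + d k))" "v j \<in> borel_measurable (F (s + d k))"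
        unfolding u_def v_def by measurable
    qed
    have Uo: "X.expectation (\<lambda>w. y w * u j w) = 0" and Vo: "X.expectation (\<lambda>w. y w * v j w) = 0"
      if y: "j < N" "y \<in> borel_measurable (F (s + d j))" "\<And>w. \<bar>y w\<bar> \<le> 1" for j y
    proof -
      have "d (Suc j) \<le> h" using d(3)[of "Suc j"] y by simp
      note r = X.mart_orthogonal[OF f s d(1,2)[of j] this y(2,3)] Y.mart_orthogonal[OF k s d(1,2)[of j] this y(2,3)]
      show "X.expectation (\<lambda>w. y w * u j w) = 0" unfolding u_def U_def by (rule r)
      show "X.expectation (\<lambda>w. y w * v j w) = 0" unfolding v_def V_def by (rule r)
    qed
    \<comment> \<open>Discrete product rule; the last summand is the covariation.\<close>
    have tel: "U h w * V h w - U 0 w * V 0 w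
        = (\<Sum>j<N. U (d j) w * v j w + V (d j) w * u j w + u j w * v j w)" for w
    proof -
      have "(\<Sum>j<N. U (d j) w * v j w + V (d j) w * u j w + u j w * v j w)
         = (\<Sum>j<N. U (d (Suc j)) w * V (d (Suc j)) w - U (d j) w * V (d j) w)"
        by (intro sum.cong) (auto simp: u_def v_def algebra_simps)
      also have "\<dots> = U (d N) w * V (d N) w - U (d 0) w * V (d 0) w"
        by (rule sum_lessThan_telescope)
      finally show ?thesis using d by simp
    qed
    define S where "S w = (\<Sum>j<N. u j w * v j w)" for w
    have SM: "S \<in> borel_measurable M" unfolding S_def using uvM by measurable
    have Sb: "\<bar>S w\<bar> \<le> N" for w
    proof -
      have "\<bar>S w\<bar> \<le> (\<Sum>j<N. \<bar>u j w * v j w\<bar>)" unfolding S_def by (rule sum_abs)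
      also have "\<dots> \<le> (\<Sum>j<N. 1)" by (intro sum_mono) (auto simp: abs_mult intro!: mult_le_one ub)
      finally show ?thesis by simp
    qed
    have i1: "integrable M (\<lambda>w. (b w * U (d j) w) * v j w)" "integrable M (\<lambda>w. (b w * V (d j) w) * u j w)"
       "integrable M (\<lambda>w. b w * (u j w * v j w))" for j
      using bM UM[OF d(1)[of j]] uvM[of j]
      by (auto intro!: int1 mult_le_one b01 ub simp: abs_mult abs_of_nonneg Ub Vb)
    have bS: "\<bar>b w * S w\<bar> \<le> real N" for w
      using mult_mono[OF b01[of w] Sb[of w]] by (simp add: abs_mult)
    have bSM: "(\<lambda>w. b w * S w) \<in> borel_measurable M" using bM SM by measurable
    have iS: "integrable M (\<lambda>w. b w * S w)"
      by (rule X.integrable_const_bound[of _ "real N"]) (use bS bSM in auto)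
    have iUV: "integrable M (\<lambda>w. b w * (U c w * V c w))" if c: "0 \<le> c" for c
    proof (rule int1)
      note [measurable] = bM UM[OF c]
      show "(\<lambda>w. b w * (U c w * V c w)) \<in> borel_measurable M" by measurable
      show "\<bar>b w * (U c w * V c w)\<bar> \<le> 1" for w
        unfolding abs_mult by (intro mult_le_one b01) (simp_all add: Ub Vb abs_of_nonneg)
    qed
    have bU: "(\<lambda>w. b w * U (d j) w) \<in> borel_measurable (F (s + d j))" "\<bar>b w * U (d j) w\<bar> \<le> 1"
       "(\<lambda>w. b w * V (d j) w) \<in> borel_measurable (F (s + d j))" "\<bar>b w * V (d j) w\<bar> \<le> 1" for j w
    proof -
      have "s \<le> s + d j" using d(1)[of j] by simp
      note [measurable] = bm[OF this] Um[OF d(1)[of j] order_refl]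
      show "(\<lambda>w. b w * U (d j) w) \<in> borel_measurable (F (s + d j))"
        "(\<lambda>w. b w * V (d j) w) \<in> borel_measurable (F (s + d j))" by measurable
      show "\<bar>b w * U (d j) w\<bar> \<le> 1" "\<bar>b w * V (d j) w\<bar> \<le> 1"
        unfolding abs_mult by (intro mult_le_one b01; simp add: Ub Vb abs_of_nonneg)+
    qed
    have "X.expectation (\<lambda>w. b w * (U h w * V h w)) - X.expectation (\<lambda>w. b w * (U 0 w * V 0 w))
        = X.expectation (\<lambda>w. b w * (U h w * V h w) - b w * (U 0 w * V 0 w))"
      using h by (intro Bochner_Integration.integral_diff[symmetric] iUV) simp_all
    also have "\<dots> = X.expectation (\<lambda>w. (\<Sum>j<N. (b w * U (d j) w) * v j w)
        + (\<Sum>j<N. (b w * V (d j) w) * u j w) + b w * S w)"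
      unfolding right_diff_distrib[symmetric] tel
      by (simp add: S_def sum.distrib distrib_left sum_distrib_left mult_ac)
    also have "\<dots> = (\<Sum>j<N. X.expectation (\<lambda>w. (b w * U (d j) w) * v j w))
        + (\<Sum>j<N. X.expectation (\<lambda>w. (b w * V (d j) w) * u j w)) + X.expectation (\<lambda>w. b w * S w)"
      using i1 iS by (simp add: Bochner_Integration.integral_add Bochner_Integration.integral_sum)
    \<comment> \<open>The weight \<open>b w * U (d j) w\<close> is known at time
      \<open>s + d j\<close>, and the increment of the other martingale after that time is
      orthogonal to it.\<close>
    also have "(\<Sum>j<N. X.expectation (\<lambda>w. (b w * U (d j) w) * v j w)) = 0"
      by (intro sum.neutral ballI Vo bU) auto
    also have "(\<Sum>j<N. X.expectation (\<lambda>w. (b w * V (d j) w) * u j w)) = 0"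
      by (intro sum.neutral ballI Uo bU) auto
    finally have eq: "X.expectation (\<lambda>w. b w * (U h w * V h w)) - X.expectation (\<lambda>w. b w * (U 0 w * V 0 w))
        = X.expectation (\<lambda>w. b w * S w)" by simp
    have iS2: "integrable M (\<lambda>w. (S w)\<^sup>2)" "integrable M (\<lambda>w. (b w * S w)\<^sup>2)"
    proof -
      have "(S w)\<^sup>2 \<le> (real N)\<^sup>2" for w using Sb[of w] by (metis abs_ge_zero power2_abs power_mono)
      moreover from this have "(b w * S w)\<^sup>2 \<le> (real N)\<^sup>2" for w by (auto simp: b_def indicator_def)
      ultimately show "integrable M (\<lambda>w. (S w)\<^sup>2)" "integrable M (\<lambda>w. (b w * S w)\<^sup>2)"
        using SM bSM by (auto intro!: X.integrable_const_bound[of _ "(real N)\<^sup>2"] borel_measurable_power)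
    qed
    have "(X.expectation (\<lambda>w. b w * S w))\<^sup>2 \<le> X.expectation (\<lambda>w. (b w * S w)\<^sup>2)"
      using X.variance_eq[OF iS iS2(2)] X.variance_positive[of "\<lambda>w. b w * S w"] by simp
    also have "\<dots> \<le> X.expectation (\<lambda>w. (S w)\<^sup>2)"
      using iS2 by (intro integral_mono) (auto simp: b_def indicator_def)
    also have "\<dots> = (\<Sum>j<N. X.expectation (\<lambda>w. (u j w)\<^sup>2) * X.expectation (\<lambda>w. (v j w)\<^sup>2))"
      unfolding S_def
    proof (rule X.expectation_orthogonal_products)
      fix i j assume ij: "i < j" "j < N"
      show "X.expectation (\<lambda>w. u i w * u j w) = 0"
        by (rule Uo) (use ij um ub in auto)
    next
      fix i j assume "i < N" "j < N"
      have [measurable]: "f \<in> borel_measurable borel" "k \<in> borel_measurable borel"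
        using f k by (auto simp: test_fun_def)
      \<comment> \<open>The martingale increments are written as functionals of whole paths, because
        independence is given between the paths of \<open>X\<close> and those of
        \<open>Y\<close>.\<close>
      define G where "G i p = X.trans f (h - d (Suc i)) (p (s + d (Suc i)) - p s)
          - X.trans f (h - d i) (p (s + d i) - p s)" for i and p :: "real => real"
      define H where "H i p = Y.trans k (h - d (Suc i)) (p (s + d (Suc i)) - p s)
          - Y.trans k (h - d i) (p (s + d i) - p s)" for i and p :: "real => real"
      have c: "(\<lambda>p. p (s + d i)) \<in> borel_measurable (\<Pi>\<^sub>M t\<in>{0..}. borel)"
         "(\<lambda>p. p s) \<in> borel_measurable (\<Pi>\<^sub>M t\<in>{0..}. borel)" for i
        using s d(1)[of i] by (auto intro!: measurable_component_singleton)
      have Gm: "G i \<in> borel_measurable (\<Pi>\<^sub>M t\<in>{0..}. borel)" "H i \<in> borel_measurable (\<Pi>\<^sub>M t\<in>{0..}. borel)" for i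
        unfolding G_def H_def using c by measurable
      have Gb: "\<bar>G i p\<bar> \<le> 1" "\<bar>H i p\<bar> \<le> 1" for i p
      proof -
        have "0 \<le> X.trans f a b" "X.trans f a b \<le> 1" "0 \<le> Y.trans k a b" "Y.trans k a b \<le> 1" for a b
          using X.test_fun_trans[OF f] Y.test_fun_trans[OF k] by (auto simp: test_fun_def)
        note t = this
        show "\<bar>G i p\<bar> \<le> 1" unfolding G_def
          using t(1,2)[of "h - d i" "p (s + d i) - p s"] t(1,2)[of "h - d (Suc i)" "p (s + d (Suc i)) - p s"] by linarith
        show "\<bar>H i p\<bar> \<le> 1" unfolding H_def
          using t(3,4)[of "h - d i" "p (s + d i) - p s"] t(3,4)[of "h - d (Suc i)" "p (s + d (Suc i)) - p s"] by linarith
      qed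
      have uG: "u i w = G i (\<lambda>t\<in>{0..}. X t w)" "v i w = H i (\<lambda>t\<in>{0..}. Y t w)" for i w
        using s d(1) by (auto simp: u_def v_def G_def H_def U_def V_def X.mart_def Y.mart_def)
      show "X.expectation (\<lambda>w. (u i w * u j w) * (v i w * v j w))
        = X.expectation (\<lambda>w. u i w * u j w) * X.expectation (\<lambda>w. v i w * v j w)"
        unfolding uG
        by (rule indep_functionals[of "\<lambda>p. G i p * G j p" "\<lambda>p. H i p * H j p"])
          (use Gm in \<open>auto simp: abs_mult intro!: mult_le_one Gb\<close>)
    qed (use uvM ub in auto)
    \<comment> \<open>One factor is bounded uniformly by \<open>osc\<close>, which tends to 0 with
      the mesh. The other factors have a bounded sum: by orthogonality of the increments of
      \<open>V\<close> their second moments telescope to a difference of second moments of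
      \<open>V\<close>, at most 1.\<close>
    also have "\<dots> \<le> (\<Sum>j<N. 2 * X.osc L \<delta> * X.expectation (\<lambda>w. (v j w)\<^sup>2))"
    proof (intro sum_mono mult_right_mono)
      fix j assume "j \<in> {..<N}"
      then show "X.expectation (\<lambda>w. (u j w)\<^sup>2) \<le> 2 * X.osc L \<delta>"
        using X.mart_increment[OF f L s, of "d j" "d (Suc j)" h] d(1,2,4)[of j] d(3)[of "Suc j"]
        by (auto simp: u_def U_def)
    qed simp
    also have "\<dots> = 2 * X.osc L \<delta> * (\<Sum>j<N. X.expectation (\<lambda>w. (v j w)\<^sup>2))"
      by (simp add: sum_distrib_left)
    also have "(\<Sum>j<N. X.expectation (\<lambda>w. (v j w)\<^sup>2))
        = (\<Sum>j<N. X.expectation (\<lambda>w. (V (d (Suc j)) w)\<^sup>2) - X.expectation (\<lambda>w. (V (d j) w)\<^sup>2))"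
    proof (intro sum.cong refl)
      fix j assume j: "j \<in> {..<N}"
      note [measurable] = UM[OF d(1)[of j]] uvM[of j]
      have i: "integrable M (\<lambda>w. (V (d j) w)\<^sup>2)" "integrable M (\<lambda>w. V (d j) w * v j w)" "integrable M (\<lambda>w. (v j w)\<^sup>2)"
      proof -
        have "\<bar>(V (d j) w)\<^sup>2\<bar> \<le> 1" "\<bar>(v j w)\<^sup>2\<bar> \<le> 1" for w
          using ub(2)[of j w] Vb[of "d j" w] by (simp_all add: abs_square_le_1)
        moreover have "\<bar>V (d j) w * v j w\<bar> \<le> 1" for w
          unfolding abs_mult using Vb[of "d j" w] by (intro mult_le_one ub) auto
        ultimately show "integrable M (\<lambda>w. (V (d j) w)\<^sup>2)" "integrable M (\<lambda>w. V (d j) w * v j w)" "integrable M (\<lambda>w. (v j w)\<^sup>2)"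
          by (auto intro!: int1)
      qed
      have e: "(V (d (Suc j)) w)\<^sup>2 = (V (d j) w)\<^sup>2 + 2 * (V (d j) w * v j w) + (v j w)\<^sup>2" for w
        by (simp add: v_def power2_eq_square algebra_simps)
      have "X.expectation (\<lambda>w. (V (d (Suc j)) w)\<^sup>2)
        = X.expectation (\<lambda>w. (V (d j) w)\<^sup>2) + 2 * X.expectation (\<lambda>w. V (d j) w * v j w) + X.expectation (\<lambda>w. (v j w)\<^sup>2)"
        unfolding e using i by simp
      also have "X.expectation (\<lambda>w. V (d j) w * v j w) = 0"
        by (rule Vo) (use j Um(2)[OF d(1)[of j] order_refl] in \<open>simp_all add: abs_of_nonneg Vb\<close>)
      finally show "X.expectation (\<lambda>w. (v j w)\<^sup>2) = X.expectation (\<lambda>w. (V (d (Suc j)) w)\<^sup>2) - X.expectation (\<lambda>w. (V (d j) w)\<^sup>2)"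
        by simp
    qed
    also have "\<dots> = X.expectation (\<lambda>w. (V (d N) w)\<^sup>2) - X.expectation (\<lambda>w. (V (d 0) w)\<^sup>2)"
      by (rule sum_lessThan_telescope)
    also have "2 * X.osc L \<delta> * \<dots> \<le> 2 * X.osc L \<delta> * 1"
    proof (rule mult_left_mono)
      have "X.expectation (\<lambda>w. (V (d N) w)\<^sup>2) \<le> 1"
      proof (rule X.integral_le_const)
        have b: "\<bar>(V (d N) w)\<^sup>2\<bar> \<le> 1" for w using Vb[of "d N" w] by (simp add: abs_square_le_1)
        show "integrable M (\<lambda>w. (V (d N) w)\<^sup>2)"
          by (rule int1) (use UM(2)[OF d(1)[of N]] b in \<open>auto intro!: borel_measurable_power\<close>)
        show "AE w in M. (V (d N) w)\<^sup>2 \<le> 1" using b by (simp add: abs_le_iff)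
      qed
      moreover have "0 \<le> X.expectation (\<lambda>w. (V (d 0) w)\<^sup>2)" by simp
      ultimately show "X.expectation (\<lambda>w. (V (d N) w)\<^sup>2) - X.expectation (\<lambda>w. (V (d 0) w)\<^sup>2) \<le> 1" by linarith
      show "0 \<le> 2 * X.osc L \<delta>" unfolding X.osc_def using L by simp
    qed
    finally show ?thesis using eq by (simp add: \<delta>_def N_def)
  qed
  have "(\<lambda>n. 2 * X.osc L (h / real (Suc n))) \<longlonglongrightarrow> 2 * 0"
    by (intro tendsto_mult_left X.osc_tendsto_0 h L)
  from LIMSEQ_le_const[OF this, of "(X.expectation (\<lambda>w. b w * (U h w * V h w)) - X.expectation (\<lambda>w. b w * (U 0 w * V 0 w)))\<^sup>2"] est
  have "X.expectation (\<lambda>w. b w * (U h w * V h w)) = X.expectation (\<lambda>w. b w * (U 0 w * V 0 w))"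
    by auto
  moreover have "U 0 w * V 0 w = X.trans f h 0 * Y.trans k h 0" for w
    using s by (simp add: U_def V_def X.mart_0 Y.mart_0)
  moreover have "B \<in> sets M" using B X.subalg[OF s] by (auto simp: subalgebra_def)
  ultimately show ?thesis
    by (simp add: U_def V_def X.mart_end[OF f] Y.mart_end[OF k] b_def mult.commute)
qed


end

text \<open>Lipschitz approximation, from above, of the indicator of \<open>{..x}\<close>.\<close>

definition ramp :: "nat => real => real => real" where
  "ramp n x z = max 0 (min 1 (1 - real n * (z - x)))"

lemma test_fun_ramp: "test_fun (real n) (ramp n x)"
proof -
  have "\<bar>ramp n x a - ramp n x b\<bar> \<le> min 1 (real n * \<bar>a - b\<bar>)" for a b
  proof -
    have *: "\<bar>max 0 (min 1 p) - max 0 (min 1 q)\<bar> \<le> min 1 \<bar>p - q\<bar>" for p q :: real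
      by (auto simp: max_def min_def)
    have "\<bar>(1 - real n * (a - x)) - (1 - real n * (b - x))\<bar> = \<bar>real n * (b - a)\<bar>"
      by (intro arg_cong[where f=abs]) (simp add: algebra_simps)
    also have "\<dots> = real n * \<bar>a - b\<bar>" by (simp add: abs_mult abs_minus_commute)
    finally show ?thesis using *[of "1 - real n * (a - x)" "1 - real n * (b - x)"] by (simp add: ramp_def)
  qed
  moreover have "ramp n x \<in> borel_measurable borel" unfolding ramp_def by measurable
  ultimately show ?thesis by (auto simp: test_fun_def ramp_def)
qed

lemma ramp_tendsto: "(\<lambda>n. ramp n x z) \<longlonglongrightarrow> indicator {..x} z"
proof (cases "z \<le> x")
  case True
  then have "ramp n x z = 1" for n
    using mult_nonneg_nonpos[of "real n" "z - x"] by (auto simp: ramp_def max_def min_def)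
  then show ?thesis using True by simp
next
  case False
  obtain N where N: "real N > 1 / (z - x)" using reals_Archimedean2 by blast
  have "ramp n x z = 0" if "n \<ge> N" for n
  proof -
    have "1 / (z - x) < real n" using N that by linarith
    then have "1 < real n * (z - x)" using False by (simp add: field_simps)
    then show ?thesis by (auto simp: ramp_def)
  qed
  then have "\<forall>\<^sub>F n in sequentially. ramp n x z = 0" unfolding eventually_sequentially by blast
  then show ?thesis using False tendsto_eventually by force
qed

lemma (in cadlag_levy) trans_ramp_tendsto:
  "(\<lambda>n. trans (ramp n x) h 0) \<longlonglongrightarrow> prob {w\<in>space M. Z h w \<le> x}"
proof -
  interpret Q: prob_space "distr M borel (Z h)" by (rule prob_space_law)
  have "(\<lambda>n. trans (ramp n x) h 0) \<longlonglongrightarrow> (\<integral>z. indicator {..x} z \<partial>distr M borel (Z h))"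
    unfolding trans_def
  proof (rule integral_dominated_convergence[of _ _ _ "\<lambda>_. 1"])
    show "AE z in distr M borel (Z h). norm (ramp n x (0 + z)) \<le> 1" for n
      using test_fun_ramp[of n x] by (auto simp: test_fun_def)
    show "(\<lambda>z. ramp n x (0 + z)) \<in> borel_measurable (distr M borel (Z h))" for n
      using test_fun_ramp[of n x] by (auto simp: test_fun_def)
  qed (auto intro: ramp_tendsto)
  also have "(\<integral>z. indicator {..x} z \<partial>distr M borel (Z h)) = measure (distr M borel (Z h)) {..x}" by simp
  also have "\<dots> = prob {w\<in>space M. Z h w \<le> x}"
    by (subst measure_distr) (auto intro!: arg_cong[where f=prob])
  finally show ?thesis .
qed

section \<open>Independence and stationarity of the joint increments\<close>

context levy_pair
begin

text \<open>Limit of \<open>joint_increment_test\<close> along \<open>ramp\<close>. A zero increment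
  is deterministic and treated apart, since the mesh argument needs \<open>0 < h\<close>.\<close>

lemma joint_increment_cdf:
  assumes s: "0 \<le> s" and h: "0 \<le> h" and B: "B \<in> sets (F s)"
  shows "X.prob {w\<in>B. X (s + h) w - X s w \<le> x \<and> Y (s + h) w - Y s w \<le> y}
     = X.prob B * (X.prob {w\<in>space M. X h w \<le> x} * X.prob {w\<in>space M. Y h w \<le> y})"
proof (cases "h = 0")
  case True
  have "{w\<in>space M. X 0 w \<le> x} = (if 0 \<le> x then space M else {})"
    "{w\<in>space M. Y 0 w \<le> y} = (if 0 \<le> y then space M else {})"
    using X.start[of _ 0] Y.start[of _ 0] by auto
  then show ?thesis using True by (auto simp: X.prob_space)
next
  case False
  with h have h: "0 < h" by simp
  have BM: "B \<in> sets M" using B X.subalg[OF s] by (auto simp: subalgebra_def)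
  have r01: "\<bar>ramp n x z\<bar> \<le> 1" and [measurable]: "ramp n x \<in> borel_measurable borel" for n x z
    using test_fun_ramp[of n x] by (auto simp: test_fun_def)
  have "(\<lambda>n. X.expectation (\<lambda>w. indicator B w * (ramp n x (X (s + h) w - X s w) * ramp n y (Y (s + h) w - Y s w))))
     \<longlonglongrightarrow> X.expectation (\<lambda>w. indicat_real B w * (indicat_real {..x} (X (s + h) w - X s w) * indicat_real {..y} (Y (s + h) w - Y s w)))"
    by (rule integral_dominated_convergence[of _ _ _ "\<lambda>_. 1"])
      (use BM in \<open>auto simp: abs_mult intro!: mult_le_one r01 tendsto_mult ramp_tendsto\<close>)
  also have "X.expectation (\<lambda>w. indicat_real B w * (indicat_real {..x} (X (s + h) w - X s w) * indicat_real {..y} (Y (s + h) w - Y s w)))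
     = X.expectation (indicat_real {w\<in>B. X (s + h) w - X s w \<le> x \<and> Y (s + h) w - Y s w \<le> y})"
    by (intro Bochner_Integration.integral_cong) (auto simp: indicator_def)
  also have "\<dots> = X.prob {w\<in>B. X (s + h) w - X s w \<le> x \<and> Y (s + h) w - Y s w \<le> y}"
    using sets.sets_into_space[OF BM] by (auto simp: Int_absorb2 subset_iff intro!: arg_cong[where f=X.prob])
  finally have 1: "(\<lambda>n. X.expectation (\<lambda>w. indicator B w * (ramp n x (X (s + h) w - X s w) * ramp n y (Y (s + h) w - Y s w))))
     \<longlonglongrightarrow> X.prob {w\<in>B. X (s + h) w - X s w \<le> x \<and> Y (s + h) w - Y s w \<le> y}" .
  have 2: "(\<lambda>n. X.prob B * (X.trans (ramp n x) h 0 * Y.trans (ramp n y) h 0))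
     \<longlonglongrightarrow> X.prob B * (X.prob {w\<in>space M. X h w \<le> x} * X.prob {w\<in>space M. Y h w \<le> y})"
    by (intro tendsto_mult tendsto_const X.trans_ramp_tendsto Y.trans_ramp_tendsto)
  have "X.expectation (\<lambda>w. indicator B w * (ramp n x (X (s + h) w - X s w) * ramp n y (Y (s + h) w - Y s w)))
     = X.prob B * (X.trans (ramp n x) h 0 * Y.trans (ramp n y) h 0)" for n
    by (rule joint_increment_test[OF s h B _ test_fun_ramp test_fun_ramp]) simp
  with 1 2 show ?thesis using LIMSEQ_unique by simp
qed

lemma sets_borel_prod_atMost: "sets (borel :: (real \<times> real) measure) = sigma_sets UNIV (range (\<lambda>a. {..a}))"
  by (subst borel_eq_atMost) simp

lemma Int_stable_atMost: "Int_stable (range (\<lambda>a. {..a :: real \<times> real}))"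
proof (rule Int_stableI)
  fix a b :: "(real \<times> real) set" assume "a \<in> range (\<lambda>a. {..a})" "b \<in> range (\<lambda>a. {..a})"
  then obtain p q where "a = {..p}" "b = {..q}" by blast
  then have "a \<inter> b = {..inf p q}" by auto
  then show "a \<inter> b \<in> range (\<lambda>a. {..a})" by blast
qed

text \<open>Lower left quadrants generate the Borel sets of the plane and are closed under
  intersection, so the factorisation of the distribution function is enough. The Markov property
  below rests on this joint form of independence from the past.\<close>

lemma joint_increment_indep:
  assumes s: "0 \<le> s" and h: "0 \<le> h"
  shows "X.indep_set (sets (F s))
     {(\<lambda>w. (X (s + h) w - X s w, Y (s + h) w - Y s w)) -` B \<inter> space M |B. B \<in> sets borel}"
proof -
  let ?D = "\<lambda>w. (X (s + h) w - X s w, Y (s + h) w - Y s w)"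
  define E where "E = {?D -` A \<inter> space M |A. A \<in> range (\<lambda>a. {..a})}"
  have D: "?D \<in> borel_measurable M" unfolding borel_prod[symmetric] by measurable
  have EM: "E \<subseteq> sets M" unfolding E_def using measurable_sets[OF D] by auto
  have FM: "sets (F s) \<subseteq> sets M" using X.subalg[OF s] by (simp add: subalgebra_def)
  have De: "?D -` {..(x, y)} \<inter> space M = {w\<in>space M. X (s + h) w - X s w \<le> x \<and> Y (s + h) w - Y s w \<le> y}" for x y
    by auto
  have "X.indep_set (sets (F s)) E"
    unfolding X.indep_sets2_eq
  proof (intro conjI FM EM ballI)
    fix B C assume B: "B \<in> sets (F s)" and C: "C \<in> E"
    show "X.prob (B \<inter> C) = X.prob B * X.prob C"
    proof -
      obtain x y where C: "C = ?D -` {..(x, y)} \<inter> space M" using C unfolding E_def by force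
      have BC: "B \<inter> C = {w\<in>B. X (s + h) w - X s w \<le> x \<and> Y (s + h) w - Y s w \<le> y}"
        using sets.sets_into_space[of B M] B FM unfolding C De by auto
      have "space M \<in> sets (F s)" using X.space_F[OF s] sets.top[of "F s"] by simp
      from joint_increment_cdf[OF s h this, of x y]
      have "X.prob C = X.prob {w\<in>space M. X h w \<le> x} * X.prob {w\<in>space M. Y h w \<le> y}"
        unfolding C De X.prob_space by linarith
      then show ?thesis
        unfolding BC using joint_increment_cdf[OF s h B, of x y] by presburger
    qed
  qed
  moreover have "Int_stable E"
  proof (rule Int_stableI)
    fix a b assume "a \<in> E" "b \<in> E"
    then obtain p q where "a = ?D -` {..p} \<inter> space M" "b = ?D -` {..q} \<inter> space M" unfolding E_def by blast
    then have "a \<inter> b = ?D -` {..inf p q} \<inter> space M" by auto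
    then show "a \<inter> b \<in> E" unfolding E_def by blast
  qed
  ultimately have "X.indep_set (sigma_sets (space M) (sets (F s))) (sigma_sets (space M) E)"
    using X.indep_set_sigma_sets sets.Int_stable by blast
  moreover have "sigma_sets (space M) (sets (F s)) = sets (F s)"
    using sets.sigma_sets_eq[of "F s"] X.space_F[OF s] by simp
  moreover have "sigma_sets (space M) E = {?D -` B \<inter> space M |B. B \<in> sets borel}"
    unfolding E_def sets_borel_prod_atMost by (rule sigma_sets_vimage_commute[symmetric]) auto
  ultimately show ?thesis by simp
qed

text \<open>The distribution function found in \<open>joint_increment_cdf\<close> does not depend on
  the starting time; the law on the right is the case of start 0.\<close>

lemma joint_increment_distr:
  assumes s: "0 \<le> s" and h: "0 \<le> h"
  shows "distr M borel (\<lambda>w. (X (s + h) w - X s w, Y (s + h) w - Y s w)) = distr M borel (\<lambda>w. (X h w, Y h w))"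
    (is "?P = ?Q")
proof -
  have m: "(\<lambda>w. (X (s + h) w - X s w, Y (s + h) w - Y s w)) \<in> borel_measurable M"
    "(\<lambda>w. (X h w, Y h w)) \<in> borel_measurable M"
    unfolding borel_prod[symmetric] by measurable
  interpret P: prob_space ?P by (rule X.prob_space_distr[OF m(1)])
  have cdf: "X.prob {w\<in>space M. X (t + h) w - X t w \<le> x \<and> Y (t + h) w - Y t w \<le> y}
     = X.prob {w\<in>space M. X h w \<le> x} * X.prob {w\<in>space M. Y h w \<le> y}" if "0 \<le> t" for t x y
    using joint_increment_cdf[OF that h, of "space M" x y] X.space_F[OF that] sets.top[of "F t"]
    by (simp add: X.prob_space)
  have 0: "{w\<in>space M. X (0 + h) w - X 0 w \<le> x \<and> Y (0 + h) w - Y 0 w \<le> y} = {w\<in>space M. X h w \<le> x \<and> Y h w \<le> y}" for x y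
    using X.start[of _ 0] Y.start[of _ 0] by auto
  show ?thesis
  proof (rule measure_eqI_generator_eq[OF Int_stable_atMost, where \<Omega>=UNIV and A="\<lambda>i. {..(real i, real i)}"])
    fix A :: "(real \<times> real) set" assume "A \<in> range (\<lambda>a. {..a})"
    then obtain x y where A: "A = {..(x, y)}" by auto
    have "emeasure ?P A = X.prob {w\<in>space M. X (s + h) w - X s w \<le> x \<and> Y (s + h) w - Y s w \<le> y}"
      unfolding A by (subst emeasure_distr[OF m(1)]) (auto simp: X.emeasure_eq_measure intro!: arg_cong[where f=X.prob])
    also have "\<dots> = X.prob {w\<in>space M. X h w \<le> x \<and> Y h w \<le> y}"
      using cdf[OF s, of x y] cdf[of 0 x y] 0[of x y] by simp
    also have "\<dots> = emeasure ?Q A"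
      unfolding A by (subst emeasure_distr[OF m(2)]) (auto simp: X.emeasure_eq_measure intro!: arg_cong[where f=X.prob])
    finally show "emeasure ?P A = emeasure ?Q A" .
  next
    show "(\<Union>i. {..(real i, real i)}) = (UNIV :: (real \<times> real) set)"
    proof -
      have "\<exists>i. p \<in> {..(real i, real i)}" for p :: "real \<times> real"
        using real_arch_simple[of "max (fst p) (snd p)"] by (cases p) auto
      then show ?thesis by auto
    qed
    show "emeasure ?P {..(real i, real i)} \<noteq> \<infinity>" for i by simp
  qed (auto simp: sets_borel_prod_atMost)
qed

end

section \<open>The Markov property\<close>

lemma fst_snd_borel[measurable]:
  "(fst :: real \<times> real => real) \<in> borel_measurable borel"
  "(snd :: real \<times> real => real) \<in> borel_measurable borel"
  by (auto intro!: borel_measurable_continuous_onI continuous_intros)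

text \<open>The state consists of the running minimum of \<open>g\<close> less \<open>a\<close>
  times \<open>X\<close>, and of \<open>Y\<close>, both counted from the start. In these coordinates
  the present value of \<open>g\<close> enters the minimum as \<open>g - a X = Y\<close>, so the
  state is updated by the increments of \<open>X\<close> and \<open>Y\<close> alone and forms a
  Markov chain.\<close>

definition walk_step :: "real => real \<times> real => real \<times> real => real \<times> real" where
  "walk_step a p z = (min (fst p - a * fst z) (snd p + snd z), snd p + snd z)"

lemma walk_step_measurable[measurable (raw)]:
  assumes [measurable]: "f \<in> borel_measurable N" "g \<in> borel_measurable N"
  shows "(\<lambda>x. walk_step a (f x) (g x)) \<in> borel_measurable N"
  unfolding walk_step_def by measurable

text \<open>The model below has \<open>X = log E\<^sub>x\<close>, \<open>Y = log E\<^sub>c\<close> and \<open>a = \<alpha>/(1-\<alpha>)\<close>. The parameter \<open>e \<le> 0\<close> of \<open>walk\<close>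
  and \<open>ratio\<close> is the difference between the running infimum of \<open>g\<close> and \<open>g\<close> at the start.\<close>

locale levy_market = levy_pair M F X Y for M :: "'a measure" and F X Y +
  fixes a :: real and r :: real
begin

definition g :: "real => 'a => real" where
  "g t w = Y t w + a * X t w"

lemma g_cadlag: "w \<in> space M ==> cadlag (\<lambda>t. g t w)"
  unfolding g_def
  by (rule cadlag_compose2[of "\<lambda>y x. y + a * x", OF _ Y.cad X.cad])
    (auto simp: case_prod_beta intro!: continuous_intros)

lemma g_start: "w \<in> space M ==> t \<le> 0 ==> g t w = 0"
  by (simp add: g_def X.start Y.start)

lemma g_adap: "0 \<le> t ==> g t \<in> borel_measurable (F t)"
  unfolding g_def using X.adap[of t] Y.adap[of t] by measurable

lemma g_right_cont: "w \<in> space M ==> continuous (at_right t) (\<lambda>s. g s w)"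
  unfolding g_def by (intro continuous_intros X.right_cont Y.right_cont)

primrec walk :: "real => real => real => nat => 'a => real \<times> real" where
  "walk e s h 0 w = (e, 0)"
| "walk e s h (Suc j) w = walk_step a (walk e s h j w)
     (X (s + real (Suc j) * h) w - X (s + real j * h) w, Y (s + real (Suc j) * h) w - Y (s + real j * h) w)"

text \<open>The grid point 0 contributes the value 0 to the minimum, which is absorbed by the
  starting value because \<open>e \<le> 0\<close>.\<close>

lemma walk_eq:
  assumes "e \<le> 0"
  shows "walk e s h N w = (min e (MIN j\<in>{..N}. g (s + real j * h) w - g s w) - a * (X (s + real N * h) w - X s w),
      Y (s + real N * h) w - Y s w)"
proof (induction N)
  case 0
  then show ?case using assms by simp
next
  case (Suc N)
  let ?f = "\<lambda>j. g (s + real j * h) w - g s w"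
  define m where "m = (MIN j\<in>{..N}. ?f j)"
  define c where "c = a * (X (s + real (Suc N) * h) w - X s w)"
  have "(MIN j\<in>{..Suc N}. ?f j) = min (?f (Suc N)) m"
    unfolding atMost_Suc image_insert m_def by (subst Min_insert) auto
  moreover have "min (min e m - c) (q - c) = min e (min q m) - c" for q
    by (auto simp: min_def)
  moreover have "Y (s + real (Suc N) * h) w - Y s w = ?f (Suc N) - c"
    by (simp add: g_def c_def algebra_simps)
  moreover have "walk e s h (Suc N) w = (min (min e m - c) (Y (s + real (Suc N) * h) w - Y s w),
      Y (s + real (Suc N) * h) w - Y s w)"
    unfolding walk.simps Suc.IH walk_step_def m_def[symmetric] fst_conv snd_conv c_def
    by (simp add: right_diff_distrib)
  ultimately show ?case unfolding c_def by metis
qed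

lemma walk_measurable_at:
  assumes [measurable]: "e \<in> borel_measurable N" "T \<in> borel_measurable N" "h \<in> borel_measurable N" "\<eta> \<in> measurable N M"
  shows "(\<lambda>z. walk (e z) (T z) (h z) n (\<eta> z)) \<in> borel_measurable N"
proof (induction n)
  case (Suc n)
  note [measurable] = Suc.IH
  have [measurable]: "(\<lambda>z. X (T z + c * h z) (\<eta> z)) \<in> borel_measurable N"
    "(\<lambda>z. Y (T z + c * h z) (\<eta> z)) \<in> borel_measurable N" for c
    by (rule X.meas_at Y.meas_at; measurable)+
  show ?case unfolding walk.simps by measurable
qed simp

definition law :: "real => (real \<times> real) measure" where
  "law h = distr M borel (\<lambda>w. (X h w, Y h w))"

definition kern :: "real => (real \<times> real => ennreal) => real \<times> real => ennreal" where
  "kern h f p = (\<integral>\<^sup>+z. f (walk_step a p z) \<partial>law h)"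

lemma sets_law[measurable_cong, simp]: "sets (law h) = sets borel"
  by (simp add: law_def)

lemma prob_space_law: "prob_space (law h)"
  unfolding law_def by (rule X.prob_space_distr) measurable

lemma kern_measurable:
  assumes [measurable]: "f \<in> borel_measurable borel"
  shows "kern h f \<in> borel_measurable borel"
proof -
  interpret prob_space "law h" by (rule prob_space_law)
  show ?thesis unfolding kern_def by measurable
qed

lemma kern_power_measurable: "f \<in> borel_measurable borel ==> (kern h ^^ n) f \<in> borel_measurable borel"
  by (induction n) (auto intro: kern_measurable)

lemma walk_adapted:
  assumes "0 \<le> s" "0 \<le> h" "e \<in> borel_measurable (F s)"
  shows "(\<lambda>w. walk (e w) s h n w) \<in> borel_measurable (F (s + real n * h))"
proof (induction n)
  case (Suc n)
  let ?F = "F (s + real (Suc n) * h)"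
  have le: "s + real n * h \<le> s + real (Suc n) * h" "0 \<le> s + real n * h" "0 \<le> s + real (Suc n) * h"
    using assms by (auto simp: algebra_simps)
  note [measurable] = X.measurable_F_mono[OF Suc.IH le(2) le(1)] X.adap_le[OF le(1,3)] X.adap_le[OF order_refl le(3)]
    Y.adap_le[OF le(1,3)] Y.adap_le[OF order_refl le(3)]
  show ?case unfolding walk.simps by measurable
qed (use assms in auto)

text \<open>The last step is integrated out first: its increments are independent of the past,
  including the walk so far, and this turns \<open>f\<close> into \<open>kern h f\<close>.\<close>

lemma walk_markov:
  assumes s: "0 \<le> s" and h: "0 \<le> h" and e: "e \<in> borel_measurable (F s)"
    and V: "V \<in> borel_measurable (F s)" and f: "f \<in> borel_measurable borel"
  shows "(\<integral>\<^sup>+w. V w * f (walk (e w) s h n w) \<partial>M) = (\<integral>\<^sup>+w. V w * (kern h ^^ n) f (e w, 0) \<partial>M)"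
  using f
proof (induction n arbitrary: f)
  case (Suc n)
  let ?t = "s + real n * h"
  have t: "0 \<le> ?t" "s \<le> ?t" using s h by auto
  note [measurable] = Suc.prems
  have "(\<lambda>w. (X (?t + h) w - X ?t w, Y (?t + h) w - Y ?t w)) \<in> borel_measurable M"
    by measurable
  from X.indep_set_nn_integral[OF X.subalg[OF t(1)] this joint_increment_indep[OF t(1) h]
      X.measurable_F_mono[OF V s t(2)] walk_adapted[OF s h e, of n], of "\<lambda>q. f (walk_step a (fst q) (snd q))"]
  have "(\<integral>\<^sup>+w. V w * f (walk_step a (walk (e w) s h n w) (X (?t + h) w - X ?t w, Y (?t + h) w - Y ?t w)) \<partial>M)
     = (\<integral>\<^sup>+w. V w * kern h f (walk (e w) s h n w) \<partial>M)"
    unfolding joint_increment_distr[OF t(1) h] by (simp add: kern_def law_def)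
  then have "(\<integral>\<^sup>+w. V w * f (walk (e w) s h (Suc n) w) \<partial>M) = (\<integral>\<^sup>+w. V w * kern h f (walk (e w) s h n w) \<partial>M)"
    by (simp add: algebra_simps)
  also have "\<dots> = (\<integral>\<^sup>+w. V w * (kern h ^^ n) (kern h f) (e w, 0) \<partial>M)"
    by (rule Suc.IH[OF kern_measurable[OF Suc.prems]])
  finally show ?case by (simp add: funpow_swap1)
qed simp

lemma kern_power_eq:
  assumes "0 \<le> h" "f \<in> borel_measurable borel"
  shows "(kern h ^^ n) f (e, 0) = (\<integral>\<^sup>+w. f (walk e 0 h n w) \<partial>M)"
  using walk_markov[of 0 h "\<lambda>_. e" "\<lambda>_. 1" f n] assms by (simp add: X.emeasure_space_1)

text \<open>For \<open>e = low s w - g s w\<close> this is the logarithm of \<open>marg\<close> at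
  time \<open>s + u\<close> over \<open>price\<close> at time \<open>s\<close>, apart from the
  discounting over \<open>u\<close>; see \<open>marg_shift\<close>.\<close>

definition ratio :: "real => real => real => 'a => real" where
  "ratio e s u w = min e (running_inf (\<lambda>v. g (s + v) w - g s w) u) - a * (X (s + u) w - X s w)"

abbreviation ratio_approx :: "nat => real => real => real => 'a => real" where
  "ratio_approx k e s u w \<equiv> fst (walk e s (u / 2 ^ k) (2 ^ k) w)"

lemma cadlag_shift: "cadlag f ==> 0 \<le> s ==> cadlag (\<lambda>v. f (s + v) - c)"
proof -
  assume f: "cadlag f" and s: "0 \<le> s"
  have "cadlag (\<lambda>v. f (s + v))"
    unfolding cadlag_def
  proof (intro conjI allI impI)
    fix t :: real assume "0 \<le> t"
    have "filterlim (\<lambda>v. s + v) (at_right (s + t)) (at_right t)"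
      unfolding filterlim_at by (auto simp: eventually_at_right_field intro!: tendsto_intros exI[of _ "t + 1"])
    with cadlag_right[OF f, of "s + t"] \<open>0 \<le> t\<close> s show "continuous (at_right t) (\<lambda>v. f (s + v))"
      unfolding continuous_within by (auto intro: filterlim_compose)
  next
    fix t :: real assume "0 < t"
    have "filterlim (\<lambda>v. s + v) (at_left (s + t)) (at_left t)"
      unfolding filterlim_at by (auto simp: eventually_at_left_field intro!: tendsto_intros exI[of _ "t - 1"])
    moreover obtain l where "(f \<longlongrightarrow> l) (at_left (s + t))" using f s \<open>0 < t\<close> unfolding cadlag_def by force
    ultimately show "\<exists>l. ((\<lambda>v. f (s + v)) \<longlongrightarrow> l) (at_left t)"
      using filterlim_compose by blast
  qed
  then show ?thesis by (rule cadlag_compose[rotated]) (intro continuous_intros)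
qed

lemma ratio_approx_eq:
  assumes "e \<le> 0"
  shows "ratio_approx k e s u w = min e (grid_min (\<lambda>v. g (s + v) w - g s w) u k) - a * (X (s + u) w - X s w)"
  by (simp add: walk_eq[OF assms] grid_min_def mult.commute)

lemma ratio_approx_tendsto:
  assumes "w \<in> space M" "e \<le> 0" "0 \<le> s" "0 \<le> u"
  shows "(\<lambda>k. ratio_approx k e s u w) \<longlonglongrightarrow> ratio e s u w"
  unfolding ratio_approx_eq[OF assms(2)] ratio_def
  by (intro tendsto_intros cadlag_grid_min_tendsto cadlag_shift g_cadlag assms)

lemma ratio_measurable_at:
  assumes [measurable]: "e \<in> borel_measurable N" "T \<in> borel_measurable N" "u \<in> borel_measurable N" "\<eta> \<in> measurable N M"
    and le: "\<And>z. z \<in> space N ==> e z \<le> 0 \<and> 0 \<le> T z \<and> 0 \<le> u z"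
  shows "(\<lambda>z. ratio (e z) (T z) (u z) (\<eta> z)) \<in> borel_measurable N"
proof (rule borel_measurable_LIMSEQ_real)
  show "(\<lambda>k. ratio_approx k (e z) (T z) (u z) (\<eta> z)) \<longlonglongrightarrow> ratio (e z) (T z) (u z) (\<eta> z)" if "z \<in> space N" for z
    using le[OF that] measurable_space[OF assms(4) that] by (intro ratio_approx_tendsto) auto
  show "(\<lambda>z. ratio_approx k (e z) (T z) (u z) (\<eta> z)) \<in> borel_measurable N" for k
    using walk_measurable_at[of e N T "\<lambda>z. u z / 2 ^ k" \<eta> "2 ^ k"] by measurable
qed

text \<open>A bounded continuous substitute for the exponential: limits pass under the integral by
  dominated convergence, and \<open>L\<close> is released afterwards.\<close>

definition cut :: "nat => real => ennreal" where
  "cut L x = ennreal (min (real L) (exp x))"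

lemma cut_measurable[measurable]: "cut L \<in> borel_measurable borel"
  unfolding cut_def by measurable

lemma cut_le: "cut L x \<le> of_nat L"
  unfolding cut_def by (simp add: ennreal_of_nat_eq_real_of_nat)

lemma cut_tendsto: "(f \<longlongrightarrow> x) G ==> ((\<lambda>k. cut L (f k)) \<longlongrightarrow> cut L x) G"
  unfolding cut_def by (intro tendsto_intros) auto

lemma SUP_cut: "(SUP L. cut L x) = ennreal (exp x)"
proof (rule antisym)
  show "(SUP L. cut L x) \<le> ennreal (exp x)" unfolding cut_def by (intro SUP_least ennreal_leI) auto
  obtain L :: nat where "exp x \<le> real L" using real_arch_simple by blast
  then have "cut L x = ennreal (exp x)" by (simp add: cut_def min_absorb2)
  then show "ennreal (exp x) \<le> (SUP L. cut L x)" by (metis SUP_upper UNIV_I)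
qed

lemma incseq_cut: "incseq (\<lambda>L. cut L x)"
  unfolding cut_def by (intro incseq_SucI ennreal_leI) auto

definition ratio_mean :: "real => real => ennreal" where
  "ratio_mean u e = (\<integral>\<^sup>+w. ennreal (exp (ratio e 0 u w)) \<partial>M)"

lemma ratio_approx_mean_tendsto:
  assumes "e \<le> 0" "0 \<le> u"
  shows "(\<lambda>k. \<integral>\<^sup>+w. cut L (ratio_approx k e 0 u w) \<partial>M) \<longlonglongrightarrow> (\<integral>\<^sup>+w. cut L (ratio e 0 u w) \<partial>M)"
proof (rule nn_integral_dominated_convergence[where w="\<lambda>_. of_nat L"])
  show "(\<lambda>w. cut L (ratio_approx k e 0 u w)) \<in> borel_measurable M" for k
    using walk_measurable_at[of "\<lambda>_. e" M "\<lambda>_. 0" "\<lambda>_. u / 2 ^ k" "\<lambda>w. w" "2 ^ k"] by measurable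
  show "(\<lambda>w. cut L (ratio e 0 u w)) \<in> borel_measurable M"
    by (rule measurable_compose[OF ratio_measurable_at cut_measurable]) (use assms in auto)
  show "(\<integral>\<^sup>+w. of_nat L \<partial>M) < \<infinity>" by (simp add: X.emeasure_space_1 ennreal_of_nat_eq_real_of_nat)
qed (use assms in \<open>auto intro!: cut_le cut_tendsto ratio_approx_tendsto\<close>)

text \<open>A single index truncates both factors. As both truncations increase, the diagonal
  already attains the double supremum, and monotone convergence applies.\<close>

lemma SUP_bounded_product:
  fixes V C :: "'b => ennreal"
  assumes [measurable]: "V \<in> borel_measurable N" "\<And>L. C' L \<in> borel_measurable N"
    and inc: "\<And>z. z \<in> space N ==> incseq (\<lambda>L. C' L z)" and C: "\<And>z. z \<in> space N ==> (SUP L. C' L z) = C z"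
  shows "(\<integral>\<^sup>+z. V z * C z \<partial>N) = (SUP L::nat. \<integral>\<^sup>+z. min (of_nat L) (V z) * C' L z \<partial>N)"
proof -
  have SV: "(SUP L::nat. min (of_nat L) v) = v" for v :: ennreal
  proof -
    have "(SUP L::nat. inf (of_nat L :: ennreal) v) = inf (SUP L::nat. of_nat L) v" by (rule SUP_inf[symmetric])
    then show ?thesis by (simp add: ennreal_SUP_of_nat_eq_top inf_min)
  qed
  have iV: "incseq (\<lambda>L::nat. min (of_nat L) v)" for v :: ennreal
    by (intro incseq_SucI min.mono order_refl) (simp add: ennreal_of_nat_eq_real_of_nat)
  have "(\<integral>\<^sup>+z. V z * C z \<partial>N) = (\<integral>\<^sup>+z. (SUP L::nat. min (of_nat L) (V z) * C' L z) \<partial>N)"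
  proof (rule nn_integral_cong)
    fix z assume z: "z \<in> space N"
    have "(SUP L::nat. min (of_nat L) (V z)) * (SUP L. C' L z) \<le> (SUP L::nat. min (of_nat L) (V z) * C' L z)"
      unfolding SUP_mult_left_ennreal unfolding SUP_mult_right_ennreal
    proof (intro SUP_least)
      fix i j :: nat
      have "min (of_nat j) (V z) * C' i z \<le> min (of_nat (max i j)) (V z) * C' (max i j) z"
        by (intro mult_mono incseqD[OF iV] incseqD[OF inc[OF z]]) auto
      also have "\<dots> \<le> (SUP L::nat. min (of_nat L) (V z) * C' L z)" by (rule SUP_upper) simp
      finally show "min (of_nat j) (V z) * C' i z \<le> (SUP L::nat. min (of_nat L) (V z) * C' L z)" .
    qed
    moreover have "(SUP L::nat. min (of_nat L) (V z) * C' L z) \<le> (SUP L::nat. min (of_nat L) (V z)) * (SUP L. C' L z)"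
      by (intro SUP_least mult_mono SUP_upper) auto
    ultimately show "V z * C z = (SUP L::nat. min (of_nat L) (V z) * C' L z)"
      unfolding SV C[OF z] by (rule antisym)
  qed
  also have "\<dots> = (SUP L::nat. \<integral>\<^sup>+z. min (of_nat L) (V z) * C' L z \<partial>N)"
  proof (rule nn_integral_monotone_convergence_SUP_AE)
    show "AE z in N. min (of_nat L) (V z) * C' L z \<le> min (of_nat (Suc L)) (V z) * C' (Suc L) z" for L
      by (intro AE_I2 mult_mono incseq_SucD[OF inc] incseq_SucD[OF iV]) simp_all
  qed measurable
  finally show ?thesis .
qed

lemma cut_mean_measurable:
  assumes "0 \<le> u"
  shows "(\<lambda>e. \<integral>\<^sup>+w. cut L (ratio (min e 0) 0 u w) \<partial>M) \<in> borel_measurable borel"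
proof -
  have "(\<lambda>z. ratio (min (fst z) 0) 0 u (snd z)) \<in> borel_measurable (borel \<Otimes>\<^sub>M M)"
    by (rule ratio_measurable_at) (use assms in auto)
  from measurable_compose[OF this cut_measurable[of L]] show ?thesis
    by (intro X.borel_measurable_nn_integral) (simp add: case_prod_beta)
qed

lemma SUP_cut_mean:
  assumes "e \<le> 0" "0 \<le> u"
  shows "(SUP L. \<integral>\<^sup>+w. cut L (ratio e 0 u w) \<partial>M) = ratio_mean u e"
  unfolding ratio_mean_def
proof (subst nn_integral_monotone_convergence_SUP[symmetric])
  show "(\<lambda>w. cut L (ratio e 0 u w)) \<in> borel_measurable M" for L
    by (rule measurable_compose[OF ratio_measurable_at cut_measurable]) (use assms in auto)
qed (use incseq_cut in \<open>auto simp: SUP_cut incseq_def le_fun_def\<close>)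

text \<open>On a grid both sides reduce to the same iterated kernel started at
  \<open>(e w, 0)\<close>. The grid is refined while the integrands are truncated, then the
  truncation is released. Integration against an arbitrary \<open>V\<close> known at
  \<open>s\<close> plays the role of a conditional expectation.\<close>

theorem markov_ratio:
  assumes s: "0 \<le> s" and u: "0 \<le> u" and e: "e \<in> borel_measurable (F s)" "\<And>w. e w \<le> 0"
    and V: "V \<in> borel_measurable (F s)"
  shows "(\<integral>\<^sup>+w. V w * ennreal (exp (ratio (e w) s u w)) \<partial>M) = (\<integral>\<^sup>+w. V w * ratio_mean u (e w) \<partial>M)"
proof -
  note [measurable] = X.measurable_F_M[OF e(1) s] X.measurable_F_M[OF V s]
  have rm: "(\<lambda>w. cut L (ratio (e w) s u w)) \<in> borel_measurable M" for L
    by (rule measurable_compose[OF ratio_measurable_at cut_measurable]) (use assms(1,2) e in auto)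
  have am: "(\<lambda>w. cut L (ratio_approx k (e w) s u w)) \<in> borel_measurable M" for L k
    using walk_measurable_at[of e M "\<lambda>_. s" "\<lambda>_. u / 2 ^ k" "\<lambda>w. w" "2 ^ k"] by measurable
  have mm: "(\<lambda>w. \<integral>\<^sup>+w'. cut L (ratio (e w) 0 u w') \<partial>M) \<in> borel_measurable M" for L
    using measurable_compose[OF X.measurable_F_M[OF e(1) s] cut_mean_measurable[OF u, of L]] e(2)
    by (simp add: min_absorb1)
  have ma: "(\<lambda>w. \<integral>\<^sup>+w'. cut L (ratio_approx k (e w) 0 u w') \<partial>M) \<in> borel_measurable M" for L k
  proof -
    have "(\<lambda>w. (kern (u / 2 ^ k) ^^ (2 ^ k)) (\<lambda>p. cut L (fst p)) (e w, 0)) \<in> borel_measurable M"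
      by (rule measurable_compose[OF _ kern_power_measurable]) measurable
    then show ?thesis using u by (subst (asm) kern_power_eq) (auto simp del: power_0)
  qed
  have bounded: "(\<integral>\<^sup>+w. V' w * cut L (ratio (e w) s u w) \<partial>M) = (\<integral>\<^sup>+w. V' w * (\<integral>\<^sup>+w'. cut L (ratio (e w) 0 u w') \<partial>M) \<partial>M)"
    if V': "V' \<in> borel_measurable (F s)" "\<And>w. V' w \<le> of_nat L" for V' L
  proof -
    note [measurable] = X.measurable_F_M[OF V'(1) s] rm[of L] am[of L] mm[of L] ma[of L]
    have fin: "(\<integral>\<^sup>+w. of_nat L * of_nat L \<partial>M) < \<infinity>"
      by (simp add: X.emeasure_space_1 ennreal_of_nat_eq_real_of_nat ennreal_mult[symmetric])
    have c: "(\<integral>\<^sup>+w'. cut L (f w') \<partial>M) \<le> of_nat L" for f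
      using nn_integral_mono[of M "\<lambda>w'. cut L (f w')" "\<lambda>_. of_nat L"] cut_le by (simp add: X.emeasure_space_1)
    have neq: "x \<noteq> \<top>" if "x \<le> of_nat L" for x :: ennreal
      using that by (metis ennreal_of_nat_neq_top top.extremum_unique)
    have 1: "(\<lambda>k. \<integral>\<^sup>+w. V' w * cut L (ratio_approx k (e w) s u w) \<partial>M) \<longlonglongrightarrow> (\<integral>\<^sup>+w. V' w * cut L (ratio (e w) s u w) \<partial>M)"
    proof (rule nn_integral_dominated_convergence[where w="\<lambda>_. of_nat L * of_nat L"])
      show "AE w in M. (\<lambda>k. V' w * cut L (ratio_approx k (e w) s u w)) \<longlonglongrightarrow> V' w * cut L (ratio (e w) s u w)"
        using e s u neq[OF V'(2)] neq[OF cut_le]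
        by (intro AE_I2 ennreal_tendsto_cmult cut_tendsto ratio_approx_tendsto) (auto simp: top.not_eq_extremum)
    qed (use fin in \<open>auto intro!: AE_I2 mult_mono cut_le V'(2)\<close>)
    have 2: "(\<lambda>k. \<integral>\<^sup>+w. V' w * (\<integral>\<^sup>+w'. cut L (ratio_approx k (e w) 0 u w') \<partial>M) \<partial>M)
        \<longlonglongrightarrow> (\<integral>\<^sup>+w. V' w * (\<integral>\<^sup>+w'. cut L (ratio (e w) 0 u w') \<partial>M) \<partial>M)"
    proof (rule nn_integral_dominated_convergence[where w="\<lambda>_. of_nat L * of_nat L"])
      show "AE w in M. (\<lambda>k. V' w * (\<integral>\<^sup>+w'. cut L (ratio_approx k (e w) 0 u w') \<partial>M))
          \<longlonglongrightarrow> V' w * (\<integral>\<^sup>+w'. cut L (ratio (e w) 0 u w') \<partial>M)"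
        using e s u neq[OF V'(2)]
        by (intro AE_I2 ennreal_tendsto_cmult ratio_approx_mean_tendsto) (auto simp: top.not_eq_extremum)
    qed (use fin in \<open>auto intro!: AE_I2 mult_mono c V'(2)\<close>)
    have "(\<integral>\<^sup>+w. V' w * cut L (ratio_approx k (e w) s u w) \<partial>M)
       = (\<integral>\<^sup>+w. V' w * (\<integral>\<^sup>+w'. cut L (ratio_approx k (e w) 0 u w') \<partial>M) \<partial>M)" for k
    proof -
      have k: "(kern (u / 2 ^ k) ^^ (2 ^ k)) (\<lambda>p. cut L (fst p)) (c, 0)
          = (\<integral>\<^sup>+w'. cut L (ratio_approx k c 0 u w') \<partial>M)" for c
        by (rule kern_power_eq) (use u in auto)
      show ?thesis
        unfolding k[symmetric] by (rule walk_markov[OF s _ e(1) V'(1)]) (use u in auto)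
    qed
    with 1 2 show ?thesis using LIMSEQ_unique by simp
  qed
  have "(\<integral>\<^sup>+w. V w * ennreal (exp (ratio (e w) s u w)) \<partial>M)
     = (SUP L. \<integral>\<^sup>+w. min (of_nat L) (V w) * cut L (ratio (e w) s u w) \<partial>M)"
    by (rule SUP_bounded_product) (use rm in \<open>auto simp: incseq_cut SUP_cut\<close>)
  also have "\<dots> = (SUP L. \<integral>\<^sup>+w. min (of_nat L) (V w) * (\<integral>\<^sup>+w'. cut L (ratio (e w) 0 u w') \<partial>M) \<partial>M)"
  proof (intro SUP_cong refl bounded)
    show "(\<lambda>w. min (of_nat L) (V w)) \<in> borel_measurable (F s)" for L :: nat using V by measurable
  qed simp
  also have "\<dots> = (\<integral>\<^sup>+w. V w * ratio_mean u (e w) \<partial>M)"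
  proof (rule SUP_bounded_product[symmetric])
    fix w
    show "incseq (\<lambda>L. \<integral>\<^sup>+w'. cut L (ratio (e w) 0 u w') \<partial>M)"
      by (intro incseq_SucI nn_integral_mono incseq_SucD[OF incseq_cut])
    show "(SUP L. \<integral>\<^sup>+w'. cut L (ratio (e w) 0 u w') \<partial>M) = ratio_mean u (e w)"
      by (rule SUP_cut_mean[OF e(2) u])
  qed (use mm in auto)
  finally show ?thesis .
qed

end

section \<open>Stopping times and the strong Markov property\<close>

context cadlag_levy
begin

text \<open>The times \<open>c n\<close> increase to \<open>q\<close>, so the event is a countable
  union of events that are known at times before \<open>q\<close>.\<close>

lemma stopping_less:
  assumes t: "ext_stopping_time M F \<tau>" and A: "A \<subseteq> space M" "\<And>t. 0 \<le> t ==> {w\<in>A. \<tau> w \<le> ennreal t} \<in> sets (F t)"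
    and q: "0 \<le> q"
  shows "{w\<in>A. \<tau> w < ennreal q} \<in> sets (F q)"
proof -
  define c where "c n = q * (1 - 1 / real (Suc n))" for n
  have c: "0 \<le> c n" "c n \<le> q" for n using q by (auto simp: c_def mult_left_le)
  have lim: "c \<longlonglongrightarrow> q"
  proof -
    have "(\<lambda>n. q * (1 - 1 / real (Suc n))) \<longlonglongrightarrow> q * (1 - 0)"
      by (intro tendsto_intros) (use LIMSEQ_inverse_real_of_nat in \<open>simp add: inverse_eq_divide\<close>)
    then show ?thesis by (simp add: c_def[abs_def])
  qed
  have "{w\<in>A. \<tau> w < ennreal q} = (\<Union>n. {w\<in>A. \<tau> w \<le> ennreal (c n)}) \<inter> {w\<in>A. \<tau> w < ennreal q}"
  proof -
    have "\<exists>n. \<tau> w \<le> ennreal (c n)" if less: "\<tau> w < ennreal q" for w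
    proof -
      obtain x where x: "\<tau> w = ennreal x" "0 \<le> x" using less by (cases "\<tau> w") auto
      then have "x < q" using less by (simp add: ennreal_less_iff)
      then have "\<forall>\<^sub>F n in sequentially. x < c n" using lim by (rule order_tendstoD(1)[rotated])
      then obtain n where "x < c n" using eventually_happens'[OF sequentially_bot] by blast
      then show ?thesis using x by (auto intro!: exI[of _ n] ennreal_leI)
    qed
    then show ?thesis by auto
  qed
  \<comment> \<open>For \<open>q = 0\<close> no \<open>n\<close> qualifies, and the left side is
    empty as well.\<close>
  also have "\<dots> = (\<Union>n\<in>{n. c n < q}. {w\<in>A. \<tau> w \<le> ennreal (c n)})"
  proof -
    have "c n < q" if "\<tau> w < ennreal q" for w n
    proof -
      have "0 < q" using that q by (cases "q = 0") auto
      then show ?thesis by (simp add: c_def)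
    qed
    moreover have "\<tau> w < ennreal q" if "\<tau> w \<le> ennreal (c n)" "c n < q" for w n
      using that c(1)[of n] by (meson ennreal_lessI le_less_trans not_le order_le_less_trans)
    ultimately show ?thesis by blast
  qed
  also have "\<dots> \<in> sets (F q)"
    using A(2)[OF c(1)] filtration[OF c(1) c(2)] by (intro sets.countable_UN'') auto
  finally show ?thesis .
qed

lemma sigma_algebra_stopped:
  assumes "ext_stopping_time M F \<tau>"
  shows "sigma_algebra (space M) {A \<in> sets M. \<forall>t\<ge>0. {w \<in> A. \<tau> w \<le> ennreal t} \<in> sets (F t)}"
  unfolding sigma_algebra_iff2
proof (intro conjI ballI allI impI)
  show "{A \<in> sets M. \<forall>t\<ge>0. {w \<in> A. \<tau> w \<le> ennreal t} \<in> sets (F t)} \<subseteq> Pow (space M)"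
    using sets.sets_into_space by blast
  show "{} \<in> {A \<in> sets M. \<forall>t\<ge>0. {w \<in> A. \<tau> w \<le> ennreal t} \<in> sets (F t)}" by auto
next
  fix A assume A: "A \<in> {A \<in> sets M. \<forall>t\<ge>0. {w \<in> A. \<tau> w \<le> ennreal t} \<in> sets (F t)}"
  have "{w \<in> space M - A. \<tau> w \<le> ennreal t} \<in> sets (F t)" if t: "0 \<le> t" for t
  proof -
    have "{w \<in> space M - A. \<tau> w \<le> ennreal t} = {w \<in> space M. \<tau> w \<le> ennreal t} - {w \<in> A. \<tau> w \<le> ennreal t}"
      by blast
    also have "\<dots> \<in> sets (F t)"
      using A t assms[unfolded ext_stopping_time_def, rule_format, OF t] by (intro sets.Diff) blast+
    finally show ?thesis .
  qed
  moreover have "space M - A \<in> sets M" using A by blast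
  ultimately show "space M - A \<in> {A \<in> sets M. \<forall>t\<ge>0. {w \<in> A. \<tau> w \<le> ennreal t} \<in> sets (F t)}"
    by blast
next
  fix A :: "nat => 'a set"
  assume A: "range A \<subseteq> {A \<in> sets M. \<forall>t\<ge>0. {w \<in> A. \<tau> w \<le> ennreal t} \<in> sets (F t)}"
  have "{w \<in> (\<Union>i. A i). \<tau> w \<le> ennreal t} = (\<Union>i. {w \<in> A i. \<tau> w \<le> ennreal t})" for t by auto
  moreover have "(\<Union>i. {w \<in> A i. \<tau> w \<le> ennreal t}) \<in> sets (F t)" if "0 \<le> t" for t
    using A that by (intro sets.countable_UN) blast
  moreover have "(\<Union>i. A i) \<in> sets M" using A by (intro sets.countable_UN) blast
  ultimately show "(\<Union>i. A i) \<in> {A \<in> sets M. \<forall>t\<ge>0. {w \<in> A. \<tau> w \<le> ennreal t} \<in> sets (F t)}" by auto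
qed

lemma
  assumes "ext_stopping_time M F \<tau>"
  shows sets_stopped: "sets (stopped_algebra M F \<tau>) = {A \<in> sets M. \<forall>t\<ge>0. {w \<in> A. \<tau> w \<le> ennreal t} \<in> sets (F t)}"
    and space_stopped: "space (stopped_algebra M F \<tau>) = space M"
    and subalgebra_stopped: "subalgebra M (stopped_algebra M F \<tau>)"
proof -
  interpret S: sigma_algebra "space M" "{A \<in> sets M. \<forall>t\<ge>0. {w \<in> A. \<tau> w \<le> ennreal t} \<in> sets (F t)}"
    by (rule sigma_algebra_stopped[OF assms])
  have sub: "{A \<in> sets M. \<forall>t\<ge>0. {w \<in> A. \<tau> w \<le> ennreal t} \<in> sets (F t)} \<subseteq> Pow (space M)"
    using sets.sets_into_space by blast
  show 1: "sets (stopped_algebra M F \<tau>) = {A \<in> sets M. \<forall>t\<ge>0. {w \<in> A. \<tau> w \<le> ennreal t} \<in> sets (F t)}"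
    unfolding stopped_algebra_def using sub by (simp add: S.sigma_sets_eq)
  show 2: "space (stopped_algebra M F \<tau>) = space M"
    unfolding stopped_algebra_def using sub by (simp add: space_measure_of)
  show "subalgebra M (stopped_algebra M F \<tau>)"
    unfolding subalgebra_def 1 2 by auto
qed

lemma stopping_time_measurable_stopped:
  assumes \<tau>: "ext_stopping_time M F \<tau>"
  shows "\<tau> \<in> borel_measurable (stopped_algebra M F \<tau>)"
proof (rule borel_measurableI_le)
  fix y :: ennreal
  have F: "{w \<in> space M. \<tau> w \<le> ennreal t} \<in> sets (F t')" if "0 \<le> t" "t \<le> t'" for t t'
    using \<tau>[unfolded ext_stopping_time_def, rule_format, OF that(1)] filtration[OF that] by (rule subsetD[rotated])
  have mem: "{w \<in> space M. \<tau> w \<le> ennreal c} \<in> sets (stopped_algebra M F \<tau>)" if c: "0 \<le> c" for c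
    unfolding sets_stopped[OF \<tau>]
  proof (intro CollectI conjI allI impI)
    show "{w \<in> space M. \<tau> w \<le> ennreal c} \<in> sets M" using F[OF c order_refl] subalg[OF c] by (auto simp: subalgebra_def)
    fix t :: real assume t: "0 \<le> t"
    have "{w \<in> {w \<in> space M. \<tau> w \<le> ennreal c}. \<tau> w \<le> ennreal t} = {w \<in> space M. \<tau> w \<le> ennreal (min c t)}"
    proof (cases "c \<le> t")
      case True
      then show ?thesis using order_trans[OF _ ennreal_leI[OF True]] by auto
    next
      case False
      then have "t \<le> c" by simp
      from order_trans[OF _ ennreal_leI[OF this]] show ?thesis using False by auto
    qed
    then show "{w \<in> {w \<in> space M. \<tau> w \<le> ennreal c}. \<tau> w \<le> ennreal t} \<in> sets (F t)"
      using F[of "min c t" t] c t by simp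
  qed
  show "{w \<in> space (stopped_algebra M F \<tau>). \<tau> w \<le> y} \<in> sets (stopped_algebra M F \<tau>)"
  proof (cases y)
    case (real c)
    then show ?thesis using mem[of c] by (simp add: space_stopped[OF \<tau>])
  next
    case top
    then show ?thesis using sets.top[of "stopped_algebra M F \<tau>"] by simp
  qed
qed

text \<open>If \<open>p\<close> and \<open>q\<close> are neighbouring grid points, the dyadic time
  above \<tau> equals \<open>q\<close> on this event. The restricted weight can therefore be used in
  the Markov property at the deterministic time \<open>q\<close>.\<close>

lemma stopped_restrict_measurable:
  fixes V :: "'a => ennreal"
  assumes \<tau>: "ext_stopping_time M F \<tau>" and V: "V \<in> borel_measurable (stopped_algebra M F \<tau>)"
    and pq: "0 \<le> p" "p \<le> q"
  shows "(\<lambda>w. V w * indicator {w. ennreal p \<le> \<tau> w \<and> \<tau> w < ennreal q} w) \<in> borel_measurable (F q)"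
proof (rule measurableI)
  fix S :: "ennreal set" assume S: "S \<in> sets borel"
  have q: "0 \<le> q" using pq by simp
  have less: "{w\<in>A. \<tau> w < ennreal t} \<in> sets (F t)" if "A \<in> sets (stopped_algebra M F \<tau>)" "0 \<le> t" for A t
    using that sets.sets_into_space[OF that(1)] unfolding sets_stopped[OF \<tau>] space_stopped[OF \<tau>]
    by (intro stopping_less[OF \<tau>]) auto
  have top: "space M \<in> sets (stopped_algebra M F \<tau>)"
    using sets.top[of "stopped_algebra M F \<tau>"] space_stopped[OF \<tau>] by simp
  define I where "I = {w\<in>space M. ennreal p \<le> \<tau> w \<and> \<tau> w < ennreal q}"
  have I: "I \<in> sets (F q)"
  proof -
    have "I = {w\<in>space M. \<tau> w < ennreal q} - {w\<in>space M. \<tau> w < ennreal p}"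
      by (auto simp: I_def)
    then show ?thesis using less[OF top q] less[OF top pq(1)] filtration[OF pq] by auto
  qed
  have "V -` S \<inter> space M \<in> sets (stopped_algebra M F \<tau>)"
    using measurable_sets[OF V S] space_stopped[OF \<tau>] by simp
  from less[OF this q] have A: "{w \<in> V -` S \<inter> space M. \<tau> w < ennreal q} \<in> sets (F q)" .
  have "(\<lambda>w. V w * indicator {w. ennreal p \<le> \<tau> w \<and> \<tau> w < ennreal q} w) -` S \<inter> space (F q)
     = ({w \<in> V -` S \<inter> space M. \<tau> w < ennreal q} \<inter> I) \<union> (if 0 \<in> S then space (F q) - I else {})"
    by (auto simp: I_def space_F[OF q] split: split_indicator split_indicator_asm if_splits)
  also have "\<dots> \<in> sets (F q)" using A I by auto
  finally show "(\<lambda>w. V w * indicator {w. ennreal p \<le> \<tau> w \<and> \<tau> w < ennreal q} w) -` S \<inter> space (F q) \<in> sets (F q)" .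
qed simp

lemma progressive:
  fixes W :: "real => 'a => real"
  assumes \<tau>: "ext_stopping_time M F \<tau>"
    and W: "\<And>t. 0 \<le> t ==> W t \<in> borel_measurable (F t)"
    and rc: "\<And>w t. w \<in> space M ==> 0 \<le> t ==> continuous (at_right t) (\<lambda>s. W s w)"
  shows "(\<lambda>w. W (enn2real (\<tau> w)) w * indicator {w. \<tau> w < \<infinity>} w) \<in> borel_measurable (stopped_algebra M F \<tau>)"
proof -
  define f where "f w = W (enn2real (\<tau> w)) w * indicator {w. \<tau> w < \<infinity>} w" for w
  have ft: "(\<lambda>w. W (enn2real (min (\<tau> w) (ennreal t))) w) \<in> borel_measurable (F t)" if t: "0 \<le> t" for t
  proof -
    have "(\<lambda>w. min (\<tau> w) (ennreal t)) \<in> borel_measurable (F t)"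
    proof (rule borel_measurableI_le)
      fix y :: ennreal
      show "{w \<in> space (F t). min (\<tau> w) (ennreal t) \<le> y} \<in> sets (F t)"
      proof (cases "ennreal t \<le> y")
        case True
        then have "{w \<in> space (F t). min (\<tau> w) (ennreal t) \<le> y} = space (F t)" by (auto simp: min_le_iff_disj)
        then show ?thesis by simp
      next
        case False
        then obtain c where c: "y = ennreal c" "0 \<le> c" "c \<le> t" using t
          by (cases y) (auto simp: ennreal_le_iff not_le)
        then have "{w \<in> space (F t). min (\<tau> w) (ennreal t) \<le> y} = {w \<in> space M. \<tau> w \<le> ennreal c}"
          using False by (auto simp: min_le_iff_disj space_F[OF t])
        then show ?thesis using \<tau> c filtration[of c t] unfolding ext_stopping_time_def by auto
      qed
    qed
    then have T: "(\<lambda>w. enn2real (min (\<tau> w) (ennreal t))) \<in> borel_measurable (F t)" by measurable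
    \<comment> \<open>Clamping to \<open>{0..t}\<close> produces a process that is right continuous
      at every real time and known at time \<open>t\<close>; the stopped time already lies in this
      range, so its value is unaffected.\<close>
    have "(\<lambda>w. W (min t (max 0 (enn2real (min (\<tau> w) (ennreal t))))) w) \<in> borel_measurable (F t)"
    proof (rule right_continuous_measurable_at[where X="\<lambda>s. W (min t (max 0 s))" and h="\<lambda>w. w"])
      fix s
      show "W (min t (max 0 s)) \<in> borel_measurable (F t)"
        using t by (intro measurable_F_mono[OF W]) auto
      fix w assume "w \<in> space (F t)"
      then have w: "w \<in> space M" using space_F[OF t] by simp
      show "continuous (at_right s) (\<lambda>s. W (min t (max 0 s)) w)"
      proof -
        consider "s < 0" | "0 \<le> s" "s < t" | "t \<le> s" by linarith
        then show ?thesis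
        proof cases
          case 1
          have "\<forall>\<^sub>F x in at_right s. W (min t (max 0 x)) w = W (min t (max 0 s)) w"
            unfolding eventually_at_right_field using 1 by (intro exI[of _ 0]) auto
          then show ?thesis unfolding continuous_within by (rule tendsto_eventually)
        next
          case 2
          have "\<forall>\<^sub>F x in at_right s. W x w = W (min t (max 0 x)) w"
            unfolding eventually_at_right_field using 2 by (intro exI[of _ t]) auto
          with rc[OF w 2(1)] show ?thesis
            unfolding continuous_within using 2 by (auto elim: Lim_transform_eventually)
        next
          case 3
          have "\<forall>\<^sub>F x in at_right s. W (min t (max 0 x)) w = W (min t (max 0 s)) w"
            unfolding eventually_at_right_field using 3 t by (intro exI[of _ "s + 1"]) (auto simp: min_def max_def)
          then show ?thesis unfolding continuous_within by (rule tendsto_eventually)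
        qed
      qed
    qed (use T in auto)
    moreover have "min t (max 0 (enn2real (min (\<tau> w) (ennreal t)))) = enn2real (min (\<tau> w) (ennreal t))" for w
    proof -
      have "enn2real (min (\<tau> w) (ennreal t)) \<le> t"
        using enn2real_mono[of "min (\<tau> w) (ennreal t)" "ennreal t"] t by simp
      then show ?thesis by simp
    qed
    ultimately show ?thesis by simp
  qed
  have rep: "f w = W (enn2real (min (\<tau> w) (ennreal t))) w" if "\<tau> w \<le> ennreal t" for w t
    using that by (auto simp: f_def indicator_def min_absorb1 top.not_eq_extremum dest: le_less_trans[OF _ ennreal_less_top])
  have "f \<in> borel_measurable (stopped_algebra M F \<tau>)"
  proof (rule measurableI)
    fix S :: "real set" assume S: "S \<in> sets borel"
    have at: "{w \<in> f -` S \<inter> space M. \<tau> w \<le> ennreal t} \<in> sets (F t)" if t: "0 \<le> t" for t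
    proof -
      have "{w \<in> f -` S \<inter> space M. \<tau> w \<le> ennreal t}
        = ((\<lambda>w. W (enn2real (min (\<tau> w) (ennreal t))) w) -` S \<inter> space (F t)) \<inter> {w\<in>space M. \<tau> w \<le> ennreal t}"
        using rep by (auto simp: space_F[OF t])
      also have "\<dots> \<in> sets (F t)"
        using measurable_sets[OF ft[OF t] S] \<tau> t unfolding ext_stopping_time_def by auto
      finally show ?thesis .
    qed
    have "f -` S \<inter> space M = (\<Union>n::nat. {w \<in> f -` S \<inter> space M. \<tau> w \<le> ennreal (real n)})
        \<union> (if 0 \<in> S then space M - (\<Union>n::nat. {w \<in> space M. \<tau> w \<le> ennreal (real n)}) else {})"
    proof -
      have fin: "\<exists>n::nat. \<tau> w \<le> ennreal (real n)" if less: "\<tau> w < \<infinity>" for w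
      proof -
        obtain x where x: "\<tau> w = ennreal x" "0 \<le> x" using less by (cases "\<tau> w") auto
        then show ?thesis using real_arch_simple[of x] by (auto intro: ennreal_leI)
      qed
      have inf: "f w = 0" if "\<not> \<tau> w < \<infinity>" for w using that by (auto simp: f_def)
      have "\<tau> w < \<infinity>" if "\<tau> w \<le> ennreal (real n)" for w n using that le_less_trans[OF that ennreal_less_top] by simp
      then show ?thesis using fin inf by (auto split: if_splits) (metis+)
    qed
    also have "\<dots> \<in> sets M"
    proof -
      have "{w \<in> f -` S \<inter> space M. \<tau> w \<le> ennreal (real n)} \<in> sets M" "{w \<in> space M. \<tau> w \<le> ennreal (real n)} \<in> sets M" for n
        using at[of "real n"] \<tau> subalg[of "real n"] unfolding ext_stopping_time_def subalgebra_def by auto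
      then show ?thesis by auto
    qed
    finally show "f -` S \<inter> space (stopped_algebra M F \<tau>) \<in> sets (stopped_algebra M F \<tau>)"
      unfolding sets_stopped[OF \<tau>] space_stopped[OF \<tau>] using at by auto
  qed simp
  then show ?thesis by (simp add: f_def[abs_def])
qed

end

section \<open>Strong Markov property of the walk and of its limit\<close>

context levy_market
begin

lemma walk_right_continuous:
  assumes w: "w \<in> space M" and T: "filterlim T (at_right t) sequentially"
  shows "(\<lambda>m. walk e (T m) h n w) \<longlonglongrightarrow> walk e t h n w"
proof (induction n)
  case (Suc n)
  have "filterlim (\<lambda>m. T m + c) (at_right (t + c)) sequentially" for c
  proof -
    have "filterlim (\<lambda>s. s + c) (at_right (t + c)) (at_right t)"
      unfolding filterlim_at by (auto simp: eventually_at_right_field intro!: tendsto_intros exI[of _ "t + 1"])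
    from filterlim_compose[OF this T] show ?thesis .
  qed
  then have "(\<lambda>m. X (T m + c) w) \<longlonglongrightarrow> X (t + c) w" "(\<lambda>m. Y (T m + c) w) \<longlonglongrightarrow> Y (t + c) w" for c
    using filterlim_compose[OF X.right_cont[OF w, of "t + c", unfolded continuous_within]]
      filterlim_compose[OF Y.right_cont[OF w, of "t + c", unfolded continuous_within]] by blast+
  note this Suc.IH
  then show ?case unfolding walk.simps walk_step_def by (intro tendsto_intros) auto
qed simp

text \<open>The dyadic times above \<tau> take countably many values, at each of which the Markov
  property at a fixed time applies. Three limits follow: in the rounding \<open>m\<close>, in the
  grid \<open>k\<close> and in the truncation \<open>L\<close>. Since every start has
  \<open>e = 0\<close>, the conditional mean is a constant and the integral factorises.\<close>

theorem strong_markov_ratio: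
  assumes \<tau>: "ext_stopping_time M F \<tau>" and V: "V \<in> borel_measurable (stopped_algebra M F \<tau>)"
    and V0: "\<And>w. w \<in> space M ==> \<tau> w = \<infinity> ==> V w = 0" and u: "0 \<le> u"
  shows "(\<integral>\<^sup>+w. V w * ennreal (exp (ratio 0 (enn2real (\<tau> w)) u w)) \<partial>M) = (\<integral>\<^sup>+w. V w \<partial>M) * ratio_mean u 0"
proof -
  let ?R = "\<lambda>L k. \<integral>\<^sup>+w. cut L (ratio_approx k 0 0 u w) \<partial>M"
  define T where "T w = enn2real (\<tau> w)" for w
  have [measurable]: "V \<in> borel_measurable M" using V X.subalgebra_stopped[OF \<tau>] by (auto simp: measurable_def subalgebra_def)
  have [measurable]: "\<tau> \<in> borel_measurable M"
    using X.stopping_time_measurable_stopped[OF \<tau>] X.subalgebra_stopped[OF \<tau>] by (auto simp: measurable_def subalgebra_def)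
  have [measurable]: "T \<in> borel_measurable M" unfolding T_def by measurable
  have T0: "0 \<le> T w" for w by (simp add: T_def)
  have rm: "(\<lambda>w. cut L (ratio 0 (T w) u w)) \<in> borel_measurable M" for L
    by (rule measurable_compose[OF ratio_measurable_at cut_measurable]) (use u T0 in auto)
  have am: "(\<lambda>w. cut L (ratio_approx k 0 (S w) u w)) \<in> borel_measurable M" if "S \<in> borel_measurable M" for L k S
    using walk_measurable_at[of "\<lambda>_. 0" M S "\<lambda>_. u / 2 ^ k" "\<lambda>w. w" "2 ^ k"] that by measurable
  have discrete: "(\<integral>\<^sup>+w. V' w * cut L (ratio_approx k 0 (dyadic_above m (T w)) u w) \<partial>M)
      = (\<integral>\<^sup>+w. V' w \<partial>M) * ?R L k"
    if V': "V' \<in> borel_measurable (stopped_algebra M F \<tau>)" and V'0: "\<And>w. w \<in> space M ==> \<tau> w = \<infinity> ==> V' w = 0" for V' m k L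
  proof -
    define c where "c i = real (Suc i) / 2 ^ m" for i
    define A where "A i = {w. ennreal (real i / 2 ^ m) \<le> \<tau> w \<and> \<tau> w < ennreal (c i)}" for i
    have c0: "0 \<le> real i / 2 ^ m" "real i / 2 ^ m \<le> c i" "0 \<le> c i" for i by (auto simp: c_def divide_right_mono)
    have [measurable]: "V' \<in> borel_measurable M" using V' X.subalgebra_stopped[OF \<tau>] by (auto simp: measurable_def subalgebra_def)
    have A_iff: "w \<in> A i \<longleftrightarrow> \<tau> w < \<infinity> \<and> \<lfloor>2 ^ m * T w\<rfloor> = int i" for w i
    proof (cases "\<tau> w")
      case (real x)
      then have "w \<in> A i \<longleftrightarrow> real i / 2 ^ m \<le> x \<and> x < c i"
        by (auto simp: A_def ennreal_le_iff ennreal_less_iff)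
      also have "\<dots> \<longleftrightarrow> real i \<le> 2 ^ m * x \<and> 2 ^ m * x < real i + 1" by (auto simp: c_def field_simps)
      also have "\<dots> \<longleftrightarrow> \<lfloor>2 ^ m * x\<rfloor> = int i" by (auto simp: floor_eq_iff)
      finally show ?thesis using real by (simp add: T_def)
    qed (auto simp: A_def)
    have disj: "disjoint_family A" unfolding disjoint_family_on_def using A_iff by auto
    \<comment> \<open>Distributes the weight over the values \<open>c i\<close> of the rounded time;
      for each outcome at most one summand survives.\<close>
    have dec: "V' w * f (dyadic_above m (T w)) = (\<Sum>i. V' w * indicator (A i) w * f (c i))" if "w \<in> space M" for w and f :: "real => ennreal"
    proof (cases "\<tau> w = \<infinity>")
      case True
      then show ?thesis using V'0[OF that] by simp
    next
      case False
      define i where "i = nat \<lfloor>2 ^ m * T w\<rfloor>"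
      have i: "\<lfloor>2 ^ m * T w\<rfloor> = int i" using T0[of w] by (simp add: i_def)
      then have iA: "w \<in> A i" using False by (simp add: A_iff top.not_eq_extremum)
      have "(\<Sum>i. (V' w * f (c i)) * indicator (A i) w) = V' w * f (c i)"
        by (rule suminf_cmult_indicator[OF disj iA])
      moreover have "dyadic_above m (T w) = c i" using i by (simp add: dyadic_above_def c_def)
      ultimately show ?thesis by (simp add: mult_ac)
    qed
    have [measurable]: "A i \<inter> space M \<in> sets M" for i
    proof -
      have "A i \<inter> space M = {w\<in>space M. ennreal (real i / 2 ^ m) \<le> \<tau> w \<and> \<tau> w < ennreal (c i)}" by (auto simp: A_def)
      then show ?thesis by simp
    qed
    have Vm: "(\<lambda>w. V' w * indicator (A i) w) \<in> borel_measurable (F (c i))" for i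
      unfolding A_def by (rule X.stopped_restrict_measurable[OF \<tau> V' c0(1,2)])
    note VM = X.measurable_F_M[OF X.stopped_restrict_measurable[OF \<tau> V' c0(1,2)] c0(3), folded A_def]
    have "(\<integral>\<^sup>+w. V' w * cut L (ratio_approx k 0 (dyadic_above m (T w)) u w) \<partial>M)
       = (\<integral>\<^sup>+w. (\<Sum>i. V' w * indicator (A i) w * cut L (ratio_approx k 0 (c i) u w)) \<partial>M)"
    proof (rule nn_integral_cong)
      fix w assume "w \<in> space M"
      then show "V' w * cut L (ratio_approx k 0 (dyadic_above m (T w)) u w)
         = (\<Sum>i. V' w * indicator (A i) w * cut L (ratio_approx k 0 (c i) u w))"
        by (rule dec[of _ "\<lambda>t. cut L (ratio_approx k 0 t u w)"])
    qed
    also have "\<dots> = (\<Sum>i. \<integral>\<^sup>+w. V' w * indicator (A i) w * cut L (ratio_approx k 0 (c i) u w) \<partial>M)"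
    proof (rule nn_integral_suminf)
      fix i
      note [measurable] = VM[of i] am[of "\<lambda>_. c i" L k, OF borel_measurable_const]
      show "(\<lambda>w. V' w * indicator (A i) w * cut L (ratio_approx k 0 (c i) u w)) \<in> borel_measurable M"
        by measurable
    qed
    also have "\<dots> = (\<Sum>i. \<integral>\<^sup>+w. V' w * indicator (A i) w * ?R L k \<partial>M)"
    proof -
      have k: "(kern (u / 2 ^ k) ^^ (2 ^ k)) (\<lambda>p. cut L (fst p)) (0, 0) = (\<integral>\<^sup>+w'. cut L (ratio_approx k 0 0 u w') \<partial>M)"
        by (rule kern_power_eq) (use u in auto)
      show ?thesis
        unfolding k[symmetric] using u by (intro suminf_cong walk_markov[OF c0(3) _ _ Vm]) auto
    qed
    also have "\<dots> = (\<integral>\<^sup>+w. (\<Sum>i. V' w * indicator (A i) w * ?R L k) \<partial>M)"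
    proof (rule nn_integral_suminf[symmetric])
      fix i
      note [measurable] = VM[of i]
      show "(\<lambda>w. V' w * indicator (A i) w * (\<integral>\<^sup>+w'. cut L (ratio_approx k 0 0 u w') \<partial>M)) \<in> borel_measurable M"
        by (rule borel_measurable_times_ennreal[OF VM borel_measurable_const])
    qed
    also have "\<dots> = (\<integral>\<^sup>+w. V' w * ?R L k \<partial>M)"
      by (rule nn_integral_cong) (rule dec[of _ "\<lambda>_. \<integral>\<^sup>+w. cut L (ratio_approx k 0 0 u w) \<partial>M", symmetric])
    also have "\<dots> = (\<integral>\<^sup>+w. V' w \<partial>M) * ?R L k"
      by (intro nn_integral_multc) simp
    finally show ?thesis .
  qed
  have bounded: "(\<integral>\<^sup>+w. V' w * cut L (ratio 0 (T w) u w) \<partial>M) = (\<integral>\<^sup>+w. V' w \<partial>M) * (\<integral>\<^sup>+w. cut L (ratio 0 0 u w) \<partial>M)"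
    if V': "V' \<in> borel_measurable (stopped_algebra M F \<tau>)" "\<And>w. w \<in> space M ==> \<tau> w = \<infinity> ==> V' w = 0" "\<And>w. V' w \<le> of_nat L" for V' L
  proof -
    have [measurable]: "V' \<in> borel_measurable M" using V' X.subalgebra_stopped[OF \<tau>] by (auto simp: measurable_def subalgebra_def)
    have fin: "(\<integral>\<^sup>+w. of_nat L * of_nat L \<partial>M) < \<infinity>"
      by (simp add: X.emeasure_space_1 ennreal_of_nat_eq_real_of_nat ennreal_mult[symmetric])
    have neq: "x \<noteq> \<top>" if "x \<le> of_nat L" for x :: ennreal
      using that by (metis ennreal_of_nat_neq_top top.extremum_unique)
    have neqI: "(\<integral>\<^sup>+w. V' w \<partial>M) \<noteq> \<top>"
      using nn_integral_mono[of M V' "\<lambda>_. of_nat L"] V'(3) by (intro neq) (simp add: X.emeasure_space_1)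
    note [measurable] = rm[of L]
    \<comment> \<open>For a fixed grid the walk reads the paths at finitely many times after its
      start, hence is right continuous in the starting time. Therefore the rounding of \<tau> is
      removed before the grid is refined.\<close>
    have 1: "(\<integral>\<^sup>+w. V' w * cut L (ratio_approx k 0 (T w) u w) \<partial>M)
       = (\<integral>\<^sup>+w. V' w \<partial>M) * ?R L k" for k
    proof -
      have "(\<lambda>m. \<integral>\<^sup>+w. V' w * cut L (ratio_approx k 0 (dyadic_above m (T w)) u w) \<partial>M)
         \<longlonglongrightarrow> (\<integral>\<^sup>+w. V' w * cut L (ratio_approx k 0 (T w) u w) \<partial>M)"
      proof (rule nn_integral_dominated_convergence[where w="\<lambda>_. of_nat L * of_nat L"])
        show "(\<lambda>w. V' w * cut L (ratio_approx k 0 (dyadic_above m (T w)) u w)) \<in> borel_measurable M" for m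
          by (intro borel_measurable_times_ennreal am) (simp_all add: dyadic_above_def)
        show "(\<lambda>w. V' w * cut L (ratio_approx k 0 (T w) u w)) \<in> borel_measurable M"
          by (intro borel_measurable_times_ennreal am) simp_all
        show "AE w in M. (\<lambda>m. V' w * cut L (ratio_approx k 0 (dyadic_above m (T w)) u w))
            \<longlonglongrightarrow> V' w * cut L (ratio_approx k 0 (T w) u w)"
          using neq[OF V'(3)]
          by (intro AE_I2 ennreal_tendsto_cmult cut_tendsto tendsto_fst walk_right_continuous dyadic_above_tendsto)
            (auto simp: top.not_eq_extremum)
      qed (use fin in \<open>auto intro!: AE_I2 mult_mono cut_le V'(3)\<close>)
      moreover have "(\<integral>\<^sup>+w. V' w * cut L (ratio_approx k 0 (dyadic_above m (T w)) u w) \<partial>M)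
         = (\<integral>\<^sup>+w. V' w \<partial>M) * ?R L k" for m
        by (rule discrete[OF V'(1)]) (rule V'(2))
      ultimately show ?thesis by (simp add: LIMSEQ_const_iff)
    qed
    have 2: "(\<lambda>k. \<integral>\<^sup>+w. V' w * cut L (ratio_approx k 0 (T w) u w) \<partial>M) \<longlonglongrightarrow> (\<integral>\<^sup>+w. V' w * cut L (ratio 0 (T w) u w) \<partial>M)"
    proof (rule nn_integral_dominated_convergence[where w="\<lambda>_. of_nat L * of_nat L"])
      show "(\<lambda>w. V' w * cut L (ratio_approx k 0 (T w) u w)) \<in> borel_measurable M" for k
        by (intro borel_measurable_times_ennreal am) simp_all
      show "AE w in M. (\<lambda>k. V' w * cut L (ratio_approx k 0 (T w) u w)) \<longlonglongrightarrow> V' w * cut L (ratio 0 (T w) u w)"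
        using u neq[OF V'(3)] T0
        by (intro AE_I2 ennreal_tendsto_cmult cut_tendsto ratio_approx_tendsto) (auto simp: top.not_eq_extremum)
    qed (use fin in \<open>auto intro!: AE_I2 mult_mono cut_le V'(3)\<close>)
    have 3: "(\<lambda>k. (\<integral>\<^sup>+w. V' w \<partial>M) * ?R L k)
        \<longlonglongrightarrow> (\<integral>\<^sup>+w. V' w \<partial>M) * (\<integral>\<^sup>+w. cut L (ratio 0 0 u w) \<partial>M)"
      using u neqI by (intro ennreal_tendsto_cmult ratio_approx_mean_tendsto) (auto simp: top.not_eq_extremum)
    from 1 2 3 show ?thesis using LIMSEQ_unique by simp
  qed
  have "(\<integral>\<^sup>+w. V w * ennreal (exp (ratio 0 (T w) u w)) \<partial>M)
     = (SUP L. \<integral>\<^sup>+w. min (of_nat L) (V w) * cut L (ratio 0 (T w) u w) \<partial>M)"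
    by (rule SUP_bounded_product) (use rm in \<open>auto simp: incseq_cut SUP_cut\<close>)
  also have "\<dots> = (SUP L. (\<integral>\<^sup>+w. min (of_nat L) (V w) \<partial>M) * (\<integral>\<^sup>+w. cut L (ratio 0 0 u w) \<partial>M))"
  proof (intro SUP_cong refl bounded)
    show "(\<lambda>w. min (of_nat L) (V w)) \<in> borel_measurable (stopped_algebra M F \<tau>)" for L :: nat using V by measurable
  qed (use V0 in auto)
  also have "\<dots> = (SUP L. \<integral>\<^sup>+w. min (of_nat L) (V w) * (\<integral>\<^sup>+w'. cut L (ratio 0 0 u w') \<partial>M) \<partial>M)"
    by (intro SUP_cong refl nn_integral_multc[symmetric]) measurable
  also have "\<dots> = (\<integral>\<^sup>+w. V w * ratio_mean u 0 \<partial>M)"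
  proof (rule SUP_bounded_product[symmetric])
    show "incseq (\<lambda>L. \<integral>\<^sup>+w'. cut L (ratio 0 0 u w') \<partial>M)"
      by (intro incseq_SucI nn_integral_mono incseq_SucD[OF incseq_cut])
    show "(SUP L. \<integral>\<^sup>+w'. cut L (ratio 0 0 u w') \<partial>M) = ratio_mean u 0"
      by (rule SUP_cut_mean[OF order_refl u])
  qed measurable
  also have "\<dots> = (\<integral>\<^sup>+w. V w \<partial>M) * ratio_mean u 0" by (intro nn_integral_multc) simp
  finally show ?thesis unfolding T_def .
qed

end

section \<open>Time change for Stieltjes measures\<close>

definition increasing_path :: "(real => real) => bool" where
  "increasing_path C \<longleftrightarrow> 0 \<le> C 0 \<and> mono_on {0..} C \<and> (\<forall>t\<ge>0. continuous (at_right t) C)"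

text \<open>Generalised inverse. The weak inequality together with right continuity makes the
  infimum attained, so that the level has been reached by time \<open>t\<close> if and only if
  \<open>y \<le> C t\<close>. A level that is never reached has time \<infinity>, the infimum of the
  empty set.\<close>

definition level_time :: "(real => real) => real => ennreal" where
  "level_time C y = (INF t\<in>{t. 0 \<le> t \<and> y \<le> C t}. ennreal t)"

lemma increasing_path_mono: "increasing_path C ==> 0 \<le> s ==> s \<le> t ==> C s \<le> C t"
  unfolding increasing_path_def using mono_onD[of "{0..}" C s t] by auto

lemma increasing_path_nonneg: "increasing_path C ==> 0 \<le> t ==> 0 \<le> C t"
  using increasing_path_mono[of C 0 t] by (auto simp: increasing_path_def)

lemma level_time_le_iff:
  assumes C: "increasing_path C" and t: "0 \<le> t"
  shows "level_time C y \<le> ennreal t \<longleftrightarrow> y \<le> C t"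
proof
  assume "y \<le> C t"
  then show "level_time C y \<le> ennreal t" unfolding level_time_def using t by (intro INF_lower) auto
next
  assume le: "level_time C y \<le> ennreal t"
  show "y \<le> C t"
  proof (rule ccontr)
    assume "\<not> y \<le> C t"
    moreover have "(C \<longlongrightarrow> C t) (at_right t)"
      using C t unfolding increasing_path_def continuous_within by blast
    ultimately have "\<forall>\<^sub>F s in at_right t. C s < y" by (intro order_tendstoD(2)) auto
    then obtain b where b: "b > t" "\<And>s. t < s ==> s < b ==> C s < y"
      unfolding eventually_at_right_field by blast
    define d where "d = (t + b) / 2"
    have d: "t < d" "C d < y" using b by (auto simp: d_def)
    have "ennreal d \<le> level_time C y"
      unfolding level_time_def
    proof (rule INF_greatest)
      fix s assume "s \<in> {t. 0 \<le> t \<and> y \<le> C t}"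
      then have "\<not> s \<le> d" using increasing_path_mono[OF C, of s d] d by auto
      then show "ennreal d \<le> ennreal s" by (intro ennreal_leI) simp
    qed
    from order_trans[OF this le] have "ennreal d \<le> ennreal t" .
    then show False using d t by simp
  qed
qed

lemma level_time_attained:
  assumes C: "increasing_path C" and "level_time C y < \<infinity>"
  shows "y \<le> C (enn2real (level_time C y))" and "0 \<le> s ==> s < enn2real (level_time C y) ==> C s < y"
proof -
  have e: "ennreal (enn2real (level_time C y)) = level_time C y" using assms(2) by simp
  show "y \<le> C (enn2real (level_time C y))"
    using level_time_le_iff[OF C, of "enn2real (level_time C y)" y] e by simp
  assume s: "0 \<le> s" "s < enn2real (level_time C y)"
  then have "ennreal s < level_time C y" using e by (metis ennreal_lessI enn2real_nonneg le_less_trans)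
  then show "C s < y" using level_time_le_iff[OF C s(1), of y] by auto
qed

lemma level_time_measurable:
  assumes C: "\<And>z. z \<in> space N ==> increasing_path (C z)"
    and m: "\<And>t. 0 \<le> t ==> (\<lambda>z. C z t) \<in> borel_measurable N" and y: "y \<in> borel_measurable N"
  shows "(\<lambda>z. level_time (C z) (y z)) \<in> borel_measurable N"
proof (rule borel_measurableI_le)
  fix x :: ennreal
  show "{z \<in> space N. level_time (C z) (y z) \<le> x} \<in> sets N"
  proof (cases x)
    case (real t)
    note [measurable] = m[OF real(1)] y
    have "{z \<in> space N. level_time (C z) (y z) \<le> x} = {z \<in> space N. y z \<le> C z t}"
      using level_time_le_iff[OF C real(1)] real(2) by auto
    then show ?thesis by simp
  qed simp
qed

lemma level_time_borel:
  assumes "increasing_path C"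
  shows "level_time C \<in> borel_measurable borel"
  by (rule level_time_measurable[of borel "\<lambda>_. C" "\<lambda>y. y"]) (simp_all add: assms)

text \<open>The level times that fall into \<open>{a<..b}\<close> are those of the levels between
  \<open>C a\<close> and \<open>C b\<close>, an interval whose length is the mass of
  \<open>{a<..b}\<close>. The point mass at time 0 comes from the levels in
  \<open>{0<..C 0}\<close>, all of which are reached at time 0.\<close>

lemma stieltjes_eq_distr:
  assumes C: "increasing_path C"
  shows "stieltjes C = distr (restrict_space lborel {y. 0 < y \<and> level_time C y < \<infinity>}) borel (\<lambda>y. enn2real (level_time C y))"
    (is "_ = ?D")
proof -
  define c where "c t = (if t < 0 then 0 else C t)" for t
  have cm: "x \<le> y ==> c x \<le> c y" for x y
    using increasing_path_mono[OF C, of x y] increasing_path_nonneg[OF C, of y] by (auto simp: c_def)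
  have cr: "continuous (at_right t) c" for t
  proof (cases "t < 0")
    case True
    have "\<forall>\<^sub>F x in at_right t. c x = c t"
      unfolding eventually_at_right_field using True by (intro exI[of _ 0]) (auto simp: c_def)
    then show ?thesis unfolding continuous_within by (rule tendsto_eventually)
  next
    case False
    have "\<forall>\<^sub>F x in at_right t. C x = c x"
      unfolding eventually_at_right_field using False by (intro exI[of _ "t + 1"]) (auto simp: c_def)
    moreover have "(C \<longlongrightarrow> C t) (at_right t)" using C False by (simp add: increasing_path_def continuous_within)
    ultimately show ?thesis using False unfolding continuous_within by (auto simp: c_def elim: Lim_transform_eventually)
  qed
  have [measurable]: "level_time C \<in> borel_measurable borel" by (rule level_time_borel[OF C])
  define S where "S = {y. 0 < y \<and> level_time C y < \<infinity>}"
  have [measurable]: "S \<in> sets borel" unfolding S_def by measurable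
  have m: "(\<lambda>y. enn2real (level_time C y)) \<in> borel_measurable (restrict_space lborel S)"
    by (intro measurable_restrict_space1) measurable
  have eq: "emeasure (stieltjes C) {a<..b} = emeasure ?D {a<..b}" for a b
  proof (cases "a \<le> b")
    case True
    have "emeasure ?D {a<..b} = emeasure (restrict_space lborel S) ((\<lambda>y. enn2real (level_time C y)) -` {a<..b} \<inter> S)"
      unfolding S_def[symmetric] by (subst emeasure_distr[OF m]) (auto simp: space_restrict_space)
    also have "\<dots> = emeasure lborel ((\<lambda>y. enn2real (level_time C y)) -` {a<..b} \<inter> S)"
      by (subst emeasure_restrict_space) auto
    also have "(\<lambda>y. enn2real (level_time C y)) -` {a<..b} \<inter> S = {c a<..c b}"
    proof (cases "b < 0")
      case True
      then show ?thesis using \<open>a \<le> b\<close> enn2real_nonneg by (auto simp: c_def) (meson leD le_less_trans enn2real_nonneg)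
    next
      case b: False
      have le: "enn2real (level_time C y) \<le> t \<longleftrightarrow> y \<le> C t" if "0 \<le> t" "level_time C y < \<infinity>" for y t
      proof -
        have "ennreal (enn2real (level_time C y)) = level_time C y" using that by simp
        then show ?thesis using level_time_le_iff[OF C that(1), of y] that by (metis ennreal_le_iff)
      qed
      have fin: "level_time C y < \<infinity>" if "y \<le> C t" "0 \<le> t" for y t
        using level_time_le_iff[OF C that(2), of y] that le_less_trans[OF _ ennreal_less_top] by auto
      show ?thesis
      proof (intro set_eqI iffI)
        fix y assume y: "y \<in> (\<lambda>y. enn2real (level_time C y)) -` {a<..b} \<inter> S"
        then have "y \<le> C b" "0 < y" using le[of b y] b by (auto simp: S_def)
        moreover have "C a < y" if "0 \<le> a" using le[of a y] y that by (auto simp: S_def)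
        ultimately show "y \<in> {c a<..c b}" using b by (auto simp: c_def)
      next
        fix y assume y: "y \<in> {c a<..c b}"
        then have yb: "y \<le> C b" using b by (auto simp: c_def)
        have "0 < y" using y increasing_path_nonneg[OF C, of a] by (auto simp: c_def split: if_splits)
        moreover note f = fin[OF yb]
        moreover have "a < enn2real (level_time C y)"
        proof (cases "a < 0")
          case True
          then show ?thesis using enn2real_nonneg[of "level_time C y"] by linarith
        next
          case False
          then show ?thesis using le[of a y] f b y by (auto simp: c_def)
        qed
        ultimately show "y \<in> (\<lambda>y. enn2real (level_time C y)) -` {a<..b} \<inter> S"
          using le[of b y] yb b by (auto simp: S_def)
      qed
    qed
    also have "emeasure lborel {c a<..c b} = ennreal (c b - c a)" using cm[OF True] by simp
    also have "\<dots> = emeasure (stieltjes C) {a<..b}"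
      unfolding stieltjes_def c_def[symmetric]
      by (rule emeasure_interval_measure_Ioc[symmetric]) (use True cm cr in auto)
    finally show ?thesis by simp
  qed simp
  show ?thesis
  proof (rule measure_eqI_generator_eq[where E="range (\<lambda>(a, b). {a<..b::real})" and \<Omega>=UNIV and A="\<lambda>n::nat. {- real n<..real n}"])
    show "Int_stable (range (\<lambda>(a, b). {a<..b::real}))"
    proof (rule Int_stableI)
      fix p q assume "p \<in> range (\<lambda>(a, b). {a<..b::real})" "q \<in> range (\<lambda>(a, b). {a<..b::real})"
      then obtain a b c d where "p = {a<..b}" "q = {c<..d}" by auto
      then have "p \<inter> q = {max a c<..min b d}" by auto
      then show "p \<inter> q \<in> range (\<lambda>(a, b). {a<..b::real})" by auto
    qed
    show "sets (stieltjes C) = sigma_sets UNIV (range (\<lambda>(a, b). {a<..b::real}))"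
      "sets ?D = sigma_sets UNIV (range (\<lambda>(a, b). {a<..b::real}))"
      by (simp_all add: stieltjes_def borel_sigma_sets_Ioc)
    show "(\<Union>n::nat. {- real n<..real n}) = UNIV"
    proof -
      have "\<exists>n::nat. x \<in> {- real n<..real n}" for x
      proof -
        obtain n :: nat where "\<bar>x\<bar> < real n" using reals_Archimedean2 by blast
        then show ?thesis by (intro exI[of _ n]) auto
      qed
      then show ?thesis by auto
    qed
    show "emeasure (stieltjes C) {- real n<..real n} \<noteq> \<infinity>" for n
      unfolding stieltjes_def c_def[symmetric]
      by (subst emeasure_interval_measure_Ioc) (use cm cr in auto)
  qed (use eq in auto)
qed

lemma nn_integral_stieltjes:
  fixes f :: "real => ennreal"
  assumes C: "increasing_path C" and f: "f \<in> borel_measurable borel"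
  shows "(\<integral>\<^sup>+t\<in>{0..}. f t \<partial>stieltjes C)
     = (\<integral>\<^sup>+y. f (enn2real (level_time C y)) * indicator {y. 0 < y \<and> level_time C y < \<infinity>} y \<partial>lborel)"
proof -
  note lt[measurable] = level_time_borel[OF C]
  define S where "S = {y. 0 < y \<and> level_time C y < \<infinity>}"
  have [measurable]: "S \<in> sets borel" unfolding S_def by measurable
  have m: "(\<lambda>y. enn2real (level_time C y)) \<in> borel_measurable (restrict_space lborel S)"
    by (intro measurable_restrict_space1) measurable
  have "(\<integral>\<^sup>+t\<in>{0..}. f t \<partial>stieltjes C)
     = (\<integral>\<^sup>+y. f (enn2real (level_time C y)) * indicator {0..} (enn2real (level_time C y)) \<partial>restrict_space lborel S)"
    unfolding stieltjes_eq_distr[OF C] S_def[symmetric] by (rule nn_integral_distr[OF m]) (use f in simp)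
  also have "\<dots> = (\<integral>\<^sup>+y. f (enn2real (level_time C y)) * indicator S y \<partial>lborel)"
    by (subst nn_integral_restrict_space) (auto intro!: nn_integral_cong split: split_indicator)
  finally show ?thesis unfolding S_def .
qed

text \<open>Layer cake formula: \<open>C t\<close> is the Lebesgue measure of the positive levels
  reached by time \<open>t\<close>, and Fubini exchanges time and level.\<close>

lemma nn_integral_level_time:
  fixes m :: "real => ennreal"
  assumes C: "increasing_path C" and m: "m \<in> borel_measurable borel"
  shows "(\<integral>\<^sup>+t\<in>{0..}. m t * ennreal (C t) \<partial>lborel)
     = (\<integral>\<^sup>+y. (\<integral>\<^sup>+t. m t * indicator {t. 0 \<le> t \<and> level_time C y \<le> ennreal t} t \<partial>lborel) * indicator {0<..} y \<partial>lborel)"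
proof -
  note [measurable] = m level_time_borel[OF C]
  have "(\<integral>\<^sup>+t\<in>{0..}. m t * ennreal (C t) \<partial>lborel)
     = (\<integral>\<^sup>+t. \<integral>\<^sup>+y. m t * indicator {t. 0 \<le> t \<and> level_time C y \<le> ennreal t} t * indicator {0<..} y \<partial>lborel \<partial>lborel)"
  proof (rule nn_integral_cong)
    fix t :: real
    show "m t * ennreal (C t) * indicator {0..} t
      = (\<integral>\<^sup>+y. m t * indicator {t. 0 \<le> t \<and> level_time C y \<le> ennreal t} t * indicator {0<..} y \<partial>lborel)"
    proof (cases "0 \<le> t")
      case True
      have "(\<integral>\<^sup>+y. m t * indicator {t. 0 \<le> t \<and> level_time C y \<le> ennreal t} t * indicator {0<..} y \<partial>lborel)
         = (\<integral>\<^sup>+y. m t * indicator {0<..C t} y \<partial>lborel)"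
        by (intro nn_integral_cong) (simp add: level_time_le_iff[OF C True] True split: split_indicator)
      also have "\<dots> = m t * ennreal (C t)"
        using increasing_path_nonneg[OF C True] by (subst nn_integral_cmult) auto
      finally show ?thesis using True by simp
    qed simp
  qed
  also have "\<dots> = (\<integral>\<^sup>+y. \<integral>\<^sup>+t. m t * indicator {t. 0 \<le> t \<and> level_time C y \<le> ennreal t} t * indicator {0<..} y \<partial>lborel \<partial>lborel)"
    by (rule lborel_pair.Fubini') measurable
  also have "\<dots> = (\<integral>\<^sup>+y. (\<integral>\<^sup>+t. m t * indicator {t. 0 \<le> t \<and> level_time C y \<le> ennreal t} t \<partial>lborel) * indicator {0<..} y \<partial>lborel)"
    by (intro nn_integral_cong nn_integral_multc) measurable
  finally show ?thesis .
qed

section \<open>Future marginal utility along a stopping time\<close>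

context levy_market
begin

sublocale M_time: pair_sigma_finite M lborel ..

abbreviation "MT \<equiv> M \<Otimes>\<^sub>M (lborel :: real measure)"

definition low :: "real => 'a => real" where
  "low t w = running_inf (\<lambda>s. g s w) t"

text \<open>At the claimed plan the discounted marginal utility of the contribution is
  \<open>lam / E0\<close> times this quantity; see \<open>foc_public\<close>.\<close>

definition marg :: "real => 'a => real" where
  "marg t w = exp (- r * t - a * X t w + low t w)"

definition price :: "real => 'a => real" where
  "price t w = exp (- r * t + Y t w)"

definition future :: "real => real => 'a => ennreal" where
  "future e s w = (\<integral>\<^sup>+u\<in>{0..}. ennreal (exp (- r * u)) * ennreal (exp (ratio e s u w)) \<partial>lborel)"

definition future_mean :: "real => ennreal" where
  "future_mean e = (\<integral>\<^sup>+u\<in>{0..}. ennreal (exp (- r * u)) * ratio_mean u e \<partial>lborel)"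

text \<open>Measurability is available for nonnegative elapsed times only. Clamping by
  \<open>max 0\<close> extends it to the product space, and the indicator of \<open>{0..}\<close> in
  the integrals hides the difference; the same device recurs in \<open>regular\<close>.\<close>

lemma ratio_pair_measurable:
  assumes [measurable]: "e \<in> borel_measurable M" "T \<in> borel_measurable M" and le: "\<And>w. e w \<le> 0" "\<And>w. 0 \<le> T w"
  shows "(\<lambda>z. ratio (e (fst z)) (T (fst z)) (max 0 (snd z)) (fst z)) \<in> borel_measurable MT"
  by (rule ratio_measurable_at) (use le in auto)

lemma future_swap:
  assumes V: "V \<in> borel_measurable M" and e: "e \<in> borel_measurable M" "\<And>w. e w \<le> 0"
    and T: "T \<in> borel_measurable M" "\<And>w. 0 \<le> T w"
  shows "(\<integral>\<^sup>+w. V w * future (e w) (T w) w \<partial>M)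
     = (\<integral>\<^sup>+u\<in>{0..}. ennreal (exp (- r * u)) * (\<integral>\<^sup>+w. V w * ennreal (exp (ratio (e w) (T w) u w)) \<partial>M) \<partial>lborel)"
proof -
  let ?f = "\<lambda>u w. ennreal (exp (- r * u)) * ennreal (exp (ratio (e w) (T w) (max 0 u) w)) * indicator {0..} u"
  note [measurable] = V ratio_pair_measurable[OF e(1) T(1) e(2) T(2)]
  have ru: "(\<lambda>w. ratio (e w) (T w) u w) \<in> borel_measurable M" if "0 \<le> u" for u
    by (rule ratio_measurable_at) (use e T that in auto)
  have rw: "(\<lambda>u. ratio (e w) (T w) (max 0 u) w) \<in> borel_measurable borel" if "w \<in> space M" for w
    by (rule ratio_measurable_at) (use e T that in auto)
  have "(\<integral>\<^sup>+w. V w * future (e w) (T w) w \<partial>M)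
     = (\<integral>\<^sup>+w. \<integral>\<^sup>+u. V w * ?f u w \<partial>lborel \<partial>M)"
  proof (rule nn_integral_cong)
    fix w assume w: "w \<in> space M"
    note [measurable] = rw[OF w]
    have "future (e w) (T w) w = (\<integral>\<^sup>+u. ennreal (exp (- r * u)) * ennreal (exp (ratio (e w) (T w) (max 0 u) w)) * indicator {0..} u \<partial>lborel)"
      unfolding future_def by (intro nn_integral_cong) (auto split: split_indicator simp: max_def)
    then show "V w * future (e w) (T w) w
       = (\<integral>\<^sup>+u. V w * ?f u w \<partial>lborel)"
      by (simp add: nn_integral_cmult)
  qed
  also have "\<dots> = (\<integral>\<^sup>+u. \<integral>\<^sup>+w. V w * ?f u w \<partial>M \<partial>lborel)"
    by (rule M_time.Fubini'[symmetric]) (simp add: case_prod_beta)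
  also have "\<dots> = (\<integral>\<^sup>+u\<in>{0..}. ennreal (exp (- r * u)) * (\<integral>\<^sup>+w. V w * ennreal (exp (ratio (e w) (T w) u w)) \<partial>M) \<partial>lborel)"
  proof (rule nn_integral_cong)
    fix u :: real
    show "(\<integral>\<^sup>+w. V w * ?f u w \<partial>M)
      = ennreal (exp (- r * u)) * (\<integral>\<^sup>+w. V w * ennreal (exp (ratio (e w) (T w) u w)) \<partial>M) * indicator {0..} u"
    proof (cases "0 \<le> u")
      case True
      note [measurable] = ru[OF True]
      have "(\<integral>\<^sup>+w. V w * ?f u w \<partial>M)
         = (\<integral>\<^sup>+w. ennreal (exp (- r * u)) * (V w * ennreal (exp (ratio (e w) (T w) u w))) \<partial>M)"
        using True by (simp add: max_def mult_ac)
      also have "\<dots> = ennreal (exp (- r * u)) * (\<integral>\<^sup>+w. V w * ennreal (exp (ratio (e w) (T w) u w)) \<partial>M)"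
        by (rule nn_integral_cmult) measurable
      finally show ?thesis using True by simp
    qed simp
  qed
  finally show ?thesis .
qed

lemma ratio_mean_pair_measurable:
  "(\<lambda>z. ratio_mean (max 0 (snd z)) (min (fst z) 0)) \<in> borel_measurable (borel \<Otimes>\<^sub>M borel)"
proof -
  have "(\<lambda>z. ratio (min (fst (fst z)) 0) 0 (max 0 (snd (fst z))) (snd z)) \<in> borel_measurable ((borel \<Otimes>\<^sub>M borel) \<Otimes>\<^sub>M M)"
    by (rule ratio_measurable_at) auto
  then show ?thesis unfolding ratio_mean_def
    by (intro X.borel_measurable_nn_integral) (simp add: case_prod_beta)
qed

lemma ratio_mean_measurable: "(\<lambda>u. ratio_mean (max 0 u) (min e 0)) \<in> borel_measurable borel"
proof -
  have "(\<lambda>u. (e, u)) \<in> measurable borel (borel \<Otimes>\<^sub>M borel)" by measurable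
  from measurable_compose[OF this ratio_mean_pair_measurable] show ?thesis by simp
qed

lemma future_mean_alt:
  assumes "e \<le> 0"
  shows "future_mean e = (\<integral>\<^sup>+u\<in>{0..}. ennreal (exp (- r * u)) * ratio_mean (max 0 u) (min e 0) \<partial>lborel)"
  unfolding future_mean_def using assms
  by (intro nn_integral_cong) (simp add: max_def min_def split: split_indicator)

theorem markov_future:
  assumes s: "0 \<le> s" and e: "e \<in> borel_measurable (F s)" "\<And>w. e w \<le> 0" and V: "V \<in> borel_measurable (F s)"
  shows "(\<integral>\<^sup>+w. V w * future (e w) s w \<partial>M) = (\<integral>\<^sup>+w. V w * future_mean (e w) \<partial>M)"
proof -
  let ?m = "\<lambda>u w. ennreal (exp (- r * u)) * ratio_mean (max 0 u) (e w) * indicator {0..} u"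
  note eM[measurable] = X.measurable_F_M[OF e(1) s] and VM[measurable] = X.measurable_F_M[OF V s]
  have rmm: "(\<lambda>z. ratio_mean (max 0 (snd z)) (e (fst z))) \<in> borel_measurable MT"
  proof -
    have "(\<lambda>z. (e (fst z), snd z)) \<in> measurable MT (borel \<Otimes>\<^sub>M borel)" by measurable
    from measurable_compose[OF this ratio_mean_pair_measurable] show ?thesis
      using e(2) by (simp add: min_absorb1)
  qed
  have "(\<integral>\<^sup>+w. V w * future (e w) s w \<partial>M)
     = (\<integral>\<^sup>+u\<in>{0..}. ennreal (exp (- r * u)) * (\<integral>\<^sup>+w. V w * ennreal (exp (ratio (e w) s u w)) \<partial>M) \<partial>lborel)"
    by (rule future_swap) (use s e in auto)
  also have "\<dots> = (\<integral>\<^sup>+u\<in>{0..}. ennreal (exp (- r * u)) * (\<integral>\<^sup>+w. V w * ratio_mean u (e w) \<partial>M) \<partial>lborel)"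
    by (intro nn_integral_cong) (simp add: markov_ratio[OF s _ e V] split: split_indicator)
  also have "\<dots> = (\<integral>\<^sup>+u. \<integral>\<^sup>+w. V w * ?m u w \<partial>M \<partial>lborel)"
  proof (rule nn_integral_cong)
    fix u :: real
    show "ennreal (exp (- r * u)) * (\<integral>\<^sup>+w. V w * ratio_mean u (e w) \<partial>M) * indicator {0..} u
      = (\<integral>\<^sup>+w. V w * ?m u w \<partial>M)"
    proof (cases "0 \<le> u")
      case True
      have m: "(\<lambda>w. V w * ratio_mean u (e w)) \<in> borel_measurable M"
      proof -
        have "(\<lambda>w. (w, u)) \<in> measurable M MT" by measurable
        from measurable_compose[OF this rmm] show ?thesis using True by (simp add: max_def)
      qed
      have "(\<integral>\<^sup>+w. V w * ?m u w \<partial>M)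
        = (\<integral>\<^sup>+w. ennreal (exp (- r * u)) * (V w * ratio_mean u (e w)) \<partial>M)"
        using True by (simp add: max_def mult_ac)
      also have "\<dots> = ennreal (exp (- r * u)) * (\<integral>\<^sup>+w. V w * ratio_mean u (e w) \<partial>M)"
        by (rule nn_integral_cmult[OF m])
      finally show ?thesis using True by simp
    qed simp
  qed
  also have "\<dots> = (\<integral>\<^sup>+w. \<integral>\<^sup>+u. V w * ?m u w \<partial>lborel \<partial>M)"
    by (rule M_time.Fubini') (use rmm in \<open>simp add: case_prod_beta\<close>)
  also have "\<dots> = (\<integral>\<^sup>+w. V w * future_mean (e w) \<partial>M)"
  proof (rule nn_integral_cong)
    fix w
    have "(\<lambda>u. ratio_mean (max 0 u) (e w)) \<in> borel_measurable borel"
      using ratio_mean_measurable[of "e w"] e(2)[of w] by (simp add: min_absorb1)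
    then show "(\<integral>\<^sup>+u. V w * ?m u w \<partial>lborel) = V w * future_mean (e w)"
      using future_mean_alt[OF e(2)[of w]] e(2)[of w] by (simp add: nn_integral_cmult min_absorb1)
  qed
  finally show ?thesis .
qed

theorem strong_markov_future:
  assumes \<tau>: "ext_stopping_time M F \<tau>" and V: "V \<in> borel_measurable (stopped_algebra M F \<tau>)"
    and V0: "\<And>w. w \<in> space M ==> \<tau> w = \<infinity> ==> V w = 0"
  shows "(\<integral>\<^sup>+w. V w * future 0 (enn2real (\<tau> w)) w \<partial>M) = (\<integral>\<^sup>+w. V w \<partial>M) * future_mean 0"
proof -
  have [measurable]: "V \<in> borel_measurable M" "\<tau> \<in> borel_measurable M"
    using V X.stopping_time_measurable_stopped[OF \<tau>] X.subalgebra_stopped[OF \<tau>] by (auto simp: measurable_def subalgebra_def)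
  have "(\<integral>\<^sup>+w. V w * future 0 (enn2real (\<tau> w)) w \<partial>M)
     = (\<integral>\<^sup>+u\<in>{0..}. ennreal (exp (- r * u)) * (\<integral>\<^sup>+w. V w * ennreal (exp (ratio 0 (enn2real (\<tau> w)) u w)) \<partial>M) \<partial>lborel)"
    by (rule future_swap[of V "\<lambda>_. 0"]) auto
  also have "\<dots> = (\<integral>\<^sup>+u. (\<integral>\<^sup>+w. V w \<partial>M) * (ennreal (exp (- r * u)) * ratio_mean (max 0 u) (min 0 0) * indicator {0..} u) \<partial>lborel)"
    by (intro nn_integral_cong) (simp add: strong_markov_ratio[OF \<tau> V V0] max_def mult_ac split: split_indicator)
  also have "\<dots> = (\<integral>\<^sup>+w. V w \<partial>M) * future_mean 0"
    unfolding future_mean_alt[OF order_refl]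
  proof -
    note [measurable] = ratio_mean_measurable[of 0]
    show "(\<integral>\<^sup>+u. (\<integral>\<^sup>+w. V w \<partial>M) * (ennreal (exp (- r * u)) * ratio_mean (max 0 u) (min 0 0) * indicator {0..} u) \<partial>lborel)
      = (\<integral>\<^sup>+w. V w \<partial>M) * (\<integral>\<^sup>+u\<in>{0..}. ennreal (exp (- r * u)) * ratio_mean (max 0 u) (min 0 0) \<partial>lborel)"
      by (rule nn_integral_cmult) measurable
  qed
  finally show ?thesis .
qed

lemma low_le_g: "w \<in> space M ==> 0 \<le> t ==> low t w \<le> g t w"
  unfolding low_def by (rule running_inf_le) (auto intro: cadlag_bdd_below g_cadlag)

lemma low_cadlag: "w \<in> space M ==> cadlag (\<lambda>t. low t w)"
  unfolding low_def by (rule cadlag_running_inf[OF g_cadlag])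

lemma low_antimono: "w \<in> space M ==> 0 \<le> s ==> s \<le> t ==> low t w \<le> low s w"
  unfolding low_def by (rule running_inf_antimono[OF g_cadlag])

lemma low_adapted:
  assumes t: "0 \<le> t"
  shows "low t \<in> borel_measurable (F t)"
proof (rule borel_measurable_LIMSEQ_real)
  fix w assume "w \<in> space (F t)"
  then show "(\<lambda>k. grid_min (\<lambda>s. g s w) t k) \<longlonglongrightarrow> low t w"
    unfolding low_def using X.space_F[OF t] t by (intro cadlag_grid_min_tendsto g_cadlag) auto
next
  fix k
  have "g (t * real j / 2 ^ k) \<in> borel_measurable (F t)" if "j \<le> 2 ^ k" for j
    using grid_point[OF t that] by (intro X.measurable_F_mono[OF g_adap]) auto
  then show "(\<lambda>w. grid_min (\<lambda>s. g s w) t k) \<in> borel_measurable (F t)"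
    unfolding grid_min_def by (intro borel_measurable_Min) auto
qed

definition low' :: "real => 'a => real" where
  "low' t w = low (max 0 t) w"

lemma low'_right_cont: "w \<in> space M ==> continuous (at_right t) (\<lambda>s. low' s w)"
proof (cases "0 \<le> t")
  case True
  assume w: "w \<in> space M"
  have "\<forall>\<^sub>F s in at_right t. low s w = low' s w"
    unfolding eventually_at_right_field using True by (intro exI[of _ "t + 1"]) (auto simp: low'_def)
  then show ?thesis
    using cadlag_right[OF low_cadlag[OF w] True] True unfolding continuous_within low'_def
    by (auto elim: Lim_transform_eventually)
next
  case False
  have "\<forall>\<^sub>F s in at_right t. low' s w = low' t w"
    unfolding eventually_at_right_field using False by (intro exI[of _ 0]) (auto simp: low'_def)
  then show ?thesis unfolding continuous_within by (rule tendsto_eventually)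
qed

lemma low_measurable_at:
  assumes "h \<in> measurable N M" "T \<in> borel_measurable N" "\<And>z. z \<in> space N ==> 0 \<le> T z"
  shows "(\<lambda>z. low (T z) (h z)) \<in> borel_measurable N"
proof -
  have "(\<lambda>z. low' (T z) (h z)) \<in> borel_measurable N"
    by (rule right_continuous_measurable_at[OF _ low'_right_cont assms(1,2)])
      (auto simp: low'_def[abs_def] intro!: X.measurable_F_M[OF low_adapted])
  then show ?thesis
    by (rule measurable_cong[THEN iffD1, rotated]) (use assms(3) in \<open>auto simp: low'_def\<close>)
qed

text \<open>The infimum over \<open>{0..T + u}\<close> splits at \<open>T\<close>. Measured relative
  to \<open>g T w\<close>, everything before \<open>T\<close> is summarised by the gap
  \<open>low T w - g T w\<close>, and the factor taken out is the price at \<open>T\<close>.\<close>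

lemma marg_shift:
  assumes w: "w \<in> space M" and T: "0 \<le> T" and u: "0 \<le> u"
  shows "marg (T + u) w = price T w * (exp (- r * u) * exp (ratio (low T w - g T w) T u w))"
proof -
  have "running_inf (\<lambda>v. g (T + v) w - g T w) u = running_inf (\<lambda>v. g (T + v) w) u - g T w"
    using running_inf_add_const[of "\<lambda>v. g (T + v) w - 0" u "- g T w"] cadlag_shift[OF g_cadlag[OF w] T, of 0] u by simp
  moreover have "low (T + u) w = min (low T w) (running_inf (\<lambda>v. g (T + v) w) u)"
    unfolding low_def by (rule running_inf_split[OF g_cadlag[OF w] T u])
  moreover have "min (p - c) (q - c) = min p q - c" for p q c :: real by (auto simp: min_def)
  ultimately have "ratio (low T w - g T w) T u w = low (T + u) w - g T w - a * (X (T + u) w - X T w)"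
    by (simp add: ratio_def)
  then show ?thesis by (simp add: marg_def price_def exp_add[symmetric] g_def algebra_simps)
qed

definition marg_after :: "ennreal => 'a => ennreal" where
  "marg_after \<tau> w = (\<integral>\<^sup>+t. ennreal (marg t w) * indicator {t. 0 \<le> t \<and> \<tau> \<le> ennreal t} t \<partial>lborel)"

lemma marg_measurable_at:
  assumes [measurable]: "h \<in> measurable N M" "T \<in> borel_measurable N" and "\<And>z. z \<in> space N ==> 0 \<le> T z"
  shows "(\<lambda>z. marg (T z) (h z)) \<in> borel_measurable N"
proof -
  note [measurable] = low_measurable_at[OF assms] X.meas_at[OF assms(1,2)]
  show ?thesis unfolding marg_def by measurable
qed

lemma marg_after_eq:
  assumes w: "w \<in> space M" and T: "0 \<le> T"
  shows "marg_after (ennreal T) w = ennreal (price T w) * future (low T w - g T w) T w"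
proof -
  have m: "(\<lambda>t. marg (max 0 t) w) \<in> borel_measurable borel"
    by (rule marg_measurable_at) (use w in auto)
  have rm: "(\<lambda>u. ratio (low T w - g T w) T (max 0 u) w) \<in> borel_measurable borel"
    by (rule ratio_measurable_at) (use w T low_le_g in auto)
  have "marg_after (ennreal T) w = (\<integral>\<^sup>+t. ennreal (marg (max 0 t) w) * indicator {T..} t \<partial>lborel)"
    unfolding marg_after_def using T by (intro nn_integral_cong) (auto split: split_indicator simp: max_def)
  also have "\<dots> = (\<integral>\<^sup>+u. ennreal (marg (max 0 (T + 1 * u)) w) * indicator {T..} (T + 1 * u) \<partial>lborel)"
    by (subst nn_integral_real_affine[where c=1 and t=T]) (use m in \<open>auto\<close>)
  also have "\<dots> = (\<integral>\<^sup>+u. ennreal (price T w) * (ennreal (exp (- r * u)) * ennreal (exp (ratio (low T w - g T w) T (max 0 u) w)) * indicator {0..} u) \<partial>lborel)"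
  proof (rule nn_integral_cong)
    fix u :: real
    show "ennreal (marg (max 0 (T + 1 * u)) w) * indicator {T..} (T + 1 * u)
      = ennreal (price T w) * (ennreal (exp (- r * u)) * ennreal (exp (ratio (low T w - g T w) T (max 0 u) w)) * indicator {0..} u)"
    proof (cases "0 \<le> u")
      case True
      then show ?thesis using T marg_shift[OF w T True]
        by (simp add: max_def ennreal_mult[symmetric] price_def)
    qed simp
  qed
  also have "\<dots> = ennreal (price T w) * (\<integral>\<^sup>+u. ennreal (exp (- r * u)) * ennreal (exp (ratio (low T w - g T w) T (max 0 u) w)) * indicator {0..} u \<partial>lborel)"
  proof -
    note [measurable] = rm
    show ?thesis by (rule nn_integral_cmult) measurable
  qed
  also have "(\<integral>\<^sup>+u. ennreal (exp (- r * u)) * ennreal (exp (ratio (low T w - g T w) T (max 0 u) w)) * indicator {0..} u \<partial>lborel)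
     = future (low T w - g T w) T w"
    unfolding future_def by (intro nn_integral_cong) (auto split: split_indicator simp: max_def)
  finally show ?thesis .
qed

lemma marg_after_infinity: "marg_after \<infinity> w = 0"
  by (simp add: marg_after_def top_unique)

lemma future_mono: "e \<le> e' ==> future e s w \<le> future e' s w"
  unfolding future_def ratio_def
  by (intro nn_integral_mono mult_right_mono mult_left_mono ennreal_leI) (auto simp: min_def)

definition stopped_price :: "('a => ennreal) => 'a => ennreal" where
  "stopped_price \<tau> w = ennreal (price (enn2real (\<tau> w)) w) * indicator {w. \<tau> w < \<infinity>} w"

text \<open>The gap between the infimum and the present value is at most 0, and raising it to 0 only
  raises \<open>ratio\<close>. This is the inequality in the first order condition, and it becomes
  an equality where the infimum is attained.\<close>

lemma marg_after_le:
  assumes "w \<in> space M"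
  shows "marg_after (\<tau> w) w \<le> stopped_price \<tau> w * future 0 (enn2real (\<tau> w)) w"
proof (cases "\<tau> w")
  case (real T)
  then show ?thesis
    using marg_after_eq[OF assms real(1)] future_mono[of "low T w - g T w" 0 T w] low_le_g[OF assms real(1)]
    by (auto simp: stopped_price_def intro!: mult_left_mono)
qed (auto simp: marg_after_infinity[unfolded infinity_ennreal_def])

lemma marg_after_eq_future:
  assumes "w \<in> space M" and "\<tau> w < \<infinity> ==> low (enn2real (\<tau> w)) w = g (enn2real (\<tau> w)) w"
  shows "marg_after (\<tau> w) w = stopped_price \<tau> w * future 0 (enn2real (\<tau> w)) w"
proof (cases "\<tau> w")
  case (real T)
  then show ?thesis
    using marg_after_eq[OF assms(1) real(1)] assms(2) by (auto simp: stopped_price_def)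
qed (auto simp: marg_after_infinity[unfolded infinity_ennreal_def] stopped_price_def)

lemma price_adapted: "0 \<le> t ==> price t \<in> borel_measurable (F t)"
  unfolding price_def using Y.adap[of t] by measurable

lemma price_right_cont: "w \<in> space M ==> continuous (at_right t) (\<lambda>s. price s w)"
  unfolding price_def by (intro continuous_intros Y.right_cont)

lemma price_measurable_at:
  assumes [measurable]: "h \<in> measurable N M" "T \<in> borel_measurable N"
  shows "(\<lambda>z. price (T z) (h z)) \<in> borel_measurable N"
proof -
  note [measurable] = Y.meas_at[OF assms]
  show ?thesis unfolding price_def by measurable
qed

lemma stopped_price_measurable:
  assumes "ext_stopping_time M F \<tau>"
  shows "stopped_price \<tau> \<in> borel_measurable (stopped_algebra M F \<tau>)"
proof -
  have "(\<lambda>w. ennreal (price (enn2real (\<tau> w)) w * indicator {w. \<tau> w < \<infinity>} w)) \<in> borel_measurable (stopped_algebra M F \<tau>)"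
    by (intro measurable_compose[OF X.progressive[OF assms price_adapted price_right_cont]]) auto
  also have "(\<lambda>w. ennreal (price (enn2real (\<tau> w)) w * indicator {w. \<tau> w < \<infinity>} w)) = stopped_price \<tau>"
    by (rule ext) (simp add: stopped_price_def split: split_indicator)
  finally show ?thesis .
qed

lemma stopped_future:
  assumes \<tau>: "ext_stopping_time M F \<tau>" and V: "V \<in> borel_measurable (stopped_algebra M F \<tau>)"
  shows "(\<integral>\<^sup>+w. V w * (stopped_price \<tau> w * future 0 (enn2real (\<tau> w)) w) \<partial>M) = (\<integral>\<^sup>+w. V w * stopped_price \<tau> w \<partial>M) * future_mean 0"
proof -
  have "(\<lambda>w. V w * stopped_price \<tau> w) \<in> borel_measurable (stopped_algebra M F \<tau>)"
    using V stopped_price_measurable[OF \<tau>] by (rule borel_measurable_times_ennreal)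
  from strong_markov_future[OF \<tau> this] show ?thesis
    by (simp only: mult.assoc) (simp add: stopped_price_def)
qed

section \<open>Cost and marginal value of a contribution\<close>

definition adapted_increasing :: "(real => 'a => real) => bool" where
  "adapted_increasing C \<longleftrightarrow> (\<forall>t\<ge>0. C t \<in> borel_measurable (F t)) \<and> (\<forall>w\<in>space M. increasing_path (\<lambda>t. C t w))"

abbreviation level :: "(real => 'a => real) => real => 'a => ennreal" where
  "level C y w \<equiv> level_time (\<lambda>t. C t w) y"

abbreviation "contribution_cost C \<equiv> \<integral>\<^sup>+w. (\<integral>\<^sup>+t\<in>{0..}. ennreal (price t w) \<partial>stieltjes (\<lambda>t. C t w)) \<partial>M"
abbreviation "marginal_value C \<equiv> \<integral>\<^sup>+w. (\<integral>\<^sup>+t\<in>{0..}. ennreal (marg t w * C t w) \<partial>lborel) \<partial>M"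
abbreviation "mean_price C y \<equiv> \<integral>\<^sup>+w. stopped_price (level C y) w \<partial>M"
abbreviation "mean_marg C y \<equiv> \<integral>\<^sup>+w. marg_after (level C y w) w \<partial>M"

lemma level_stopping_time:
  assumes "adapted_increasing C"
  shows "ext_stopping_time M F (level C y)"
  unfolding ext_stopping_time_def
proof (intro allI impI)
  fix t :: real assume t: "0 \<le> t"
  have "{w \<in> space M. level C y w \<le> ennreal t} = {w \<in> space (F t). y \<le> C t w}"
    using assms level_time_le_iff[OF _ t] X.space_F[OF t] unfolding adapted_increasing_def by blast
  also have "\<dots> \<in> sets (F t)"
  proof -
    have [measurable]: "C t \<in> borel_measurable (F t)" using assms t unfolding adapted_increasing_def by blast
    show ?thesis by measurable
  qed
  finally show "{w \<in> space M. level C y w \<le> ennreal t} \<in> sets (F t)" .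
qed

lemma level_measurable:
  assumes C: "adapted_increasing C"
  shows "(\<lambda>z. level C (snd z) (fst z)) \<in> borel_measurable MT"
proof (rule level_time_measurable[where C="\<lambda>z t. C t (fst z)"])
  fix t :: real assume "0 \<le> t"
  then have "C t \<in> borel_measurable M"
    using C X.measurable_F_M[of "C t" t] unfolding adapted_increasing_def by blast
  then show "(\<lambda>z. C t (fst z)) \<in> borel_measurable MT" by measurable
qed (use C in \<open>auto simp: adapted_increasing_def space_pair_measure\<close>)

lemma adapted_increasing_measurable:
  assumes C: "adapted_increasing C"
  shows "(\<lambda>z. C (max 0 (snd z)) (fst z)) \<in> borel_measurable MT"
proof -
  show ?thesis
  proof (rule right_continuous_measurable_at[where N=M and X="\<lambda>t w. C (max 0 t) w" and h=fst and T=snd])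
    fix t :: real
    show "(\<lambda>w. C (max 0 t) w) \<in> borel_measurable M"
      using C X.measurable_F_M[of "C (max 0 t)" "max 0 t"] unfolding adapted_increasing_def by simp
    fix w assume w: "w \<in> space M"
    show "continuous (at_right t) (\<lambda>s. C (max 0 s) w)"
    proof (cases "0 \<le> t")
      case True
      have "\<forall>\<^sub>F s in at_right t. C s w = C (max 0 s) w"
        unfolding eventually_at_right_field using True by (intro exI[of _ "t + 1"]) auto
      moreover have "continuous (at_right t) (\<lambda>s. C s w)"
        using C w True unfolding adapted_increasing_def increasing_path_def by blast
      ultimately show ?thesis
        using True unfolding continuous_within by (auto elim: Lim_transform_eventually)
    next
      case False
      have "\<forall>\<^sub>F s in at_right t. C (max 0 s) w = C (max 0 t) w"
        unfolding eventually_at_right_field using False by (intro exI[of _ 0]) auto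
      then show ?thesis unfolding continuous_within by (rule tendsto_eventually)
    qed
  qed measurable
qed

lemma marg_pair_measurable: "(\<lambda>z. marg (max 0 (snd z)) (fst z)) \<in> borel_measurable MT"
  by (rule marg_measurable_at) auto

lemma marg_after_measurable:
  assumes C: "adapted_increasing C"
  shows "(\<lambda>z. marg_after (level C (snd z) (fst z)) (fst z)) \<in> borel_measurable MT"
proof -
  have [measurable]: "(\<lambda>z. level C (snd (fst z)) (fst (fst z))) \<in> borel_measurable (MT \<Otimes>\<^sub>M lborel)"
    by (rule measurable_compose[OF measurable_fst level_measurable[OF C]])
  have [measurable]: "(\<lambda>z. marg (max 0 (snd z)) (fst (fst z))) \<in> borel_measurable (MT \<Otimes>\<^sub>M lborel)"
    by (rule marg_measurable_at) auto
  have "(\<lambda>z. \<integral>\<^sup>+t. ennreal (marg (max 0 t) (fst z)) * (if 0 \<le> t \<and> level C (snd z) (fst z) \<le> ennreal t then 1 else 0) \<partial>lborel)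
      \<in> borel_measurable MT"
    by (rule lborel.borel_measurable_nn_integral) (simp add: case_prod_beta)
  also have "(\<lambda>z. \<integral>\<^sup>+t. ennreal (marg (max 0 t) (fst z)) * (if 0 \<le> t \<and> level C (snd z) (fst z) \<le> ennreal t then 1 else 0) \<partial>lborel)
     = (\<lambda>z. marg_after (level C (snd z) (fst z)) (fst z))"
    unfolding marg_after_def by (intro ext nn_integral_cong) (auto simp: max_def split: split_indicator)
  finally show ?thesis .
qed

lemma stopped_price_pair_measurable:
  assumes C: "adapted_increasing C"
  shows "(\<lambda>z. stopped_price (level C (snd z)) (fst z)) \<in> borel_measurable MT"
proof -
  note [measurable] = level_measurable[OF C]
  have [measurable]: "(\<lambda>z. price (enn2real (level C (snd z) (fst z))) (fst z)) \<in> borel_measurable MT"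
    by (rule price_measurable_at) measurable
  have "(\<lambda>z. ennreal (price (enn2real (level C (snd z) (fst z))) (fst z)) * (if level C (snd z) (fst z) < \<infinity> then 1 else 0)) \<in> borel_measurable MT"
    by measurable
  also have "(\<lambda>z. ennreal (price (enn2real (level C (snd z) (fst z))) (fst z)) * (if level C (snd z) (fst z) < \<infinity> then 1 else 0))
      = (\<lambda>z. stopped_price (level C (snd z)) (fst z))"
    by (auto simp: stopped_price_def)
  finally show ?thesis .
qed

lemma stopped_price_mean_measurable:
  assumes C: "adapted_increasing C"
  shows "(\<lambda>y. mean_price C y) \<in> borel_measurable lborel"
proof (rule X.borel_measurable_nn_integral)
  have "(\<lambda>z. (snd z, fst z)) \<in> measurable (lborel \<Otimes>\<^sub>M M) MT" by measurable
  from measurable_compose[OF this stopped_price_pair_measurable[OF C]]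
  show "(\<lambda>(y, w). stopped_price (level C y) w) \<in> borel_measurable (lborel \<Otimes>\<^sub>M M)"
    by (simp add: case_prod_beta)
qed

lemma marginal_value_eq:
  assumes C: "adapted_increasing C"
  shows "marginal_value C
     = (\<integral>\<^sup>+y\<in>{0<..}. mean_marg C y \<partial>lborel)"
proof -
  note [measurable] = marg_after_measurable[OF C]
  have "marginal_value C
     = (\<integral>\<^sup>+w. \<integral>\<^sup>+y. marg_after (level C y w) w * indicator {0<..} y \<partial>lborel \<partial>M)"
  proof (rule nn_integral_cong)
    fix w assume w: "w \<in> space M"
    have i: "increasing_path (\<lambda>t. C t w)" using C w by (simp add: adapted_increasing_def)
    have m: "(\<lambda>t. ennreal (marg (max 0 t) w)) \<in> borel_measurable borel"
      by (rule measurable_compose[OF marg_measurable_at]) (use w in auto)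
    have "(\<integral>\<^sup>+t\<in>{0..}. ennreal (marg t w * C t w) \<partial>lborel) = (\<integral>\<^sup>+t\<in>{0..}. ennreal (marg (max 0 t) w) * ennreal (C t w) \<partial>lborel)"
      using increasing_path_nonneg[OF i]
      by (intro nn_integral_cong) (auto simp: max_def ennreal_mult marg_def split: split_indicator)
    also have "\<dots> = (\<integral>\<^sup>+y. (\<integral>\<^sup>+t. ennreal (marg (max 0 t) w) * indicator {t. 0 \<le> t \<and> level C y w \<le> ennreal t} t \<partial>lborel) * indicator {0<..} y \<partial>lborel)"
      by (rule nn_integral_level_time[OF i m])
    also have "\<dots> = (\<integral>\<^sup>+y. marg_after (level C y w) w * indicator {0<..} y \<partial>lborel)"
    proof (rule nn_integral_cong)
      fix y
      have "(\<integral>\<^sup>+t. ennreal (marg (max 0 t) w) * indicator {t. 0 \<le> t \<and> level C y w \<le> ennreal t} t \<partial>lborel)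
        = marg_after (level C y w) w"
        unfolding marg_after_def by (intro nn_integral_cong) (auto simp: max_def split: split_indicator)
      then show "(\<integral>\<^sup>+t. ennreal (marg (max 0 t) w) * indicator {t. 0 \<le> t \<and> level C y w \<le> ennreal t} t \<partial>lborel) * indicator {0<..} y
         = marg_after (level C y w) w * indicator {0<..} y" by simp
    qed
    finally show "(\<integral>\<^sup>+t\<in>{0..}. ennreal (marg t w * C t w) \<partial>lborel) = (\<integral>\<^sup>+y. marg_after (level C y w) w * indicator {0<..} y \<partial>lborel)" .
  qed
  also have "\<dots> = (\<integral>\<^sup>+y. \<integral>\<^sup>+w. marg_after (level C y w) w * indicator {0<..} y \<partial>M \<partial>lborel)"
    by (rule M_time.Fubini'[symmetric]) (simp add: case_prod_beta)
  also have "\<dots> = (\<integral>\<^sup>+y\<in>{0<..}. mean_marg C y \<partial>lborel)"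
    by (intro nn_integral_cong) (auto split: split_indicator)
  finally show ?thesis .
qed

lemma contribution_cost_eq:
  assumes C: "adapted_increasing C"
  shows "contribution_cost C
     = (\<integral>\<^sup>+y\<in>{0<..}. mean_price C y \<partial>lborel)"
    and "(\<lambda>w. \<integral>\<^sup>+t\<in>{0..}. ennreal (price t w) \<partial>stieltjes (\<lambda>t. C t w)) \<in> borel_measurable M"
proof -
  note [measurable] = stopped_price_pair_measurable[OF C]
  have e: "(\<integral>\<^sup>+t\<in>{0..}. ennreal (price t w) \<partial>stieltjes (\<lambda>t. C t w))
     = (\<integral>\<^sup>+y. stopped_price (level C y) w * indicator {0<..} y \<partial>lborel)" if w: "w \<in> space M" for w
  proof -
    have i: "increasing_path (\<lambda>t. C t w)" using C w by (simp add: adapted_increasing_def)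
    have m: "(\<lambda>t. ennreal (price t w)) \<in> borel_measurable borel"
      by (rule measurable_compose[OF price_measurable_at]) (use w in auto)
    show ?thesis
      unfolding nn_integral_stieltjes[OF i m]
      by (intro nn_integral_cong) (auto simp: stopped_price_def split: split_indicator)
  qed
  have "contribution_cost C
     = (\<integral>\<^sup>+w. \<integral>\<^sup>+y. stopped_price (level C y) w * indicator {0<..} y \<partial>lborel \<partial>M)"
    by (intro nn_integral_cong e)
  also have "\<dots> = (\<integral>\<^sup>+y. \<integral>\<^sup>+w. stopped_price (level C y) w * indicator {0<..} y \<partial>M \<partial>lborel)"
    by (rule M_time.Fubini'[symmetric]) (simp add: case_prod_beta)
  also have "\<dots> = (\<integral>\<^sup>+y\<in>{0<..}. mean_price C y \<partial>lborel)"
    by (intro nn_integral_cong) (auto split: split_indicator)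
  finally show "contribution_cost C
     = (\<integral>\<^sup>+y\<in>{0<..}. mean_price C y \<partial>lborel)" .
  have "(\<lambda>w. \<integral>\<^sup>+y. stopped_price (level C y) w * indicator {0<..} y \<partial>lborel) \<in> borel_measurable M"
    by (rule lborel.borel_measurable_nn_integral) (simp add: case_prod_beta)
  then show "(\<lambda>w. \<integral>\<^sup>+t\<in>{0..}. ennreal (price t w) \<partial>stieltjes (\<lambda>t. C t w)) \<in> borel_measurable M"
    by (rule measurable_cong[THEN iffD1, rotated]) (simp add: e)
qed

lemma stopped_future_level:
  assumes C: "adapted_increasing C"
  shows "(\<integral>\<^sup>+w. stopped_price (level C y) w * future 0 (enn2real (level C y w)) w \<partial>M)
     = future_mean 0 * mean_price C y"
  using stopped_future[OF level_stopping_time[OF C], of "\<lambda>_. 1" y] by (simp add: mult.commute)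

text \<open>Sliced by level, a contribution is a family of unit contributions made at the stopping
  times \<open>level C y\<close>. By \<open>marg_after_le\<close> and the strong Markov property the
  value of each slice is at most \<open>future_mean 0\<close> times its mean price.\<close>

theorem marginal_value_le:
  assumes C: "adapted_increasing C"
  shows "marginal_value C
     \<le> future_mean 0 * contribution_cost C"
proof -
  have [measurable]: "(\<lambda>y. mean_price C y) \<in> borel_measurable lborel"
    by (rule stopped_price_mean_measurable[OF C])
  have "(\<integral>\<^sup>+y\<in>{0<..}. mean_marg C y \<partial>lborel)
     \<le> (\<integral>\<^sup>+y. future_mean 0 * (mean_price C y * indicator {0<..} y) \<partial>lborel)"
  proof (rule nn_integral_mono)
    fix y :: real
    have "mean_marg C y \<le> future_mean 0 * mean_price C y"
      unfolding stopped_future_level[OF C, symmetric] by (rule nn_integral_mono) (rule marg_after_le)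
    then show "mean_marg C y * indicator {0<..} y
       \<le> future_mean 0 * (mean_price C y * indicator {0<..} y)"
      by (auto split: split_indicator)
  qed
  also have "\<dots> = future_mean 0 * (\<integral>\<^sup>+y\<in>{0<..}. mean_price C y \<partial>lborel)"
    by (rule nn_integral_cmult) measurable
  finally show ?thesis unfolding marginal_value_eq[OF C] contribution_cost_eq(1)[OF C] .
qed

text \<open>The same slicing, with equality in each slice because the infimum is attained at almost
  every level time.\<close>

theorem marginal_value_eq_cost:
  assumes C: "adapted_increasing C"
    and flat: "\<And>w. w \<in> space M ==> AE y in lborel. 0 < y --> level C y w < \<infinity> -->
       low (enn2real (level C y w)) w = g (enn2real (level C y w)) w"
  shows "marginal_value C
     = future_mean 0 * contribution_cost C"
proof -
  note [measurable] = stopped_price_pair_measurable[OF C] marg_after_measurable[OF C] level_measurable[OF C]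
  have [measurable]: "(\<lambda>y. mean_price C y) \<in> borel_measurable lborel"
    by (rule stopped_price_mean_measurable[OF C])
  have fm: "(\<lambda>z. future 0 (enn2real (level C (snd z) (fst z))) (fst z)) \<in> borel_measurable MT"
  proof -
    have "(\<lambda>z. ratio 0 (enn2real (level C (snd (fst z)) (fst (fst z)))) (max 0 (snd z)) (fst (fst z)))
       \<in> borel_measurable (MT \<Otimes>\<^sub>M lborel)"
      by (rule ratio_measurable_at) (use measurable_compose[OF measurable_fst level_measurable[OF C]] in auto)
    note [measurable] = this
    have "(\<lambda>z. \<integral>\<^sup>+u\<in>{0..}. ennreal (exp (- r * u)) * ennreal (exp (ratio 0 (enn2real (level C (snd z) (fst z))) (max 0 u) (fst z))) \<partial>lborel)
       \<in> borel_measurable MT"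
      by (rule lborel.borel_measurable_nn_integral) (simp add: case_prod_beta)
    also have "(\<lambda>z. \<integral>\<^sup>+u\<in>{0..}. ennreal (exp (- r * u)) * ennreal (exp (ratio 0 (enn2real (level C (snd z) (fst z))) (max 0 u) (fst z))) \<partial>lborel)
       = (\<lambda>z. future 0 (enn2real (level C (snd z) (fst z))) (fst z))"
      unfolding future_def by (intro ext nn_integral_cong) (auto simp: max_def split: split_indicator)
    finally show ?thesis .
  qed
  note [measurable] = fm
  have "(\<integral>\<^sup>+y\<in>{0<..}. mean_marg C y \<partial>lborel)
     = (\<integral>\<^sup>+y. \<integral>\<^sup>+w. marg_after (level C y w) w * indicator {0<..} y \<partial>M \<partial>lborel)"
    by (intro nn_integral_cong) (auto split: split_indicator)
  \<comment> \<open>The exceptional levels depend on the path, so the integral over \<open>y\<close>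
    has to be the inner one while \<open>flat\<close> is applied.\<close>
  also have "\<dots> = (\<integral>\<^sup>+w. \<integral>\<^sup>+y. marg_after (level C y w) w * indicator {0<..} y \<partial>lborel \<partial>M)"
    by (rule M_time.Fubini') (simp add: case_prod_beta)
  also have "\<dots> = (\<integral>\<^sup>+w. \<integral>\<^sup>+y. (stopped_price (level C y) w * future 0 (enn2real (level C y w)) w) * indicator {0<..} y \<partial>lborel \<partial>M)"
  proof (rule nn_integral_cong)
    fix w assume w: "w \<in> space M"
    show "(\<integral>\<^sup>+y. marg_after (level C y w) w * indicator {0<..} y \<partial>lborel)
      = (\<integral>\<^sup>+y. (stopped_price (level C y) w * future 0 (enn2real (level C y w)) w) * indicator {0<..} y \<partial>lborel)"
    proof (rule nn_integral_cong_AE)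
      show "AE y in lborel. marg_after (level C y w) w * indicator {0<..} y
         = (stopped_price (level C y) w * future 0 (enn2real (level C y w)) w) * indicator {0<..} y"
        using flat[OF w]
      proof eventually_elim
        case (elim y)
        show ?case
          using marg_after_eq_future[OF w, of "level C y"] elim by (auto split: split_indicator)
      qed
    qed
  qed
  also have "\<dots> = (\<integral>\<^sup>+y. \<integral>\<^sup>+w. (stopped_price (level C y) w * future 0 (enn2real (level C y w)) w) * indicator {0<..} y \<partial>M \<partial>lborel)"
    by (rule M_time.Fubini'[symmetric]) (simp add: case_prod_beta)
  also have "\<dots> = (\<integral>\<^sup>+y. future_mean 0 * (mean_price C y * indicator {0<..} y) \<partial>lborel)"
    by (intro nn_integral_cong) (auto simp: stopped_future_level[OF C] split: split_indicator)
  also have "\<dots> = future_mean 0 * (\<integral>\<^sup>+y\<in>{0<..}. mean_price C y \<partial>lborel)"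
    by (rule nn_integral_cmult) measurable
  finally show ?thesis unfolding marginal_value_eq[OF C] contribution_cost_eq(1)[OF C] .
qed

end

section \<open>Contributions that track the running infimum\<close>

context levy_market
begin

lemma tracking_adapted_increasing:
  assumes "0 < \<kappa>" "0 < c"
  shows "adapted_increasing (\<lambda>t w. c * exp (- \<kappa> * low t w))"
  unfolding adapted_increasing_def increasing_path_def
proof (intro conjI allI ballI impI)
  fix t :: real assume "0 \<le> t"
  note [measurable] = low_adapted[OF this]
  show "(\<lambda>w. c * exp (- \<kappa> * low t w)) \<in> borel_measurable (F t)" by measurable
next
  fix w assume w: "w \<in> space M"
  show "mono_on {0..} (\<lambda>t. c * exp (- \<kappa> * low t w))"
    using low_antimono[OF w] assms by (intro mono_onI) auto
  fix t :: real assume "0 \<le> t"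
  from cadlag_right[OF low_cadlag[OF w] this]
  show "continuous (at_right t) (\<lambda>t. c * exp (- \<kappa> * low t w))" by (intro continuous_intros)
qed (use assms in auto)

text \<open>At a level time \<open>T\<close> at which the infimum is not attained, \<open>low\<close> is constant on an interval
  to the right of \<open>T\<close>, so that the level itself is the value of the contribution at a rational time.\<close>

lemma tracking_flat:
  assumes \<kappa>: "0 < \<kappa>" and c: "0 < c" and w: "w \<in> space M"
  shows "AE y in lborel. 0 < y --> level (\<lambda>t w. c * exp (- \<kappa> * low t w)) y w < \<infinity> -->
       low (enn2real (level (\<lambda>t w. c * exp (- \<kappa> * low t w)) y w)) w = g (enn2real (level (\<lambda>t w. c * exp (- \<kappa> * low t w)) y w)) w"
    (is "AE y in lborel. 0 < y --> ?L y < \<infinity> --> ?P y")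
proof -
  define C where "C t = c * exp (- \<kappa> * low t w)" for t
  have C: "increasing_path C"
    using tracking_adapted_increasing[OF \<kappa> c] w unfolding adapted_increasing_def C_def by blast
  have bad: "y \<in> C ` \<rat>" if y: "0 < y" "level_time C y < \<infinity>"
    and ne: "low (enn2real (level_time C y)) w \<noteq> g (enn2real (level_time C y)) w" for y
  proof -
    define T where "T = enn2real (level_time C y)"
    have T: "0 \<le> T" by (simp add: T_def)
    have lt: "low T w < g T w" using low_le_g[OF w T] ne by (simp add: T_def)
    have yT: "y \<le> C T" unfolding T_def by (rule level_time_attained(1)[OF C y(2)])
    have "\<forall>\<^sub>F s in at_right T. low T w < g s w"
      using g_right_cont[OF w, of T] lt unfolding continuous_within by (rule order_tendstoD(1))
    then obtain b where b: "b > T" "\<And>s. T < s ==> s < b ==> low T w < g s w"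
      unfolding eventually_at_right_field by blast
    obtain q where q: "q \<in> \<rat>" "T < q" "q < b" using Rats_dense_in_real[OF b(1)] by blast
    have "low T w \<le> low q w"
      unfolding low_def[of q]
    proof (rule running_inf_greatest)
      fix s assume s: "0 \<le> s" "s \<le> q"
      show "low T w \<le> g s w"
      proof (cases "s \<le> T")
        case True
        then show ?thesis unfolding low_def using s by (intro running_inf_le cadlag_bdd_below g_cadlag[OF w]) auto
      next
        case False
        then show ?thesis using b(2)[of s] s q by auto
      qed
    qed (use T q in auto)
    then have "low q w = low T w" using low_antimono[OF w T, of q] q by auto
    then have Cq: "C q = C T" by (simp add: C_def)
    \<comment> \<open>If \<open>y < C T\<close>, the infimum up to \<open>T\<close> lies below the
      value that corresponds to the level \<open>y\<close>; then so does some \<open>g s w\<close>,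
      and the contribution at \<open>s\<close> already exceeds \<open>y\<close>.\<close>
    have "y = C T"
    proof (rule ccontr)
      assume "y \<noteq> C T"
      then have "y < C T" using yT by simp
      then have "y / c < exp (- \<kappa> * low T w)" using c by (simp add: C_def field_simps)
      then have "ln (y / c) < - \<kappa> * low T w" using y c by (metis divide_pos_pos ln_exp ln_less_cancel_iff exp_gt_zero)
      then have l: "low T w < - ln (y / c) / \<kappa>" using \<kappa> by (simp add: field_simps)
      \<comment> \<open>Staying below \<open>g T w\<close> as well forces \<open>s\<close> to be
        strictly before \<open>T\<close>, where the level has not yet been reached.\<close>
      define d where "d = min (- ln (y / c) / \<kappa>) (g T w)"
      have "running_inf (\<lambda>s. g s w) T < d" using l lt by (simp add: d_def low_def)
      then obtain s where s: "0 \<le> s" "s \<le> T" "g s w < d" using running_inf_less[OF T] by blast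
      then have "s \<noteq> T" by (auto simp: d_def)
      then have "C s < y" using level_time_attained(2)[OF C y(2) s(1)] s by (simp add: T_def)
      have "low s w < - ln (y / c) / \<kappa>" using low_le_g[OF w s(1)] s(3) by (simp add: d_def)
      then have "ln (y / c) < - \<kappa> * low s w" using \<kappa> by (simp add: field_simps)
      then have "y / c < exp (- \<kappa> * low s w)" using y c by (metis divide_pos_pos exp_ln exp_less_mono)
      then have "y < C s" using c by (simp add: C_def field_simps)
      with \<open>C s < y\<close> show False by simp
    qed
    with Cq q show ?thesis by (intro image_eqI[of _ _ q]) auto
  qed
  have "countable (C ` \<rat>)" by (rule countable_image[OF countable_rat])
  then have "C ` \<rat> \<in> null_sets lborel" by (rule countable_imp_null_set_lborel)
  then have "AE y in lborel. y \<notin> C ` \<rat>" by (rule AE_not_in)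
  then show ?thesis
  proof eventually_elim
    case (elim y)
    then show ?case using bad[of y] unfolding C_def[abs_def] by blast
  qed
qed

end

section \<open>Time reversal\<close>

context cadlag_levy
begin

definition inc :: "real => nat => 'a => real" where
  "inc h i w = Z (real (Suc i) * h) w - Z (real i * h) w"

lemma inc_measurable[measurable]: "inc h i \<in> borel_measurable M"
  unfolding inc_def by measurable

text \<open>The event is carried along as an element of the filtration at \<open>real n * h\<close>,
  because the next increment is independent of exactly these events.\<close>

lemma inc_box:
  assumes h: "0 \<le> h" and A: "\<And>i. A i \<in> sets borel"
  shows "emeasure M {w\<in>space M. \<forall>i<n. inc h i w \<in> A i} = (\<Prod>i<n. emeasure (distr M borel (Z h)) (A i)) \<and>
     {w\<in>space M. \<forall>i<n. inc h i w \<in> A i} \<in> sets (F (real n * h))"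
proof (induction n)
  case 0
  have "space M \<in> sets (F 0)" using sets.top[of "F 0"] space_F[of 0] by simp
  then show ?case by (simp add: emeasure_space_1)
next
  case (Suc n)
  define B where "B = {w\<in>space M. \<forall>i<n. inc h i w \<in> A i}"
  define D where "D = (\<lambda>w. Z (real n * h + h) w - Z (real n * h) w) -` A n \<inter> space M"
  have t: "0 \<le> real n * h" "real n * h \<le> real (Suc n) * h" using h by (auto simp: mult_right_mono)
  have eq: "{w\<in>space M. \<forall>i<Suc n. inc h i w \<in> A i} = B \<inter> D"
    by (auto simp: B_def D_def inc_def less_Suc_eq algebra_simps)
  have BF: "B \<in> sets (F (real n * h))" unfolding B_def by (rule conjunct2[OF Suc.IH])
  have "D \<in> {(\<lambda>w. Z (real n * h + h) w - Z (real n * h) w) -` B \<inter> space M |B. B \<in> sets borel}"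
    unfolding D_def using A by blast
  from indep_setD[OF increment_indep[OF t(1) h] BF this]
  have "emeasure M (B \<inter> D) = emeasure M B * emeasure M D"
    unfolding emeasure_eq_measure by (metis ennreal_mult measure_nonneg)
  also have "emeasure M D = emeasure (distr M borel (Z h)) (A n)"
    unfolding increment_distr[OF t(1) h, symmetric] D_def using A by (subst emeasure_distr) auto
  finally have 1: "emeasure M (B \<inter> D) = (\<Prod>i<Suc n. emeasure (distr M borel (Z h)) (A i))"
    unfolding B_def conjunct1[OF Suc.IH] by (simp add: mult.commute)
  have le: "0 \<le> real (Suc n) * h" using h by simp
  note [measurable] = adap_le[OF t(2) le] adap_le[OF order_refl le]
  have "{w\<in>space (F (real (Suc n) * h)). inc h n w \<in> A n} \<in> sets (F (real (Suc n) * h))"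
    unfolding inc_def using A[of n] by measurable
  moreover have "B \<inter> D = B \<inter> {w\<in>space (F (real (Suc n) * h)). inc h n w \<in> A n}"
    unfolding space_F[OF le] by (auto simp: B_def D_def inc_def algebra_simps)
  ultimately have "B \<inter> D \<in> sets (F (real (Suc n) * h))" using BF filtration[OF t] by auto
  with 1 show ?case unfolding eq by (rule conjI)
qed

text \<open>Independent increments with a common law can be rearranged without changing their joint
  law. An involution reindexes the product by itself; the identity and the reversal are the two
  cases applied.\<close>

lemma inc_distr:
  assumes h: "0 \<le> h" and p: "\<And>i. i < N ==> p i < N" "\<And>i. i < N ==> p (p i) = i"
  shows "distr M (\<Pi>\<^sub>M i\<in>{..<N}. borel) (\<lambda>w. \<lambda>i\<in>{..<N}. inc h (p i) w) = (\<Pi>\<^sub>M i\<in>{..<N}. distr M borel (Z h))"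
proof -
  interpret L: prob_space "distr M borel (Z h)" by (rule prob_space_law)
  interpret P: product_sigma_finite "\<lambda>i :: nat. distr M borel (Z h)" ..
  have m: "(\<lambda>w. \<lambda>i\<in>{..<N}. inc h (p i) w) \<in> measurable M (\<Pi>\<^sub>M i\<in>{..<N}. borel)"
    by (intro measurable_restrict) measurable
  have sets: "sets (\<Pi>\<^sub>M i\<in>{..<N}. distr M borel (Z h)) = sets (\<Pi>\<^sub>M i\<in>{..<N}. borel)"
    by (intro sets_PiM_cong) auto
  show ?thesis
  proof (rule P.PiM_eqI)
    fix A :: "nat => real set" assume A: "\<And>i. i \<in> {..<N} ==> A i \<in> sets (distr M borel (Z h))"
    define A' where "A' i = (if i < N then A (p i) else UNIV)" for i
    have A': "A' i \<in> sets borel" for i using A p(1) by (auto simp: A'_def)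
    have box: "Pi\<^sub>E {..<N} A \<in> sets (\<Pi>\<^sub>M i\<in>{..<N}. borel)" using A by (intro sets_PiM_I_finite) auto
    have "(\<lambda>w. \<lambda>i\<in>{..<N}. inc h (p i) w) -` Pi\<^sub>E {..<N} A \<inter> space M = {w\<in>space M. \<forall>i<N. inc h i w \<in> A' i}"
      (is "?l = ?r")
    proof (intro set_eqI iffI)
      fix w assume *: "w \<in> ?l"
      have "inc h i w \<in> A' i" if i: "i < N" for i
      proof -
        have "inc h (p (p i)) w \<in> A (p i)" using * p(1)[OF i] by (auto simp: PiE_iff)
        then show ?thesis using i p(2)[OF i] by (simp add: A'_def)
      qed
      then show "w \<in> ?r" using * by auto
    next
      fix w assume *: "w \<in> ?r"
      have "inc h (p i) w \<in> A i" if i: "i < N" for i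
        using * p(1)[OF i] p(2)[OF i] by (auto simp: A'_def dest!: spec[of _ "p i"])
      then show "w \<in> ?l" using * by auto
    qed
    then have "emeasure (distr M (\<Pi>\<^sub>M i\<in>{..<N}. borel) (\<lambda>w. \<lambda>i\<in>{..<N}. inc h (p i) w)) (Pi\<^sub>E {..<N} A)
       = (\<Prod>i<N. emeasure (distr M borel (Z h)) (A' i))"
      unfolding emeasure_distr[OF m box] by (simp only: conjunct1[OF inc_box[OF h A', of N]])
    also have "\<dots> = (\<Prod>i<N. emeasure (distr M borel (Z h)) (A (p i)))"
      by (intro prod.cong) (auto simp: A'_def)
    also have "\<dots> = (\<Prod>i<N. emeasure (distr M borel (Z h)) (A i))"
      by (rule prod.reindex_bij_witness[where i=p and j=p]) (use p in auto)
    finally show "emeasure (distr M (\<Pi>\<^sub>M i\<in>{..<N}. borel) (\<lambda>w. \<lambda>i\<in>{..<N}. inc h (p i) w)) (Pi\<^sub>E {..<N} A)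
       = (\<Prod>i\<in>{..<N}. emeasure (distr M borel (Z h)) (A i))" .
  qed (use sets in auto)
qed

lemma sum_inc: "w \<in> space M ==> (\<Sum>i<m. inc h i w) = Z (real m * h) w"
  by (induction m) (auto simp: inc_def start)

lemma sum_inc_reversed:
  "m \<le> N ==> (\<Sum>i<m. inc h (N - Suc i) w) = Z (real N * h) w - Z (real (N - m) * h) w"
proof (induction m)
  case (Suc m)
  then have "N - m = Suc (N - Suc m)" by simp
  with Suc show ?case by (simp add: inc_def)
qed simp

end

section \<open>Reversal of the increments of \<open>X\<close> along a fixed path of
  \<open>Y\<close>\<close>

context levy_market
begin

lemma path_measurable:
  "(\<lambda>w. \<lambda>t\<in>{0..}. X t w) \<in> measurable M (\<Pi>\<^sub>M t\<in>{0..}. borel)"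
  "(\<lambda>w. \<lambda>t\<in>{0..}. Y t w) \<in> measurable M (\<Pi>\<^sub>M t\<in>{0..}. borel)"
  by (auto intro!: measurable_restrict)

text \<open>The right-hand side does not involve \<open>p\<close>. Hence two rearrangements of the
  increments of \<open>X\<close> have the same joint law with the path of \<open>Y\<close>.\<close>

lemma increments_exchangeable:
  assumes h: "0 \<le> h" and \<Phi>: "\<Phi> \<in> borel_measurable ((\<Pi>\<^sub>M i\<in>{..<N}. borel) \<Otimes>\<^sub>M (\<Pi>\<^sub>M t\<in>{0..}. borel))"
    and p: "\<And>i. i < N ==> p i < N" "\<And>i. i < N ==> p (p i) = i"
  shows "(\<integral>\<^sup>+w. \<Phi> (\<lambda>i\<in>{..<N}. X.inc h (p i) w, \<lambda>t\<in>{0..}. Y t w) \<partial>M)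
     = (\<integral>\<^sup>+d. (\<integral>\<^sup>+y. \<Phi> (d, y) \<partial>distr M (\<Pi>\<^sub>M t\<in>{0..}. borel) (\<lambda>w. \<lambda>t\<in>{0..}. Y t w)) \<partial>(\<Pi>\<^sub>M i\<in>{..<N}. distr M borel (X h)))"
proof -
  let ?S = "PiM {0::real..} (\<lambda>t. borel :: real measure)"
  let ?I = "PiM {..<N} (\<lambda>i. borel :: real measure)"
  let ?x = "\<lambda>w. \<lambda>t\<in>{0..}. X t w" and ?y = "\<lambda>w. \<lambda>t\<in>{0..}. Y t w"
  let ?d = "\<lambda>\<eta>. \<lambda>i\<in>{..<N}. \<eta> (real (Suc (p i)) * h) - \<eta> (real (p i) * h)"
  note xm = path_measurable(1) and ym = path_measurable(2)
  interpret PY: prob_space "distr M ?S ?y" by (rule X.prob_space_distr[OF ym])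
  have d: "?d \<in> measurable ?S ?I"
    using h by (intro measurable_restrict borel_measurable_diff measurable_component_singleton) auto
  have dx: "?d (?x w) = (\<lambda>i\<in>{..<N}. X.inc h (p i) w)" for w
    using h by (auto simp: X.inc_def restrict_def)
  have \<psi>: "(\<lambda>e. \<integral>\<^sup>+y. \<Phi> (e, y) \<partial>distr M ?S ?y) \<in> borel_measurable ?I"
    by (rule PY.borel_measurable_nn_integral) (use \<Phi> in \<open>simp add: case_prod_beta\<close>)
  have prod: "distr M (?S \<Otimes>\<^sub>M ?S) (\<lambda>w. (?x w, ?y w)) = distr M ?S ?x \<Otimes>\<^sub>M distr M ?S ?y"
    using processes_indep unfolding independent_processes_def X.indep_var_distribution_eq by simp
  have dm: "(\<lambda>q. (?d (fst q), snd q)) \<in> measurable (?S \<Otimes>\<^sub>M ?S) (?I \<Otimes>\<^sub>M ?S)"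
    using measurable_compose[OF measurable_fst d] by (intro measurable_Pair) auto
  have \<Phi>d: "(\<lambda>q. \<Phi> (?d (fst q), snd q)) \<in> borel_measurable (?S \<Otimes>\<^sub>M ?S)"
    by (rule measurable_compose[OF dm \<Phi>])
  have pm: "(\<lambda>w. (?x w, ?y w)) \<in> measurable M (?S \<Otimes>\<^sub>M ?S)" using xm ym by (rule measurable_Pair)
  have "(\<integral>\<^sup>+w. \<Phi> (\<lambda>i\<in>{..<N}. X.inc h (p i) w, ?y w) \<partial>M) = (\<integral>\<^sup>+q. \<Phi> (?d (fst q), snd q) \<partial>distr M (?S \<Otimes>\<^sub>M ?S) (\<lambda>w. (?x w, ?y w)))"
  proof (subst nn_integral_distr[OF pm])
    show "(\<lambda>q. \<Phi> (?d (fst q), snd q)) \<in> borel_measurable (distr M (?S \<Otimes>\<^sub>M ?S) (\<lambda>w. (?x w, ?y w)))"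
      using \<Phi>d by simp
  qed (simp only: fst_conv snd_conv dx)
  also have "\<dots> = (\<integral>\<^sup>+\<eta>. \<integral>\<^sup>+y. \<Phi> (?d \<eta>, y) \<partial>distr M ?S ?y \<partial>distr M ?S ?x)"
    unfolding prod
    by (subst PY.nn_integral_fst[symmetric]) (use \<Phi>d in \<open>simp_all cong: measurable_cong_sets\<close>)
  also have "\<dots> = (\<integral>\<^sup>+w. (\<integral>\<^sup>+y. \<Phi> (?d (?x w), y) \<partial>distr M ?S ?y) \<partial>M)"
    by (rule nn_integral_distr[OF xm]) (use measurable_compose[OF d \<psi>] in simp)
  also have "\<dots> = (\<integral>\<^sup>+w. (\<integral>\<^sup>+y. \<Phi> (\<lambda>i\<in>{..<N}. X.inc h (p i) w, y) \<partial>distr M ?S ?y) \<partial>M)"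
    unfolding dx ..
  also have "\<dots> = (\<integral>\<^sup>+e. (\<integral>\<^sup>+y. \<Phi> (e, y) \<partial>distr M ?S ?y) \<partial>distr M ?I (\<lambda>w. \<lambda>i\<in>{..<N}. X.inc h (p i) w))"
  proof (rule nn_integral_distr[symmetric])
    show "(\<lambda>w. \<lambda>i\<in>{..<N}. X.inc h (p i) w) \<in> measurable M ?I"
      by (intro measurable_restrict) measurable
  qed (use \<psi> in simp)
  also have "distr M ?I (\<lambda>w. \<lambda>i\<in>{..<N}. X.inc h (p i) w) = (\<Pi>\<^sub>M i\<in>{..<N}. distr M borel (X h))"
    by (rule X.inc_distr[OF h p])
  finally show ?thesis .
qed

definition reversed_min :: "nat => real => 'a => real" where
  "reversed_min k v w = grid_min (\<lambda>s. Y s w - a * X (v - s) w) v k"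

text \<open>Reversing the increments of \<open>X\<close> on the grid replaces
  \<open>X (v - s)\<close> by \<open>X v - X s\<close>. Then \<open>Y s - a * X (v - s)\<close>
  becomes \<open>g s - a * X v\<close>, whose grid minimum is the walk started at
  \<open>e = 0\<close>.\<close>

lemma reversed_min_law:
  assumes v: "0 \<le> v" and f[measurable]: "f \<in> borel_measurable borel"
  shows "(\<integral>\<^sup>+w. f (reversed_min k v w) \<partial>M) = (\<integral>\<^sup>+w. f (ratio_approx k 0 0 v w) \<partial>M)"
proof -
  define N where "N = (2 :: nat) ^ k"
  define h where "h = v / real N"
  have N: "0 < N" "real N * h = v" by (simp_all add: N_def h_def)
  have h: "0 \<le> h" using v by (simp add: h_def)
  \<comment> \<open>\<open>X\<close> enters only through sums of its first \<open>N - j\<close>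
    increments. In the original order such a sum is \<open>X (v - j h)\<close>, in the reversed
    order it is \<open>X v - X (j h)\<close>.\<close>
  define \<Phi> where "\<Phi> q = f (MIN j\<in>{..N}. snd q (real j * h) - a * (\<Sum>i<N - j. fst q i))" for q :: "(nat => real) \<times> (real => real)"
  have \<Phi>: "\<Phi> \<in> borel_measurable ((\<Pi>\<^sub>M i\<in>{..<N}. borel) \<Otimes>\<^sub>M (\<Pi>\<^sub>M t\<in>{0..}. borel))"
  proof -
    have [measurable]: "(\<lambda>q. fst q i) \<in> borel_measurable ((\<Pi>\<^sub>M i\<in>{..<N}. borel) \<Otimes>\<^sub>M (PiM {0..} (\<lambda>t. borel :: real measure)))" if "i < N" for i
      using that by (intro measurable_compose[OF measurable_fst] measurable_component_singleton) auto
    have [measurable]: "(\<lambda>q. snd q (real j * h)) \<in> borel_measurable ((PiM {..<N} (\<lambda>i. borel :: real measure)) \<Otimes>\<^sub>M (\<Pi>\<^sub>M t\<in>{0..}. borel))" for j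
      using h by (intro measurable_compose[OF measurable_snd] measurable_component_singleton) auto
    have "(\<lambda>q. MIN j\<in>{..N}. snd q (real j * h) - a * (\<Sum>i<N - j. fst q i)) \<in> borel_measurable ((\<Pi>\<^sub>M i\<in>{..<N}. borel) \<Otimes>\<^sub>M (\<Pi>\<^sub>M t\<in>{0..}. borel))"
      by (intro borel_measurable_Min borel_measurable_diff borel_measurable_times borel_measurable_sum) auto
    from measurable_compose[OF this f] show ?thesis by (simp add: \<Phi>_def[abs_def])
  qed
  have jh: "v * real j / 2 ^ k = real j * h" for j by (simp add: h_def N_def)
  have 1: "f (reversed_min k v w) = \<Phi> (\<lambda>i\<in>{..<N}. X.inc h i w, \<lambda>t\<in>{0..}. Y t w)" if w: "w \<in> space M" for w
  proof -
    have "Y (real j * h) w - a * X (v - real j * h) w = (\<lambda>t\<in>{0..}. Y t w) (real j * h) - a * (\<Sum>i<N - j. (\<lambda>i\<in>{..<N}. X.inc h i w) i)"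
      if "j \<le> N" for j
    proof -
      have "v - real j * h = real (N - j) * h" using that N by (simp add: of_nat_diff left_diff_distrib)
      moreover have "(\<Sum>i<N - j. (\<lambda>i\<in>{..<N}. X.inc h i w) i) = (\<Sum>i<N - j. X.inc h i w)"
        by (intro sum.cong) auto
      ultimately show ?thesis using X.sum_inc[OF w, of h "N - j"] h by simp
    qed
    then show ?thesis
      unfolding reversed_min_def grid_min_def \<Phi>_def jh N_def[symmetric] fst_conv snd_conv
      by (intro arg_cong[where f=f] arg_cong[where f=Min] image_cong) auto
  qed
  have 2: "f (ratio_approx k 0 0 v w) = \<Phi> (\<lambda>i\<in>{..<N}. X.inc h (N - Suc i) w, \<lambda>t\<in>{0..}. Y t w)" if w: "w \<in> space M" for w
  proof -
    have gm: "grid_min (\<lambda>v. g (0 + v) w - g 0 w) v k = (MIN j\<in>{..N}. g (real j * h) w)"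
      unfolding grid_min_def jh N_def[symmetric] using g_start[OF w, of 0] by simp
    moreover have "(MIN j\<in>{..N}. g (real j * h) w) \<le> g (real 0 * h) w"
      by (rule Min_le) (simp, rule imageI, simp)
    ultimately have "ratio_approx k 0 0 v w = (MIN j\<in>{..N}. g (real j * h) w) - a * X v w"
      unfolding ratio_approx_eq[OF order_refl] using g_start[OF w, of 0] X.start[OF w, of 0] by simp
    also have "\<dots> = (MIN x\<in>((\<lambda>j. g (real j * h) w) ` {..N}). x - a * X v w)"
      by (rule mono_Min_commute) (auto simp: mono_def)
    also have "\<dots> = (MIN j\<in>{..N}. g (real j * h) w - a * X v w)" by (simp add: image_image)
    also have "\<dots> = (MIN j\<in>{..N}. (\<lambda>t\<in>{0..}. Y t w) (real j * h) - a * (\<Sum>i<N - j. (\<lambda>i\<in>{..<N}. X.inc h (N - Suc i) w) i))"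
    proof (intro arg_cong[where f=Min] image_cong refl)
      fix j assume j: "j \<in> {..N}"
      have "(\<Sum>i<N - j. (\<lambda>i\<in>{..<N}. X.inc h (N - Suc i) w) i) = (\<Sum>i<N - j. X.inc h (N - Suc i) w)"
        by (intro sum.cong) auto
      also have "\<dots> = X v w - X (real j * h) w" using X.sum_inc_reversed[of "N - j" N h w] j N by simp
      finally have e: "(\<Sum>i<N - j. (\<lambda>i\<in>{..<N}. X.inc h (N - Suc i) w) i) = X v w - X (real j * h) w" .
      have "(\<lambda>t\<in>{0..}. Y t w) (real j * h) = Y (real j * h) w" using h by simp
      then show "g (real j * h) w - a * X v w = (\<lambda>t\<in>{0..}. Y t w) (real j * h) - a * (\<Sum>i<N - j. (\<lambda>i\<in>{..<N}. X.inc h (N - Suc i) w) i)"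
        unfolding e g_def by (simp only: right_diff_distrib)
    qed
    finally show ?thesis by (simp add: \<Phi>_def)
  qed
  have "(\<integral>\<^sup>+w. f (reversed_min k v w) \<partial>M) = (\<integral>\<^sup>+w. \<Phi> (\<lambda>i\<in>{..<N}. X.inc h i w, \<lambda>t\<in>{0..}. Y t w) \<partial>M)"
    by (intro nn_integral_cong 1)
  also have "\<dots> = (\<integral>\<^sup>+w. \<Phi> (\<lambda>i\<in>{..<N}. X.inc h (N - Suc i) w, \<lambda>t\<in>{0..}. Y t w) \<partial>M)"
    using increments_exchangeable[OF h \<Phi>, of "\<lambda>i. i"] increments_exchangeable[OF h \<Phi>, of "\<lambda>i. N - Suc i"] by simp
  also have "\<dots> = (\<integral>\<^sup>+w. f (ratio_approx k 0 0 v w) \<partial>M)"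
    by (intro nn_integral_cong 2[symmetric])
  finally show ?thesis .
qed


lemma SUP_min_of_nat: "(SUP L::nat. min (of_nat L) v) = (v :: ennreal)"
proof -
  have "(SUP L::nat. inf (of_nat L :: ennreal) v) = inf (SUP L::nat. of_nat L) v" by (rule SUP_inf[symmetric])
  then show ?thesis by (simp add: ennreal_SUP_of_nat_eq_top inf_min)
qed

lemma cut_eq_min: "cut L x = min (of_nat L) (ennreal (exp x))"
  by (simp add: cut_def ennreal_of_nat_eq_real_of_nat min_def ennreal_le_iff)

lemma reversed_min_measurable_at:
  assumes [measurable]: "\<eta> \<in> measurable N M" "v \<in> borel_measurable N"
  shows "(\<lambda>z. reversed_min k (v z) (\<eta> z)) \<in> borel_measurable N"
proof -
  have [measurable]: "(\<lambda>z. Y (v z * real j / 2 ^ k) (\<eta> z)) \<in> borel_measurable N"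
    "(\<lambda>z. X (v z - v z * real j / 2 ^ k) (\<eta> z)) \<in> borel_measurable N" for j
    by (rule X.meas_at Y.meas_at; measurable)+
  show ?thesis unfolding reversed_min_def grid_min_def
    by (intro borel_measurable_Min) auto
qed

text \<open>The infimum over the grids stands in for the infimum over the whole interval. The two
  are known to agree only for almost every \<open>v\<close>, with exceptions that depend on the
  path, so the exchange is postponed to the integral over \<open>v\<close>.\<close>

lemma reversed_inf_mean:
  assumes v: "0 \<le> v"
  shows "(\<integral>\<^sup>+w. (INF k. ennreal (exp (reversed_min k v w))) \<partial>M) = ratio_mean v 0"
proof -
  define R where "R w = (INF k. ennreal (exp (reversed_min k v w)))" for w
  have rm[measurable]: "(\<lambda>w. reversed_min k v w) \<in> borel_measurable M" for k
    by (rule reversed_min_measurable_at) auto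
  have [measurable]: "R \<in> borel_measurable M" unfolding R_def by measurable
  have dec: "decseq (\<lambda>k. ennreal (exp (reversed_min k v w)))" for w
    unfolding reversed_min_def using decseq_grid_min by (auto simp: decseq_def intro!: ennreal_leI)
  have eq: "(\<integral>\<^sup>+w. min (of_nat L) (R w) \<partial>M) = (\<integral>\<^sup>+w. cut L (ratio 0 0 v w) \<partial>M)" for L
  proof -
    have "(\<lambda>k. \<integral>\<^sup>+w. cut L (reversed_min k v w) \<partial>M) \<longlonglongrightarrow> (\<integral>\<^sup>+w. min (of_nat L) (R w) \<partial>M)"
    proof (rule nn_integral_dominated_convergence[where w="\<lambda>_. of_nat L"])
      show "(\<integral>\<^sup>+w. of_nat L \<partial>M) < \<infinity>" by (simp add: X.emeasure_space_1 ennreal_of_nat_eq_real_of_nat)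
      show "AE w in M. (\<lambda>k. cut L (reversed_min k v w)) \<longlonglongrightarrow> min (of_nat L) (R w)"
        unfolding cut_eq_min R_def by (intro AE_I2 tendsto_min tendsto_const LIMSEQ_INF dec)
    qed (auto intro: cut_le)
    moreover have "(\<lambda>k. \<integral>\<^sup>+w. cut L (reversed_min k v w) \<partial>M) \<longlonglongrightarrow> (\<integral>\<^sup>+w. cut L (ratio 0 0 v w) \<partial>M)"
      unfolding reversed_min_law[OF v cut_measurable] by (rule ratio_approx_mean_tendsto[OF order_refl v])
    ultimately show ?thesis by (rule LIMSEQ_unique)
  qed
  have "(\<integral>\<^sup>+w. R w \<partial>M) = (\<integral>\<^sup>+w. (SUP L::nat. min (of_nat L) (R w)) \<partial>M)"
    by (simp add: SUP_min_of_nat)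
  also have "\<dots> = (SUP L::nat. \<integral>\<^sup>+w. min (of_nat L) (R w) \<partial>M)"
  proof (rule nn_integral_monotone_convergence_SUP)
    show "incseq (\<lambda>L w. min (of_nat L) (R w))"
      by (intro incseq_SucI le_funI min.mono order_refl) (simp add: ennreal_of_nat_eq_real_of_nat)
  qed measurable
  also have "\<dots> = ratio_mean v 0"
    unfolding eq by (rule SUP_cut_mean[OF order_refl v])
  finally show ?thesis unfolding R_def .
qed

text \<open>Trouble can arise only where \<open>Y\<close> jumps at \<open>s\<close> while
  \<open>X\<close> jumps at \<open>v - s\<close>, that is, for \<open>v\<close> a sum of two jump
  times; such sums are countable.\<close>

lemma reversed_min_tendsto:
  assumes w: "w \<in> space M"
  shows "AE v in lborel. 0 \<le> v -->
    (\<lambda>k. reversed_min k v w) \<longlonglongrightarrow> running_inf (\<lambda>s. Y s w - a * X (v - s) w) v"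
proof -
  define JY where "JY = {t. 0 < t \<and> \<not> continuous (at_left t) (\<lambda>t. Y t w)}"
  define JX where "JX = {t. 0 < t \<and> \<not> continuous (at_left t) (\<lambda>t. - a * X t w)}"
  have cY: "cadlag (\<lambda>t. Y t w)" by (rule Y.cad[OF w])
  have cX: "cadlag (\<lambda>t. - a * X t w)"
    by (rule cadlag_compose[OF _ X.cad[OF w]]) (intro continuous_intros)
  have "countable ((\<lambda>(p, q). p + q) ` (JY \<times> JX))"
    unfolding JY_def JX_def by (intro countable_image countable_SIGMA cadlag_countable_jumps cY cX)
  then have "AE v in lborel. v \<notin> (\<lambda>(p, q). p + q) ` (JY \<times> JX)"
    by (intro AE_not_in countable_imp_null_set_lborel)
  then show ?thesis
  proof eventually_elim
    case (elim v)
    show ?case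
    proof
      assume v: "0 \<le> v"
      have "continuous (at_left s) (\<lambda>t. Y t w) \<or> continuous (at_left (v - s)) (\<lambda>t. - a * X t w)" if s: "0 < s" "s < v" for s
      proof (rule ccontr)
        assume "\<not> ?thesis"
        then have "(s, v - s) \<in> JY \<times> JX" using s by (simp add: JY_def JX_def)
        then have "(\<lambda>(p, q). p + q) (s, v - s) \<in> (\<lambda>(p, q). p + q) ` (JY \<times> JX)" by (rule imageI)
        then show False using elim by simp
      qed
      from cadlag_reversed_grid_min_tendsto(1)[OF cY cX v this]
      show "(\<lambda>k. reversed_min k v w) \<longlonglongrightarrow> running_inf (\<lambda>s. Y s w - a * X (v - s) w) v"
        unfolding reversed_min_def by simp
    qed
  qed
qed

text \<open>Reversing the time of the first process turns its increments after \<open>s\<close> into its values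
  at \<open>v - s\<close>.\<close>

theorem reversed_future_mean:
  "(\<integral>\<^sup>+w. (\<integral>\<^sup>+v\<in>{0..}. ennreal (exp (- r * v)) *
      ennreal (exp (running_inf (\<lambda>s. Y s w - a * X (v - s) w) v)) \<partial>lborel) \<partial>M) = future_mean 0"
proof -
  let ?J = "\<lambda>v w. running_inf (\<lambda>s. Y s w - a * X (v - s) w) v"
  have [measurable]: "(\<lambda>z. reversed_min k (snd z) (fst z)) \<in> borel_measurable MT" for k
    by (rule reversed_min_measurable_at) auto
  have "(\<integral>\<^sup>+w. (\<integral>\<^sup>+v\<in>{0..}. ennreal (exp (- r * v)) *
      ennreal (exp (?J v w)) \<partial>lborel) \<partial>M)
    = (\<integral>\<^sup>+w. (\<integral>\<^sup>+v\<in>{0..}. ennreal (exp (- r * v)) * (INF k. ennreal (exp (reversed_min k v w))) \<partial>lborel) \<partial>M)"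
  proof (rule nn_integral_cong, rule nn_integral_cong_AE)
    fix w assume w: "w \<in> space M"
    show "AE v in lborel. ennreal (exp (- r * v)) * ennreal (exp (?J v w)) * indicator {0..} v
      = ennreal (exp (- r * v)) * (INF k. ennreal (exp (reversed_min k v w))) * indicator {0..} v"
      using reversed_min_tendsto[OF w]
    proof eventually_elim
      case (elim v)
      show ?case
      proof (cases "0 \<le> v")
        case True
        with elim have "(\<lambda>k. ennreal (exp (reversed_min k v w))) \<longlonglongrightarrow> ennreal (exp (?J v w))"
          by (intro tendsto_intros) auto
        moreover have "(\<lambda>k. ennreal (exp (reversed_min k v w))) \<longlonglongrightarrow> (INF k. ennreal (exp (reversed_min k v w)))"
          unfolding reversed_min_def
          by (rule LIMSEQ_INF) (use decseq_grid_min in \<open>auto simp: decseq_def intro!: ennreal_leI\<close>)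
        ultimately have e: "ennreal (exp (?J v w)) = (INF k. ennreal (exp (reversed_min k v w)))"
          by (rule LIMSEQ_unique)
        show ?thesis unfolding e ..
      qed simp
    qed
  qed
  also have "\<dots> = (\<integral>\<^sup>+v. \<integral>\<^sup>+w. ennreal (exp (- r * v)) * (INF k. ennreal (exp (reversed_min k v w))) * indicator {0..} v \<partial>M \<partial>lborel)"
    by (rule M_time.Fubini'[symmetric]) (simp add: case_prod_beta)
  also have "\<dots> = future_mean 0"
    unfolding future_mean_def
  proof (rule nn_integral_cong)
    fix v :: real
    have [measurable]: "(\<lambda>w. reversed_min k v w) \<in> borel_measurable M" for k
      by (rule reversed_min_measurable_at) auto
    show "(\<integral>\<^sup>+w. ennreal (exp (- r * v)) * (INF k. ennreal (exp (reversed_min k v w))) * indicator {0..} v \<partial>M)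
       = ennreal (exp (- r * v)) * ratio_mean v 0 * indicator {0..} v"
    proof (cases "0 \<le> v")
      case True
      then show ?thesis using reversed_inf_mean[OF True] by (simp add: nn_integral_cmult)
    qed simp
  qed
  finally show ?thesis .
qed

end

section \<open>Exponential moments\<close>

context cadlag_levy
begin

definition moment :: "real => real => ennreal" where
  "moment c t = (\<integral>\<^sup>+w. ennreal (exp (c * Z t w)) \<partial>M)"

lemma moment_increment:
  assumes s: "0 \<le> s" and h: "0 \<le> h" and V: "V \<in> borel_measurable (F s)"
  shows "(\<integral>\<^sup>+w. V w * ennreal (exp (c * (Z (s + h) w - Z s w))) \<partial>M) = (\<integral>\<^sup>+w. V w \<partial>M) * moment c h"
proof -
  have "(\<integral>\<^sup>+w. V w * ennreal (exp (c * (0 + (Z (s + h) w - Z s w)))) \<partial>M)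
     = (\<integral>\<^sup>+w. V w * (\<integral>\<^sup>+z. ennreal (exp (c * (0 + z))) \<partial>distr M borel (Z h)) \<partial>M)"
    by (rule increment_nn_integral[OF s h V, of "\<lambda>_. 0" "\<lambda>x. ennreal (exp (c * x))"]) measurable
  also have "(\<integral>\<^sup>+z. ennreal (exp (c * (0 + z))) \<partial>distr M borel (Z h)) = moment c h"
    unfolding moment_def by (subst nn_integral_distr) simp_all
  also have "(\<integral>\<^sup>+w. V w * moment c h \<partial>M) = (\<integral>\<^sup>+w. V w \<partial>M) * moment c h"
    by (rule nn_integral_multc) (rule measurable_F_M[OF V s])
  finally show ?thesis by simp
qed

lemma moment_add:
  assumes s: "0 \<le> s" and h: "0 \<le> h"
  shows "moment c (s + h) = moment c s * moment c h"
proof -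
  note [measurable] = adap[OF s]
  have "moment c (s + h) = (\<integral>\<^sup>+w. ennreal (exp (c * Z s w)) * ennreal (exp (c * (Z (s + h) w - Z s w))) \<partial>M)"
    unfolding moment_def by (intro nn_integral_cong) (simp add: ennreal_mult[symmetric] exp_add[symmetric] algebra_simps)
  also have "\<dots> = moment c s * moment c h"
    unfolding moment_def[of c s] by (rule moment_increment[OF s h]) measurable
  finally show ?thesis .
qed

lemma moment_0: "moment c 0 = 1"
proof -
  have "moment c 0 = (\<integral>\<^sup>+w. 1 \<partial>M)" unfolding moment_def by (intro nn_integral_cong) (simp add: start)
  then show ?thesis by (simp add: emeasure_space_1)
qed

lemma moment_multiple: "0 \<le> h ==> moment c (real n * h) = moment c h ^ n"
proof (induction n)
  case (Suc n)
  then have "moment c (real n * h + h) = moment c (real n * h) * moment c h"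
    by (intro moment_add) auto
  with Suc show ?case by (simp add: algebra_simps)
qed (simp add: moment_0)

definition cumulant :: "real => real" where
  "cumulant c = ln (expectation (\<lambda>w. exp (c * Z 1 w)))"

lemma expectation_exp_pos:
  assumes i: "integrable M (\<lambda>w. exp (c * Z 1 w))"
  shows "0 < expectation (\<lambda>w. exp (c * Z 1 w))"
proof (rule ccontr)
  assume "\<not> ?thesis"
  then have "expectation (\<lambda>w. exp (c * Z 1 w)) = 0" by (simp add: order_antisym)
  then have "AE w in M. exp (c * Z 1 w) = 0"
    by (subst (asm) integral_nonneg_eq_0_iff_AE[OF i]) auto
  then show False by simp
qed

lemma moment_1:
  assumes i: "integrable M (\<lambda>w. exp (c * Z 1 w))"
  shows "moment c 1 = ennreal (exp (cumulant c))"
proof -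
  have "moment c 1 = ennreal (expectation (\<lambda>w. exp (c * Z 1 w)))"
    unfolding moment_def by (rule nn_integral_eq_integral[OF i]) simp
  then show ?thesis using expectation_exp_pos[OF i] by (simp add: cumulant_def)
qed

text \<open>Multiplicativity in time determines the moment at \<open>1 / N\<close> as an
  \<open>N\<close>-th root, hence at all positive multiples of such times. Fatou's lemma along the
  dyadic times above \<open>t\<close> then bounds the moment at \<open>t\<close> itself.\<close>

lemma moment_le:
  assumes i: "integrable M (\<lambda>w. exp (c * Z 1 w))" and t: "0 \<le> t"
  shows "moment c t \<le> ennreal (exp (t * cumulant c))"
proof -
  have root: "moment c (1 / real N) = ennreal (exp (cumulant c / real N))" if N: "0 < N" for N
  proof -
    have e: "moment c (1 / real N) ^ N = ennreal (exp (cumulant c))"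
      using moment_multiple[of "1 / real N" c N] moment_1[OF i] N by simp
    have "moment c (1 / real N) \<noteq> \<top>"
    proof
      assume "moment c (1 / real N) = \<top>"
      then show False using e N by (simp add: power_eq_top_ennreal_iff)
    qed
    then obtain x where x: "moment c (1 / real N) = ennreal x" "0 \<le> x"
      by (cases "moment c (1 / real N)") auto
    have "ennreal (x ^ N) = ennreal (exp (cumulant c))"
      using e unfolding x(1) ennreal_power[OF x(2)] .
    then have "x ^ N = exp (cumulant c)" using x(2) by (subst (asm) ennreal_inj) auto
    also have "\<dots> = exp (cumulant c / real N) ^ N" using N by (subst exp_of_nat_mult[symmetric]) simp
    finally have "x = exp (cumulant c / real N)"
      using x(2) N by (intro power_eq_imp_eq_base[of x N]) auto
    with x show ?thesis by simp
  qed
  have dy: "moment c (dyadic_above k t) = ennreal (exp (dyadic_above k t * cumulant c))" for k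
  proof -
    define N where "N = (2::nat) ^ k"
    define n where "n = nat (\<lfloor>2 ^ k * t\<rfloor> + 1)"
    have "0 \<le> \<lfloor>2 ^ k * t\<rfloor>" using t by simp
    then have n: "dyadic_above k t = real n * (1 / real N)" by (simp add: dyadic_above_def n_def N_def)
    have N: "0 < N" by (simp add: N_def)
    have "moment c (dyadic_above k t) = ennreal (exp (cumulant c / real N)) ^ n"
      unfolding n by (subst moment_multiple) (simp_all add: root[OF N])
    also have "\<dots> = ennreal (exp (real n * (cumulant c / real N)))"
      unfolding exp_of_nat_mult by (rule ennreal_power) simp
    also have "real n * (cumulant c / real N) = dyadic_above k t * cumulant c" by (simp add: n)
    finally show ?thesis .
  qed
  have "moment c t = (\<integral>\<^sup>+w. liminf (\<lambda>k. ennreal (exp (c * Z (dyadic_above k t) w))) \<partial>M)"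
    unfolding moment_def
  proof (rule nn_integral_cong)
    fix w assume w: "w \<in> space M"
    have "(\<lambda>k. ennreal (exp (c * Z (dyadic_above k t) w))) \<longlonglongrightarrow> ennreal (exp (c * Z t w))"
      by (intro tendsto_intros dyadic_above_tendsto_right_continuous right_cont[OF w]) auto
    then show "ennreal (exp (c * Z t w)) = liminf (\<lambda>k. ennreal (exp (c * Z (dyadic_above k t) w)))"
      by (rule lim_imp_Liminf[OF sequentially_bot, symmetric])
  qed
  also have "\<dots> \<le> liminf (\<lambda>k. moment c (dyadic_above k t))"
    unfolding moment_def by (rule nn_integral_liminf) measurable
  also have "\<dots> = ennreal (exp (t * cumulant c))"
  proof -
    have "filterlim (\<lambda>k. dyadic_above k t) (nhds t) sequentially"
      by (rule filterlim_mono[OF dyadic_above_tendsto]) (auto simp: at_within_def inf.coboundedI1)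
    then have "(\<lambda>k. ennreal (exp (dyadic_above k t * cumulant c))) \<longlonglongrightarrow> ennreal (exp (t * cumulant c))"
      by (intro tendsto_intros) auto
    then show ?thesis unfolding dy by (rule lim_imp_Liminf[OF sequentially_bot])
  qed
  finally show ?thesis .
qed

section \<open>A maximal inequality\<close>

text \<open>Ville's inequality for a supermartingale sampled at finitely many times: the mass that has
  crossed the level and the remaining mass are bounded together by induction.\<close>

lemma ville_discrete:
  fixes m :: "nat => 'a => ennreal" and l :: ennreal
  assumes m: "\<And>j. m j \<in> borel_measurable M" and m0: "(\<integral>\<^sup>+w. m 0 w \<partial>M) \<le> 1"
    and super: "\<And>j. (\<integral>\<^sup>+w. m (Suc j) w * indicator {w. \<forall>i\<le>j. m i w \<le> l} w \<partial>M)
        \<le> (\<integral>\<^sup>+w. m j w * indicator {w. \<forall>i\<le>j. m i w \<le> l} w \<partial>M)"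
  shows "l * emeasure M {w\<in>space M. \<exists>i\<le>N. l < m i w} \<le> 1"
proof -
  note [measurable] = m
  have "l * emeasure M {w\<in>space M. \<exists>i\<le>j. l < m i w} + (\<integral>\<^sup>+w. m j w * indicator {w. \<forall>i\<le>j. m i w \<le> l} w \<partial>M) \<le> 1" for j
  proof (induction j)
    case 0
    have "l * emeasure M {w\<in>space M. \<exists>i\<le>0. l < m i w} = (\<integral>\<^sup>+w. l * indicator {w\<in>space M. l < m 0 w} w \<partial>M)"
      by (subst nn_integral_cmult_indicator) auto
    also have "\<dots> + (\<integral>\<^sup>+w. m 0 w * indicator {w. \<forall>i\<le>0. m i w \<le> l} w \<partial>M)
       = (\<integral>\<^sup>+w. l * indicator {w\<in>space M. l < m 0 w} w + m 0 w * indicator {w\<in>space M. m 0 w \<le> l} w \<partial>M)"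
      by (subst nn_integral_add) (auto intro!: arg_cong2[where f="(+)"] nn_integral_cong split: split_indicator)
    also have "\<dots> \<le> (\<integral>\<^sup>+w. m 0 w \<partial>M)"
      by (intro nn_integral_mono) (auto split: split_indicator)
    finally show ?case using m0 by (rule order_trans)
  next
    case (Suc j)
    define A where "A = {w\<in>space M. \<exists>i\<le>j. l < m i w}"
    define B where "B = {w\<in>space M. \<forall>i\<le>j. m i w \<le> l}"
    have AB: "A \<in> sets M" "B \<in> sets M" unfolding A_def B_def by measurable
    \<comment> \<open>The event of a first crossing at step \<open>Suc j\<close>; on it
      \<open>m (Suc j)\<close> pays for the level \<open>l\<close>.\<close>
    define D where "D = {w\<in>space M. l < m (Suc j) w} \<inter> B"
    have D: "D \<in> sets M" unfolding D_def using AB by auto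
    have "{w\<in>space M. \<exists>i\<le>Suc j. l < m i w} = A \<union> D"
      by (auto simp: A_def B_def D_def le_Suc_eq not_le[symmetric])
    moreover have "A \<inter> D = {}" by (auto simp: A_def B_def D_def)
    ultimately have "emeasure M {w\<in>space M. \<exists>i\<le>Suc j. l < m i w} = emeasure M A + emeasure M D"
      using AB D by (simp add: plus_emeasure)
    moreover have "l * emeasure M D + (\<integral>\<^sup>+w. m (Suc j) w * indicator {w. \<forall>i\<le>Suc j. m i w \<le> l} w \<partial>M)
       \<le> (\<integral>\<^sup>+w. m (Suc j) w * indicator B w \<partial>M)"
    proof -
      have "l * emeasure M D + (\<integral>\<^sup>+w. m (Suc j) w * indicator {w. \<forall>i\<le>Suc j. m i w \<le> l} w \<partial>M)
        = (\<integral>\<^sup>+w. l * indicator D w \<partial>M) + (\<integral>\<^sup>+w. m (Suc j) w * indicator {w\<in>space M. \<forall>i\<le>Suc j. m i w \<le> l} w \<partial>M)"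
        using D by (intro arg_cong2[where f="(+)"] nn_integral_cong) (auto simp: nn_integral_cmult_indicator split: split_indicator)
      also have "\<dots> = (\<integral>\<^sup>+w. l * indicator D w + m (Suc j) w * indicator {w\<in>space M. \<forall>i\<le>Suc j. m i w \<le> l} w \<partial>M)"
        using D by (intro nn_integral_add[symmetric]) auto
      also have "\<dots> \<le> (\<integral>\<^sup>+w. m (Suc j) w * indicator B w \<partial>M)"
        by (intro nn_integral_mono) (auto simp: D_def B_def split: split_indicator)
      finally show ?thesis .
    qed
    moreover have "(\<integral>\<^sup>+w. m i w * indicator B w \<partial>M) = (\<integral>\<^sup>+w. m i w * indicator {w. \<forall>i\<le>j. m i w \<le> l} w \<partial>M)" for i
      by (intro nn_integral_cong) (auto simp: B_def split: split_indicator)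
    moreover note super[of j] Suc.IH
    ultimately show ?case
      unfolding A_def[symmetric] by (simp add: distrib_left add.assoc) (meson add_left_mono order_trans)
  qed
  from this[of N] show ?thesis by (meson add_increasing2 le_iff_add order_trans zero_le)
qed

text \<open>As \<open>\<rho>\<close> dominates the cumulant,
  \<open>exp (c * Z t w - \<rho> * t)\<close> is a supermartingale, and the infimum is below
  \<open>- x\<close> if and only if this process exceeds \<open>exp x\<close> somewhere. Ville's
  inequality holds on each grid, and the grid events increase to the event in question.\<close>

lemma crossing_probability:
  assumes i: "integrable M (\<lambda>w. exp (c * Z 1 w))" and \<rho>: "cumulant c \<le> \<rho>" and u: "0 \<le> u"
  shows "emeasure M {w\<in>space M. running_inf (\<lambda>s. \<rho> * s - c * Z s w) u < - x} \<le> ennreal (exp (- x))"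
proof -
  let ?f = "\<lambda>w s. \<rho> * s - c * Z s w"
  have cf: "cadlag (?f w)" if "w \<in> space M" for w
    by (rule cadlag_compose2[OF _ cadlag_ident cad[OF that], of "\<lambda>s z. \<rho> * s - c * z"])
      (auto simp: case_prod_beta intro!: continuous_intros)
  have grid: "emeasure M {w\<in>space M. grid_min (?f w) u k < - x} \<le> ennreal (exp (- x))" for k
  proof -
    define h where "h = u / 2 ^ k"
    have h: "0 \<le> h" using u by (simp add: h_def)
    define m where "m j w = ennreal (exp (- ?f w (real j * h)))" for j w
    define l where "l = ennreal (exp x)"
    have mm: "m j \<in> borel_measurable M" for j unfolding m_def by measurable
    have ad: "m i \<in> borel_measurable (F (real j * h))" if "i \<le> j" for i j
    proof -
      have "real i * h \<le> real j * h" "0 \<le> real j * h" using that h by (auto intro: mult_right_mono)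
      note [measurable] = adap_le[OF this]
      show ?thesis unfolding m_def by measurable
    qed
    have "l * emeasure M {w\<in>space M. \<exists>i\<le>2 ^ k. l < m i w} \<le> 1"
    proof (rule ville_discrete[OF mm])
      have "(\<integral>\<^sup>+w. m 0 w \<partial>M) = (\<integral>\<^sup>+w. 1 \<partial>M)" unfolding m_def by (intro nn_integral_cong) (simp add: start)
      then show "(\<integral>\<^sup>+w. m 0 w \<partial>M) \<le> 1" by (simp add: emeasure_space_1)
      fix j
      let ?t = "real j * h"
      have t: "0 \<le> ?t" using h by simp
      define S where "S = (\<Inter>i\<in>{..j}. {w\<in>space (F ?t). m i w \<le> l})"
      have S: "S \<in> sets (F ?t)"
        unfolding S_def
      proof (rule sets.finite_INT)
        fix i assume "i \<in> {..j}"
        then have [measurable]: "m i \<in> borel_measurable (F ?t)" by (intro ad) simp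
        show "{w\<in>space (F ?t). m i w \<le> l} \<in> sets (F ?t)" by measurable
      qed auto
      have Si: "indicator {w. \<forall>i\<le>j. m i w \<le> l} w = (indicator S w :: ennreal)" if "w \<in> space M" for w
        using that by (auto simp: S_def space_F[OF t] split: split_indicator)
      define V where "V w = m j w * indicator S w" for w
      have V: "V \<in> borel_measurable (F ?t)"
        unfolding V_def using S ad[OF order_refl] by (intro borel_measurable_times_ennreal borel_measurable_indicator)
      have step: "m (Suc j) w = ennreal (exp (- \<rho> * h)) * (m j w * ennreal (exp (c * (Z (?t + h) w - Z ?t w))))" for w
        unfolding m_def by (simp add: ennreal_mult[symmetric] exp_add[symmetric] algebra_simps)
      have "(\<integral>\<^sup>+w. m (Suc j) w * indicator {w. \<forall>i\<le>j. m i w \<le> l} w \<partial>M)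
         = (\<integral>\<^sup>+w. ennreal (exp (- \<rho> * h)) * (V w * ennreal (exp (c * (Z (?t + h) w - Z ?t w)))) \<partial>M)"
        by (intro nn_integral_cong) (simp add: V_def step Si mult_ac)
      also have "\<dots> = ennreal (exp (- \<rho> * h)) * (\<integral>\<^sup>+w. V w * ennreal (exp (c * (Z (?t + h) w - Z ?t w))) \<partial>M)"
        by (intro nn_integral_cmult borel_measurable_times_ennreal[OF measurable_F_M[OF V t]]) measurable
      also have "\<dots> = ennreal (exp (- \<rho> * h)) * ((\<integral>\<^sup>+w. V w \<partial>M) * moment c h)"
        by (simp only: moment_increment[OF t h V])
      also have "\<dots> \<le> ennreal (exp (- \<rho> * h)) * ((\<integral>\<^sup>+w. V w \<partial>M) * ennreal (exp (h * cumulant c)))"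
        by (intro mult_left_mono moment_le[OF i h]) auto
      also have "\<dots> = ennreal (exp (- \<rho> * h) * exp (h * cumulant c)) * (\<integral>\<^sup>+w. V w \<partial>M)"
        by (simp add: ennreal_mult mult_ac)
      also have "\<dots> \<le> ennreal 1 * (\<integral>\<^sup>+w. V w \<partial>M)"
      proof (intro mult_right_mono ennreal_leI)
        have "- \<rho> * h + h * cumulant c \<le> 0" using mult_left_mono[OF \<rho> h] by (simp add: mult.commute)
        then show "exp (- \<rho> * h) * exp (h * cumulant c) \<le> 1" unfolding exp_add[symmetric] by simp
      qed simp
      also have "\<dots> = (\<integral>\<^sup>+w. m j w * indicator {w. \<forall>i\<le>j. m i w \<le> l} w \<partial>M)"
        by (simp add: V_def Si cong: nn_integral_cong)
      finally show "(\<integral>\<^sup>+w. m (Suc j) w * indicator {w. \<forall>i\<le>j. m i w \<le> l} w \<partial>M)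
          \<le> (\<integral>\<^sup>+w. m j w * indicator {w. \<forall>i\<le>j. m i w \<le> l} w \<partial>M)" .
    qed
    moreover have "{w\<in>space M. grid_min (?f w) u k < - x} \<subseteq> {w\<in>space M. \<exists>i\<le>2 ^ k. l < m i w}"
    proof
      fix w assume w: "w \<in> {w\<in>space M. grid_min (?f w) u k < - x}"
      obtain j where j: "j \<le> 2 ^ k" "grid_min (?f w) u k = ?f w (u * real j / 2 ^ k)"
        using grid_min_attained by blast
      have "u * real j / 2 ^ k = real j * h" by (simp add: h_def)
      with j w have "x < - ?f w (real j * h)" by simp
      then have "l < m j w" unfolding l_def m_def by (intro ennreal_lessI) auto
      with j w show "w \<in> {w\<in>space M. \<exists>i\<le>2 ^ k. l < m i w}" by auto
    qed
    moreover have "{w\<in>space M. \<exists>i\<le>2 ^ k. l < m i w} \<in> sets M"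
    proof -
      have "{w\<in>space M. \<exists>i\<le>2 ^ k. l < m i w} = (\<Union>i\<in>{..2 ^ k}. {w\<in>space M. l < m i w})" by auto
      also have "\<dots> \<in> sets M" using mm by (intro sets.finite_UN) auto
      finally show ?thesis .
    qed
    ultimately have le: "l * emeasure M {w\<in>space M. grid_min (?f w) u k < - x} \<le> 1"
      by (meson emeasure_mono mult_left_mono order_trans zero_le)
    have "ennreal (exp (- x)) * l = ennreal (exp (- x) * exp x)"
      unfolding l_def by (rule ennreal_mult[symmetric]) auto
    also have "exp (- x) * exp x = 1" by (simp add: exp_minus)
    finally have el: "ennreal (exp (- x)) * l = 1" by simp
    have "emeasure M {w\<in>space M. grid_min (?f w) u k < - x}
       = ennreal (exp (- x)) * (l * emeasure M {w\<in>space M. grid_min (?f w) u k < - x})"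
      unfolding mult.assoc[symmetric] el by simp
    also have "\<dots> \<le> ennreal (exp (- x)) * 1" by (rule mult_left_mono[OF le]) simp
    finally show ?thesis by simp
  qed
  have gm: "(\<lambda>w. grid_min (?f w) u k) \<in> borel_measurable M" for k
    unfolding grid_min_def by (intro borel_measurable_Min) auto
  have "{w\<in>space M. running_inf (?f w) u < - x} = (\<Union>k. {w\<in>space M. grid_min (?f w) u k < - x})"
  proof (intro set_eqI iffI)
    fix w assume w: "w \<in> {w\<in>space M. running_inf (?f w) u < - x}"
    then have "\<forall>\<^sub>F k in sequentially. grid_min (?f w) u k < - x"
      by (intro order_tendstoD(2)[OF cadlag_grid_min_tendsto[OF cf u]]) auto
    then obtain k where "grid_min (?f w) u k < - x" using eventually_happens'[OF sequentially_bot] by blast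
    with w show "w \<in> (\<Union>k. {w\<in>space M. grid_min (?f w) u k < - x})" by auto
  next
    fix w assume "w \<in> (\<Union>k. {w\<in>space M. grid_min (?f w) u k < - x})"
    then obtain k where k: "w \<in> space M" "grid_min (?f w) u k < - x" by auto
    then show "w \<in> {w\<in>space M. running_inf (?f w) u < - x}"
      using running_inf_le_grid_min[OF u cadlag_bdd_below[OF cf[OF k(1)]], of k] by auto
  qed
  also have "emeasure M \<dots> = (SUP k. emeasure M {w\<in>space M. grid_min (?f w) u k < - x})"
  proof (rule SUP_emeasure_incseq[symmetric])
    show "range (\<lambda>k. {w\<in>space M. grid_min (?f w) u k < - x}) \<subseteq> sets M" using gm by auto
    show "incseq (\<lambda>k. {w\<in>space M. grid_min (?f w) u k < - x})"
      unfolding incseq_def using decseqD[OF decseq_grid_min] by (blast intro: le_less_trans)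
  qed
  also have "\<dots> \<le> ennreal (exp (- x))" by (intro SUP_least grid)
  finally show ?thesis .
qed


text \<open>On the slice where \<open>- I w\<close> lies between \<open>n\<close> and
  \<open>n + 1\<close> the integrand is at most \<open>exp ((n + 1) / p)\<close>, while the slice
  has probability at most \<open>exp (- n)\<close>. The sum is a geometric series that converges
  because \<open>1 < p\<close>; the bound does not depend on \<open>u\<close>.\<close>

lemma exp_sup_moment:
  assumes i: "integrable M (\<lambda>w. exp (c * Z 1 w))" and \<rho>: "cumulant c \<le> \<rho>" and u: "0 \<le> u" and p: "1 < p"
  shows "(\<integral>\<^sup>+w. ennreal (exp (- running_inf (\<lambda>s. \<rho> * s - c * Z s w) u / p)) \<partial>M)
     \<le> 1 + (\<Sum>n. ennreal (exp ((real n + 1) / p - real n)))"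
proof -
  define I where "I w = running_inf (\<lambda>s. \<rho> * s - c * Z s w) u" for w
  have cf: "cadlag (\<lambda>s. \<rho> * s - c * Z s w)" if "w \<in> space M" for w
    by (rule cadlag_compose2[OF _ cadlag_ident cad[OF that], of "\<lambda>s z. \<rho> * s - c * z"])
      (auto simp: case_prod_beta intro!: continuous_intros)
  have [measurable]: "I \<in> borel_measurable M"
  proof (rule borel_measurable_LIMSEQ_real)
    show "(\<lambda>k. grid_min (\<lambda>s. \<rho> * s - c * Z s w) u k) \<longlonglongrightarrow> I w" if "w \<in> space M" for w
      unfolding I_def by (rule cadlag_grid_min_tendsto[OF cf[OF that] u])
    show "(\<lambda>w. grid_min (\<lambda>s. \<rho> * s - c * Z s w) u k) \<in> borel_measurable M" for k
      unfolding grid_min_def by (intro borel_measurable_Min) auto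
  qed
  define A where "A n = {w\<in>space M. I w < - real n}" for n
  have [measurable]: "A n \<in> sets M" for n unfolding A_def by measurable
  have "(\<integral>\<^sup>+w. ennreal (exp (- I w / p)) \<partial>M) \<le> (\<integral>\<^sup>+w. 1 + (\<Sum>n. ennreal (exp ((real n + 1) / p)) * indicator (A n) w) \<partial>M)"
  proof (rule nn_integral_mono)
    fix w assume w: "w \<in> space M"
    show "ennreal (exp (- I w / p)) \<le> 1 + (\<Sum>n. ennreal (exp ((real n + 1) / p)) * indicator (A n) w)"
    proof (cases "I w < 0")
      case False
      then have "ennreal (exp (- I w / p)) \<le> ennreal 1" using p by (intro ennreal_leI) simp
      then show ?thesis by (simp add: add_increasing2)
    next
      case True
      \<comment> \<open>The largest integer strictly below \<open>- I w\<close>.\<close>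
      define n where "n = nat (\<lceil>- I w\<rceil> - 1)"
      have "1 \<le> \<lceil>- I w\<rceil>" using True by simp
      then have n: "real n = real_of_int \<lceil>- I w\<rceil> - 1" by (simp add: n_def)
      then have "real n < - I w" "- I w \<le> real n + 1" by linarith+
      moreover from this(2) have "- I w / p \<le> (real n + 1) / p" by (rule divide_right_mono) (use p in simp)
      ultimately have "w \<in> A n" "- I w / p \<le> (real n + 1) / p" using w by (simp_all add: A_def)
      then have "ennreal (exp (- I w / p)) \<le> ennreal (exp ((real n + 1) / p)) * indicator (A n) w"
        by (simp add: ennreal_leI)
      also have "\<dots> \<le> (\<Sum>n. ennreal (exp ((real n + 1) / p)) * indicator (A n) w)"
      proof -
        define f where "f n = ennreal (exp ((real n + 1) / p)) * indicator (A n) w" for n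
        have "sum f {n} \<le> suminf f" by (rule sum_le_suminf) (auto intro: summableI)
        then show ?thesis by (simp add: f_def[symmetric])
      qed
      finally have le: "ennreal (exp (- I w / p)) \<le> (\<Sum>n. ennreal (exp ((real n + 1) / p)) * indicator (A n) w)" .
      show ?thesis using add_mono[OF zero_le[of 1] le] by simp
    qed
  qed
  also have "\<dots> = 1 + (\<Sum>n. ennreal (exp ((real n + 1) / p)) * emeasure M (A n))"
    by (subst nn_integral_add) (auto simp: emeasure_space_1 nn_integral_suminf nn_integral_cmult_indicator)
  also have "\<dots> \<le> 1 + (\<Sum>n. ennreal (exp ((real n + 1) / p - real n)))"
  proof (intro add_left_mono suminf_le summableI)
    fix n
    have "emeasure M (A n) \<le> ennreal (exp (- real n))"
      using crossing_probability[OF i \<rho> u, of "real n"] by (simp add: A_def I_def)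
    then have "ennreal (exp ((real n + 1) / p)) * emeasure M (A n) \<le> ennreal (exp ((real n + 1) / p)) * ennreal (exp (- real n))"
      by (intro mult_left_mono) auto
    also have "\<dots> = ennreal (exp ((real n + 1) / p - real n))"
      by (simp add: ennreal_mult[symmetric] exp_add[symmetric])
    finally show "ennreal (exp ((real n + 1) / p)) * emeasure M (A n) \<le> ennreal (exp ((real n + 1) / p - real n))" .
  qed
  finally show ?thesis unfolding I_def .
qed

end

lemma geometric_bound_finite:
  assumes p: "1 < p"
  shows "(\<Sum>n. ennreal (exp ((real n + 1) / p - real n))) < \<infinity>"
proof -
  have e: "exp ((real n + 1) / p - real n) = exp (1 / p) * exp (1 / p - 1) ^ n" for n
    by (subst exp_of_nat_mult[symmetric]) (simp add: exp_add[symmetric] algebra_simps add_divide_distrib)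
  have "summable (\<lambda>n. exp (1 / p) * exp (1 / p - 1) ^ n)"
    using p by (intro summable_mult summable_geometric) simp
  then show ?thesis unfolding e by (subst suminf_ennreal2) auto
qed

lemma nn_integral_exp_decay:
  assumes s: "0 < (s::real)"
  shows "(\<integral>\<^sup>+t\<in>{0..}. ennreal (exp (- s * t)) \<partial>lborel) = ennreal (1 / s)"
proof -
  have "(\<integral>\<^sup>+t\<in>{0..}. ennreal (exp (- s * t)) \<partial>lborel) = ennreal (0 - (- exp (- s * 0) / s))"
  proof (rule nn_integral_FTC_atLeast)
    show "((\<lambda>x. - exp (- s * x) / s) \<longlongrightarrow> 0) at_top"
      using s by real_asymp
    show "((\<lambda>x. - exp (- s * x) / s) has_real_derivative exp (- s * x)) (at x)" for x
      using s by (auto intro!: derivative_eq_intros)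
  qed auto
  then show ?thesis by simp
qed

section \<open>Moments of the running infimum and finiteness of the integrals\<close>

context levy_market
begin

text \<open>A linear image of the pair; what matters is that the joint increment is independent of
  the past.\<close>

lemma g_levy: "cadlag_levy M F g"
proof
  fix s h :: real assume s: "0 \<le> s" and h: "0 \<le> h"
  let ?D = "\<lambda>w. (X (s + h) w - X s w, Y (s + h) w - Y s w)"
  let ?l = "\<lambda>p :: real \<times> real. snd p + a * fst p"
  have l: "?l \<in> borel_measurable borel" by measurable
  have gd: "g (s + h) w - g s w = ?l (?D w)" for w by (simp add: g_def algebra_simps)
  have gm[measurable]: "g t \<in> borel_measurable M" for t unfolding g_def by measurable
  have sub: "{(\<lambda>w. g (s + h) w - g s w) -` B \<inter> space M |B. B \<in> sets borel} \<subseteq> {?D -` B \<inter> space M |B. B \<in> sets borel}"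
  proof clarify
    fix B :: "real set" assume "B \<in> sets borel"
    then have "?l -` B \<in> sets borel" using measurable_sets[OF l] by simp
    moreover have "(\<lambda>w. g (s + h) w - g s w) -` B \<inter> space M = ?D -` (?l -` B) \<inter> space M" unfolding gd by auto
    ultimately show "\<exists>B'. (\<lambda>w. g (s + h) w - g s w) -` B \<inter> space M = ?D -` B' \<inter> space M \<and> B' \<in> sets borel" by blast
  qed
  show "X.indep_set (sets (F s)) {(\<lambda>w. g (s + h) w - g s w) -` B \<inter> space M |B. B \<in> sets borel}"
  proof -
    note j = joint_increment_indep[OF s h, unfolded X.indep_sets2_eq]
    show ?thesis
      unfolding X.indep_sets2_eq
    proof (intro conjI ballI)
      show "sets (F s) \<subseteq> X.events" by (rule conjunct1[OF j])
      show "{(\<lambda>w. g (s + h) w - g s w) -` B \<inter> space M |B. B \<in> sets borel} \<subseteq> X.events"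
        by (rule subset_trans[OF sub conjunct1[OF conjunct2[OF j]]])
      fix A B assume "A \<in> sets (F s)" "B \<in> {(\<lambda>w. g (s + h) w - g s w) -` B \<inter> space M |B. B \<in> sets borel}"
      then show "X.prob (A \<inter> B) = X.prob A * X.prob B"
        by (intro conjunct2[OF conjunct2[OF j], rule_format] subsetD[OF sub])
    qed
  qed
  have "distr M borel (\<lambda>w. g (s + h) w - g s w) = distr (distr M borel ?D) borel ?l"
    unfolding gd by (subst distr_distr[OF l]) (auto simp: comp_def)
  also have "\<dots> = distr (distr M borel (\<lambda>w. (X h w, Y h w))) borel ?l"
    unfolding joint_increment_distr[OF s h] ..
  also have "\<dots> = distr M borel (g h)"
    by (subst distr_distr[OF l]) (auto simp: comp_def g_def[abs_def])
  finally show "distr M borel (\<lambda>w. g (s + h) w - g s w) = distr M borel (g h)" .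
qed (auto intro: X.subalg X.filtration[THEN subsetD] g_adap g_cadlag g_start)

sublocale G: cadlag_levy M F g by (rule g_levy)

text \<open>The maximal inequality controls a moment only after division of the exponent by some
  \<open>p > 1\<close>, so it is applied with exponent and rate both multiplied by \<open>p\<close>.
  The cumulant is continuous along \<open>p k\<close>, which tends to 1, and the strict inequality
  for \<open>\<rho>\<close> leaves room for some \<open>p k\<close> with the cumulant at most
  \<open>p k * \<rho>\<close>.\<close>

lemma low_moment:
  assumes i: "\<And>c. integrable M (\<lambda>w. exp (c * g 1 w))" and q: "0 < q"
    and \<rho>: "G.cumulant (- 2 * q) < \<rho>" "0 \<le> \<rho>"
  shows "\<exists>K<\<infinity>. \<forall>u\<ge>0. (\<integral>\<^sup>+w. ennreal (exp (- 2 * q * low u w)) \<partial>M) \<le> ennreal (exp (\<rho> * u)) * K"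
proof -
  define p where "p k = 1 + 1 / real (Suc k)" for k
  have p: "1 < p k" "p k \<le> 2" for k by (auto simp: p_def)
  have pl: "p \<longlonglongrightarrow> 1 + 0"
    unfolding p_def[abs_def] by (intro tendsto_intros) (use LIMSEQ_inverse_real_of_nat in \<open>simp add: inverse_eq_divide\<close>)
  have pos: "0 < X.expectation (\<lambda>w. exp (- 2 * q * g 1 w))"
    by (rule G.expectation_exp_pos[OF i])
  have "(\<lambda>k. X.expectation (\<lambda>w. exp (- 2 * q * p k * g 1 w))) \<longlonglongrightarrow> X.expectation (\<lambda>w. exp (- 2 * q * g 1 w))"
  proof (rule integral_dominated_convergence[where w="\<lambda>w. 1 + exp (- 4 * q * g 1 w)"])
    show "integrable M (\<lambda>w. 1 + exp (- 4 * q * g 1 w))"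
      by (rule Bochner_Integration.integrable_add[OF X.integrable_const i])
    show "AE w in M. (\<lambda>k. exp (- 2 * q * p k * g 1 w)) \<longlonglongrightarrow> exp (- 2 * q * g 1 w)"
    proof (rule AE_I2)
      fix w
      have "(\<lambda>k. exp (- 2 * q * p k * g 1 w)) \<longlonglongrightarrow> exp (- 2 * q * (1 + 0) * g 1 w)"
        by (intro tendsto_intros pl)
      then show "(\<lambda>k. exp (- 2 * q * p k * g 1 w)) \<longlonglongrightarrow> exp (- 2 * q * g 1 w)" by simp
    qed
    show "AE w in M. norm (exp (- 2 * q * p k * g 1 w)) \<le> 1 + exp (- 4 * q * g 1 w)" for k
    proof (rule AE_I2)
      fix w
      show "norm (exp (- 2 * q * p k * g 1 w)) \<le> 1 + exp (- 4 * q * g 1 w)"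
      proof (cases "0 \<le> g 1 w")
        case True
        then have "0 \<le> 2 * q * p k * g 1 w" using q p[of k] by simp
        then have "exp (- 2 * q * p k * g 1 w) \<le> 1" by simp
        then show ?thesis by (simp add: add_increasing2)
      next
        case False
        then have "(2 * q * - g 1 w) * p k \<le> (2 * q * - g 1 w) * 2"
          using q p[of k] by (intro mult_left_mono) (auto intro: mult_nonneg_nonpos)
        moreover have "- 2 * q * p k * g 1 w = (2 * q * - g 1 w) * p k" "- 4 * q * g 1 w = (2 * q * - g 1 w) * 2"
          by (simp_all add: mult_ac)
        ultimately have "exp (- 2 * q * p k * g 1 w) \<le> exp (- 4 * q * g 1 w)" unfolding exp_le_cancel_iff by linarith
        then show ?thesis unfolding real_norm_def abs_exp_cancel by linarith
      qed
    qed
  qed auto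
  from tendsto_diff[OF tendsto_ln[OF this less_imp_neq[OF pos, symmetric]] tendsto_mult_right[OF pl, of \<rho>]]
  have "(\<lambda>k. G.cumulant (- 2 * q * p k) - p k * \<rho>) \<longlonglongrightarrow> G.cumulant (- 2 * q) - \<rho>"
    unfolding G.cumulant_def add_0_right mult_1_left .
  then have "\<forall>\<^sub>F k in sequentially. G.cumulant (- 2 * q * p k) - p k * \<rho> < 0"
    by (rule order_tendstoD(2)) (use \<rho> in simp)
  from eventually_happens'[OF sequentially_bot this]
  obtain k where "G.cumulant (- 2 * q * p k) - p k * \<rho> < 0" by blast
  then have k: "G.cumulant (- 2 * q * p k) \<le> p k * \<rho>" by linarith
  define K where "K = 1 + (\<Sum>n. ennreal (exp ((real n + 1) / p k - real n)))"
  have fin: "x < \<infinity> ==> 1 + x < \<infinity>" for x :: ennreal by simp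
  have "K < \<infinity>" unfolding K_def by (rule fin[OF geometric_bound_finite[OF p(1)]])
  moreover have "(\<integral>\<^sup>+w. ennreal (exp (- 2 * q * low u w)) \<partial>M) \<le> ennreal (exp (\<rho> * u)) * K" if u: "0 \<le> u" for u
  proof -
    \<comment> \<open>The linear term is largest at the end of \<open>{0..u}\<close>. Hence
      \<open>2 * q * low u w\<close> is at least \<open>?I w / p k - \<rho> * u\<close>, which
      produces the factor \<open>exp (\<rho> * u)\<close>.\<close>
    let ?I = "\<lambda>w. running_inf (\<lambda>s. p k * \<rho> * s - - 2 * q * p k * g s w) u"
    have Im: "?I \<in> borel_measurable M"
    proof (rule borel_measurable_LIMSEQ_real)
      show "(\<lambda>j. grid_min (\<lambda>s. p k * \<rho> * s - - 2 * q * p k * g s w) u j) \<longlonglongrightarrow> ?I w" if "w \<in> space M" for w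
        by (rule cadlag_grid_min_tendsto[OF cadlag_compose2[OF _ cadlag_ident g_cadlag[OF that], of "\<lambda>s z. p k * \<rho> * s - - 2 * q * p k * z"] u])
          (auto simp: case_prod_beta intro!: continuous_intros)
      show "(\<lambda>w. grid_min (\<lambda>s. p k * \<rho> * s - - 2 * q * p k * g s w) u j) \<in> borel_measurable M" for j
        unfolding grid_min_def by (intro borel_measurable_Min) auto
    qed
    have "(\<integral>\<^sup>+w. ennreal (exp (- 2 * q * low u w)) \<partial>M) \<le> (\<integral>\<^sup>+w. ennreal (exp (\<rho> * u)) * ennreal (exp (- ?I w / p k)) \<partial>M)"
    proof (rule nn_integral_mono)
      fix w assume w: "w \<in> space M"
      define d where "d = 2 * q * p k"
      have d: "0 < d" using q p(1)[of k] by (simp add: d_def)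
      have "(?I w - p k * \<rho> * u) / d \<le> low u w"
        unfolding low_def
      proof (rule running_inf_greatest[OF u])
        fix s assume s: "0 \<le> s" "s \<le> u"
        have "?I w \<le> p k * \<rho> * s - - 2 * q * p k * g s w"
          using s by (intro running_inf_le cadlag_bdd_below cadlag_compose2[OF _ cadlag_ident g_cadlag[OF w], of "\<lambda>s z. p k * \<rho> * s - - 2 * q * p k * z"])
            (auto simp: case_prod_beta intro!: continuous_intros)
        moreover have "p k * \<rho> * s \<le> p k * \<rho> * u" using s \<rho>(2) p(1)[of k] by (intro mult_left_mono) auto
        ultimately have "?I w - p k * \<rho> * u \<le> d * g s w" by (simp add: d_def)
        then show "(?I w - p k * \<rho> * u) / d \<le> g s w" using d by (simp add: field_simps)
      qed
      then have "?I w - p k * \<rho> * u \<le> low u w * d" using d by (simp add: pos_divide_le_eq)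
      then have "?I w - p k * \<rho> * u \<le> p k * (2 * q * low u w)" by (simp add: d_def mult_ac)
      then have "?I w / p k - \<rho> * u \<le> 2 * q * low u w" using p(1)[of k] by (simp add: field_simps)
      then have "exp (- 2 * q * low u w) \<le> exp (\<rho> * u) * exp (- ?I w / p k)"
        unfolding exp_add[symmetric] by simp
      then show "ennreal (exp (- 2 * q * low u w)) \<le> ennreal (exp (\<rho> * u)) * ennreal (exp (- ?I w / p k))"
        by (simp add: ennreal_mult[symmetric] ennreal_leI)
    qed
    also have "\<dots> = ennreal (exp (\<rho> * u)) * (\<integral>\<^sup>+w. ennreal (exp (- ?I w / p k)) \<partial>M)"
      using Im by (intro nn_integral_cmult) simp
    also have "\<dots> \<le> ennreal (exp (\<rho> * u)) * K"
      unfolding K_def by (intro mult_left_mono G.exp_sup_moment i k u p) auto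
    finally show ?thesis .
  qed
  ultimately show ?thesis by blast
qed

text \<open>\<open>X\<close> and the infimum of \<open>g\<close> are dependent. The discount rate is
  divided as \<open>r1 + r2\<close>, one part for each factor of the integrand, and
  \<open>x * y \<le> x\<^sup>2 + y\<^sup>2\<close> reduces the claim to a moment of \<open>X\<close>
  and one of the infimum, both with doubled exponents.\<close>

theorem tracking_integral_finite:
  assumes i: "\<And>c. integrable M (\<lambda>w. exp (c * g 1 w))" "integrable M (\<lambda>w. exp (- 2 * a * X 1 w))" and q: "0 < q"
    and r12: "r1 + r2 = r" and r1: "X.cumulant (- 2 * a) < 2 * r1" and r2: "G.cumulant (- 2 * q) < 2 * r2" "0 < r2"
  shows "(\<integral>\<^sup>+w. (\<integral>\<^sup>+t\<in>{0..}. ennreal (exp (- r * t - a * X t w - q * low t w)) \<partial>lborel) \<partial>M) < \<infinity>"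
proof -
  \<comment> \<open>Strictly between the cumulant and the available discount: the first gap is spent
    in \<open>low_moment\<close>, the second makes the time integral converge.\<close>
  obtain \<rho> where \<rho>: "max 0 (G.cumulant (- 2 * q)) < \<rho>" "\<rho> < 2 * r2"
    using dense[of "max 0 (G.cumulant (- 2 * q))" "2 * r2"] r2 by auto
  then obtain K where K: "K < \<infinity>" "\<And>u. 0 \<le> u ==> (\<integral>\<^sup>+w. ennreal (exp (- 2 * q * low u w)) \<partial>M) \<le> ennreal (exp (\<rho> * u)) * K"
    using low_moment[OF i(1) q, of \<rho>] by auto
  have pm[measurable]: "(\<lambda>z. X (snd z) (fst z)) \<in> borel_measurable MT"
    "(\<lambda>z. low (max 0 (snd z)) (fst z)) \<in> borel_measurable MT"
    by (rule X.meas_at low_measurable_at; auto)+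
  have "(\<integral>\<^sup>+w. (\<integral>\<^sup>+t\<in>{0..}. ennreal (exp (- r * t - a * X t w - q * low t w)) \<partial>lborel) \<partial>M)
     \<le> (\<integral>\<^sup>+w. (\<integral>\<^sup>+t. ennreal (exp (- 2 * r1 * t)) * ennreal (exp (- 2 * a * X t w)) * indicator {0..} t
          + ennreal (exp (- 2 * r2 * t)) * ennreal (exp (- 2 * q * low (max 0 t) w)) * indicator {0..} t \<partial>lborel) \<partial>M)"
  proof (rule nn_integral_mono, rule nn_integral_mono)
    fix w and t :: real
    show "ennreal (exp (- r * t - a * X t w - q * low t w)) * indicator {0..} t
       \<le> ennreal (exp (- 2 * r1 * t)) * ennreal (exp (- 2 * a * X t w)) * indicator {0..} t
          + ennreal (exp (- 2 * r2 * t)) * ennreal (exp (- 2 * q * low (max 0 t) w)) * indicator {0..} t"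
    proof (cases "0 \<le> t")
      case True
      define x where "x = exp (- r1 * t - a * X t w)"
      define y where "y = exp (- r2 * t - q * low t w)"
      have "0 \<le> (x - y)\<^sup>2" by simp
      then have "2 * (x * y) \<le> x\<^sup>2 + y\<^sup>2" by (simp add: power2_diff)
      moreover have "0 \<le> x * y" by (simp add: x_def y_def)
      ultimately have "x * y \<le> x\<^sup>2 + y\<^sup>2" by linarith
      moreover have "x * y = exp (- r * t - a * X t w - q * low t w)"
        by (simp add: x_def y_def exp_add[symmetric] r12[symmetric] algebra_simps)
      moreover have "x\<^sup>2 = exp (- 2 * r1 * t) * exp (- 2 * a * X t w)" "y\<^sup>2 = exp (- 2 * r2 * t) * exp (- 2 * q * low t w)"
        by (simp_all add: x_def y_def power2_eq_square exp_add[symmetric] algebra_simps)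
      ultimately show ?thesis using True
        by (simp add: ennreal_mult[symmetric] ennreal_plus[symmetric] ennreal_leI max_def del: ennreal_plus)
    qed simp
  qed
  also have "\<dots> = (\<integral>\<^sup>+t. \<integral>\<^sup>+w. ennreal (exp (- 2 * r1 * t)) * ennreal (exp (- 2 * a * X t w)) * indicator {0..} t
          + ennreal (exp (- 2 * r2 * t)) * ennreal (exp (- 2 * q * low (max 0 t) w)) * indicator {0..} t \<partial>M \<partial>lborel)"
    by (rule M_time.Fubini'[symmetric]) (simp add: case_prod_beta)
  also have "\<dots> \<le> (\<integral>\<^sup>+t. ennreal (exp (- (2 * r1 - X.cumulant (- 2 * a)) * t)) * indicator {0..} t
      + K * (ennreal (exp (- (2 * r2 - \<rho>) * t)) * indicator {0..} t) \<partial>lborel)"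
  proof (rule nn_integral_mono)
    fix t :: real
    show "(\<integral>\<^sup>+w. ennreal (exp (- 2 * r1 * t)) * ennreal (exp (- 2 * a * X t w)) * indicator {0..} t
          + ennreal (exp (- 2 * r2 * t)) * ennreal (exp (- 2 * q * low (max 0 t) w)) * indicator {0..} t \<partial>M)
       \<le> ennreal (exp (- (2 * r1 - X.cumulant (- 2 * a)) * t)) * indicator {0..} t
      + K * (ennreal (exp (- (2 * r2 - \<rho>) * t)) * indicator {0..} t)"
    proof (cases "0 \<le> t")
      case True
      have lm[measurable]: "low t \<in> borel_measurable M" by (rule X.measurable_F_M[OF low_adapted[OF True] True])
      have "(\<integral>\<^sup>+w. ennreal (exp (- 2 * r1 * t)) * ennreal (exp (- 2 * a * X t w)) * indicator {0..} t
          + ennreal (exp (- 2 * r2 * t)) * ennreal (exp (- 2 * q * low (max 0 t) w)) * indicator {0..} t \<partial>M)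
        = ennreal (exp (- 2 * r1 * t)) * X.moment (- 2 * a) t + ennreal (exp (- 2 * r2 * t)) * (\<integral>\<^sup>+w. ennreal (exp (- 2 * q * low t w)) \<partial>M)"
        using True by (simp add: max_def nn_integral_add nn_integral_cmult X.moment_def)
      also have "\<dots> \<le> ennreal (exp (- 2 * r1 * t)) * ennreal (exp (t * X.cumulant (- 2 * a))) + ennreal (exp (- 2 * r2 * t)) * (ennreal (exp (\<rho> * t)) * K)"
        by (intro add_mono mult_left_mono K(2) X.moment_le i(2) True) auto
      also have "\<dots> = ennreal (exp (- (2 * r1 - X.cumulant (- 2 * a)) * t)) + K * ennreal (exp (- (2 * r2 - \<rho>) * t))"
      proof -
        have e: "ennreal (exp x) * ennreal (exp y) = ennreal (exp (x + y))" for x y :: real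
          by (subst ennreal_mult[symmetric]) (simp_all add: exp_add)
        have "ennreal (exp (- 2 * r1 * t)) * ennreal (exp (t * X.cumulant (- 2 * a)))
            = ennreal (exp (- (2 * r1 - X.cumulant (- 2 * a)) * t))"
          unfolding e by (intro arg_cong[where f="\<lambda>x. ennreal (exp x)"]) (simp add: algebra_simps)
        moreover have "ennreal (exp (- 2 * r2 * t)) * (ennreal (exp (\<rho> * t)) * K)
            = K * ennreal (exp (- 2 * r2 * t + \<rho> * t))"
          unfolding mult.assoc[symmetric] e by (rule mult.commute)
        moreover have "- 2 * r2 * t + \<rho> * t = - (2 * r2 - \<rho>) * t" by (simp add: left_diff_distrib)
        ultimately show ?thesis by (simp only:)
      qed
      finally show ?thesis using True by simp
    qed simp
  qed
  also have "\<dots> = (\<integral>\<^sup>+t\<in>{0..}. ennreal (exp (- (2 * r1 - X.cumulant (- 2 * a)) * t)) \<partial>lborel)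
      + K * (\<integral>\<^sup>+t\<in>{0..}. ennreal (exp (- (2 * r2 - \<rho>) * t)) \<partial>lborel)"
    by (simp add: nn_integral_add nn_integral_cmult)
  also have "\<dots> = ennreal (1 / (2 * r1 - X.cumulant (- 2 * a))) + K * ennreal (1 / (2 * r2 - \<rho>))"
    using r1 \<rho> by (subst (1 2) nn_integral_exp_decay) auto
  also have "\<dots> < \<infinity>" using K(1) by (simp add: ennreal_mult_less_top)
  finally show ?thesis .
qed

lemma nn_integral_pos:
  assumes "f \<in> borel_measurable N" "\<And>x. x \<in> space N ==> x \<in> S ==> 0 < f x" "S \<in> sets N" "emeasure N S \<noteq> 0"
  shows "0 < (\<integral>\<^sup>+x. f x \<partial>N)"
proof (rule ccontr)
  assume "\<not> ?thesis"
  then have "AE x in N. f x = 0" using nn_integral_0_iff_AE[OF assms(1)] by simp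
  then have "AE x in N. x \<notin> S"
    using AE_space by eventually_elim (use assms(2) in force)
  then have "S \<in> null_sets N" using AE_iff_null_sets[OF assms(3)] by simp
  then show False using assms(4) by (simp add: null_setsD1)
qed

text \<open>For the upper bound the infimum is replaced by the value of \<open>g\<close> at the end
  point, which leaves \<open>exp (Y u w)\<close> with mean at most 1; discounting does the
  rest.\<close>

lemma future_mean_bounds:
  assumes i: "integrable M (\<lambda>w. exp (1 * Y 1 w))" and Y1: "Y.cumulant 1 \<le> 0" and r: "0 < r"
  shows "0 < future_mean 0" "future_mean 0 < \<infinity>"
proof -
  have rm: "(\<lambda>u. ratio_mean (max 0 u) (min 0 0)) \<in> borel_measurable borel" by (rule ratio_mean_measurable)
  have rp: "0 < ratio_mean u 0" if "0 \<le> u" for u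
    unfolding ratio_mean_def
  proof (rule nn_integral_pos[where S="space M"])
    have "(\<lambda>w. ratio 0 0 u w) \<in> borel_measurable M" by (rule ratio_measurable_at) (use that in auto)
    then show "(\<lambda>w. ennreal (exp (ratio 0 0 u w))) \<in> borel_measurable M" by measurable
  qed (auto simp: X.emeasure_space_1)
  show "0 < future_mean 0"
    unfolding future_mean_alt[OF order_refl]
  proof (rule nn_integral_pos[where S="{0..1}"])
    note [measurable] = rm
    show "(\<lambda>u. ennreal (exp (- r * u)) * ratio_mean (max 0 u) (min 0 0) * indicator {0..} u) \<in> borel_measurable lborel"
      by measurable
    show "0 < ennreal (exp (- r * u)) * ratio_mean (max 0 u) (min 0 0) * indicator {0..} u" if "u \<in> {0..1}" for u :: real
      using rp[of u] that by (simp add: max_def ennreal_zero_less_mult_iff)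
  qed auto
  have "future_mean 0 \<le> (\<integral>\<^sup>+u\<in>{0..}. ennreal (exp (- r * u)) \<partial>lborel)"
    unfolding future_mean_def
  proof (rule nn_integral_mono)
    fix u :: real
    have "ratio_mean u 0 \<le> 1" if u: "0 \<le> u"
    proof -
      have "ratio_mean u 0 \<le> Y.moment 1 u"
        unfolding ratio_mean_def Y.moment_def
      proof (intro nn_integral_mono ennreal_leI)
        fix w assume w: "w \<in> space M"
        have "running_inf (\<lambda>v. g (0 + v) w - g 0 w) u \<le> g (0 + u) w - g 0 w"
          using u by (intro running_inf_le cadlag_bdd_below cadlag_shift g_cadlag w) auto
        then have "ratio 0 0 u w \<le> 1 * Y u w"
          using w by (simp add: ratio_def g_def X.start Y.start)
        then show "exp (ratio 0 0 u w) \<le> exp (1 * Y u w)" by simp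
      qed
      also have "\<dots> \<le> ennreal (exp (u * Y.cumulant 1))" by (rule Y.moment_le[OF i u])
      also have "\<dots> \<le> ennreal 1" using mult_nonneg_nonpos[OF u Y1] by (intro ennreal_leI) simp
      finally show ?thesis by simp
    qed
    then show "ennreal (exp (- r * u)) * ratio_mean u 0 * indicator {0..} u \<le> ennreal (exp (- r * u)) * indicator {0..} u"
      using mult_left_mono[of "ratio_mean u 0" 1 "ennreal (exp (- r * u))"] by (auto split: split_indicator)
  qed
  also have "\<dots> = ennreal (1 / r)" by (rule nn_integral_exp_decay[OF r])
  also have "\<dots> < \<infinity>" by simp
  finally show "future_mean 0 < \<infinity>" .
qed

end

section \<open>Optional processes\<close>

context cadlag_levy
begin

lemma optional_generator:
  "{{(t, w). 0 \<le> t \<and> w \<in> space M \<and> X t w \<in> B} | X B. cadlag_adapted M F X \<and> B \<in> sets borel} \<subseteq> Pow ({0..} \<times> space M)"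
  by auto

lemma space_optional: "space (optional_algebra M F) = {0..} \<times> space M"
  unfolding optional_algebra_def by (simp add: space_measure_of[OF optional_generator])

text \<open>Checked on the generators. Fixing the time shows that optional processes are adapted;
  evaluation at the clamped time shows that they are jointly measurable.\<close>

lemma measurable_optional_algebra:
  assumes "\<And>z. z \<in> space N ==> 0 \<le> T z \<and> h z \<in> space M"
    and "\<And>X. cadlag_adapted M F X ==> (\<lambda>z. X (T z) (h z)) \<in> borel_measurable N"
  shows "(\<lambda>z. (T z, h z)) \<in> measurable N (optional_algebra M F)"
  unfolding optional_algebra_def
proof (rule measurable_measure_of[OF optional_generator])
  show "(\<lambda>z. (T z, h z)) \<in> space N \<rightarrow> {0..} \<times> space M" using assms(1) by auto
  fix S assume "S \<in> {{(t, w). 0 \<le> t \<and> w \<in> space M \<and> X t w \<in> B} | X B. cadlag_adapted M F X \<and> B \<in> sets borel}"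
  then obtain X B where X: "cadlag_adapted M F X" "B \<in> sets borel"
    and S: "S = {(t, w). 0 \<le> t \<and> w \<in> space M \<and> X t w \<in> B}" by blast
  have "(\<lambda>z. (T z, h z)) -` S \<inter> space N = (\<lambda>z. X (T z) (h z)) -` B \<inter> space N"
    using assms(1) by (auto simp: S)
  then show "(\<lambda>z. (T z, h z)) -` S \<inter> space N \<in> sets N"
    using measurable_sets[OF assms(2)[OF X(1)] X(2)] by simp
qed

lemma optional_adapted:
  assumes "optional M F X" "0 \<le> t"
  shows "X t \<in> borel_measurable (F t)"
proof -
  have "(\<lambda>w. (t, w)) \<in> measurable (F t) (optional_algebra M F)"
    by (rule measurable_optional_algebra) (use assms(2) space_F in \<open>auto simp: cadlag_adapted_def adapted_def\<close>)
  from measurable_compose[OF this assms(1)[unfolded optional_def]] show ?thesis by simp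
qed

lemma right_continuous_max:
  assumes "\<And>t. 0 \<le> t ==> continuous (at_right t) (f :: real => real)"
  shows "continuous (at_right t) (\<lambda>s. f (max 0 s))"
proof (cases "0 \<le> t")
  case True
  have "\<forall>\<^sub>F s in at_right t. f s = f (max 0 s)"
    unfolding eventually_at_right_field using True by (intro exI[of _ "t + 1"]) auto
  then show ?thesis
    using assms[OF True] True unfolding continuous_within by (auto elim: Lim_transform_eventually)
next
  case False
  have "\<forall>\<^sub>F s in at_right t. f (max 0 s) = f (max 0 t)"
    unfolding eventually_at_right_field using False by (intro exI[of _ 0]) auto
  then show ?thesis unfolding continuous_within by (rule tendsto_eventually)
qed

lemma optional_jointly_measurable:
  assumes "optional M F X"
  shows "(\<lambda>z. X (max 0 (snd z)) (fst z)) \<in> borel_measurable (M \<Otimes>\<^sub>M lborel)"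
proof -
  have "(\<lambda>z. (max 0 (snd z), fst z)) \<in> measurable (M \<Otimes>\<^sub>M lborel) (optional_algebra M F)"
  proof (rule measurable_optional_algebra)
    fix W assume W: "cadlag_adapted M F W"
    show "(\<lambda>z. W (max 0 (snd z)) (fst z)) \<in> borel_measurable (M \<Otimes>\<^sub>M lborel)"
    proof (rule right_continuous_measurable_at[where N=M and X="\<lambda>t w. W (max 0 t) w" and h=fst and T=snd])
      fix t :: real
      have "W (max 0 t) \<in> borel_measurable (F (max 0 t))" using W by (simp add: cadlag_adapted_def adapted_def)
      then show "(\<lambda>w. W (max 0 t) w) \<in> borel_measurable M" by (rule measurable_F_M) simp
      fix w assume "w \<in> space M"
      then have "cadlag (\<lambda>t. W t w)" using W by (simp add: cadlag_adapted_def)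
      from right_continuous_max[OF cadlag_right[OF this]]
      show "continuous (at_right t) (\<lambda>s. W (max 0 s) w)" .
    qed measurable
  qed (auto simp: space_pair_measure)
  from measurable_compose[OF this assms[unfolded optional_def]] show ?thesis by simp
qed

lemma cadlag_adapted_optional:
  assumes "cadlag_adapted M F X"
  shows "optional M F X"
  unfolding optional_def
proof (rule measurableI)
  fix B :: "real set" assume "B \<in> sets borel"
  then have "{(t, w). 0 \<le> t \<and> w \<in> space M \<and> X t w \<in> B} \<in> sets (optional_algebra M F)"
    unfolding optional_algebra_def sets_measure_of[OF optional_generator] using assms by (intro sigma_sets.Basic) blast
  moreover have "(\<lambda>(t, w). X t w) -` B \<inter> space (optional_algebra M F) = {(t, w). 0 \<le> t \<and> w \<in> space M \<and> X t w \<in> B}"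
    unfolding space_optional by auto
  ultimately show "(\<lambda>(t, w). X t w) -` B \<inter> space (optional_algebra M F) \<in> sets (optional_algebra M F)" by simp
qed simp

end

lemma increasing_path_scale:
  assumes "increasing_path C" "0 \<le> c"
  shows "increasing_path (\<lambda>t. c * C t)"
  using assms unfolding increasing_path_def mono_on_def
  by (auto intro!: mult_left_mono continuous_intros)

lemma stieltjes_cong:
  assumes "\<And>t. 0 \<le> t ==> C t = D t"
  shows "stieltjes C = stieltjes D"
  unfolding stieltjes_def using assms by (intro arg_cong[where f=interval_measure]) auto

text \<open>Scaling the path rescales the levels, so the factor comes out by substitution in the
  integral over levels.\<close>

lemma nn_integral_stieltjes_scale:
  assumes C: "increasing_path C" and c: "0 < c" and f: "f \<in> borel_measurable borel"
  shows "(\<integral>\<^sup>+t\<in>{0..}. f t \<partial>stieltjes (\<lambda>t. c * C t)) = ennreal c * (\<integral>\<^sup>+t\<in>{0..}. f t \<partial>stieltjes C)"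
proof -
  have lt: "level_time (\<lambda>t. c * C t) y = level_time C (y / c)" for y
    unfolding level_time_def using c by (intro arg_cong[where f=Inf] image_cong) (auto simp: field_simps)
  have "(\<integral>\<^sup>+t\<in>{0..}. f t \<partial>stieltjes (\<lambda>t. c * C t))
    = (\<integral>\<^sup>+y. f (enn2real (level_time C (y / c))) * indicator {y. 0 < y \<and> level_time C (y / c) < \<infinity>} y \<partial>lborel)"
    by (simp only: nn_integral_stieltjes[OF increasing_path_scale[OF C less_imp_le[OF c]] f] lt)
  also have "\<dots> = (\<integral>\<^sup>+y. f (enn2real (level_time C (y / c))) * indicator {y. 0 < y \<and> level_time C y < \<infinity>} (y / c) \<partial>lborel)"
    using c by (intro nn_integral_cong) (auto split: split_indicator simp: zero_less_divide_iff)
  also have "\<dots> = ennreal \<bar>c\<bar> * (\<integral>\<^sup>+y. f (enn2real (level_time C ((0 + c * y) / c))) * indicator {y. 0 < y \<and> level_time C y < \<infinity>} ((0 + c * y) / c) \<partial>lborel)"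
  proof (rule nn_integral_real_affine)
    note [measurable] = level_time_borel[OF C]
    have 1: "(\<lambda>y. f (enn2real (level_time C (y / c)))) \<in> borel_measurable borel"
      by (rule measurable_compose[OF _ f]) measurable
    have "{y. 0 < y \<and> level_time C y < \<infinity>} \<in> sets borel" by measurable
    then have "indicator {y. 0 < y \<and> level_time C y < \<infinity>} \<in> borel_measurable borel" by simp
    then have 2: "(\<lambda>y. indicator {y. 0 < y \<and> level_time C y < \<infinity>} (y / c) :: ennreal) \<in> borel_measurable borel"
      by (rule measurable_compose[rotated]) measurable
    show "(\<lambda>y. f (enn2real (level_time C (y / c))) * indicator {y. 0 < y \<and> level_time C y < \<infinity>} (y / c)) \<in> borel_measurable borel"
      using 1 2 by (rule borel_measurable_times_ennreal)
  qed (use c in simp)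
  also have "\<dots> = ennreal c * (\<integral>\<^sup>+t\<in>{0..}. f t \<partial>stieltjes C)"
    unfolding nn_integral_stieltjes[OF C f] using c by simp
  finally show ?thesis .
qed

section \<open>Cobb-Douglas utility\<close>

lemma cobb_douglas_exp:
  "cobb_douglas \<alpha> \<beta> (exp x) (exp c) = exp (\<alpha> * x + \<beta> * c) / (\<alpha> + \<beta>)"
  by (simp add: cobb_douglas_def exp_powr_real exp_add mult.commute)

lemma deriv_cobb_douglas_private:
  "deriv (\<lambda>y. cobb_douglas \<alpha> \<beta> y (exp c)) (exp x) = \<alpha> * exp ((\<alpha> - 1) * x + \<beta> * c) / (\<alpha> + \<beta>)"
proof (rule DERIV_imp_deriv)
  have "((\<lambda>y. y powr \<alpha> * exp c powr \<beta> / (\<alpha> + \<beta>)) has_real_derivative (\<alpha> * exp x powr (\<alpha> - 1)) * exp c powr \<beta> / (\<alpha> + \<beta>)) (at (exp x))"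
    by (intro DERIV_cdivide DERIV_cmult_right has_real_derivative_powr) simp
  then show "((\<lambda>y. cobb_douglas \<alpha> \<beta> y (exp c)) has_real_derivative \<alpha> * exp ((\<alpha> - 1) * x + \<beta> * c) / (\<alpha> + \<beta>)) (at (exp x))"
    by (simp add: cobb_douglas_def exp_powr_real exp_add mult_ac)
qed

lemma deriv_cobb_douglas_public:
  "deriv (\<lambda>y. cobb_douglas \<alpha> \<beta> (exp x) y) (exp c) = \<beta> * exp (\<alpha> * x + (\<beta> - 1) * c) / (\<alpha> + \<beta>)"
proof (rule DERIV_imp_deriv)
  have "((\<lambda>y. exp x powr \<alpha> * y powr \<beta> / (\<alpha> + \<beta>)) has_real_derivative exp x powr \<alpha> * (\<beta> * exp c powr (\<beta> - 1)) / (\<alpha> + \<beta>)) (at (exp c))"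
    by (intro DERIV_cdivide DERIV_cmult has_real_derivative_powr) simp
  then show "((\<lambda>y. cobb_douglas \<alpha> \<beta> (exp x) y) has_real_derivative \<beta> * exp (\<alpha> * x + (\<beta> - 1) * c) / (\<alpha> + \<beta>)) (at (exp c))"
    by (simp add: cobb_douglas_def exp_powr_real exp_add mult_ac)
qed

lemma exp_tangent_strict: "x \<noteq> 0 ==> 1 + x < exp (x :: real)"
proof (rule ccontr)
  assume "x \<noteq> 0" "\<not> 1 + x < exp x"
  then have "exp x = 1 + x" using exp_ge_add_one_self[of x] by linarith
  then have "ln (exp x) = exp x - 1" unfolding ln_exp by linarith
  from ln_eq_minus_one[OF exp_gt_zero this] have "exp x = 1" .
  with \<open>x \<noteq> 0\<close> show False by simp
qed

text \<open>Weighted AM-GM in tangent form; \<open>p\<close> and \<open>q\<close> are the ratios to the reference bundle.\<close>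

lemma powr_tangent:
  fixes p q :: real
  assumes ab: "0 < \<alpha>" "0 < \<beta>" "\<alpha> + \<beta> < 1" and pq: "0 \<le> p" "0 \<le> q"
  shows "p powr \<alpha> * q powr \<beta> \<le> \<alpha> * p + \<beta> * q + (1 - \<alpha> - \<beta>)"
    and "p powr \<alpha> * q powr \<beta> = \<alpha> * p + \<beta> * q + (1 - \<alpha> - \<beta>) ==> p = 1 \<and> q = 1"
proof -
  have *: "p powr \<alpha> * q powr \<beta> \<le> \<alpha> * p + \<beta> * q + (1 - \<alpha> - \<beta>) \<and>
     (p powr \<alpha> * q powr \<beta> = \<alpha> * p + \<beta> * q + (1 - \<alpha> - \<beta>) --> p = 1 \<and> q = 1)"
  proof (cases "p = 0 \<or> q = 0")
    case True
    then have "p powr \<alpha> * q powr \<beta> = 0" by auto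
    moreover have "0 \<le> \<alpha> * p" "0 \<le> \<beta> * q" using ab pq by auto
    ultimately show ?thesis using ab by linarith
  next
    case False
    \<comment> \<open>The mean of \<open>ln p\<close>, \<open>ln q\<close> and 0 with weights
      \<alpha>, \<beta> and \<open>1 - \<alpha> - \<beta>\<close>. The tangent to \<open>exp\<close>
      at \<open>m\<close>, evaluated at these three points and averaged, gives \<open>exp m\<close>
      because the linear parts cancel. Strict convexity away from \<open>m\<close> decides the case
      of equality.\<close>
    define m where "m = \<alpha> * ln p + \<beta> * ln q"
    have p: "0 < p" "0 < q" using False pq by auto
    have e: "p powr \<alpha> * q powr \<beta> = exp m" using p by (simp add: powr_def m_def exp_add)
    have t: "exp m * (1 + (x - m)) \<le> exp x" "x \<noteq> m ==> exp m * (1 + (x - m)) < exp x" for x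
    proof -
      have "exp x = exp m * exp (x - m)" by (simp add: exp_add[symmetric])
      moreover have "1 + (x - m) \<le> exp (x - m)" by (rule exp_ge_add_one_self)
      moreover have "1 + (x - m) < exp (x - m)" if "x \<noteq> m" using that by (intro exp_tangent_strict) simp
      ultimately show "exp m * (1 + (x - m)) \<le> exp x" "x \<noteq> m ==> exp m * (1 + (x - m)) < exp x"
        by simp_all
    qed
    define P where "P = exp m * (1 + (ln p - m))"
    define Q where "Q = exp m * (1 + (ln q - m))"
    define R where "R = exp m * (1 + (0 - m))"
    have s: "exp m = \<alpha> * P + \<beta> * Q + (1 - \<alpha> - \<beta>) * R"
    proof -
      have "\<alpha> * P + \<beta> * Q + (1 - \<alpha> - \<beta>) * R = exp m * (1 + (\<alpha> * ln p + \<beta> * ln q - m))"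
        unfolding P_def Q_def R_def by (simp add: algebra_simps)
      then show ?thesis by (simp add: m_def)
    qed
    have le: "P \<le> p" "Q \<le> q" "R \<le> 1" using t(1)[of "ln p"] t(1)[of "ln q"] t(1)[of 0] p by (simp_all add: P_def Q_def R_def)
    define d where "d = 1 - \<alpha> - \<beta>"
    have d: "0 < d" using ab by (simp add: d_def)
    note s = s[folded d_def]
    have le': "\<alpha> * P \<le> \<alpha> * p" "\<beta> * Q \<le> \<beta> * q" "d * R \<le> d"
      using le ab d mult_left_mono[of R 1 d] by (auto intro: mult_left_mono)
    show ?thesis
      unfolding d_def[symmetric]
    proof (rule conjI[OF _ impI])
      show "p powr \<alpha> * q powr \<beta> \<le> \<alpha> * p + \<beta> * q + d" using e s le' by linarith
    next
      assume eq: "p powr \<alpha> * q powr \<beta> = \<alpha> * p + \<beta> * q + d"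
      have "\<alpha> * P = \<alpha> * p" "\<beta> * Q = \<beta> * q" "d * R = d"
        using eq e s le' by linarith+
      then have "P = p" "Q = q" "R = 1" using ab d by auto
      then have m: "ln p = m" "ln q = m" "0 = m"
        using t(2)[of "ln p"] t(2)[of "ln q"] t(2)[of 0] p by (auto simp: P_def Q_def R_def)
      then show "p = 1 \<and> q = 1" using p by simp
    qed
  qed
  from * show "p powr \<alpha> * q powr \<beta> \<le> \<alpha> * p + \<beta> * q + (1 - \<alpha> - \<beta>)" by blast
  from * show "p powr \<alpha> * q powr \<beta> = \<alpha> * p + \<beta> * q + (1 - \<alpha> - \<beta>) ==> p = 1 \<and> q = 1" by blast
qed

lemma cobb_douglas_tangent:
  assumes ab: "0 < \<alpha>" "0 < \<beta>" "\<alpha> + \<beta> < 1" and pq: "0 \<le> x" "0 \<le> c" "0 < x0" "0 < c0"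
  shows "cobb_douglas \<alpha> \<beta> x c \<le> cobb_douglas \<alpha> \<beta> x0 c0 * (\<alpha> * (x / x0) + \<beta> * (c / c0) + (1 - \<alpha> - \<beta>))"
    and "cobb_douglas \<alpha> \<beta> x c = cobb_douglas \<alpha> \<beta> x0 c0 * (\<alpha> * (x / x0) + \<beta> * (c / c0) + (1 - \<alpha> - \<beta>)) ==> x = x0 \<and> c = c0"
proof -
  have e: "cobb_douglas \<alpha> \<beta> x c = cobb_douglas \<alpha> \<beta> x0 c0 * ((x / x0) powr \<alpha> * (c / c0) powr \<beta>)"
    using pq by (simp add: cobb_douglas_def powr_divide)
  have pos: "0 < cobb_douglas \<alpha> \<beta> x0 c0" using pq ab by (simp add: cobb_douglas_def)
  have r: "0 \<le> x / x0" "0 \<le> c / c0" using pq by auto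
  show "cobb_douglas \<alpha> \<beta> x c \<le> cobb_douglas \<alpha> \<beta> x0 c0 * (\<alpha> * (x / x0) + \<beta> * (c / c0) + (1 - \<alpha> - \<beta>))"
    unfolding e by (intro mult_left_mono powr_tangent(1)[OF ab r] less_imp_le[OF pos])
  assume "cobb_douglas \<alpha> \<beta> x c = cobb_douglas \<alpha> \<beta> x0 c0 * (\<alpha> * (x / x0) + \<beta> * (c / c0) + (1 - \<alpha> - \<beta>))"
  then have "(x / x0) powr \<alpha> * (c / c0) powr \<beta> = \<alpha> * (x / x0) + \<beta> * (c / c0) + (1 - \<alpha> - \<beta>)"
    unfolding e using pos by (metis mult_left_cancel less_irrefl)
  from powr_tangent(2)[OF ab r this] show "x = x0 \<and> c = c0" using pq by simp
qed

section \<open>The planner's problem\<close>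

context levy_market
begin

definition total :: "(real => 'a => real) => ennreal" where
  "total h = (\<integral>\<^sup>+w. (\<integral>\<^sup>+t\<in>{0..}. ennreal (h t w) \<partial>lborel) \<partial>M)"

definition regular :: "(real => 'a => real) => bool" where
  "regular h \<longleftrightarrow> (\<lambda>z. h (max 0 (snd z)) (fst z)) \<in> borel_measurable MT \<and>
     (\<forall>w\<in>space M. \<forall>t\<ge>0. 0 \<le> h t w)"

lemma regularD:
  assumes "regular h"
  shows "(\<lambda>z. h (max 0 (snd z)) (fst z)) \<in> borel_measurable MT"
    and "w \<in> space M ==> 0 \<le> t ==> 0 \<le> h t w"
  using assms by (auto simp: regular_def)

lemma total_eq:
  assumes h: "regular h"
  shows "total h = (\<integral>\<^sup>+z. ennreal (h (max 0 (snd z)) (fst z)) * indicator {0..} (snd z) \<partial>MT)"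
proof -
  note [measurable] = regularD(1)[OF h]
  have "(\<integral>\<^sup>+z. ennreal (h (max 0 (snd z)) (fst z)) * indicator {0..} (snd z) \<partial>MT)
     = (\<integral>\<^sup>+w. \<integral>\<^sup>+t. ennreal (h (max 0 t) w) * indicator {0..} t \<partial>lborel \<partial>M)"
    by (subst lborel.nn_integral_fst[symmetric]) simp_all
  also have "\<dots> = total h"
    unfolding total_def by (intro nn_integral_cong) (auto simp: max_def split: split_indicator)
  finally show ?thesis ..
qed

lemma total_add:
  assumes f: "regular f" and h: "regular h"
  shows "total (\<lambda>t w. f t w + h t w) = total f + total h" and "regular (\<lambda>t w. f t w + h t w)"
proof -
  note [measurable] = regularD(1)[OF f] regularD(1)[OF h]
  show r: "regular (\<lambda>t w. f t w + h t w)"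
    using regularD(2)[OF f] regularD(2)[OF h] by (auto simp: regular_def intro!: add_nonneg_nonneg)
  have "total (\<lambda>t w. f t w + h t w)
      = (\<integral>\<^sup>+z. ennreal (f (max 0 (snd z)) (fst z)) * indicator {0..} (snd z) + ennreal (h (max 0 (snd z)) (fst z)) * indicator {0..} (snd z) \<partial>MT)"
    unfolding total_eq[OF r]
  proof (rule nn_integral_cong)
    fix z :: "'a \<times> real" assume "z \<in> space MT"
    then have "fst z \<in> space M" by (auto simp: space_pair_measure)
    from regularD(2)[OF f this, of "max 0 (snd z)"] regularD(2)[OF h this, of "max 0 (snd z)"]
    show "ennreal (f (max 0 (snd z)) (fst z) + h (max 0 (snd z)) (fst z)) * indicator {0..} (snd z)
      = ennreal (f (max 0 (snd z)) (fst z)) * indicator {0..} (snd z) + ennreal (h (max 0 (snd z)) (fst z)) * indicator {0..} (snd z)"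
      by (simp add: distrib_right)
  qed
  also have "\<dots> = total f + total h"
    unfolding total_eq[OF f] total_eq[OF h] by (rule nn_integral_add) measurable
  finally show "total (\<lambda>t w. f t w + h t w) = total f + total h" .
qed

lemma total_cmult:
  assumes h: "regular h" and c: "0 \<le> c"
  shows "total (\<lambda>t w. c * h t w) = ennreal c * total h" and "regular (\<lambda>t w. c * h t w)"
proof -
  note [measurable] = regularD(1)[OF h]
  show r: "regular (\<lambda>t w. c * h t w)"
    using regularD(2)[OF h] c by (auto simp: regular_def)
  have "total (\<lambda>t w. c * h t w)
      = (\<integral>\<^sup>+z. ennreal c * (ennreal (h (max 0 (snd z)) (fst z)) * indicator {0..} (snd z)) \<partial>MT)"
    unfolding total_eq[OF r]
  proof (rule nn_integral_cong)
    fix z :: "'a \<times> real" assume "z \<in> space MT"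
    then have "fst z \<in> space M" by (auto simp: space_pair_measure)
    from regularD(2)[OF h this, of "max 0 (snd z)"] c
    show "ennreal (c * h (max 0 (snd z)) (fst z)) * indicator {0..} (snd z)
      = ennreal c * (ennreal (h (max 0 (snd z)) (fst z)) * indicator {0..} (snd z))"
      by (simp add: ennreal_mult mult.assoc)
  qed
  also have "\<dots> = ennreal c * total h"
    unfolding total_eq[OF h] by (rule nn_integral_cmult) measurable
  finally show "total (\<lambda>t w. c * h t w) = ennreal c * total h" .
qed

lemma total_sum:
  assumes "finite I" "\<And>i. i \<in> I ==> regular (h i)"
  shows "total (\<lambda>t w. \<Sum>i\<in>I. h i t w) = (\<Sum>i\<in>I. total (h i)) \<and> regular (\<lambda>t w. \<Sum>i\<in>I. h i t w)"
  using assms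
proof (induction I rule: finite_induct)
  case empty
  then show ?case by (simp add: total_def regular_def)
next
  case (insert i I)
  then have "regular (h i)" "regular (\<lambda>t w. \<Sum>i\<in>I. h i t w)" by auto
  from total_add[OF this] insert show ?case by simp
qed

lemma total_mono: "(\<And>t w. w \<in> space M ==> 0 \<le> t ==> f t w \<le> h t w) ==> total f \<le> total h"
  unfolding total_def by (intro nn_integral_mono) (auto intro: ennreal_leI split: split_indicator)

lemma regular_mult:
  assumes "regular f" "regular h"
  shows "regular (\<lambda>t w. f t w * h t w)"
proof -
  note [measurable] = regularD(1)[OF assms(1)] regularD(1)[OF assms(2)]
  show ?thesis using regularD(2)[OF assms(1)] regularD(2)[OF assms(2)] by (auto simp: regular_def)
qed

lemma total_eq_imp_AE:
  assumes f: "regular f" and h: "regular h"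
    and le: "\<And>t w. w \<in> space M ==> 0 \<le> t ==> f t w \<le> h t w"
    and eq: "total h \<le> total f" "total f < \<infinity>"
  shows "AE z in MT. 0 \<le> snd z --> f (snd z) (fst z) = h (snd z) (fst z)"
proof -
  note [measurable] = regularD(1)[OF f] regularD(1)[OF h]
  let ?F = "\<lambda>z. ennreal (f (max 0 (snd z)) (fst z)) * indicator {0..} (snd z)"
  let ?H = "\<lambda>z. ennreal (h (max 0 (snd z)) (fst z)) * indicator {0..} (snd z)"
  have "AE z in MT. ?H z \<le> ?F z"
  proof (rule ccontr)
    assume "\<not> ?thesis"
    moreover have "AE z in MT. ?F z \<le> ?H z"
      by (intro AE_I2 mult_right_mono ennreal_leI le) (auto simp: space_pair_measure)
    moreover have "(\<integral>\<^sup>+z. ?F z \<partial>MT) \<noteq> \<infinity>" using eq(2) unfolding total_eq[OF f] by simp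
    ultimately have "(\<integral>\<^sup>+z. ?F z \<partial>MT) < (\<integral>\<^sup>+z. ?H z \<partial>MT)"
      by (intro nn_integral_less) measurable
    then show False using eq(1) unfolding total_eq[OF f] total_eq[OF h] by simp
  qed
  then show ?thesis using AE_space
  proof eventually_elim
    case (elim z)
    show ?case
    proof
      assume t: "0 \<le> snd z"
      have w: "fst z \<in> space M" using elim(2) by (auto simp: space_pair_measure)
      have "ennreal (h (snd z) (fst z)) \<le> ennreal (f (snd z) (fst z))" using elim(1) t by (simp add: max_def)
      then have "h (snd z) (fst z) \<le> f (snd z) (fst z)" using regularD(2)[OF f w t] by (simp add: ennreal_le_iff)
      then show "f (snd z) (fst z) = h (snd z) (fst z)" using le[OF w t] by simp
    qed
  qed
qed

end

text \<open>The consequences of the bounds on \<open>r\<close> enter as assumptions in the form in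
  which they are used; the theorem discharges them when it instantiates the locale.\<close>

locale economy = levy_market M F X Y "\<alpha> / (1 - \<alpha>)" r
  for M :: "'a measure" and F X Y and \<alpha> r :: real +
  fixes \<beta> endow :: real and n :: nat
  assumes complete: "complete_measure M"
    and ab: "0 < \<alpha>" "0 < \<beta>" "\<alpha> + \<beta> < 1" and n: "1 \<le> n" and w: "0 < endow"
    and future_mean_pos: "0 < future_mean 0" and future_mean_fin: "future_mean 0 < \<infinity>"
    and tracking_fin: "(\<integral>\<^sup>+w. (\<integral>\<^sup>+t\<in>{0..}.
        ennreal (exp (- r * t - \<alpha> / (1 - \<alpha>) * X t w - \<beta> / (1 - \<alpha> - \<beta>) * low t w)) \<partial>lborel) \<partial>M) < \<infinity>"
begin

text \<open>At given prices the private condition makes consumption proportional to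
  \<open>C powr (\<beta> / (1 - \<alpha>))\<close>, so the marginal utility of \<open>C\<close> is a
  power of \<open>C\<close> with exponent
  \<open>\<beta> - 1 + \<alpha> * \<beta> / (1 - \<alpha>)\<close>. For
  \<open>C = exp (- \<kappa> * low)\<close> this power equals \<open>exp low\<close> under the
  equation for \<open>\<kappa>\<close> in \<open>kappa\<close>.\<close>

definition "\<kappa> = (1 - \<alpha>) / (1 - \<alpha> - \<beta>)"
definition "E0 = enn2real (future_mean 0)"
definition "c0 = ((\<alpha> + \<beta>) / \<alpha>) powr (1 / (\<alpha> - 1))"
definition "A = \<beta> / \<alpha> * c0 * E0"
text \<open>The integrand common to both halves of the cost: \<open>marg * theta\<close> equals it
  and \<open>xprice * gam\<close> is a constant multiple of it.\<close>

definition "track t w = exp (- r * t - \<alpha> / (1 - \<alpha>) * X t w - \<beta> / (1 - \<alpha> - \<beta>) * low t w)"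
definition "Q = enn2real (total track)"
text \<open>Sum of the cost \<open>\<alpha> / (\<beta> * E0) * Q\<close> of \<open>gam\<close> and
  the cost \<open>Q / E0\<close> of \<open>theta\<close>.\<close>

definition "El = (\<alpha> + \<beta>) / \<beta> * (Q / E0)"
definition "l0 = real n * endow / El"
definition "lam = 1 / real n powr \<alpha> * A powr (1 - \<alpha>) * l0 powr (\<alpha> + \<beta> - 1)"
definition "theta t w = exp (- \<kappa> * low t w)"
definition "gam t w = c0 / A * exp (- ((X t w + \<beta> * \<kappa> * low t w) / (1 - \<alpha>)))"
definition "xprice t w = exp (- r * t + X t w)"
definition "xopt t w = 1 / real n * l0 * gam t w"
definition "copt t w = l0 * theta t w"
definition "util t w = exp (- r * t) * cobb_douglas \<alpha> \<beta> (xopt t w) (copt t w)"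

lemma E0: "0 < E0" "future_mean 0 = ennreal E0"
  using future_mean_pos future_mean_fin by (auto simp: E0_def enn2real_positive_iff)

lemma c0: "0 < c0" using ab by (simp add: c0_def)

lemma A: "0 < A" using ab c0 E0 by (simp add: A_def)

lemma ln_c0: "\<alpha> / (\<alpha> + \<beta>) = exp ((1 - \<alpha>) * ln c0)"
proof -
  have "(1 - \<alpha>) * ln c0 = (1 - \<alpha>) * (1 / (\<alpha> - 1)) * ln ((\<alpha> + \<beta>) / \<alpha>)"
    using ab by (simp add: c0_def ln_powr)
  also have "(1 - \<alpha>) * (1 / (\<alpha> - 1)) = - 1" using ab by (simp add: field_simps)
  finally have "exp ((1 - \<alpha>) * ln c0) = exp (- ln ((\<alpha> + \<beta>) / \<alpha>))" by simp
  also have "\<dots> = \<alpha> / (\<alpha> + \<beta>)" using ab by (simp add: exp_minus)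
  finally show ?thesis ..
qed

lemma track_regular: "regular track"
proof -
  have [measurable]: "(\<lambda>z. X (max 0 (snd z)) (fst z)) \<in> borel_measurable MT"
    "(\<lambda>z. low (max 0 (snd z)) (fst z)) \<in> borel_measurable MT"
    by (rule X.meas_at low_measurable_at; auto)+
  have "(\<lambda>z. track (max 0 (snd z)) (fst z)) \<in> borel_measurable MT"
    unfolding track_def by measurable
  then show ?thesis by (simp add: regular_def track_def)
qed

lemma Q: "0 < Q" "total track = ennreal Q"
proof -
  have fin: "total track < \<infinity>" using tracking_fin unfolding total_def track_def .
  note [measurable] = regularD(1)[OF track_regular]
  have "0 < total track"
    unfolding total_eq[OF track_regular]
  proof (rule nn_integral_pos[where S="space M \<times> {0..1}"])
    show "(\<lambda>z. ennreal (track (max 0 (snd z)) (fst z)) * indicator {0..} (snd z)) \<in> borel_measurable MT"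
      by measurable
    show "emeasure MT (space M \<times> {0..1::real}) \<noteq> 0"
      by (subst lborel.emeasure_pair_measure_Times) (auto simp: X.emeasure_space_1)
  qed (auto simp: track_def)
  with fin show "0 < Q" "total track = ennreal Q" by (auto simp: Q_def enn2real_positive_iff)
qed

lemma El: "0 < El" using ab Q E0 by (simp add: El_def)

lemma l0: "0 < l0" using El n w by (simp add: l0_def)

lemma lam: "0 < lam" using A l0 n by (simp add: lam_def)

lemma n_pos: "0 < real n" using n by simp

lemma lam_exp: "lam = exp (- \<alpha> * ln (real n) + (1 - \<alpha>) * ln A + (\<alpha> + \<beta> - 1) * ln l0)"
proof -
  have "1 / real n powr \<alpha> = exp (- \<alpha> * ln (real n))" using n_pos by (simp add: powr_def exp_minus field_simps)
  moreover have "A powr (1 - \<alpha>) = exp ((1 - \<alpha>) * ln A)" "l0 powr (\<alpha> + \<beta> - 1) = exp ((\<alpha> + \<beta> - 1) * ln l0)"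
    using A l0 by (simp_all add: powr_def)
  ultimately show ?thesis unfolding lam_def exp_add by (simp only:)
qed

lemma kappa: "\<kappa> * (1 - \<beta> - \<alpha> / (1 - \<alpha>) * \<beta>) = 1" "1 - \<kappa> = - (\<beta> / (1 - \<alpha> - \<beta>))" "0 < \<kappa>"
  "\<beta> * \<kappa> / (1 - \<alpha>) = \<beta> / (1 - \<alpha> - \<beta>)"
proof -
  have p: "0 < 1 - \<alpha>" "0 < 1 - \<alpha> - \<beta>" using ab by auto
  have "1 - \<beta> - \<alpha> / (1 - \<alpha>) * \<beta> = (1 - \<alpha> - \<beta>) / (1 - \<alpha>)" using p by (simp add: field_simps)
  then show "\<kappa> * (1 - \<beta> - \<alpha> / (1 - \<alpha>) * \<beta>) = 1" using p by (simp add: \<kappa>_def)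
  show "1 - \<kappa> = - (\<beta> / (1 - \<alpha> - \<beta>))" using p by (simp add: \<kappa>_def field_simps)
  show "0 < \<kappa>" using p by (simp add: \<kappa>_def)
  show "\<beta> * \<kappa> / (1 - \<alpha>) = \<beta> / (1 - \<alpha> - \<beta>)" using p by (simp add: \<kappa>_def)
qed

text \<open>Logarithms of \<open>xopt\<close> and of \<open>copt\<close>, through \<open>lc\<close>;
  in them the first order conditions are linear identities between exponents.\<close>

definition "lx t w = - ln (real n) + ln l0 + ln c0 - ln A - (X t w + \<beta> * \<kappa> * low t w) / (1 - \<alpha>)"
definition "lc t w = ln l0 - \<kappa> * low t w"

lemma xopt_exp: "xopt t w = exp (lx t w)"
  unfolding xopt_def gam_def lx_def using n_pos l0 c0 A
  by (simp add: exp_add exp_diff exp_minus field_simps)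

lemma copt_exp: "copt t w = exp (lc t w)"
  unfolding copt_def theta_def lc_def using l0 by (simp add: exp_add exp_diff exp_minus field_simps)

lemma xopt_pos: "0 < xopt t w" by (simp add: xopt_exp)

lemma copt_pos: "0 < copt t w" by (simp add: copt_exp)

lemma foc_private:
  "1 / real n * exp (- r * t) * (\<alpha> * exp ((\<alpha> - 1) * lx t w + \<beta> * lc t w) / (\<alpha> + \<beta>)) = lam * xprice t w"
proof -
  define z where "z = (X t w + \<beta> * \<kappa> * low t w) / (1 - \<alpha>)"
  have z: "(1 - \<alpha>) * z = X t w + \<beta> * \<kappa> * low t w" using ab by (simp add: z_def)
  have nn: "1 / real n = exp (- ln (real n))" using n_pos by (simp add: exp_minus inverse_eq_divide)
  have "1 / real n * exp (- r * t) * (\<alpha> * exp ((\<alpha> - 1) * lx t w + \<beta> * lc t w) / (\<alpha> + \<beta>))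
     = 1 / real n * exp (- r * t) * (\<alpha> / (\<alpha> + \<beta>)) * exp ((\<alpha> - 1) * lx t w + \<beta> * lc t w)"
    by simp
  also have "\<dots> = exp (- ln (real n) + - r * t + (1 - \<alpha>) * ln c0 + ((\<alpha> - 1) * lx t w + \<beta> * lc t w))"
    unfolding nn ln_c0 exp_add ..
  also have "- ln (real n) + - r * t + (1 - \<alpha>) * ln c0 + ((\<alpha> - 1) * lx t w + \<beta> * lc t w)
     = (- \<alpha> * ln (real n) + (1 - \<alpha>) * ln A + (\<alpha> + \<beta> - 1) * ln l0) + (- r * t + X t w)"
  proof -
    have "(\<alpha> - 1) * lx t w = (1 - \<alpha>) * ln (real n) - (1 - \<alpha>) * ln l0 - (1 - \<alpha>) * ln c0 + (1 - \<alpha>) * ln A + (1 - \<alpha>) * z"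
      unfolding lx_def z_def[symmetric] by (simp add: algebra_simps)
    then show ?thesis unfolding z lc_def by (simp add: algebra_simps)
  qed
  finally show ?thesis unfolding lam_exp xprice_def exp_add .
qed

text \<open>The defining equation of \<open>\<kappa>\<close> collapses all multiples of the infimum
  in the exponent to \<open>low\<close>, and the choice of \<open>A\<close> as a multiple of
  \<open>E0\<close> turns the remaining constant into \<open>lam / E0\<close>.\<close>

lemma foc_public:
  "exp (- r * t) * (\<beta> * exp (\<alpha> * lx t w + (\<beta> - 1) * lc t w) / (\<alpha> + \<beta>)) = lam / E0 * marg t w"
proof -
  let ?e = "\<alpha> * lx t w + (\<beta> - 1) * lc t w"
  define z where "z = (X t w + \<beta> * \<kappa> * low t w) / (1 - \<alpha>)"
  have z: "\<alpha> * z = \<alpha> / (1 - \<alpha>) * X t w + \<alpha> / (1 - \<alpha>) * \<beta> * \<kappa> * low t w" by (simp add: z_def add_divide_distrib distrib_left)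
  have k: "\<kappa> * low t w - \<beta> * \<kappa> * low t w - \<alpha> / (1 - \<alpha>) * \<beta> * \<kappa> * low t w = low t w"
  proof -
    have "\<kappa> * low t w - \<beta> * \<kappa> * low t w - \<alpha> / (1 - \<alpha>) * \<beta> * \<kappa> * low t w = (\<kappa> * (1 - \<beta> - \<alpha> / (1 - \<alpha>) * \<beta>)) * low t w"
      by (simp only: left_diff_distrib right_diff_distrib mult_1_right mult_1_left mult_ac)
    then show ?thesis unfolding kappa(1) by simp
  qed
  have iE: "1 / E0 = \<beta> / \<alpha> * exp (ln c0 - ln A)"
    using c0 A E0 ab by (simp add: exp_diff A_def)
  have "exp (- r * t) * (\<beta> * exp ?e / (\<alpha> + \<beta>))
     = \<beta> / \<alpha> * (exp (- r * t) * (\<alpha> / (\<alpha> + \<beta>)) * exp ?e)"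
    using ab by simp
  also have "\<dots> = \<beta> / \<alpha> * exp (- r * t + (1 - \<alpha>) * ln c0 + ?e)"
    unfolding ln_c0 exp_add ..
  finally have 1: "exp (- r * t) * (\<beta> * exp ?e / (\<alpha> + \<beta>))
     = \<beta> / \<alpha> * exp (- r * t + (1 - \<alpha>) * ln c0 + ?e)" .
  have 2: "\<alpha> * lx t w = - \<alpha> * ln (real n) + \<alpha> * ln l0 + \<alpha> * ln c0 - \<alpha> * ln A - \<alpha> * z"
    unfolding lx_def z_def[symmetric] by (simp add: algebra_simps)
  have 3: "(\<beta> - 1) * lc t w = (\<beta> - 1) * ln l0 + (\<kappa> * low t w - \<beta> * \<kappa> * low t w)"
    unfolding lc_def by (simp add: algebra_simps)
  have 4: "- r * t + (1 - \<alpha>) * ln c0 + ?e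
     = (- \<alpha> * ln (real n) + (1 - \<alpha>) * ln A + (\<alpha> + \<beta> - 1) * ln l0) + (ln c0 - ln A)
       + (- r * t - \<alpha> / (1 - \<alpha>) * X t w + low t w)"
  proof -
    define p q L where "p = \<alpha> / (1 - \<alpha>) * X t w" and "q = \<alpha> / (1 - \<alpha>) * \<beta> * \<kappa> * low t w" and "L = \<kappa> * low t w - \<beta> * \<kappa> * low t w"
    have "\<alpha> * z = p + q" "L - q = low t w" using z k by (simp_all add: p_def q_def L_def)
    then have *: "L = low t w + \<alpha> * z - p" by linarith
    show ?thesis unfolding 2 3 p_def[symmetric] L_def[symmetric] * by (simp add: algebra_simps)
  qed
  have 5: "lam / E0 * marg t w = lam * (1 / E0) * marg t w" by simp
  show ?thesis unfolding 5 unfolding 1 4 iE lam_exp marg_def by (simp only: exp_add mult_ac)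
qed

lemma util_exp: "util t w = exp (- r * t) * (exp (\<alpha> * lx t w + \<beta> * lc t w) / (\<alpha> + \<beta>))"
  unfolding util_def xopt_exp copt_exp cobb_douglas_exp ..

lemma util_private: "\<alpha> * util t w / xopt t w = real n * lam * xprice t w"
proof -
  have "exp (\<alpha> * lx t w + \<beta> * lc t w) / exp (lx t w) = exp ((\<alpha> - 1) * lx t w + \<beta> * lc t w)"
    unfolding exp_diff[symmetric] by (simp add: algebra_simps)
  then have *: "exp (\<alpha> * lx t w + \<beta> * lc t w) = exp ((\<alpha> - 1) * lx t w + \<beta> * lc t w) * exp (lx t w)"
    by (simp add: exp_diff[symmetric] exp_add[symmetric] algebra_simps)
  then have "\<alpha> * util t w / xopt t w = real n * (1 / real n * exp (- r * t) * (\<alpha> * exp ((\<alpha> - 1) * lx t w + \<beta> * lc t w) / (\<alpha> + \<beta>)))"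
    unfolding util_exp xopt_exp * using n_pos by simp
  then show ?thesis unfolding foc_private by simp
qed

lemma util_public: "\<beta> * util t w / copt t w = lam / E0 * marg t w"
proof -
  have "exp (\<alpha> * lx t w + \<beta> * lc t w) / exp (lc t w) = exp (\<alpha> * lx t w + (\<beta> - 1) * lc t w)"
    unfolding exp_diff[symmetric] by (simp add: algebra_simps)
  then have *: "exp (\<alpha> * lx t w + \<beta> * lc t w) = exp (\<alpha> * lx t w + (\<beta> - 1) * lc t w) * exp (lc t w)"
    by (simp add: exp_diff[symmetric] exp_add[symmetric] algebra_simps)
  then have "\<beta> * util t w / copt t w = exp (- r * t) * (\<beta> * exp (\<alpha> * lx t w + (\<beta> - 1) * lc t w) / (\<alpha> + \<beta>))"
    unfolding util_exp copt_exp * by simp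
  then show ?thesis unfolding foc_public .
qed

lemma xprice_gam: "xprice t w * gam t w = \<alpha> / (\<beta> * E0) * track t w"
proof -
  have c: "c0 / A = \<alpha> / (\<beta> * E0)" using c0 ab E0 by (simp add: A_def)
  have "(X t w + \<beta> * \<kappa> * low t w) / (1 - \<alpha>) = X t w / (1 - \<alpha>) + \<beta> / (1 - \<alpha> - \<beta>) * low t w"
    unfolding kappa(4)[symmetric] by (simp add: add_divide_distrib)
  moreover have "X t w / (1 - \<alpha>) = X t w + \<alpha> / (1 - \<alpha>) * X t w" using ab by (simp add: field_simps)
  ultimately have "exp (- r * t + X t w) * exp (- ((X t w + \<beta> * \<kappa> * low t w) / (1 - \<alpha>))) = track t w"
    unfolding track_def exp_add[symmetric] by simp
  then show ?thesis unfolding xprice_def gam_def c by (simp add: mult_ac)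
qed

lemma marg_theta: "marg t w * theta t w = track t w"
proof -
  have "low t w - \<kappa> * low t w = (1 - \<kappa>) * low t w" by (simp add: left_diff_distrib)
  then have "low t w - \<kappa> * low t w = - (\<beta> / (1 - \<alpha> - \<beta>)) * low t w" unfolding kappa(2) .
  then show ?thesis unfolding marg_def theta_def track_def exp_add[symmetric]
    by (intro arg_cong[where f=exp]) (simp add: algebra_simps)
qed

lemma util_track: "util t w = lam * l0 / (\<beta> * E0) * track t w"
proof -
  have "\<beta> * util t w = lam / E0 * marg t w * copt t w"
    using util_public[of t w] copt_pos[of t w] by (simp add: field_simps)
  also have "\<dots> = lam / E0 * l0 * track t w" unfolding copt_def marg_theta[symmetric] by simp
  finally show ?thesis using ab E0 by (simp add: field_simps)
qed

definition "V = lam * l0 / (\<beta> * E0) * Q"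

text \<open>The last equation is Euler's identity for a utility that is homogeneous of degree
  \<open>\<alpha> + \<beta>\<close>: marginal values priced at the multiplier add up to the
  budget.\<close>

lemma V: "total util = ennreal V" "regular util" "0 < V" "(\<alpha> + \<beta>) * V = lam * (real n * endow)"
proof -
  have c: "0 < lam * l0 / (\<beta> * E0)" using lam l0 ab E0 by simp
  have u: "util = (\<lambda>t w. lam * l0 / (\<beta> * E0) * track t w)" by (rule ext, rule ext, rule util_track)
  note cm = total_cmult[OF track_regular less_imp_le[OF c]]
  show "regular util" unfolding u by (rule cm(2))
  have "total util = ennreal (lam * l0 / (\<beta> * E0)) * ennreal Q" unfolding u cm(1) Q(2) ..
  also have "\<dots> = ennreal V" unfolding V_def by (rule ennreal_mult[symmetric, OF less_imp_le[OF c] less_imp_le[OF Q(1)]])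
  finally show "total util = ennreal V" .
  show "0 < V" unfolding V_def by (rule mult_pos_pos[OF c Q(1)])
  have "(\<alpha> + \<beta>) * V = lam * (l0 * El)" using ab E0 by (simp add: V_def El_def)
  also have "l0 * El = real n * endow" using El by (simp add: l0_def)
  finally show "(\<alpha> + \<beta>) * V = lam * (real n * endow)" .
qed

text \<open>Tangent plane of utility at the claimed optimum, its slopes rewritten by the first order
  conditions as multiples of the price of consumption and of \<open>marg\<close>.\<close>

lemma tangent:
  assumes "0 \<le> x" "0 \<le> c"
  shows "exp (- r * t) * cobb_douglas \<alpha> \<beta> x c
      \<le> real n * lam * xprice t w * x + lam / E0 * marg t w * c + (1 - \<alpha> - \<beta>) * util t w"
    and "exp (- r * t) * cobb_douglas \<alpha> \<beta> x c
      = real n * lam * xprice t w * x + lam / E0 * marg t w * c + (1 - \<alpha> - \<beta>) * util t w ==>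
      x = xopt t w \<and> c = copt t w"
proof -
  note ct = cobb_douglas_tangent[OF ab assms xopt_pos[of t w] copt_pos[of t w]]
  have e: "real n * lam * xprice t w * x + lam / E0 * marg t w * c + (1 - \<alpha> - \<beta>) * util t w
     = exp (- r * t) * (cobb_douglas \<alpha> \<beta> (xopt t w) (copt t w) * (\<alpha> * (x / xopt t w) + \<beta> * (c / copt t w) + (1 - \<alpha> - \<beta>)))"
  proof -
    have "exp (- r * t) * (cobb_douglas \<alpha> \<beta> (xopt t w) (copt t w) * (\<alpha> * (x / xopt t w) + \<beta> * (c / copt t w) + (1 - \<alpha> - \<beta>)))
      = util t w * (\<alpha> * (x / xopt t w) + \<beta> * (c / copt t w) + (1 - \<alpha> - \<beta>))" by (simp add: util_def)
    also have "\<dots> = (\<alpha> * util t w / xopt t w) * x + (\<beta> * util t w / copt t w) * c + (1 - \<alpha> - \<beta>) * util t w"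
      by (simp add: algebra_simps)
    finally show ?thesis unfolding util_private util_public by simp
  qed
  show "exp (- r * t) * cobb_douglas \<alpha> \<beta> x c
      \<le> real n * lam * xprice t w * x + lam / E0 * marg t w * c + (1 - \<alpha> - \<beta>) * util t w"
    unfolding e by (intro mult_left_mono ct(1)) simp
  assume "exp (- r * t) * cobb_douglas \<alpha> \<beta> x c
      = real n * lam * xprice t w * x + lam / E0 * marg t w * c + (1 - \<alpha> - \<beta>) * util t w"
  then show "x = xopt t w \<and> c = copt t w" unfolding e by (intro ct(2)) simp
qed

end

context levy_market
begin

lemma regular_inner:
  assumes "regular h"
  shows "(\<lambda>w. \<integral>\<^sup>+t\<in>{0..}. ennreal (h t w) \<partial>lborel) \<in> borel_measurable M"
proof -
  note [measurable] = regularD(1)[OF assms]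
  have "(\<lambda>w. \<integral>\<^sup>+t. ennreal (h (max 0 t) w) * indicator {0..} t \<partial>lborel) \<in> borel_measurable M"
    using regularD(1)[OF assms] by (intro lborel.borel_measurable_nn_integral) (simp add: case_prod_beta)
  also have "(\<lambda>w. \<integral>\<^sup>+t. ennreal (h (max 0 t) w) * indicator {0..} t \<partial>lborel) = (\<lambda>w. \<integral>\<^sup>+t\<in>{0..}. ennreal (h t w) \<partial>lborel)"
    by (intro ext nn_integral_cong) (auto simp: max_def split: split_indicator)
  finally show ?thesis .
qed

lemma adapted_increasing_regular:
  assumes C: "adapted_increasing C"
  shows "regular C"
  using adapted_increasing_measurable[OF C] C
  by (auto simp: regular_def adapted_increasing_def intro: increasing_path_nonneg)

end

lemma right_continuous_AE_eq:
  fixes f h :: "real => real"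
  assumes f: "\<And>t. 0 \<le> t ==> continuous (at_right t) f" and h: "\<And>t. 0 \<le> t ==> continuous (at_right t) h"
    and ae: "AE t in lborel. 0 \<le> t --> f t = h t" and t: "0 \<le> t"
  shows "f t = h t"
proof (rule ccontr)
  assume ne: "f t \<noteq> h t"
  have "((\<lambda>s. f s - h s) \<longlongrightarrow> f t - h t) (at_right t)"
    using f[OF t] h[OF t] unfolding continuous_within by (intro tendsto_diff)
  then have "\<forall>\<^sub>F s in at_right t. f s - h s \<noteq> 0"
    by (rule tendsto_imp_eventually_ne) (use ne in simp)
  then obtain b where b: "t < b" "\<And>s. t < s ==> s < b ==> f s - h s \<noteq> 0"
    unfolding eventually_at_right_field by auto
  have "AE s in lborel. s \<notin> {t<..<b}"
    using ae by eventually_elim (use b(2) t in force)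
  then have "emeasure lborel {t<..<b} = 0"
    by (subst (asm) AE_iff_measurable[where N="{t<..<b}"]) auto
  then show False using b(1) by simp
qed

section \<open>Welfare bound, existence and uniqueness of the optimum\<close>

context economy
begin

abbreviation "crra \<equiv> \<lambda>i::nat. cobb_douglas \<alpha> \<beta>"
abbreviation "weight \<equiv> \<lambda>i::nat. 1 / real n"
abbreviation "optimal \<equiv> planner_optimal M F n r crra weight xprice price (real n * endow)"
abbreviation "affordable \<equiv> feasible M F n xprice price (real n * endow)"
abbreviation "social_welfare \<equiv> welfare M n r crra weight"
abbreviation "planner_foc \<equiv> first_order_conditions M F n r crra weight xprice price (real n * endow)"
abbreviation "future_utility \<equiv> future_marginal n r crra weight"
abbreviation "total_cost \<equiv> cost M n xprice price"

lemma marg_regular: "regular marg"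
  using marg_pair_measurable by (simp add: regular_def marg_def)

lemma xprice_regular: "regular xprice"
proof -
  have [measurable]: "(\<lambda>z. X (max 0 (snd z)) (fst z)) \<in> borel_measurable MT"
    by (rule X.meas_at) auto
  have "(\<lambda>z. xprice (max 0 (snd z)) (fst z)) \<in> borel_measurable MT"
    unfolding xprice_def by measurable
  then show ?thesis by (simp add: regular_def xprice_def)
qed

lemma admissibleD:
  assumes a: "admissible M F n x C" and i: "i \<in> {1..n}"
  shows "regular (x i)" "adapted_increasing (C i)" "regular (C i)"
proof -
  have 1: "optional M F (x i)" "optional M F (C i)"
    and 2: "\<And>w t. w \<in> space M ==> 0 \<le> t ==> 0 \<le> x i t w"
    and 3: "\<And>w. w \<in> space M ==> increasing_path (\<lambda>t. C i t w)"
    using a i unfolding admissible_def increasing_path_def by blast+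
  show "regular (x i)" unfolding regular_def using X.optional_jointly_measurable[OF 1(1)] 2 by blast
  show C: "adapted_increasing (C i)" unfolding adapted_increasing_def using X.optional_adapted[OF 1(2)] 3 by blast
  show "regular (C i)" by (rule adapted_increasing_regular[OF C])
qed

lemma aggregate_regular:
  assumes a: "admissible M F n x C"
  shows "regular (aggregate n C)"
    and "total (\<lambda>t w. marg t w * aggregate n C t w) = (\<Sum>i=1..n. total (\<lambda>t w. marg t w * C i t w))"
proof -
  have "aggregate n C = (\<lambda>t w. \<Sum>i=1..n. C i t w)" by (intro ext) (simp add: aggregate_def)
  then show "regular (aggregate n C)" using total_sum[of "{1..n}" C] admissibleD(3)[OF a] by simp
  have "(\<lambda>t w. marg t w * aggregate n C t w) = (\<lambda>t w. \<Sum>i=1..n. marg t w * C i t w)"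
    by (intro ext) (simp add: aggregate_def sum_distrib_left)
  then show "total (\<lambda>t w. marg t w * aggregate n C t w) = (\<Sum>i=1..n. total (\<lambda>t w. marg t w * C i t w))"
    using total_sum[of "{1..n}" "\<lambda>i t w. marg t w * C i t w"] regular_mult[OF marg_regular admissibleD(3)[OF a]] by simp
qed

lemma aggregate_right_cont:
  assumes a: "admissible M F n x C" and "w \<in> space M" "0 \<le> t"
  shows "continuous (at_right t) (\<lambda>s. aggregate n C s w)"
  using assms unfolding aggregate_def admissible_def by (intro continuous_sum) auto

lemma cost_eq:
  assumes a: "\<And>i. i \<in> {1..n} ==> regular (x i) \<and> adapted_increasing (C i)"
  shows "total_cost x C = (\<Sum>i=1..n. total (\<lambda>t w. xprice t w * x i t w) + contribution_cost (C i))"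
  unfolding cost_def total_def
  by (intro sum.cong refl nn_integral_add regular_inner regular_mult[OF xprice_regular] contribution_cost_eq(2)) (use a in auto)

definition density :: "(nat => real => 'a => real) => (nat => real => 'a => real) => nat => real => 'a => real" where
  "density x C i t w = exp (- r * t) * cobb_douglas \<alpha> \<beta> (x i t w) (aggregate n C t w)"

text \<open>The tangent plane of \<open>tangent\<close>, evaluated along an arbitrary plan.\<close>

definition support :: "(nat => real => 'a => real) => (nat => real => 'a => real) => nat => real => 'a => real" where
  "support x C i t w = real n * lam * xprice t w * x i t w + lam / E0 * marg t w * aggregate n C t w + (1 - \<alpha> - \<beta>) * util t w"

lemma density_regular:
  assumes a: "admissible M F n x C" and i: "i \<in> {1..n}"
  shows "regular (density x C i)"
proof -
  note [measurable] = regularD(1)[OF admissibleD(1)[OF a i]] regularD(1)[OF aggregate_regular(1)[OF a]]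
  have "(\<lambda>z. density x C i (max 0 (snd z)) (fst z)) \<in> borel_measurable MT"
    unfolding density_def cobb_douglas_def by measurable
  then show ?thesis using ab by (simp add: regular_def density_def cobb_douglas_def)
qed

lemma welfare_eq: "social_welfare x C = ennreal (1 / real n) * (\<Sum>i=1..n. total (density x C i))"
  unfolding welfare_def total_def density_def by (rule sum_distrib_left[symmetric])

lemma support_regular:
  assumes a: "admissible M F n x C" and i: "i \<in> {1..n}"
  shows "regular (support x C i)"
    and "total (support x C i) = ennreal (real n * lam) * total (\<lambda>t w. xprice t w * x i t w)
       + ennreal (lam / E0) * total (\<lambda>t w. marg t w * aggregate n C t w) + ennreal ((1 - \<alpha> - \<beta>) * V)"
proof -
  have c: "0 \<le> real n * lam" "0 \<le> lam / E0" "0 \<le> 1 - \<alpha> - \<beta>" using lam E0 ab by auto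
  note r = regular_mult[OF xprice_regular admissibleD(1)[OF a i]] regular_mult[OF marg_regular aggregate_regular(1)[OF a]] V(2)
  note m = total_cmult[OF r(1) c(1)] total_cmult[OF r(2) c(2)] total_cmult[OF r(3) c(3)]
  note s = total_add[OF m(2) m(4)]
  note s' = total_add[OF s(2) m(6)]
  have e: "support x C i = (\<lambda>t w. real n * lam * (xprice t w * x i t w) + lam / E0 * (marg t w * aggregate n C t w) + (1 - \<alpha> - \<beta>) * util t w)"
    by (intro ext) (simp add: support_def mult.assoc)
  show "regular (support x C i)" unfolding e by (rule s'(2))
  have v: "ennreal (1 - \<alpha> - \<beta>) * ennreal V = ennreal ((1 - \<alpha> - \<beta>) * V)" using c V(3) by (simp add: ennreal_mult)
  show "total (support x C i) = ennreal (real n * lam) * total (\<lambda>t w. xprice t w * x i t w)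
       + ennreal (lam / E0) * total (\<lambda>t w. marg t w * aggregate n C t w) + ennreal ((1 - \<alpha> - \<beta>) * V)"
    unfolding e s'(1) s(1) m(1) m(3) m(5) V(1) v ..
qed

lemma density_le_support:
  assumes a: "admissible M F n x C" and i: "i \<in> {1..n}" and w: "w \<in> space M" "0 \<le> t"
  shows "density x C i t w \<le> support x C i t w"
  unfolding density_def support_def
  by (rule tangent(1)[OF regularD(2)[OF admissibleD(1)[OF a i] w] regularD(2)[OF aggregate_regular(1)[OF a] w]])

text \<open>The aggregate contribution appears in the plane of every agent, which produces a factor
  \<open>n\<close> on its cost; the slope \<open>n * lam\<close> does the same for private
  consumption. Each agent's contribution is bounded separately by
  \<open>marginal_value_le\<close>.\<close>

lemma total_support_le:
  assumes a: "admissible M F n x C"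
  shows "(\<Sum>i=1..n. total (support x C i)) \<le> ennreal (real n) * (ennreal lam * total_cost x C + ennreal ((1 - \<alpha> - \<beta>) * V))"
proof -
  have c: "0 \<le> real n" "0 \<le> lam" "0 \<le> lam / E0" using lam E0 by auto
  have lamE: "ennreal (lam / E0) * ennreal E0 = ennreal lam" using c(3) E0 by (simp add: ennreal_mult[symmetric])
  let ?T = "\<lambda>i. total (\<lambda>t w. xprice t w * x i t w)"
  let ?G = "total (\<lambda>t w. marg t w * aggregate n C t w)"
  have G: "?G \<le> ennreal E0 * (\<Sum>i=1..n. contribution_cost (C i))"
    unfolding aggregate_regular(2)[OF a] sum_distrib_left
  proof (rule sum_mono)
    fix i assume i: "i \<in> {1..n}"
    from marginal_value_le[OF admissibleD(2)[OF a i]]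
    show "total (\<lambda>t w. marg t w * C i t w) \<le> ennreal E0 * contribution_cost (C i)"
      unfolding total_def E0(2) .
  qed
  have "ennreal (lam / E0) * ?G \<le> ennreal (lam / E0) * (ennreal E0 * (\<Sum>i=1..n. contribution_cost (C i)))"
    by (rule mult_left_mono[OF G]) simp
  also have "\<dots> = ennreal lam * (\<Sum>i=1..n. contribution_cost (C i))" unfolding mult.assoc[symmetric] lamE ..
  finally have G': "ennreal (lam / E0) * ?G \<le> ennreal lam * (\<Sum>i=1..n. contribution_cost (C i))" .
  have "(\<Sum>i=1..n. total (support x C i))
      = (\<Sum>i=1..n. ennreal (real n * lam) * ?T i + ennreal (lam / E0) * ?G + ennreal ((1 - \<alpha> - \<beta>) * V))"
    by (intro sum.cong refl support_regular(2)[OF a])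
  also have "\<dots> = ennreal (real n * lam) * (\<Sum>i=1..n. ?T i) + ennreal (real n) * (ennreal (lam / E0) * ?G) + ennreal (real n) * ennreal ((1 - \<alpha> - \<beta>) * V)"
    by (simp add: sum.distrib sum_distrib_left ennreal_of_nat_eq_real_of_nat)
  also have "\<dots> \<le> ennreal (real n * lam) * (\<Sum>i=1..n. ?T i) + ennreal (real n) * (ennreal lam * (\<Sum>i=1..n. contribution_cost (C i))) + ennreal (real n) * ennreal ((1 - \<alpha> - \<beta>) * V)"
    by (intro add_mono order_refl mult_left_mono G') simp
  also have "\<dots> = ennreal (real n) * (ennreal lam * ((\<Sum>i=1..n. ?T i) + (\<Sum>i=1..n. contribution_cost (C i))) + ennreal ((1 - \<alpha> - \<beta>) * V))"
    unfolding ennreal_mult[OF c(1,2)] by (simp add: distrib_left mult.assoc)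
  also have "(\<Sum>i=1..n. ?T i) + (\<Sum>i=1..n. contribution_cost (C i)) = total_cost x C"
    using cost_eq[of x C] admissibleD(1,2)[OF a] by (simp add: sum.distrib)
  finally show ?thesis .
qed

lemma budget_value: "ennreal lam * ennreal (real n * endow) + ennreal ((1 - \<alpha> - \<beta>) * V) = ennreal V"
proof -
  have "ennreal lam * ennreal (real n * endow) = ennreal ((\<alpha> + \<beta>) * V)"
    unfolding V(4) using lam n w by (simp add: ennreal_mult)
  also have "ennreal ((\<alpha> + \<beta>) * V) + ennreal ((1 - \<alpha> - \<beta>) * V) = ennreal ((\<alpha> + \<beta>) * V + (1 - \<alpha> - \<beta>) * V)"
    using V(3) ab by (intro ennreal_plus[symmetric] mult_nonneg_nonneg) auto
  also have "(\<alpha> + \<beta>) * V + (1 - \<alpha> - \<beta>) * V = V" by (simp add: algebra_simps)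
  finally show ?thesis .
qed

lemma welfare_cancel: "ennreal (1 / real n) * (ennreal (real n) * z) = z"
  using n_pos by (simp add: mult.assoc[symmetric] ennreal_mult[symmetric])

lemma total_density_le:
  assumes a: "admissible M F n x C"
  shows "(\<Sum>i=1..n. total (density x C i)) \<le> (\<Sum>i=1..n. total (support x C i))"
  by (intro sum_mono total_mono density_le_support[OF a])

lemma welfare_le:
  assumes f: "affordable x C"
  shows "social_welfare x C \<le> ennreal V"
proof -
  have a: "admissible M F n x C" and c: "total_cost x C \<le> ennreal (real n * endow)"
    using f by (auto simp: feasible_def)
  have "social_welfare x C \<le> ennreal (1 / real n) * (ennreal (real n) * (ennreal lam * total_cost x C + ennreal ((1 - \<alpha> - \<beta>) * V)))"
    unfolding welfare_eq by (intro mult_left_mono order_trans[OF total_density_le[OF a] total_support_le[OF a]]) simp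
  also have "\<dots> \<le> ennreal lam * ennreal (real n * endow) + ennreal ((1 - \<alpha> - \<beta>) * V)"
    unfolding welfare_cancel by (intro add_mono mult_left_mono c) simp_all
  finally show ?thesis unfolding budget_value .
qed

text \<open>If welfare reaches the bound, every estimate in between is an equality. Then the budget
  binds since \<open>lam\<close> is positive, and utility meets its tangent plane almost everywhere,
  which by strictness happens only at the claimed point. Only the aggregate of the contributions is
  determined in this way.\<close>

lemma optimal_characterization:
  assumes f: "affordable x C" and opt: "ennreal V \<le> social_welfare x C"
  shows "total_cost x C = ennreal (real n * endow)"
    and "AE z in MT. 0 \<le> snd z -->
       aggregate n C (snd z) (fst z) = copt (snd z) (fst z) \<and> (\<forall>i\<in>{1..n}. x i (snd z) (fst z) = xopt (snd z) (fst z))"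
proof -
  let ?K = "\<lambda>z. aggregate n C (snd z) (fst z) = copt (snd z) (fst z) \<and> (\<forall>i\<in>{1..n}. x i (snd z) (fst z) = xopt (snd z) (fst z))"
  have a: "admissible M F n x C" and c: "total_cost x C \<le> ennreal (real n * endow)"
    using f by (auto simp: feasible_def)
  let ?D = "\<Sum>i=1..n. total (density x C i)" and ?S = "\<Sum>i=1..n. total (support x C i)"
  have "ennreal (real n) * ennreal V \<le> ennreal (real n) * (ennreal (1 / real n) * ?D)"
    using opt unfolding welfare_eq by (intro mult_left_mono) simp_all
  also have "\<dots> = ?D" using n_pos by (simp add: mult.assoc[symmetric] ennreal_mult[symmetric])
  finally have D: "ennreal (real n) * ennreal V \<le> ?D" .
  have "ennreal (real n) * ennreal V \<le> ennreal (real n) * (ennreal lam * total_cost x C + ennreal ((1 - \<alpha> - \<beta>) * V))"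
    by (rule order_trans[OF D order_trans[OF total_density_le[OF a] total_support_le[OF a]]])
  then have lower: "ennreal V \<le> ennreal lam * total_cost x C + ennreal ((1 - \<alpha> - \<beta>) * V)"
    using n_pos by (subst (asm) ennreal_mult_le_mult_iff) auto
  show cw: "total_cost x C = ennreal (real n * endow)"
  proof (rule antisym[OF c])
    obtain k where k: "0 \<le> k" "total_cost x C = ennreal k"
      using c by (cases "total_cost x C") (auto simp: top_unique)
    have "ennreal V \<le> ennreal (lam * k + (1 - \<alpha> - \<beta>) * V)"
      using lower V(3) ab lam k by (simp add: ennreal_mult[symmetric] ennreal_plus[symmetric] del: ennreal_plus)
    then have "V \<le> lam * k + (1 - \<alpha> - \<beta>) * V"
      using lam k V(3) ab by (subst (asm) ennreal_le_iff) auto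
    then have "lam * (real n * endow) \<le> lam * k" using V(4) by (simp add: algebra_simps)
    then show "ennreal (real n * endow) \<le> total_cost x C"
      unfolding k(2) using lam by (intro ennreal_leI) simp
  qed
  have S: "?S \<le> ennreal (real n) * ennreal V"
    using total_support_le[OF a] unfolding cw budget_value .
  note td = total_sum[of "{1..n}" "density x C", OF _ density_regular[OF a]]
  note ts = total_sum[of "{1..n}" "support x C", OF _ support_regular(1)[OF a]]
  have "AE z in MT. 0 \<le> snd z -->
      (\<Sum>i=1..n. density x C i (snd z) (fst z)) = (\<Sum>i=1..n. support x C i (snd z) (fst z))"
  proof (rule total_eq_imp_AE)
    show "regular (\<lambda>t w. \<Sum>i=1..n. density x C i t w)" "regular (\<lambda>t w. \<Sum>i=1..n. support x C i t w)"
      using td ts by auto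
    show "(\<Sum>i=1..n. density x C i t w) \<le> (\<Sum>i=1..n. support x C i t w)" if "w \<in> space M" "0 \<le> t" for t w
      by (intro sum_mono density_le_support[OF a] that)
    show "total (\<lambda>t w. \<Sum>i=1..n. support x C i t w) \<le> total (\<lambda>t w. \<Sum>i=1..n. density x C i t w)"
      using td ts order_trans[OF S D] by simp
    have "?D \<le> ennreal (real n) * ennreal V" by (rule order_trans[OF total_density_le[OF a] S])
    also have "\<dots> < \<infinity>" by (simp add: ennreal_mult_less_top)
    finally show "total (\<lambda>t w. \<Sum>i=1..n. density x C i t w) < \<infinity>" using td by simp
  qed
  then show "AE z in MT. 0 \<le> snd z -->
       ?K z"
    using AE_space
  proof eventually_elim
    case (elim z)
    have w: "fst z \<in> space M" using elim(2) by (auto simp: space_pair_measure)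
    show ?case
    proof
      assume t: "0 \<le> snd z"
      have eq: "x i (snd z) (fst z) = xopt (snd z) (fst z) \<and> aggregate n C (snd z) (fst z) = copt (snd z) (fst z)"
        if i: "i \<in> {1..n}" for i
      proof -
        have "density x C i (snd z) (fst z) = support x C i (snd z) (fst z)"
          by (rule sum_mono_inv[OF elim(1)[rule_format, OF t]]) (use density_le_support[OF a _ w t] i in auto)
        then show ?thesis unfolding density_def support_def
          by (rule tangent(2)[OF regularD(2)[OF admissibleD(1)[OF a i] w t] regularD(2)[OF aggregate_regular(1)[OF a] w t]])
      qed
      \<comment> \<open>The identity for the aggregate is read off from the plane of some agent, and
        there is one.\<close>
      have "1 \<in> {1..n}" using n by simp
      then show "?K z"
        using eq by blast
    qed
  qed
qed

lemma copt_adapted_increasing: "adapted_increasing copt" "adapted_increasing theta"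
  using tracking_adapted_increasing[OF kappa(3) l0] tracking_adapted_increasing[OF kappa(3), of 1]
  by (simp_all add: copt_def[abs_def] theta_def[abs_def])

lemma theta_flat:
  assumes "w \<in> space M"
  shows "AE y in lborel. 0 < y --> level theta y w < \<infinity> -->
       low (enn2real (level theta y w)) w = g (enn2real (level theta y w)) w"
  using tracking_flat[OF kappa(3), of 1, OF _ assms] by (simp add: theta_def[abs_def])

lemma gam_regular: "regular gam"
proof -
  have [measurable]: "(\<lambda>z. X (max 0 (snd z)) (fst z)) \<in> borel_measurable MT"
    "(\<lambda>z. low (max 0 (snd z)) (fst z)) \<in> borel_measurable MT"
    by (rule X.meas_at low_measurable_at; auto)+
  have "(\<lambda>z. gam (max 0 (snd z)) (fst z)) \<in> borel_measurable MT"
    unfolding gam_def by measurable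
  then show ?thesis using c0 A by (simp add: regular_def gam_def)
qed

text \<open>The Stieltjes integral is computed through the marginal value: for \<open>theta\<close>
  the two differ by the factor \<open>E0\<close>, and \<open>marg * theta\<close> is
  \<open>track\<close>.\<close>

lemma theta_cost: "contribution_cost theta = ennreal (Q / E0)"
proof -
  have "ennreal E0 * contribution_cost theta = total (\<lambda>t w. marg t w * theta t w)"
    unfolding total_def E0(2)[symmetric] by (rule marginal_value_eq_cost[symmetric, OF copt_adapted_increasing(2) theta_flat])
  also have "\<dots> = ennreal Q" unfolding marg_theta Q(2)[symmetric] ..
  finally have e: "ennreal E0 * contribution_cost theta = ennreal Q" .
  have "ennreal (1 / E0) * (ennreal E0 * contribution_cost theta) = contribution_cost theta"
    using E0(1) by (simp add: mult.assoc[symmetric] ennreal_mult[symmetric])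
  then show ?thesis unfolding e using E0(1) Q(1) by (simp add: ennreal_mult[symmetric])
qed

lemma gam_cost: "total (\<lambda>t w. xprice t w * gam t w) = ennreal (\<alpha> / (\<beta> * E0) * Q)"
proof -
  have c: "0 \<le> \<alpha> / (\<beta> * E0)" using ab E0 by simp
  show ?thesis unfolding xprice_gam total_cmult(1)[OF track_regular c] Q(2)
    by (rule ennreal_mult[symmetric, OF c less_imp_le[OF Q(1)]])
qed

lemma El_eq:
  "(\<integral>\<^sup>+w. (\<integral>\<^sup>+t\<in>{0..}. ennreal (xprice t w * gam t w) \<partial>lborel) +
      (\<integral>\<^sup>+t\<in>{0..}. ennreal (price t w) \<partial>stieltjes (\<lambda>t. theta t w)) \<partial>M) = ennreal El"
proof -
  have "(\<integral>\<^sup>+w. (\<integral>\<^sup>+t\<in>{0..}. ennreal (xprice t w * gam t w) \<partial>lborel) +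
      (\<integral>\<^sup>+t\<in>{0..}. ennreal (price t w) \<partial>stieltjes (\<lambda>t. theta t w)) \<partial>M)
    = total (\<lambda>t w. xprice t w * gam t w) + contribution_cost theta"
    unfolding total_def
    by (intro nn_integral_add regular_inner regular_mult[OF xprice_regular gam_regular] contribution_cost_eq(2) copt_adapted_increasing)
  also have "\<dots> = ennreal (\<alpha> / (\<beta> * E0) * Q + Q / E0)"
    unfolding gam_cost theta_cost using ab E0 Q by (intro ennreal_plus[symmetric]) auto
  also have "\<alpha> / (\<beta> * E0) * Q + Q / E0 = El" using ab E0 by (simp add: El_def field_simps)
  finally show ?thesis .
qed

lemma path_cost_scale:
  assumes "w \<in> space M" "0 < c"
  shows "(\<integral>\<^sup>+t\<in>{0..}. ennreal (price t w) \<partial>stieltjes (\<lambda>t. c * theta t w))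
     = ennreal c * (\<integral>\<^sup>+t\<in>{0..}. ennreal (price t w) \<partial>stieltjes (\<lambda>t. theta t w))"
proof (rule nn_integral_stieltjes_scale[OF _ assms(2)])
  show "increasing_path (\<lambda>t. theta t w)"
    using copt_adapted_increasing(2) assms(1) by (simp add: adapted_increasing_def)
  have [measurable]: "(\<lambda>t. price t w) \<in> borel_measurable borel"
    by (rule price_measurable_at) (use assms in auto)
  show "(\<lambda>t. ennreal (price t w)) \<in> borel_measurable borel" by measurable
qed

definition "xcan = (\<lambda>i::nat. xopt)"
text \<open>The optimum fixes only the aggregate contribution; equal shares are one way to divide
  it.\<close>

definition "ccan = (\<lambda>i::nat. \<lambda>t w. l0 / real n * theta t w)"

lemma aggregate_ccan: "aggregate n ccan t w = copt t w"
  using n_pos by (simp add: aggregate_def ccan_def copt_def)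

lemma canonical_feasible: "affordable xcan ccan"
proof -
  have l: "0 < l0 / real n" using l0 n_pos by simp
  have ai: "adapted_increasing (ccan i)" for i
    using tracking_adapted_increasing[OF kappa(3) l] by (simp add: ccan_def theta_def[abs_def])
  have cx: "cadlag_adapted M F xopt"
    unfolding cadlag_adapted_def adapted_def
  proof (intro conjI allI impI ballI)
    fix t :: real assume "0 \<le> t"
    note [measurable] = low_adapted[OF this] X.adap[OF this]
    show "xopt t \<in> borel_measurable (F t)" unfolding xopt_exp lx_def by measurable
  next
    fix w assume w: "w \<in> space M"
    show "cadlag (\<lambda>t. xopt t w)" unfolding xopt_def gam_def
      by (rule cadlag_compose2[of "\<lambda>x y. 1 / real n * l0 * (c0 / A * exp (- ((x + \<beta> * \<kappa> * y) / (1 - \<alpha>))))", OF _ X.cad[OF w] low_cadlag[OF w]])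
        (use ab A n in \<open>auto simp: case_prod_beta intro!: continuous_intros\<close>)
  qed
  have cc: "cadlag_adapted M F (ccan i)" for i
    unfolding cadlag_adapted_def adapted_def
  proof (intro conjI allI impI ballI)
    show "ccan i t \<in> borel_measurable (F t)" if "0 \<le> t" for t
      using ai[of i] that by (simp add: adapted_increasing_def)
    fix w assume w: "w \<in> space M"
    show "cadlag (\<lambda>t. ccan i t w)" unfolding ccan_def theta_def
      by (rule cadlag_compose[of "\<lambda>y. l0 / real n * exp (- \<kappa> * y)", OF _ low_cadlag[OF w]]) (intro continuous_intros)
  qed
  have adm: "admissible M F n xcan ccan"
    unfolding admissible_def
    using X.cadlag_adapted_optional[OF cx] X.cadlag_adapted_optional[OF cc] ai xopt_pos
    by (auto simp: xcan_def adapted_increasing_def increasing_path_def less_imp_le)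
  have cn: "0 \<le> 1 / real n * l0" using l by simp
  have 1: "total (\<lambda>t w. xprice t w * xopt t w) = ennreal (l0 / real n) * ennreal (\<alpha> / (\<beta> * E0) * Q)"
  proof -
    have "(\<lambda>t w. xprice t w * xopt t w) = (\<lambda>t w. 1 / real n * l0 * (xprice t w * gam t w))"
      by (intro ext) (simp add: xopt_def)
    then show ?thesis using total_cmult(1)[OF regular_mult[OF xprice_regular gam_regular] cn] by (simp add: gam_cost)
  qed
  have 2: "contribution_cost (ccan i) = ennreal (l0 / real n) * ennreal (Q / E0)" for i
    unfolding ccan_def theta_cost[symmetric]
    by (subst nn_integral_cmult[symmetric, OF contribution_cost_eq(2)[OF copt_adapted_increasing(2)]])
      (intro nn_integral_cong path_cost_scale l)
  have "total_cost xcan ccan = (\<Sum>i=1..n. total (\<lambda>t w. xprice t w * xcan i t w) + contribution_cost (ccan i))"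
    by (rule cost_eq) (use admissibleD(1,2)[OF adm] in blast)
  also have "\<dots> = (\<Sum>i=1..n. ennreal (l0 / real n * El))"
  proof (intro sum.cong refl)
    fix i
    have "ennreal (l0 / real n) * ennreal (\<alpha> / (\<beta> * E0) * Q) + ennreal (l0 / real n) * ennreal (Q / E0) = ennreal (l0 / real n * (\<alpha> / (\<beta> * E0) * Q + Q / E0))"
    proof -
      have 3: "ennreal c * ennreal p + ennreal c * ennreal q = ennreal (c * (p + q))" if "0 \<le> c" "0 \<le> p" "0 \<le> q" for c p q
        using that by (simp add: ennreal_mult ennreal_plus distrib_left)
      have "0 \<le> \<alpha> / (\<beta> * E0) * Q" "0 \<le> Q / E0" using ab E0 Q by auto
      from 3[OF less_imp_le[OF l] this] show ?thesis .
    qed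
    also have "\<alpha> / (\<beta> * E0) * Q + Q / E0 = El" using ab E0 by (simp add: El_def field_simps)
    finally show "total (\<lambda>t w. xprice t w * xcan i t w) + contribution_cost (ccan i) = ennreal (l0 / real n * El)"
      unfolding xcan_def 1 2 .
  qed
  also have "\<dots> = ennreal (real n * endow)"
  proof -
    have "(\<Sum>i=1..n. ennreal (l0 / real n * El)) = ennreal (\<Sum>i=1..n. l0 / real n * El)"
      by (intro sum_ennreal mult_nonneg_nonneg less_imp_le[OF l] less_imp_le[OF El])
    also have "(\<Sum>i=1..n. l0 / real n * El) = real n * endow" using n_pos El by (simp add: l0_def)
    finally show ?thesis .
  qed
  finally show ?thesis unfolding feasible_def using adm by simp
qed

lemma canonical_welfare: "social_welfare xcan ccan = ennreal V"
proof -
  have "density xcan ccan i = util" for i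
    by (intro ext) (simp add: density_def util_def aggregate_ccan xcan_def)
  then have "(\<Sum>i=1..n. total (density xcan ccan i)) = ennreal (real n) * ennreal V"
    by (simp add: V(1) ennreal_of_nat_eq_real_of_nat)
  then show ?thesis unfolding welfare_eq by (simp only: welfare_cancel)
qed

lemma canonical_optimal: "optimal xcan ccan"
  unfolding planner_optimal_def canonical_welfare using canonical_feasible welfare_le by blast

text \<open>An optimal plan does at least as well as the canonical one, so it attains the welfare
  bound and \<open>optimal_characterization\<close> applies. For the aggregate, right continuity of
  both paths upgrades almost every time to every time.\<close>

lemma optimum:
  assumes "optimal x C"
  shows "admissible M F n x C" "total_cost x C = ennreal (real n * endow)"
    and "AE z in MT. 0 \<le> snd z -->
       aggregate n C (snd z) (fst z) = copt (snd z) (fst z) \<and> (\<forall>i\<in>{1..n}. x i (snd z) (fst z) = xopt (snd z) (fst z))"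
    and "AE w in M. \<forall>t\<ge>0. aggregate n C t w = copt t w"
proof -
  have f: "affordable x C"
    and o: "ennreal V \<le> social_welfare x C"
    using assms canonical_feasible canonical_welfare unfolding planner_optimal_def by metis+
  show a: "admissible M F n x C" using f by (simp add: feasible_def)
  show "total_cost x C = ennreal (real n * endow)" by (rule optimal_characterization(1)[OF f o])
  show ae: "AE z in MT. 0 \<le> snd z -->
       aggregate n C (snd z) (fst z) = copt (snd z) (fst z) \<and> (\<forall>i\<in>{1..n}. x i (snd z) (fst z) = xopt (snd z) (fst z))"
    by (rule optimal_characterization(2)[OF f o])
  from M_time.AE_pair[OF ae] AE_space[of M]
  show "AE w in M. \<forall>t\<ge>0. aggregate n C t w = copt t w"
  proof eventually_elim
    case (elim w)
    have w: "w \<in> space M" by (rule elim(2))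
    have "increasing_path (\<lambda>t. copt t w)" using copt_adapted_increasing(1) w by (simp add: adapted_increasing_def)
    then have rc: "continuous (at_right t) (\<lambda>s. copt s w)" if "0 \<le> t" for t using that by (simp add: increasing_path_def)
    have "AE t in lborel. 0 \<le> t --> aggregate n C t w = copt t w"
      using elim(1) by eventually_elim simp
    then show ?case
      using right_continuous_AE_eq[where f="\<lambda>s. aggregate n C s w" and h="\<lambda>s. copt s w", OF aggregate_right_cont[OF a w] rc] by blast
  qed
qed

end

section \<open>First order conditions\<close>

context levy_market
begin

lemma ratio_shift: "e \<le> e' ==> ratio e' s u w \<le> (e' - e) + ratio e s u w"
  unfolding ratio_def by (auto simp: min_def)

lemma ratio_mono: "e \<le> e' ==> ratio e s u w \<le> ratio e' s u w"
  unfolding ratio_def by (auto simp: min_def)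

lemma future_mean_mono:
  assumes "e \<le> e'"
  shows "future_mean e \<le> future_mean e'"
  unfolding future_mean_def ratio_mean_def using assms
  by (intro nn_integral_mono mult_right_mono mult_left_mono ennreal_leI) (auto intro: ratio_mono)

lemma future_mean_shift:
  assumes "e \<le> e'" "e' \<le> 0"
  shows "future_mean e' \<le> ennreal (exp (e' - e)) * future_mean e"
proof -
  have e: "e \<le> 0" using assms by simp
  have rm: "ratio_mean u e' \<le> ennreal (exp (e' - e)) * ratio_mean u e" if u: "0 \<le> u" for u
  proof -
    have [measurable]: "(\<lambda>w. ratio e 0 u w) \<in> borel_measurable M"
      by (rule ratio_measurable_at) (use e u in auto)
    have "ratio_mean u e' \<le> (\<integral>\<^sup>+w. ennreal (exp (e' - e)) * ennreal (exp (ratio e 0 u w)) \<partial>M)"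
      unfolding ratio_mean_def
      by (intro nn_integral_mono) (simp add: ennreal_mult[symmetric] exp_add[symmetric] ratio_shift[OF assms(1)])
    also have "\<dots> = ennreal (exp (e' - e)) * ratio_mean u e"
      unfolding ratio_mean_def by (rule nn_integral_cmult) measurable
    finally show ?thesis .
  qed
  note m = ratio_mean_measurable[of e]
  have "future_mean e' \<le> (\<integral>\<^sup>+u. ennreal (exp (e' - e)) * (ennreal (exp (- r * u)) * ratio_mean (max 0 u) (min e 0) * indicator {0..} u) \<partial>lborel)"
    unfolding future_mean_def
  proof (intro nn_integral_mono)
    fix u :: real
    show "ennreal (exp (- r * u)) * ratio_mean u e' * indicator {0..} u
      \<le> ennreal (exp (e' - e)) * (ennreal (exp (- r * u)) * ratio_mean (max 0 u) (min e 0) * indicator {0..} u)"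
    proof (cases "0 \<le> u")
      case True
      have "ennreal (exp (- r * u)) * ratio_mean u e' \<le> ennreal (exp (- r * u)) * (ennreal (exp (e' - e)) * ratio_mean u e)"
        by (rule mult_left_mono[OF rm[OF True]]) simp
      then show ?thesis using True e by (simp add: max_def min_def mult_ac)
    qed simp
  qed
  also have "\<dots> = ennreal (exp (e' - e)) * future_mean e"
    unfolding future_mean_alt[OF e]
  proof (rule nn_integral_cmult)
    have [measurable]: "(\<lambda>u. ratio_mean (max 0 u) (min e 0)) \<in> borel_measurable borel" by (rule m)
    show "(\<lambda>u. ennreal (exp (- r * u)) * ratio_mean (max 0 u) (min e 0) * indicator {0..} u) \<in> borel_measurable lborel"
      by measurable
  qed
  finally show ?thesis .
qed

end

text \<open>An optimal plan agrees with the explicit one only up to a null set, so the measurability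
  of its future marginal utility is drawn from completeness.\<close>

lemma complete_measurable_AE:
  assumes c: "complete_measure M" and ae: "AE w in M. f w = h w" and h: "h \<in> measurable M N"
    and sp: "\<And>w. w \<in> space M ==> f w \<in> space N"
  shows "f \<in> measurable M N"
proof (rule measurableI)
  interpret complete_measure M by (rule c)
  fix A assume A: "A \<in> sets N"
  obtain Z where Z: "Z \<in> null_sets M" "{w \<in> space M. f w \<noteq> h w} \<subseteq> Z" using ae by (rule AE_E3) blast
  have e: "f -` A \<inter> space M = (h -` A \<inter> space M - Z) \<union> (f -` A \<inter> space M \<inter> Z)" using Z(2) by auto
  have p: "f -` A \<inter> space M \<inter> Z \<in> sets M" using complete[OF _ Z(1)] by auto
  have q: "h -` A \<inter> space M - Z \<in> sets M"
    by (rule sets.Diff[OF measurable_sets[OF h A] null_setsD2[OF Z(1)]])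
  show "f -` A \<inter> space M \<in> sets M" by (subst e) (rule sets.Un[OF q p])
qed (rule sp)

context economy
begin

text \<open>Real-valued version of \<open>future_mean\<close>, made constant to the right of 0 so
  that it is continuous on the whole line; at 0 it equals \<open>E0\<close>.\<close>

definition hedge :: "real => real" where
  "hedge e = enn2real (future_mean (min e 0))"

lemma hedge: "future_mean (min e 0) = ennreal (hedge e)" "0 \<le> hedge e"
proof -
  have "future_mean (min e 0) \<le> future_mean 0" by (rule future_mean_mono) simp
  then have "future_mean (min e 0) < \<infinity>" using future_mean_fin by (rule le_less_trans)
  then show "future_mean (min e 0) = ennreal (hedge e)" by (simp add: hedge_def)
  show "0 \<le> hedge e" by (simp add: hedge_def)
qed

lemma hedge_0: "hedge 0 = E0" by (simp add: hedge_def E0_def)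

text \<open>Shifting the gap by \<open>e' - e\<close> changes \<open>ratio\<close> by at most that
  amount. Together with monotonicity this makes \<open>hedge\<close> continuous, which is needed for
  \<open>wait\<close> to have cadlag paths.\<close>

lemma hedge_bounds:
  assumes "e \<le> e'"
  shows "hedge e \<le> hedge e'" "hedge e' \<le> exp (e' - e) * hedge e"
proof -
  have "min e 0 \<le> min e' 0" "min e' 0 \<le> 0" using assms by auto
  note f = future_mean_mono[OF this(1)] future_mean_shift[OF this]
  show "hedge e \<le> hedge e'" using f(1) hedge(2) unfolding hedge(1) by (simp add: ennreal_le_iff)
  have "ennreal (hedge e') \<le> ennreal (exp (min e' 0 - min e 0) * hedge e)"
    using f(2) hedge(2) unfolding hedge(1) by (simp add: ennreal_mult)
  then have "hedge e' \<le> exp (min e' 0 - min e 0) * hedge e"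
    by (subst (asm) ennreal_le_iff) (simp_all add: hedge(2))
  also have "\<dots> \<le> exp (e' - e) * hedge e"
    using assms by (intro mult_right_mono hedge(2)) auto
  finally show "hedge e' \<le> exp (e' - e) * hedge e" .
qed

lemma hedge_continuous: "continuous_on UNIV hedge"
proof -
  have "isCont hedge e" for e
  proof -
    have "(hedge \<longlongrightarrow> hedge e) (at e)"
    proof (rule tendsto_sandwich)
      have lo: "exp (- \<bar>x - e\<bar>) * hedge e \<le> hedge x" and hi: "hedge x \<le> exp \<bar>x - e\<bar> * hedge e" for x
      proof -
        have 1: "exp (- \<bar>x - e\<bar>) * hedge e \<le> hedge e" "hedge e \<le> exp \<bar>x - e\<bar> * hedge e"
          using hedge(2)[of e] by (auto intro: mult_left_le_one_le mult_left_le simp: mult_le_cancel_right1)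
        have *: "exp (- \<bar>x - e\<bar>) * (exp \<bar>x - e\<bar> * y) = y" for y
          by (simp add: mult.assoc[symmetric] exp_add[symmetric])
        have 2: "exp (- \<bar>x - e\<bar>) * hedge e \<le> hedge x \<and> hedge x \<le> exp \<bar>x - e\<bar> * hedge e"
        proof (cases "e \<le> x")
          case True
          then show ?thesis using hedge_bounds[OF True] 1 by simp
        next
          case False
          then have xe: "x \<le> e" by simp
          have "exp (- \<bar>x - e\<bar>) * hedge e \<le> exp (- \<bar>x - e\<bar>) * (exp \<bar>x - e\<bar> * hedge x)"
            using hedge_bounds(2)[OF xe] xe by (intro mult_left_mono) auto
          then show ?thesis unfolding * using hedge_bounds(1)[OF xe] 1 by simp
        qed
        then show "exp (- \<bar>x - e\<bar>) * hedge e \<le> hedge x" "hedge x \<le> exp \<bar>x - e\<bar> * hedge e" by auto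
      qed
      show "\<forall>\<^sub>F x in at e. exp (- \<bar>x - e\<bar>) * hedge e \<le> hedge x" "\<forall>\<^sub>F x in at e. hedge x \<le> exp \<bar>x - e\<bar> * hedge e"
        using lo hi by (auto intro: always_eventually)
      have "((\<lambda>x. exp (- \<bar>x - e\<bar>) * hedge e) \<longlongrightarrow> exp (- \<bar>e - e\<bar>) * hedge e) (at e)"
        "((\<lambda>x. exp \<bar>x - e\<bar> * hedge e) \<longlongrightarrow> exp \<bar>e - e\<bar> * hedge e) (at e)"
        by (intro tendsto_intros)+
      then show "((\<lambda>x. exp (- \<bar>x - e\<bar>) * hedge e) \<longlongrightarrow> hedge e) (at e)" "((\<lambda>x. exp \<bar>x - e\<bar> * hedge e) \<longlongrightarrow> hedge e) (at e)"
        by simp_all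
    qed
    then show ?thesis by (simp add: isCont_def)
  qed
  then show ?thesis by (simp add: continuous_on_eq_continuous_at)
qed

lemma hedge_measurable [measurable]: "hedge \<in> borel_measurable borel"
  by (rule borel_measurable_continuous_onI[OF hedge_continuous])

text \<open>The conditional expectation of the marginal utility still to come, by the Markov property.\<close>

definition wait :: "real => 'a => real" where
  "wait t w = lam / E0 * (price t w * hedge (low t w - g t w))"

lemma wait_cadlag_adapted: "cadlag_adapted M F wait"
  unfolding cadlag_adapted_def adapted_def
proof (intro conjI allI impI ballI)
  fix t :: real assume t: "0 \<le> t"
  note [measurable] = low_adapted[OF t] g_adap[OF t] price_adapted[OF t]
  show "wait t \<in> borel_measurable (F t)" unfolding wait_def by measurable
next
  fix w assume w: "w \<in> space M"
  have h: "cadlag (\<lambda>t. hedge (low t w - g t w))"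
    by (rule cadlag_compose2[of "\<lambda>x y. hedge (x - y)", OF _ low_cadlag[OF w] g_cadlag[OF w]])
      (auto simp: case_prod_beta intro!: continuous_intros continuous_on_compose2[OF hedge_continuous])
  have p: "cadlag (\<lambda>t. price t w)" unfolding price_def
    by (rule cadlag_compose2[of "\<lambda>x y. exp (- r * x + y)", OF _ cadlag_ident Y.cad[OF w]])
      (auto simp: case_prod_beta intro!: continuous_intros)
  show "cadlag (\<lambda>t. wait t w)" unfolding wait_def
    by (rule cadlag_compose2[of "\<lambda>x y. lam / E0 * (x * y)", OF _ p h])
      (use E0(1) in \<open>auto simp: case_prod_beta intro!: continuous_intros\<close>)
qed

lemma wait_nonneg: "0 \<le> wait t w"
  using lam E0 hedge(2) by (simp add: wait_def price_def)

lemma lamE: "0 < lam / E0" "ennreal (lam / E0) * ennreal E0 = ennreal lam"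
  using lam E0 by (simp_all add: ennreal_mult[symmetric])

lemma future_measurable:
  assumes [measurable]: "e \<in> borel_measurable M" "T \<in> borel_measurable M" and le: "\<And>w. w \<in> space M ==> e w \<le> 0 \<and> 0 \<le> T w"
  shows "(\<lambda>w. future (e w) (T w) w) \<in> borel_measurable M"
proof -
  have [measurable]: "(\<lambda>z. ratio (e (fst z)) (T (fst z)) (max 0 (snd z)) (fst z)) \<in> borel_measurable MT"
    by (rule ratio_measurable_at) (use le in \<open>auto simp: space_pair_measure\<close>)
  have "(\<lambda>w. \<integral>\<^sup>+u. ennreal (exp (- r * u)) * ennreal (exp (ratio (e w) (T w) (max 0 u) w)) * indicator {0..} u \<partial>lborel) \<in> borel_measurable M"
    by (intro lborel.borel_measurable_nn_integral) (simp add: case_prod_beta)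
  also have "(\<lambda>w. \<integral>\<^sup>+u. ennreal (exp (- r * u)) * ennreal (exp (ratio (e w) (T w) (max 0 u) w)) * indicator {0..} u \<partial>lborel)
     = (\<lambda>w. future (e w) (T w) w)"
    unfolding future_def by (intro ext nn_integral_cong) (auto simp: max_def split: split_indicator)
  finally show ?thesis .
qed

lemma marg_after_meas:
  assumes [measurable]: "\<tau> \<in> borel_measurable M"
  shows "(\<lambda>w. marg_after (\<tau> w) w) \<in> borel_measurable M"
proof -
  have [measurable]: "(\<lambda>z. marg (max 0 (snd z)) (fst z)) \<in> borel_measurable MT" by (rule marg_pair_measurable)
  have "(\<lambda>w. \<integral>\<^sup>+t. ennreal (marg (max 0 t) w) * (if 0 \<le> t \<and> \<tau> w \<le> ennreal t then 1 else 0) \<partial>lborel) \<in> borel_measurable M"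
    by (intro lborel.borel_measurable_nn_integral) (simp add: case_prod_beta)
  also have "(\<lambda>w. \<integral>\<^sup>+t. ennreal (marg (max 0 t) w) * (if 0 \<le> t \<and> \<tau> w \<le> ennreal t then 1 else 0) \<partial>lborel) = (\<lambda>w. marg_after (\<tau> w) w)"
    unfolding marg_after_def by (intro ext nn_integral_cong) (auto simp: max_def split: split_indicator)
  finally show ?thesis .
qed

lemma cond_exp_sub: "subalgebra M G ==> sigma_finite_subalgebra M G"
  by (intro finite_measure_subalgebra_is_sigma_finite) (simp add: finite_measure_subalgebra_def finite_measure_subalgebra_axioms_def X.finite_measure_axioms)

text \<open>By \<open>marg_after_le\<close> the integrand is dominated by one whose conditional
  expectation is known exactly: the strong Markov property gives \<open>lam\<close> times the
  stopped price.\<close>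

lemma stopping_bound:
  assumes \<tau>: "ext_stopping_time M F \<tau>"
    and f: "AE w in M. f w = ennreal (lam / E0) * marg_after (\<tau> w) w"
  shows "AE w in M. \<tau> w < \<infinity> --> nn_cond_exp M (stopped_algebra M F \<tau>) f w \<le> ennreal (lam * price (enn2real (\<tau> w)) w)"
proof -
  note sub = X.subalgebra_stopped[OF \<tau>]
  interpret S: sigma_finite_subalgebra M "stopped_algebra M F \<tau>" by (rule cond_exp_sub[OF sub])
  have [measurable]: "\<tau> \<in> borel_measurable M"
    using X.stopping_time_measurable_stopped[OF \<tau>] sub by (rule measurable_from_subalg[rotated])
  have sp: "stopped_price \<tau> \<in> borel_measurable (stopped_algebra M F \<tau>)" by (rule stopped_price_measurable[OF \<tau>])
  have spM [measurable]: "stopped_price \<tau> \<in> borel_measurable M" by (rule measurable_from_subalg[OF sub sp])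
  have [measurable]: "(\<lambda>w. future 0 (enn2real (\<tau> w)) w) \<in> borel_measurable M" by (rule future_measurable) auto
  define h where "h w = ennreal (lam / E0) * (stopped_price \<tau> w * future 0 (enn2real (\<tau> w)) w)" for w
  have hM: "h \<in> borel_measurable M" unfolding h_def by measurable
  have fM: "f \<in> borel_measurable M"
    by (rule complete_measurable_AE[OF complete f]) (use marg_after_meas[of \<tau>] in \<open>simp_all\<close>)
  have "AE w in M. f w \<le> h w"
    using f AE_space by eventually_elim (auto simp: h_def intro!: mult_left_mono marg_after_le)
  from S.nn_cond_exp_mono[OF this fM hM]
  have 1: "AE w in M. nn_cond_exp M (stopped_algebra M F \<tau>) f w \<le> nn_cond_exp M (stopped_algebra M F \<tau>) h w" .
  have 2: "AE w in M. ennreal lam * stopped_price \<tau> w = nn_cond_exp M (stopped_algebra M F \<tau>) h w"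
  proof (rule S.nn_cond_exp_charact[OF _ hM])
    show "(\<lambda>w. ennreal lam * stopped_price \<tau> w) \<in> borel_measurable (stopped_algebra M F \<tau>)"
      by (rule borel_measurable_times_ennreal[OF _ sp]) simp
    fix B assume B: "B \<in> sets (stopped_algebra M F \<tau>)"
    have BM [measurable]: "B \<in> sets M" using B sub by (auto simp: subalgebra_def)
    have "(\<integral>\<^sup>+w\<in>B. h w \<partial>M) = (\<integral>\<^sup>+w. ennreal (lam / E0) * (indicator B w * (stopped_price \<tau> w * future 0 (enn2real (\<tau> w)) w)) \<partial>M)"
      unfolding h_def by (intro nn_integral_cong) (simp only: mult_ac)
    also have "\<dots> = ennreal (lam / E0) * (\<integral>\<^sup>+w. indicator B w * (stopped_price \<tau> w * future 0 (enn2real (\<tau> w)) w) \<partial>M)"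
      by (rule nn_integral_cmult) measurable
    also have "(\<integral>\<^sup>+w. indicator B w * (stopped_price \<tau> w * future 0 (enn2real (\<tau> w)) w) \<partial>M) = (\<integral>\<^sup>+w. indicator B w * stopped_price \<tau> w \<partial>M) * future_mean 0"
      by (rule stopped_future[OF \<tau>]) (use B in simp)
    also have "ennreal (lam / E0) * ((\<integral>\<^sup>+w. indicator B w * stopped_price \<tau> w \<partial>M) * future_mean 0)
       = ennreal lam * (\<integral>\<^sup>+w. indicator B w * stopped_price \<tau> w \<partial>M)"
      unfolding E0(2) lamE(2)[symmetric] by (simp only: mult_ac)
    also have "\<dots> = (\<integral>\<^sup>+w. ennreal lam * (indicator B w * stopped_price \<tau> w) \<partial>M)"
      by (rule nn_integral_cmult[symmetric]) measurable
    also have "\<dots> = (\<integral>\<^sup>+w\<in>B. (ennreal lam * stopped_price \<tau> w) \<partial>M)"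
      by (intro nn_integral_cong) (simp only: mult_ac)
    finally show "(\<integral>\<^sup>+w\<in>B. h w \<partial>M) = (\<integral>\<^sup>+w\<in>B. (ennreal lam * stopped_price \<tau> w) \<partial>M)" .
  qed
  from 1 2 show ?thesis
  proof eventually_elim
    case (elim w)
    show ?case
    proof
      assume "\<tau> w < \<infinity>"
      then have "ennreal lam * stopped_price \<tau> w = ennreal (lam * price (enn2real (\<tau> w)) w)"
        using lam by (simp add: stopped_price_def ennreal_mult price_def)
      then show "nn_cond_exp M (stopped_algebra M F \<tau>) f w \<le> ennreal (lam * price (enn2real (\<tau> w)) w)" using elim by simp
    qed
  qed
qed

lemma wait_cond_exp:
  assumes t: "0 \<le> t" and f: "AE w in M. f w = ennreal (lam / E0) * marg_after (ennreal t) w"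
  shows "AE w in M. ennreal (wait t w) = nn_cond_exp M (F t) f w"
proof -
  interpret S: sigma_finite_subalgebra M "F t" by (rule cond_exp_sub[OF X.subalg[OF t]])
  have fM: "f \<in> borel_measurable M"
    by (rule complete_measurable_AE[OF complete f]) (use marg_after_meas[of "\<lambda>_. ennreal t"] in \<open>simp_all\<close>)
  note [measurable] = low_adapted[OF t] g_adap[OF t] price_adapted[OF t]
  \<comment> \<open>The minimum with 0 changes nothing on the space, by \<open>low_le_g\<close>; it
    supplies the sign for all arguments, as \<open>markov_future\<close> asks.\<close>
  define e where "e w = min (low t w - g t w) 0" for w
  have eF [measurable]: "e \<in> borel_measurable (F t)" unfolding e_def by measurable
  have e0: "e w \<le> 0" for w by (simp add: e_def)
  have eM: "e \<in> borel_measurable M" by (rule X.measurable_F_M[OF eF t])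
  have fe [measurable]: "(\<lambda>w. future (e w) t w) \<in> borel_measurable M"
    by (rule future_measurable[OF eM]) (use t e0 in auto)
  have fm: "future_mean (e w) = ennreal (hedge (low t w - g t w))" for w unfolding e_def by (rule hedge(1))
  show ?thesis
  proof (rule S.nn_cond_exp_charact[OF _ fM])
    show "(\<lambda>w. ennreal (wait t w)) \<in> borel_measurable (F t)" unfolding wait_def by measurable
    fix B assume B: "B \<in> sets (F t)"
    let ?V = "\<lambda>w. indicator B w * ennreal (price t w)"
  have VF: "?V \<in> borel_measurable (F t)"
      using B by measurable
    note VM [measurable] = X.measurable_F_M[OF VF t]
    have fmM [measurable]: "(\<lambda>w. future_mean (e w)) \<in> borel_measurable M"
      unfolding fm using X.measurable_F_M[OF low_adapted[OF t] t] X.measurable_F_M[OF g_adap[OF t] t] by measurable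
    have "(\<integral>\<^sup>+w\<in>B. f w \<partial>M) = (\<integral>\<^sup>+w. ennreal (lam / E0) * (?V w * future (e w) t w) \<partial>M)"
    proof (rule nn_integral_cong_AE)
      show "AE w in M. f w * indicator B w = ennreal (lam / E0) * (?V w * future (e w) t w)"
        using f AE_space
      proof eventually_elim
        case (elim w)
        have "low t w - g t w = e w" using low_le_g[OF elim(2) t] by (simp add: e_def)
        then show ?case unfolding elim(1) marg_after_eq[OF elim(2) t] by (simp only: mult_ac)
      qed
    qed
    also have "\<dots> = ennreal (lam / E0) * (\<integral>\<^sup>+w. ?V w * future (e w) t w \<partial>M)"
      by (rule nn_integral_cmult) measurable
    also have "(\<integral>\<^sup>+w. ?V w * future (e w) t w \<partial>M)
       = (\<integral>\<^sup>+w. ?V w * future_mean (e w) \<partial>M)"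
      by (rule markov_future[OF t eF e0 VF])
    also have "ennreal (lam / E0) * \<dots> = (\<integral>\<^sup>+w. ennreal (lam / E0) * (?V w * future_mean (e w)) \<partial>M)"
      by (rule nn_integral_cmult[symmetric]) measurable
    also have "\<dots> = (\<integral>\<^sup>+w\<in>B. ennreal (wait t w) \<partial>M)"
    proof (rule nn_integral_cong)
      fix w
      have "ennreal (wait t w) = ennreal (lam / E0) * (ennreal (price t w) * future_mean (e w))"
      proof -
        have "0 \<le> price t w" by (simp add: price_def)
        with hedge(2) lamE(1) show ?thesis
          unfolding fm wait_def by (simp only: ennreal_mult mult_nonneg_nonneg less_imp_le)
      qed
      then show "ennreal (lam / E0) * (?V w * future_mean (e w)) = ennreal (wait t w) * indicator B w"
        by (simp only: mult_ac)
    qed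
    finally show "(\<integral>\<^sup>+w\<in>B. f w \<partial>M) = (\<integral>\<^sup>+w\<in>B. ennreal (wait t w) \<partial>M)" .
  qed
qed

text \<open>In terms of levels, \<open>copt\<close> grows only at times where the infimum is
  attained, and there \<open>wait\<close> equals \<open>lam * price\<close>. A general \<phi> covers
  the positive and the negative part at once.\<close>

lemma wait_flat_off:
  assumes w: "w \<in> space M" and \<phi>: "\<phi> 0 = (0::ennreal)" "\<phi> \<in> borel_measurable borel"
  shows "(\<integral>\<^sup>+t\<in>{0..}. \<phi> (wait t w - lam * price t w) \<partial>stieltjes (\<lambda>t. copt t w)) = 0"
proof -
  have ip: "increasing_path (\<lambda>t. copt t w)"
    using copt_adapted_increasing(1) w by (simp add: adapted_increasing_def)
  have [measurable]: "(\<lambda>t. price t w) \<in> borel_measurable borel"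
    "(\<lambda>t. low (max 0 t) w) \<in> borel_measurable borel" "(\<lambda>t. X t w) \<in> borel_measurable borel" "(\<lambda>t. Y t w) \<in> borel_measurable borel"
    by (rule price_measurable_at low_measurable_at X.meas_at Y.meas_at; use w in auto)+
  define f where "f t = \<phi> (lam / E0 * (price t w * hedge (low (max 0 t) w - g t w)) - lam * price t w)" for t
  have fb: "f \<in> borel_measurable borel"
    unfolding f_def g_def by (rule measurable_compose[OF _ \<phi>(2)]) measurable
  have "(\<integral>\<^sup>+t\<in>{0..}. \<phi> (wait t w - lam * price t w) \<partial>stieltjes (\<lambda>t. copt t w)) = (\<integral>\<^sup>+t\<in>{0..}. f t \<partial>stieltjes (\<lambda>t. copt t w))"
    by (intro nn_integral_cong) (simp add: f_def wait_def max_def split: split_indicator)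
  also have "\<dots> = (\<integral>\<^sup>+y. f (enn2real (level copt y w)) * indicator {y. 0 < y \<and> level copt y w < \<infinity>} y \<partial>lborel)"
    by (rule nn_integral_stieltjes[OF ip fb])
  also have "\<dots> = (\<integral>\<^sup>+y. 0 \<partial>(lborel :: real measure))"
  proof (rule nn_integral_cong_AE)
    have "AE y in lborel. 0 < y --> level copt y w < \<infinity> -->
       low (enn2real (level copt y w)) w = g (enn2real (level copt y w)) w"
      using tracking_flat[OF kappa(3) l0 w] by (simp add: copt_def[abs_def] theta_def[abs_def])
    then show "AE y in lborel. f (enn2real (level copt y w)) * indicator {y. 0 < y \<and> level copt y w < \<infinity>} y = 0"
    proof eventually_elim
      case (elim y)
      show ?case
      proof (cases "0 < y \<and> level copt y w < \<infinity>")
        case True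
        then have "f (enn2real (level copt y w)) = \<phi> 0"
          unfolding f_def using elim E0(1) by (simp add: max_def hedge_0)
        then show ?thesis using \<phi> by simp
      qed auto
    qed
  qed
  finally show ?thesis by simp
qed

text \<open>One null set serves every \<tau>, as \<tau> only restricts the domain of the time
  integral; therefore a random time may be inserted afterwards.\<close>

lemma future_marginal_optimum:
  assumes "optimal x C"
  shows "AE w in M. \<forall>\<tau>. future_utility x C \<tau> w = ennreal (lam / E0) * marg_after \<tau> w"
proof -
  from M_time.AE_pair[OF optimum(3)[OF assms]] AE_space[of M]
  show ?thesis
  proof eventually_elim
    case (elim w)
    note w = elim(2)
    have ae: "AE t in lborel. 0 \<le> t --> marginal_C n r crra weight x C t w = lam / E0 * marg t w"
      using elim(1)
    proof eventually_elim
      case (elim t)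
      show ?case
      proof
        assume "0 \<le> t"
        then have "marginal_C n r crra weight x C t w
            = exp (- r * t) * (\<Sum>i=1..n. 1 / real n * deriv (\<lambda>c. cobb_douglas \<alpha> \<beta> (exp (lx t w)) c) (exp (lc t w)))"
          using elim unfolding marginal_C_def xopt_exp copt_exp by simp
        also have "\<dots> = exp (- r * t) * (\<beta> * exp (\<alpha> * lx t w + (\<beta> - 1) * lc t w) / (\<alpha> + \<beta>))"
          unfolding deriv_cobb_douglas_public using n_pos by simp
        finally show "marginal_C n r crra weight x C t w = lam / E0 * marg t w" unfolding foc_public .
      qed
    qed
    have m: "(\<lambda>t. marg (max 0 t) w) \<in> borel_measurable borel"
      by (rule marg_measurable_at) (use w in auto)
    show ?case
    proof
      fix \<tau> :: ennreal
      note [measurable] = m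
      have "future_utility x C \<tau> w
          = (\<integral>\<^sup>+t. ennreal (lam / E0) * (ennreal (marg (max 0 t) w) * indicator {t. 0 \<le> t \<and> \<tau> \<le> ennreal t} t) \<partial>lborel)"
        unfolding future_marginal_def
      proof (rule nn_integral_cong_AE)
        show "AE t in lborel. ennreal (marginal_C n r crra weight x C t w) * indicator {t. 0 \<le> t \<and> \<tau> \<le> ennreal t} t
           = ennreal (lam / E0) * (ennreal (marg (max 0 t) w) * indicator {t. 0 \<le> t \<and> \<tau> \<le> ennreal t} t)"
          using ae
        proof eventually_elim
          case (elim t)
          show ?case
          proof (cases "0 \<le> t")
            case True
            have "ennreal (lam / E0 * marg t w) = ennreal (lam / E0) * ennreal (marg t w)"
              by (rule ennreal_mult[OF less_imp_le[OF lamE(1)]]) (simp add: marg_def)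
            then show ?thesis using elim True by (simp only: max_absorb2 mult.assoc simp_thms)
          qed simp
        qed
      qed
      also have "\<dots> = ennreal (lam / E0) * (\<integral>\<^sup>+t. ennreal (marg (max 0 t) w) * indicator {t. 0 \<le> t \<and> \<tau> \<le> ennreal t} t \<partial>lborel)"
        by (rule nn_integral_cmult) measurable
      also have "(\<integral>\<^sup>+t. ennreal (marg (max 0 t) w) * indicator {t. 0 \<le> t \<and> \<tau> \<le> ennreal t} t \<partial>lborel) = marg_after \<tau> w"
        unfolding marg_after_def by (intro nn_integral_cong) (auto simp: max_def split: split_indicator)
      finally show "future_utility x C \<tau> w = ennreal (lam / E0) * marg_after \<tau> w" .
    qed
  qed
qed

lemma private_condition:
  assumes opt: "optimal x C" and i: "i \<in> {1..n}"
  shows "AE z in MT. 0 \<le> snd z -->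
     weight i * exp (- r * snd z) * deriv (\<lambda>y. crra i y (aggregate n C (snd z) (fst z))) (x i (snd z) (fst z)) = lam * xprice (snd z) (fst z)"
  using optimum(3)[OF opt]
proof eventually_elim
  case (elim z)
  show ?case
  proof
    assume "0 \<le> snd z"
    then have "x i (snd z) (fst z) = exp (lx (snd z) (fst z))" "aggregate n C (snd z) (fst z) = exp (lc (snd z) (fst z))"
      using elim i by (auto simp: xopt_exp copt_exp)
    then show "weight i * exp (- r * snd z) * deriv (\<lambda>y. crra i y (aggregate n C (snd z) (fst z))) (x i (snd z) (fst z)) = lam * xprice (snd z) (fst z)"
      by (simp only: deriv_cobb_douglas_private foc_private)
  qed
qed

text \<open>Uniqueness of the multiplier comes from the private condition alone, in which
  \<open>xprice\<close> is positive. For existence the process required by the flat-off condition is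
  \<open>wait\<close>, and both of its integrals vanish.\<close>

lemma first_order_conditions_iff:
  assumes opt: "optimal x C"
  shows "planner_foc x C lam' \<longleftrightarrow> lam' = lam"
proof
  assume foc: "planner_foc x C lam'"
  have i: "1 \<in> {1..n}" using n by simp
  have "AE z in MT. 0 \<le> snd z -->
     weight 1 * exp (- r * snd z) * deriv (\<lambda>y. crra 1 y (aggregate n C (snd z) (fst z))) (x 1 (snd z) (fst z)) = lam' * xprice (snd z) (fst z)"
    using foc i unfolding first_order_conditions_def by (simp add: case_prod_beta)
  with private_condition[OF opt i]
  have ae: "AE z in MT. 0 \<le> snd z --> lam' * xprice (snd z) (fst z) = lam * xprice (snd z) (fst z)"
    by eventually_elim metis
  show "lam' = lam"
  proof (rule ccontr)
    assume ne: "lam' \<noteq> lam"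
    have "AE z in MT. \<not> (0::real) \<le> snd z"
      using ae by eventually_elim (use ne in \<open>auto simp: xprice_def\<close>)
    from M_time.AE_pair[OF this] have "AE w in M. AE t in lborel. \<not> (0::real) \<le> t" by simp
    then have "AE t in lborel. \<not> (0::real) \<le> t" by simp
    then have "AE t in lborel. t \<notin> {0..1::real}" by eventually_elim auto
    then have "emeasure lborel {0..1::real} = 0"
      by (subst (asm) AE_iff_measurable[where N="{0..1}"]) auto
    then show False by simp
  qed
next
  assume l: "lam' = lam"
  note fm = future_marginal_optimum[OF opt]
  have flat: "(\<integral>\<^sup>+w. (\<integral>\<^sup>+t\<in>{0..}. \<phi> (wait t w - lam * price t w) \<partial>stieltjes (\<lambda>t. aggregate n C t w)) \<partial>M) = 0"
    if \<phi>: "\<phi> 0 = (0::ennreal)" "\<phi> \<in> borel_measurable borel" for \<phi>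
  proof -
    have "(\<integral>\<^sup>+w. (\<integral>\<^sup>+t\<in>{0..}. \<phi> (wait t w - lam * price t w) \<partial>stieltjes (\<lambda>t. aggregate n C t w)) \<partial>M) = (\<integral>\<^sup>+w. 0 \<partial>M)"
    proof (rule nn_integral_cong_AE)
      show "AE w in M. (\<integral>\<^sup>+t\<in>{0..}. \<phi> (wait t w - lam * price t w) \<partial>stieltjes (\<lambda>t. aggregate n C t w)) = 0"
        using optimum(4)[OF opt] AE_space
      proof eventually_elim
        case (elim w)
        have "stieltjes (\<lambda>t. aggregate n C t w) = stieltjes (\<lambda>t. copt t w)"
          by (rule stieltjes_cong) (use elim(1) in blast)
        then show ?case using wait_flat_off[OF elim(2) \<phi>] by simp
      qed
    qed
    then show ?thesis by simp
  qed
  show "planner_foc x C lam'"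
    unfolding first_order_conditions_def l
  proof (intro conjI allI impI ballI exI[of _ wait])
    show "total_cost x C = ennreal (real n * endow)" by (rule optimum(2)[OF opt])
  next
    fix \<tau> assume \<tau>: "ext_stopping_time M F \<tau>"
    have "AE w in M. future_utility x C (\<tau> w) w = ennreal (lam / E0) * marg_after (\<tau> w) w"
      using fm by eventually_elim blast
    then show "AE w in M. \<tau> w < \<infinity> --> nn_cond_exp M (stopped_algebra M F \<tau>) (\<lambda>w'. future_utility x C (\<tau> w') w') w
         \<le> ennreal (lam * price (enn2real (\<tau> w)) w)"
      by (rule stopping_bound[OF \<tau>])
  next
    show "cadlag_adapted M F wait" by (rule wait_cadlag_adapted)
  next
    fix t :: real assume t: "0 \<le> t"
    have "AE w in M. future_utility x C (ennreal t) w = ennreal (lam / E0) * marg_after (ennreal t) w"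
      using fm by eventually_elim blast
    from wait_cond_exp[OF t this]
    show "AE w in M. 0 \<le> wait t w \<and> ennreal (wait t w) = nn_cond_exp M (F t) (future_utility x C (ennreal t)) w"
      using wait_nonneg by simp
  next
    have 1: "(\<integral>\<^sup>+w. (\<integral>\<^sup>+t\<in>{0..}. ennreal (wait t w - lam * price t w) \<partial>stieltjes (\<lambda>t. aggregate n C t w)) \<partial>M) = 0"
      by (rule flat) auto
    have 2: "(\<integral>\<^sup>+w. (\<integral>\<^sup>+t\<in>{0..}. ennreal (lam * price t w - wait t w) \<partial>stieltjes (\<lambda>t. aggregate n C t w)) \<partial>M) = 0"
      using flat[of "\<lambda>x. ennreal (- x)"] by simp
    show "(\<integral>\<^sup>+w. (\<integral>\<^sup>+t\<in>{0..}. ennreal (wait t w - lam * price t w) \<partial>stieltjes (\<lambda>t. aggregate n C t w)) \<partial>M)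
        = (\<integral>\<^sup>+w. (\<integral>\<^sup>+t\<in>{0..}. ennreal (lam * price t w - wait t w) \<partial>stieltjes (\<lambda>t. aggregate n C t w)) \<partial>M)"
      unfolding 1 2 ..
    show "(\<integral>\<^sup>+w. (\<integral>\<^sup>+t\<in>{0..}. ennreal (lam * price t w - wait t w) \<partial>stieltjes (\<lambda>t. aggregate n C t w)) \<partial>M) < \<infinity>"
      unfolding 2 by simp
  next
    fix i assume "i \<in> {1..n}"
    from private_condition[OF opt this]
    show "AE (w, t) in MT. 0 \<le> t -->
        weight i * exp (- r * t) * deriv (\<lambda>y. crra i y (aggregate n C t w)) (x i t w) = lam * xprice t w"
      by (simp add: case_prod_beta)
  qed
qed

end

section \<open>Regular modifications\<close>

lemma cadlag_cong:
  assumes eq: "\<And>t. 0 \<le> t ==> f t = h t" and h: "cadlag h"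
  shows "cadlag f"
  unfolding cadlag_def
proof (intro conjI allI impI)
  fix t :: real assume t: "0 \<le> t"
  have "\<forall>\<^sub>F s in at_right t. h s = f s"
    unfolding eventually_at_right_field using t eq by (intro exI[of _ "t + 1"]) auto
  then show "continuous (at_right t) f"
    using cadlag_right[OF h t] eq[OF t] unfolding continuous_within by (auto elim: Lim_transform_eventually)
next
  fix t :: real assume t: "0 < t"
  then obtain l where l: "(h \<longlongrightarrow> l) (at_left t)" using h by (auto simp: cadlag_def)
  have "\<forall>\<^sub>F s in at_left t. h s = f s"
    unfolding eventually_at_left_field using t eq by (intro exI[of _ 0]) auto
  with l show "\<exists>l. (f \<longlongrightarrow> l) (at_left t)" by (blast intro: Lim_transform_eventually)
qed

text \<open>Removing the drift with \<open>c\<close> equal to the Laplace exponent at 1 gives the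
  logarithm of the price process. On the null set of bad paths, and up to time 0, the value is 0,
  which yields the path properties demanded by \<open>cadlag_levy\<close>.\<close>

definition centered :: "(real => 'a => real) => real => 'a set => real => 'a => real" where
  "centered Z c N t w = (if t \<le> 0 \<or> w \<in> N then 0 else Z t w - c * t)"

lemma centered_eq:
  assumes "w \<notin> N" "Z 0 w = 0" "0 \<le> t"
  shows "centered Z c N t w = Z t w - c * t"
  using assms by (auto simp: centered_def)

text \<open>The usual conditions put the null set into \<open>F 0\<close>, so the modification stays
  adapted. Increments change by a constant outside the null set, which preserves independence from
  the past and stationarity.\<close>

lemma centered_levy:
  assumes sp: "filtered_space M F" and uc: "usual_conditions M F" and Z: "levy_process M F Z"
    and N: "N \<in> null_sets M" and reg: "\<And>w. w \<in> space M ==> w \<notin> N ==> Z 0 w = 0 \<and> cadlag (\<lambda>t. Z t w)"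
  shows "cadlag_levy M F (centered Z c N)"
proof -
  interpret prob_space M using sp by (simp add: filtered_space_def)
  have sub: "subalgebra M (F t)" if "0 \<le> t" for t using sp that by (simp add: filtered_space_def)
  have mono: "sets (F s) \<subseteq> sets (F t)" if "0 \<le> s" "s \<le> t" for s t using sp that by (simp add: filtered_space_def)
  have ZF: "Z t \<in> borel_measurable (F t)" if "0 \<le> t" for t
    using Z that by (simp add: levy_process_def adapted_def)
  have ZM [measurable]: "Z t \<in> borel_measurable M" if "0 \<le> t" for t
    by (rule measurable_from_subalg[OF sub[OF that] ZF[OF that]])
  have NF: "N \<in> sets (F t)" if "0 \<le> t" for t
  proof -
    have "N \<in> sets (F 0)" using uc N unfolding usual_conditions_def by blast
    then show ?thesis using mono[of 0 t] that by blast
  qed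
  have XF: "centered Z c N t \<in> borel_measurable (F t)" if t: "0 \<le> t" for t
  proof -
    note [measurable] = ZF[OF t] NF[OF t]
    have "(\<lambda>w. if w \<in> N then 0 else if t \<le> 0 then 0 else Z t w - c * t) \<in> borel_measurable (F t)" by measurable
    also have "(\<lambda>w. if w \<in> N then 0 else if t \<le> 0 then 0 else Z t w - c * t) = centered Z c N t"
      by (auto simp: centered_def fun_eq_iff)
    finally show ?thesis .
  qed
  have XM: "centered Z c N t \<in> borel_measurable M" if "0 \<le> t" for t
    by (rule measurable_from_subalg[OF sub[OF that] XF[OF that]])
  have nice: "AE w in M. \<forall>t\<ge>0. centered Z c N t w = Z t w - c * t"
    using AE_not_in[OF N] AE_space by eventually_elim (use reg in \<open>auto intro: centered_eq\<close>)
  show ?thesis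
  proof (intro cadlag_levy.intro cadlag_levy_axioms.intro)
    show "prob_space M" by (rule prob_space_axioms)
    show "subalgebra M (F t)" if "0 \<le> t" for t by (rule sub[OF that])
    show "sets (F s) \<subseteq> sets (F t)" if "0 \<le> s" "s \<le> t" for s t by (rule mono[OF that])
    show "centered Z c N t \<in> borel_measurable (F t)" if "0 \<le> t" for t by (rule XF[OF that])
    show "cadlag (\<lambda>t. centered Z c N t w)" if w: "w \<in> space M" for w
    proof (cases "w \<in> N")
      case True
      then show ?thesis by (simp add: centered_def cadlag_const)
    next
      case False
      have "cadlag (\<lambda>t. Z t w - c * t)"
        by (rule cadlag_compose2[of "\<lambda>z t. z - c * t", OF _ _ cadlag_ident])
          (use reg[OF w False] in \<open>auto simp: case_prod_beta intro!: continuous_intros\<close>)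
      then show ?thesis
        by (rule cadlag_cong[rotated]) (use reg[OF w False] False in \<open>auto intro: centered_eq\<close>)
    qed
    show "centered Z c N t w = 0" if "t \<le> 0" for t w using that by (simp add: centered_def)
  next
    fix s h :: real assume s: "0 \<le> s" and h: "0 \<le> h"
    define W where "W w = Z (s + h) w - Z s w" for w
    define W' where "W' w = centered Z c N (s + h) w - centered Z c N s w" for w
    have Wm [measurable]: "W \<in> borel_measurable M" unfolding W_def by (intro borel_measurable_diff ZM) (use s h in auto)
    have W'm [measurable]: "W' \<in> borel_measurable M" unfolding W'_def by (intro borel_measurable_diff XM) (use s h in auto)
    have WW: "AE w in M. W' w = W w - c * h"
      using nice
    proof eventually_elim
      case (elim w)
      have "centered Z c N (s + h) w = Z (s + h) w - c * (s + h)" "centered Z c N s w = Z s w - c * s"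
        using elim s h by auto
      then show ?case unfolding W_def W'_def by (simp add: algebra_simps)
    qed
    have lv: "indep_set (sets (F s)) {W -` B \<inter> space M |B. B \<in> sets borel}" "distr M borel W = distr M borel (Z h)"
    proof -
      have W: "W = (\<lambda>w. Z (s + h) w - Z s w)" by (rule ext) (rule W_def)
      have "s \<le> s + h" using h by simp
      then have "indep_set (sets (F s)) {W -` B \<inter> space M |B. B \<in> sets borel} \<and> distr M borel W = distr M borel (Z (s + h - s))"
        using Z s unfolding levy_process_def W by blast
      then show "indep_set (sets (F s)) {W -` B \<inter> space M |B. B \<in> sets borel}" "distr M borel W = distr M borel (Z h)"
        by (simp_all only: add_diff_cancel_left')
    qed
    show "indep_set (sets (F s)) {(\<lambda>w. centered Z c N (s + h) w - centered Z c N s w) -` B \<inter> space M |B. B \<in> sets borel}"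
      unfolding W'_def[symmetric] indep_sets2_eq
    proof (intro conjI ballI)
      show "sets (F s) \<subseteq> events" using sub[OF s] by (simp add: subalgebra_def)
      show "{W' -` B \<inter> space M |B. B \<in> sets borel} \<subseteq> events" using measurable_sets[OF W'm] by auto
      fix A D assume A: "A \<in> sets (F s)" and "D \<in> {W' -` B \<inter> space M |B. B \<in> sets borel}"
      then obtain B where B: "B \<in> sets borel" and D: "D = W' -` B \<inter> space M" by blast
      have AM [measurable]: "A \<in> events" using A sub[OF s] by (auto simp: subalgebra_def)
      define B' where "B' = (\<lambda>x. x - c * h) -` B"
      have B' [measurable]: "B' \<in> sets borel"
        using measurable_sets[of "\<lambda>x::real. x - c * h" borel borel B] B by (simp add: B'_def)
      have DM [measurable]: "D \<in> events" "W -` B' \<inter> space M \<in> events"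
        using measurable_sets[OF W'm B] measurable_sets[OF Wm B'] D by auto
      have ae: "AE w in M. w \<in> D \<longleftrightarrow> w \<in> W -` B' \<inter> space M"
        using WW AE_space by eventually_elim (simp add: D B'_def)
      have "prob (A \<inter> D) = prob (A \<inter> (W -` B' \<inter> space M))"
        by (rule finite_measure_eq_AE) (use ae in \<open>auto simp: Int_def\<close>)
      also have "\<dots> = prob A * prob (W -` B' \<inter> space M)"
        using lv(1) A B' unfolding indep_sets2_eq by blast
      also have "prob (W -` B' \<inter> space M) = prob D"
        by (rule finite_measure_eq_AE) (use ae in \<open>auto elim: AE_mp\<close>)
      finally show "prob (A \<inter> D) = prob A * prob D" .
    qed
    have [measurable]: "Z h \<in> borel_measurable M" by (rule ZM[OF h])
    have "distr M borel W' = distr M borel (\<lambda>w. W w - c * h)"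
      by (rule distr_cong_AE) (use WW in auto)
    also have "\<dots> = distr (distr M borel W) borel (\<lambda>x. x - c * h)"
      by (subst distr_distr) (auto simp: comp_def)
    also have "\<dots> = distr M borel (\<lambda>w. Z h w - c * h)"
      unfolding lv(2) by (subst distr_distr) (auto simp: comp_def)
    also have "\<dots> = distr M borel (centered Z c N h)"
      by (rule distr_cong_AE) (use nice h XM[OF h] in \<open>auto elim: AE_mp\<close>)
    finally show "distr M borel (\<lambda>w. centered Z c N (s + h) w - centered Z c N s w) = distr M borel (centered Z c N h)"
      unfolding W'_def[symmetric] .
  qed
qed

lemma (in prob_space) indep_var_cong_AE:
  assumes i: "indep_var S A T B" and m: "A' \<in> measurable M S" "B' \<in> measurable M T"
    and ae: "AE w in M. A w = A' w" "AE w in M. B w = B' w"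
  shows "indep_var S A' T B'"
proof -
  have rv: "A \<in> measurable M S" "B \<in> measurable M T" and
    d: "distr M S A \<Otimes>\<^sub>M distr M T B = distr M (S \<Otimes>\<^sub>M T) (\<lambda>x. (A x, B x))"
    using i unfolding indep_var_distribution_eq by auto
  have 1: "distr M S A' = distr M S A" by (rule distr_cong_AE) (use ae(1) m rv in auto)
  have 2: "distr M T B' = distr M T B" by (rule distr_cong_AE) (use ae(2) m rv in auto)
  have "AE w in M. (A' w, B' w) = (A w, B w)" using ae by eventually_elim simp
  then have 3: "distr M (S \<Otimes>\<^sub>M T) (\<lambda>x. (A' x, B' x)) = distr M (S \<Otimes>\<^sub>M T) (\<lambda>x. (A x, B x))"
    by (intro distr_cong_AE measurable_Pair) (use m rv in auto)
  show ?thesis unfolding indep_var_distribution_eq 1 2 3 using d m by simp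
qed

lemma centered_independent:
  assumes i: "independent_processes M Z Z'" and N: "N \<in> null_sets M"
    and L: "cadlag_levy M F (centered Z c N)" "cadlag_levy M F (centered Z' c' N)"
    and start: "\<And>w. w \<in> space M ==> w \<notin> N ==> Z 0 w = 0 \<and> Z' 0 w = 0"
  shows "independent_processes M (centered Z c N) (centered Z' c' N)"
proof -
  interpret X: cadlag_levy M F "centered Z c N" by (rule L(1))
  interpret Y: cadlag_levy M F "centered Z' c' N" by (rule L(2))
  let ?P = "\<Pi>\<^sub>M t\<in>{0::real..}. (borel :: real measure)"
  define shift where "shift c p = (\<lambda>t\<in>{0..}. p t - c * t)" for c :: real and p :: "real => real"
  have sm: "shift c \<in> measurable ?P ?P" for c
    unfolding shift_def
  proof (rule measurable_restrict)
    fix t :: real assume "t \<in> {0..}"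
    then have [measurable]: "(\<lambda>p. p t) \<in> borel_measurable ?P" by (rule measurable_component_singleton)
    show "(\<lambda>p. p t - c * t) \<in> borel_measurable ?P" by measurable
  qed
  have iv: "X.indep_var ?P (shift c \<circ> (\<lambda>w. \<lambda>t\<in>{0..}. Z t w)) ?P (shift c' \<circ> (\<lambda>w. \<lambda>t\<in>{0..}. Z' t w))"
    by (rule X.indep_var_compose[OF i[unfolded independent_processes_def] sm sm])
  have ae: "AE w in M. w \<notin> N \<and> w \<in> space M" using AE_not_in[OF N] AE_space by eventually_elim simp
  show ?thesis
    unfolding independent_processes_def
  proof (rule X.indep_var_cong_AE[OF iv])
    show "(\<lambda>w. \<lambda>t\<in>{0..}. centered Z c N t w) \<in> measurable M ?P" by (rule measurable_restrict) (rule X.meas_Z)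
    show "(\<lambda>w. \<lambda>t\<in>{0..}. centered Z' c' N t w) \<in> measurable M ?P" by (rule measurable_restrict) (rule Y.meas_Z)
    show "AE w in M. (shift c \<circ> (\<lambda>w. \<lambda>t\<in>{0..}. Z t w)) w = (\<lambda>t\<in>{0..}. centered Z c N t w)"
      using ae by eventually_elim (use start in \<open>auto simp: shift_def centered_eq fun_eq_iff restrict_def\<close>)
    show "AE w in M. (shift c' \<circ> (\<lambda>w. \<lambda>t\<in>{0..}. Z' t w)) w = (\<lambda>t\<in>{0..}. centered Z' c' N t w)"
      using ae by eventually_elim (use start in \<open>auto simp: shift_def centered_eq fun_eq_iff restrict_def\<close>)
  qed
qed

text \<open>Off the null set the drift multiplies the exponential by a constant, so the exponent
  changes by a linear term. For the drift used below, the new exponent vanishes at 1.\<close>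

lemma centered_moment:
  assumes M: "prob_space M" and m [measurable]: "Z 1 \<in> borel_measurable M" "centered Z c N 1 \<in> borel_measurable M"
    and N: "N \<in> null_sets M" and i: "exp_moments M Z"
  shows "integrable M (\<lambda>w. exp (\<xi> * centered Z c N 1 w))"
    and "ln (\<integral>w. exp (\<xi> * centered Z c N 1 w) \<partial>M) = laplace_exponent M Z \<xi> - \<xi> * c"
proof -
  interpret prob_space M by (rule M)
  have int: "integrable M (\<lambda>w. exp (\<xi> * Z 1 w))" using i by (simp add: exp_moments_def)
  have ae: "AE w in M. exp (- \<xi> * c) * exp (\<xi> * Z 1 w) = exp (\<xi> * centered Z c N 1 w)"
    using AE_not_in[OF N] by eventually_elim (simp add: centered_def exp_add[symmetric] algebra_simps)
  show "integrable M (\<lambda>w. exp (\<xi> * centered Z c N 1 w))"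
    by (rule integrable_cong_AE_imp[OF integrable_mult_right[OF int, of "exp (- \<xi> * c)"]]) (use ae in auto)
  have "(\<integral>w. exp (\<xi> * centered Z c N 1 w) \<partial>M) = (\<integral>w. exp (- \<xi> * c) * exp (\<xi> * Z 1 w) \<partial>M)"
    by (rule integral_cong_AE) (use ae in auto)
  also have "\<dots> = exp (- \<xi> * c) * (\<integral>w. exp (\<xi> * Z 1 w) \<partial>M)" by simp
  finally have e: "(\<integral>w. exp (\<xi> * centered Z c N 1 w) \<partial>M) = exp (- \<xi> * c) * (\<integral>w. exp (\<xi> * Z 1 w) \<partial>M)" .
  have "0 < (\<integral>w. exp (\<xi> * Z 1 w) \<partial>M)"
    by (rule integral_less_AE_space[of "\<lambda>_. 0", simplified]) (use int in \<open>auto simp: emeasure_space_1\<close>)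
  then show "ln (\<integral>w. exp (\<xi> * centered Z c N 1 w) \<partial>M) = laplace_exponent M Z \<xi> - \<xi> * c"
    unfolding e laplace_exponent_def by (simp add: ln_mult)
qed

text \<open>Exponential moments of independent variables multiply, so the cumulants add.\<close>

lemma (in levy_market) g_cumulant:
  assumes i: "integrable M (\<lambda>w. exp (c * Y 1 w))" "integrable M (\<lambda>w. exp (c * a * X 1 w))"
  shows "integrable M (\<lambda>w. exp (c * g 1 w))" and "G.cumulant c = Y.cumulant c + X.cumulant (c * a)"
proof -
  have "(\<lambda>p. exp (k * p 1)) \<in> borel_measurable (\<Pi>\<^sub>M t\<in>{0::real..}. (borel :: real measure))" for k :: real
  proof -
    have [measurable]: "(\<lambda>p. p 1) \<in> borel_measurable (\<Pi>\<^sub>M t\<in>{0::real..}. (borel :: real measure))"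
      by (rule measurable_component_singleton) simp
    show ?thesis by measurable
  qed
  from X.indep_var_compose[OF processes_indep[unfolded independent_processes_def] this this, of "c * a" c]
  have iv: "X.indep_var borel (\<lambda>w. exp (c * a * X 1 w)) borel (\<lambda>w. exp (c * Y 1 w))"
    by (simp add: comp_def)
  have e: "exp (c * g 1 w) = exp (c * a * X 1 w) * exp (c * Y 1 w)" for w
    by (simp add: g_def exp_add[symmetric] algebra_simps)
  show "integrable M (\<lambda>w. exp (c * g 1 w))"
    unfolding e by (rule X.indep_var_integrable[OF iv i(2,1)])
  have "X.expectation (\<lambda>w. exp (c * g 1 w)) = X.expectation (\<lambda>w. exp (c * a * X 1 w)) * X.expectation (\<lambda>w. exp (c * Y 1 w))"
    unfolding e by (rule X.indep_var_lebesgue_integral[OF iv i(2,1)])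
  then show "G.cumulant c = Y.cumulant c + X.cumulant (c * a)"
    unfolding G.cumulant_def X.cumulant_def Y.cumulant_def
    using X.expectation_exp_pos[OF i(2)] Y.expectation_exp_pos[OF i(1)] by (simp add: ln_mult)
qed

section \<open>Dependence on the price processes\<close>

lemma AE_pair_fst:
  assumes "AE w in M. P w"
  shows "AE z in M \<Otimes>\<^sub>M (lborel :: real measure). P (fst z)"
proof -
  obtain N where N: "N \<in> null_sets M" "{w \<in> space M. \<not> P w} \<subseteq> N" using assms by (rule AE_E3) blast
  show ?thesis
  proof (rule AE_I)
    show "{z \<in> space (M \<Otimes>\<^sub>M lborel). \<not> P (fst z)} \<subseteq> N \<times> (UNIV :: real set)"
      using N(2) by (auto simp: space_pair_measure)
    show "emeasure (M \<Otimes>\<^sub>M lborel) (N \<times> (UNIV :: real set)) = 0"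
      using N(1) by (subst lborel.emeasure_pair_measure_Times) auto
    show "N \<times> (UNIV :: real set) \<in> sets (M \<Otimes>\<^sub>M lborel)" using N(1) by auto
  qed
qed

lemma cost_cong:
  assumes ae: "AE w in M. \<forall>t\<ge>0. p t w = p' t w \<and> q t w = q' t w"
  shows "cost M n p q x C = cost M n p' q' x C"
  unfolding cost_def
proof (intro sum.cong refl nn_integral_cong_AE)
  fix i
  show "AE w in M. (\<integral>\<^sup>+t\<in>{0..}. ennreal (p t w * x i t w) \<partial>lborel) + (\<integral>\<^sup>+t\<in>{0..}. ennreal (q t w) \<partial>stieltjes (\<lambda>t. C i t w))
     = (\<integral>\<^sup>+t\<in>{0..}. ennreal (p' t w * x i t w) \<partial>lborel) + (\<integral>\<^sup>+t\<in>{0..}. ennreal (q' t w) \<partial>stieltjes (\<lambda>t. C i t w))"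
    using ae by eventually_elim (intro arg_cong2[where f="(+)"] nn_integral_cong; simp split: split_indicator)
qed

lemma planner_optimal_cong:
  assumes "AE w in M. \<forall>t\<ge>0. p t w = p' t w \<and> q t w = q' t w"
  shows "planner_optimal M F n r u wt p q W x C \<longleftrightarrow> planner_optimal M F n r u wt p' q' W x C"
  unfolding planner_optimal_def feasible_def cost_cong[OF assms] ..

lemma first_order_conditions_cong:
  assumes ae: "AE w in M. \<forall>t\<ge>0. p t w = p' t w \<and> q t w = q' t w"
  shows "first_order_conditions M F n r u wt p q W x C lam \<longleftrightarrow> first_order_conditions M F n r u wt p' q' W x C lam"
proof -
  have 1: "(AE w in M. \<tau> w < \<infinity> --> f w \<le> ennreal (lam * q (enn2real (\<tau> w)) w))
    \<longleftrightarrow> (AE w in M. \<tau> w < \<infinity> --> f w \<le> ennreal (lam * q' (enn2real (\<tau> w)) w))" for \<tau> f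
    by (rule eventually_subst) (use ae in \<open>eventually_elim; simp\<close>)
  have 2: "(\<integral>\<^sup>+w. (\<integral>\<^sup>+t\<in>{0..}. h (q t w) t w \<partial>stieltjes (\<lambda>t. aggregate n C t w)) \<partial>M)
     = (\<integral>\<^sup>+w. (\<integral>\<^sup>+t\<in>{0..}. h (q' t w) t w \<partial>stieltjes (\<lambda>t. aggregate n C t w)) \<partial>M)" for h :: "real => real => 'a => ennreal"
    by (rule nn_integral_cong_AE, use ae in eventually_elim) (intro nn_integral_cong; simp split: split_indicator)
  have 3: "(AE (w, t) in M \<Otimes>\<^sub>M lborel. 0 \<le> t --> f w t = lam * p t w)
    \<longleftrightarrow> (AE (w, t) in M \<Otimes>\<^sub>M lborel. 0 \<le> t --> f w t = lam * p' t w)" for f :: "'a => real => real"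
    by (rule eventually_subst) (use AE_pair_fst[OF ae] in \<open>eventually_elim; auto\<close>)
  show ?thesis
    unfolding first_order_conditions_def cost_cong[OF ae] 1 3
      2[of "\<lambda>v t w. ennreal (\<Phi> t w - lam * v)" for \<Phi>] 2[of "\<lambda>v t w. ennreal (lam * v - \<Phi> t w)" for \<Phi>]
    by (rule refl)
qed

lemma INF_exp_scaled:
  assumes "bdd_below (f ` {0..t})" "0 \<le> t" "0 \<le> c"
  shows "(INF s\<in>{0..t}. exp (c * f s)) = exp (c * running_inf f t)"
proof -
  have "exp (c * Inf (f ` {0..t})) = (INF x\<in>f ` {0..t}. exp (c * x))"
    by (rule continuous_at_Inf_mono) (use assms in \<open>auto simp: mono_def mult_left_mono intro!: continuous_intros\<close>)
  then show ?thesis by (simp add: running_inf_def image_image)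
qed

lemma SUP_exp_scaled:
  assumes "bdd_below (f ` {0..t})" "0 \<le> t" "0 \<le> c"
  shows "(SUP s\<in>{0..t}. exp (- c * f s)) = exp (- c * running_inf f t)"
proof -
  have "exp (- c * Inf (f ` {0..t})) = (SUP x\<in>f ` {0..t}. exp (- c * x))"
    by (rule continuous_at_Inf_antimono) (use assms in \<open>auto simp: antimono_def mult_left_mono intro!: continuous_intros\<close>)
  then show ?thesis by (simp add: running_inf_def image_image)
qed

section \<open>The explicit formulas in terms of running infima\<close>

context economy
begin

lemma low_path: "low t w = running_inf (\<lambda>s. Y s w + \<alpha> / (1 - \<alpha>) * X s w) t"
  by (simp add: low_def g_def)

lemma path_bdd: "w \<in> space M ==> bdd_below ((\<lambda>s. Y s w + \<alpha> / (1 - \<alpha>) * X s w) ` {0..t})"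
  using cadlag_bdd_below[OF g_cadlag, of w t] by (simp add: g_def)

text \<open>Since \<open>\<kappa> * (\<alpha> / (1 - \<alpha>))\<close> is
  \<open>\<alpha> / (1 - \<alpha> - \<beta>)\<close>, the two powers combine to
  \<open>exp (- \<kappa> * g)\<close>, and the supremum of a decreasing function of \<open>g\<close>
  is taken at its infimum.\<close>

lemma theta_path:
  assumes w: "w \<in> space M" "0 \<le> t" and p: "\<And>s. 0 \<le> s ==> ex s = exp (X s w) \<and> ec s = exp (Y s w)"
  shows "(SUP s\<in>{0..t}. ec s powr (- ((1 - \<alpha>) / (1 - \<alpha> - \<beta>))) * ex s powr (- (\<alpha> / (1 - \<alpha> - \<beta>)))) = theta t w"
proof -
  have "ec s powr (- ((1 - \<alpha>) / (1 - \<alpha> - \<beta>))) * ex s powr (- (\<alpha> / (1 - \<alpha> - \<beta>))) = exp (- \<kappa> * (Y s w + \<alpha> / (1 - \<alpha>) * X s w))"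
    if "s \<in> {0..t}" for s
  proof -
    have k: "\<kappa> * (\<alpha> / (1 - \<alpha>)) = \<alpha> / (1 - \<alpha> - \<beta>)" using ab by (simp add: \<kappa>_def)
    have "- \<kappa> * (Y s w + \<alpha> / (1 - \<alpha>) * X s w) = - \<kappa> * Y s w - (\<kappa> * (\<alpha> / (1 - \<alpha>))) * X s w" by (simp add: algebra_simps)
    then have "- \<kappa> * (Y s w + \<alpha> / (1 - \<alpha>) * X s w) = - \<kappa> * Y s w - (\<alpha> / (1 - \<alpha> - \<beta>)) * X s w" unfolding k .
    then show ?thesis using p that by (simp add: exp_powr_real \<kappa>_def exp_add[symmetric] exp_diff[symmetric] mult.commute)
  qed
  then have "(SUP s\<in>{0..t}. ec s powr (- ((1 - \<alpha>) / (1 - \<alpha> - \<beta>))) * ex s powr (- (\<alpha> / (1 - \<alpha> - \<beta>))))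
     = (SUP s\<in>{0..t}. exp (- \<kappa> * (Y s w + \<alpha> / (1 - \<alpha>) * X s w)))"
    by (intro SUP_cong refl)
  also have "\<dots> = theta t w"
    unfolding theta_def low_path by (rule SUP_exp_scaled[OF path_bdd[OF w(1)] w(2) less_imp_le[OF kappa(3)]])
  finally show ?thesis .
qed

lemma gam_path:
  assumes w: "w \<in> space M" "0 \<le> t" and p: "\<And>s. 0 \<le> s ==> ex s = exp (X s w) \<and> ec s = exp (Y s w)"
  shows "1 / A * ((\<alpha> + \<beta>) / \<alpha> * ex t * (INF s\<in>{0..t}. ec s powr (\<beta> * (1 - \<alpha>) / (1 - \<alpha> - \<beta>)) * ex s powr (\<alpha> * \<beta> / (1 - \<alpha> - \<beta>)))) powr (- (1 / (1 - \<alpha>)))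
     = gam t w"
proof -
  let ?I = "INF s\<in>{0..t}. ec s powr (\<beta> * (1 - \<alpha>) / (1 - \<alpha> - \<beta>)) * ex s powr (\<alpha> * \<beta> / (1 - \<alpha> - \<beta>))"
  have p1: "0 < 1 - \<alpha>" using ab by simp
  have "ec s powr (\<beta> * (1 - \<alpha>) / (1 - \<alpha> - \<beta>)) * ex s powr (\<alpha> * \<beta> / (1 - \<alpha> - \<beta>)) = exp (\<beta> * \<kappa> * (Y s w + \<alpha> / (1 - \<alpha>) * X s w))"
    if "s \<in> {0..t}" for s
  proof -
    have k: "\<beta> * \<kappa> * (\<alpha> / (1 - \<alpha>)) = \<alpha> * \<beta> / (1 - \<alpha> - \<beta>)" using ab by (simp add: \<kappa>_def)
    have "\<beta> * \<kappa> * (Y s w + \<alpha> / (1 - \<alpha>) * X s w) = \<beta> * \<kappa> * Y s w + (\<beta> * \<kappa> * (\<alpha> / (1 - \<alpha>))) * X s w" by (simp add: algebra_simps)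
    then have "\<beta> * \<kappa> * (Y s w + \<alpha> / (1 - \<alpha>) * X s w) = \<beta> * \<kappa> * Y s w + (\<alpha> * \<beta> / (1 - \<alpha> - \<beta>)) * X s w" unfolding k .
    then show ?thesis using p that by (simp add: exp_powr_real \<kappa>_def exp_add[symmetric] mult.commute)
  qed
  then have "?I
     = (INF s\<in>{0..t}. exp (\<beta> * \<kappa> * (Y s w + \<alpha> / (1 - \<alpha>) * X s w)))"
    by (intro INF_cong refl)
  also have "\<dots> = exp (\<beta> * \<kappa> * low t w)"
    unfolding low_path by (rule INF_exp_scaled[OF path_bdd[OF w(1)] w(2)]) (use kappa(3) ab in simp)
  finally have i: "?I = exp (\<beta> * \<kappa> * low t w)" .
  have c: "c0 = ((\<alpha> + \<beta>) / \<alpha>) powr (- (1 / (1 - \<alpha>)))"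
  proof -
    have "1 / (\<alpha> - 1) = - (1 / (1 - \<alpha>))" using p1 by (simp add: field_simps)
    then show ?thesis by (simp add: c0_def)
  qed
  have "((\<alpha> + \<beta>) / \<alpha> * ex t * exp (\<beta> * \<kappa> * low t w)) powr (- (1 / (1 - \<alpha>)))
     = c0 * exp (X t w + \<beta> * \<kappa> * low t w) powr (- (1 / (1 - \<alpha>)))"
  proof -
    have "(\<alpha> + \<beta>) / \<alpha> * ex t * exp (\<beta> * \<kappa> * low t w) = (\<alpha> + \<beta>) / \<alpha> * exp (X t w + \<beta> * \<kappa> * low t w)"
      using p[OF w(2)] by (simp add: exp_add)
    then show ?thesis unfolding c by (simp only: powr_mult)
  qed
  also have "exp (X t w + \<beta> * \<kappa> * low t w) powr (- (1 / (1 - \<alpha>))) = exp (- ((X t w + \<beta> * \<kappa> * low t w) / (1 - \<alpha>)))"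
    by (simp add: exp_powr_real)
  finally show ?thesis unfolding i gam_def by simp
qed

lemma reversed_path:
  assumes w: "w \<in> space M" "0 \<le> v" and p: "\<And>s. 0 \<le> s ==> ex s = exp (X s w) \<and> ec s = exp (Y s w)"
  shows "(INF s\<in>{0..v}. ec s * ex (v - s) powr (- (\<alpha> / (1 - \<alpha>)))) = exp (running_inf (\<lambda>s. Y s w - \<alpha> / (1 - \<alpha>) * X (v - s) w) v)"
proof -
  have e: "ec s * ex (v - s) powr (- (\<alpha> / (1 - \<alpha>))) = exp (1 * (Y s w - \<alpha> / (1 - \<alpha>) * X (v - s) w))" if "s \<in> {0..v}" for s
    using p[of s] p[of "v - s"] that by (simp add: exp_powr_real exp_diff exp_minus field_simps)
  have "cadlag (\<lambda>t. \<alpha> / (1 - \<alpha>) * X t w)"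
    by (rule cadlag_compose[OF _ X.cad[OF w(1)]]) (intro continuous_intros)
  from cadlag_bounded[OF this, of v] cadlag_bounded[OF Y.cad[OF w(1)], of v]
  obtain B B' where B: "\<forall>t\<in>{0..v}. \<bar>Y t w\<bar> \<le> B" "\<forall>t\<in>{0..v}. \<bar>\<alpha> / (1 - \<alpha>) * X t w\<bar> \<le> B'"
    by blast
  have "- B - B' \<le> Y s w - \<alpha> / (1 - \<alpha>) * X (v - s) w" if "s \<in> {0..v}" for s
  proof -
    have "\<bar>Y s w\<bar> \<le> B" using B(1) that by blast
    moreover have "\<bar>\<alpha> / (1 - \<alpha>) * X (v - s) w\<bar> \<le> B'" by (rule B(2)[rule_format]) (use that in auto)
    ultimately show ?thesis by linarith
  qed
  then have bd: "bdd_below ((\<lambda>s. Y s w - \<alpha> / (1 - \<alpha>) * X (v - s) w) ` {0..v})" by (intro bdd_belowI2)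
  have "(INF s\<in>{0..v}. ec s * ex (v - s) powr (- (\<alpha> / (1 - \<alpha>)))) = (INF s\<in>{0..v}. exp (1 * (Y s w - \<alpha> / (1 - \<alpha>) * X (v - s) w)))"
    by (rule INF_cong[OF refl e])
  also have "\<dots> = exp (1 * running_inf (\<lambda>s. Y s w - \<alpha> / (1 - \<alpha>) * X (v - s) w) v)"
    by (rule INF_exp_scaled[OF bd w(2)]) simp
  finally show ?thesis by simp
qed

end

text \<open>Proved through simple functions below \<open>f\<close>, so that it applies to integrands
  such as an infimum over a continuum of times.\<close>

lemma nn_integral_cmult_le: "c * (\<integral>\<^sup>+x. f x \<partial>M) \<le> (\<integral>\<^sup>+x. c * f x \<partial>M)"
  unfolding nn_integral_def[of M f] SUP_mult_left_ennreal
proof (rule SUP_least)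
  fix s assume "s \<in> {s. simple_function M s \<and> s \<le> f}"
  then have s: "simple_function M s" "\<And>x. s x \<le> f x" by (auto simp: le_fun_def)
  have "c * integral\<^sup>S M s = (\<integral>\<^sup>+x. c * s x \<partial>M)"
    using s(1) by (simp add: nn_integral_eq_simple_integral[symmetric] nn_integral_cmult borel_measurable_simple_function)
  also have "\<dots> \<le> (\<integral>\<^sup>+x. c * f x \<partial>M)" by (intro nn_integral_mono mult_left_mono s(2)) simp
  finally show "c * integral\<^sup>S M s \<le> (\<integral>\<^sup>+x. c * f x \<partial>M)" .
qed

lemma nn_integral_cmult_positive:
  assumes c: "0 < c"
  shows "(\<integral>\<^sup>+x. ennreal c * f x \<partial>M) = ennreal c * (\<integral>\<^sup>+x. f x \<partial>M)"
proof (rule antisym)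
  have i: "ennreal c * (ennreal (1 / c) * z) = z" "ennreal (1 / c) * (ennreal c * z) = z" for z
    using c by (simp_all add: mult.assoc[symmetric] ennreal_mult[symmetric])
  have "(\<integral>\<^sup>+x. ennreal c * f x \<partial>M) = ennreal c * (ennreal (1 / c) * (\<integral>\<^sup>+x. ennreal c * f x \<partial>M))" by (rule i(1)[symmetric])
  also have "\<dots> \<le> ennreal c * (\<integral>\<^sup>+x. ennreal (1 / c) * (ennreal c * f x) \<partial>M)"
    by (intro mult_left_mono nn_integral_cmult_le) simp
  finally show "(\<integral>\<^sup>+x. ennreal c * f x \<partial>M) \<le> ennreal c * (\<integral>\<^sup>+x. f x \<partial>M)" by (simp only: i(2))
qed (rule nn_integral_cmult_le)

theorem proposition5p3:
  fixes M :: "'a measure" and F :: "real \<Rightarrow> 'a measure"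
    and n :: nat and r w\<^sub>o \<alpha> \<beta> :: real
    and Zx Zc Ex Ec \<psi>x \<psi>c :: "real \<Rightarrow> 'a \<Rightarrow> real"
    and \<pi>x \<pi>c :: "real \<Rightarrow> real"
    and \<pi>hat2 \<pi>tilde1 \<delta> A l\<^sub>0 lam_opt :: real
    and \<gamma> \<theta> :: "real \<Rightarrow> 'a \<Rightarrow> real"
    and EA El :: ennreal
    and u :: "nat \<Rightarrow> real \<Rightarrow> real \<Rightarrow> real" and wt :: "nat \<Rightarrow> real"
  assumes space: "filtered_space M F" "usual_conditions M F"
    and n: "1 \<le> n" and wealth: "0 < w\<^sub>o"
    and ab: "0 < \<alpha>" "\<alpha> < 1" "0 < \<beta>" "\<beta> < 1" "\<alpha> + \<beta> < 1"
    and levy: "levy_process M F Zx" "levy_process M F Zc"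
    and indep: "independent_processes M Zx Zc"
    and moments: "exp_moments M Zx" "exp_moments M Zc"
    and laplace: "\<pi>x = laplace_exponent M Zx" "\<pi>c = laplace_exponent M Zc"
    and Ex: "\<And>t \<omega>. Ex t \<omega> = exp (Zx t \<omega> - \<pi>x 1 * t)"
    and Ec: "\<And>t \<omega>. Ec t \<omega> = exp (Zc t \<omega> - \<pi>c 1 * t)"
    and \<psi>x: "\<And>t \<omega>. \<psi>x t \<omega> = exp (- r * t) * Ex t \<omega>"
    and \<psi>c: "\<And>t \<omega>. \<psi>c t \<omega> = exp (- r * t) * Ec t \<omega>"
    and \<pi>hat2: "\<pi>hat2 =
      2 / (1 - \<alpha> - \<beta>) * (\<beta> * \<pi>c 1 + \<alpha> * \<beta> / (1 - \<alpha>) * \<pi>x 1)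
      + \<pi>c (- (2 * \<beta> / (1 - \<alpha> - \<beta>)))
      + \<pi>x (- (2 * \<alpha> * \<beta> / ((1 - \<alpha>) * (1 - \<alpha> - \<beta>))))"
    and \<pi>tilde1: "\<pi>tilde1 =
      1 / (1 - \<alpha> - \<beta>) * (\<beta> * \<pi>c 1 + \<alpha> * \<pi>x 1)
      + \<pi>c (- (\<beta> / (1 - \<alpha> - \<beta>)))
      + \<pi>x (- (\<alpha> / (1 - \<alpha> - \<beta>)))"
    and rate: "r > Max {0,
      \<alpha> / (1 - \<alpha>) * \<pi>x 1,
      \<alpha> / (1 - \<alpha>) * \<pi>x 1 + \<pi>x (- (2 * \<alpha> / (1 - \<alpha>))),
      \<pi>hat2 + \<alpha> / (1 - \<alpha>) * \<pi>x 1,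
      \<pi>tilde1}"
    and \<delta>: "\<delta> = \<beta> / \<alpha> * ((\<alpha> + \<beta>) / \<alpha>) powr (1 / (\<alpha> - 1))"
    and EA: "EA = (\<integral>\<^sup>+\<omega>. (\<integral>\<^sup>+v\<in>{0..}. ennreal (\<delta> * exp (- r * v) *
      (INF s\<in>{0..v}. Ec s \<omega> * Ex (v - s) \<omega> powr (- (\<alpha> / (1 - \<alpha>))))) \<partial>lborel) \<partial>M)"
    and A: "A = enn2real EA"
    and \<gamma>: "\<And>t \<omega>. \<gamma> t \<omega> = 1 / A * ((\<alpha> + \<beta>) / \<alpha> * Ex t \<omega> *
      (INF s\<in>{0..t}. Ec s \<omega> powr (\<beta> * (1 - \<alpha>) / (1 - \<alpha> - \<beta>)) *
                      Ex s \<omega> powr (\<alpha> * \<beta> / (1 - \<alpha> - \<beta>)))) powr (- (1 / (1 - \<alpha>)))"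
    and \<theta>: "\<And>t \<omega>. \<theta> t \<omega> =
      (SUP s\<in>{0..t}. Ec s \<omega> powr (- ((1 - \<alpha>) / (1 - \<alpha> - \<beta>))) *
                      Ex s \<omega> powr (- (\<alpha> / (1 - \<alpha> - \<beta>))))"
    and El: "El = (\<integral>\<^sup>+\<omega>.
      (\<integral>\<^sup>+t\<in>{0..}. ennreal (\<psi>x t \<omega> * \<gamma> t \<omega>) \<partial>lborel) +
      (\<integral>\<^sup>+t\<in>{0..}. ennreal (\<psi>c t \<omega>) \<partial>stieltjes (\<lambda>t. \<theta> t \<omega>)) \<partial>M)"
    and l0: "l\<^sub>0 = real n * w\<^sub>o / enn2real El"
    and lam_opt: "lam_opt = 1 / real n powr \<alpha> * A powr (1 - \<alpha>) * l\<^sub>0 powr (\<alpha> + \<beta> - 1)"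
    and u: "\<And>i. u i = cobb_douglas \<alpha> \<beta>"
    and wt: "\<And>i. wt i = 1 / real n"
  shows "0 < EA \<and> EA < \<infinity> \<and> 0 < El \<and> El < \<infinity> \<and>
    (\<exists>x C. planner_optimal M F n r u wt \<psi>x \<psi>c (real n * w\<^sub>o) x C) \<and>
    (\<forall>x C. planner_optimal M F n r u wt \<psi>x \<psi>c (real n * w\<^sub>o) x C \<longrightarrow>
       (AE \<omega> in M. \<forall>t\<ge>0. aggregate n C t \<omega> = l\<^sub>0 * \<theta> t \<omega>) \<and>
       (\<forall>i\<in>{1..n}. AE (\<omega>, t) in M \<Otimes>\<^sub>M lborel. 0 \<le> t \<longrightarrow>
          x i t \<omega> = 1 / real n * l\<^sub>0 * \<gamma> t \<omega>) \<and>
       (\<forall>lam>0. first_order_conditions M F n r u wt \<psi>x \<psi>c (real n * w\<^sub>o) x C lam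
                  \<longleftrightarrow> lam = lam_opt))"
proof -
  define a where "a = \<alpha> / (1 - \<alpha>)"
  define q where "q = \<beta> / (1 - \<alpha> - \<beta>)"
  have pos: "0 < 1 - \<alpha>" "0 < 1 - \<alpha> - \<beta>" using ab by auto
  have q: "0 < q" using ab pos by (simp add: q_def)
  have M: "prob_space M" using space(1) by (simp add: filtered_space_def)
  \<comment> \<open>A single null set collects the bad paths of both processes.\<close>
  have "AE w in M. (Zx 0 w = 0 \<and> cadlag (\<lambda>t. Zx t w)) \<and> (Zc 0 w = 0 \<and> cadlag (\<lambda>t. Zc t w))"
    using levy(1)[unfolded levy_process_def, THEN conjunct2, THEN conjunct1]
      levy(2)[unfolded levy_process_def, THEN conjunct2, THEN conjunct1]
    by eventually_elim (rule conjI)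
  then obtain N where N: "N \<in> null_sets M"
    and reg: "\<And>w. w \<in> space M ==> w \<notin> N ==> (Zx 0 w = 0 \<and> cadlag (\<lambda>t. Zx t w)) \<and> (Zc 0 w = 0 \<and> cadlag (\<lambda>t. Zc t w))"
    by (rule AE_E3) blast
  define X where "X = centered Zx (\<pi>x 1) N"
  define Y where "Y = centered Zc (\<pi>c 1) N"
  have L: "cadlag_levy M F X" "cadlag_levy M F Y"
    unfolding X_def Y_def
    by (rule centered_levy[OF space levy(1) N], rule conjunct1[OF reg], assumption+)
      (rule centered_levy[OF space levy(2) N], rule conjunct2[OF reg], assumption+)
  have I: "independent_processes M X Y"
    unfolding X_def Y_def
    by (rule centered_independent[OF indep N L[unfolded X_def Y_def]]) (use reg in auto)
  interpret P: levy_market M F X Y a r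
    by (intro levy_market.intro levy_pair.intro levy_pair_axioms.intro L I)
  have Z1: "Zx 1 \<in> borel_measurable M" "Zc 1 \<in> borel_measurable M"
  proof -
    have s: "subalgebra M (F 1)" by (rule P.X.subalg) simp
    show "Zx 1 \<in> borel_measurable M"
      by (rule measurable_from_subalg[OF s levy(1)[unfolded levy_process_def adapted_def, THEN conjunct1, rule_format]]) simp
    show "Zc 1 \<in> borel_measurable M"
      by (rule measurable_from_subalg[OF s levy(2)[unfolded levy_process_def adapted_def, THEN conjunct1, rule_format]]) simp
  qed
  have mX: "integrable M (\<lambda>w. exp (\<xi> * X 1 w))" "P.X.cumulant \<xi> = \<pi>x \<xi> - \<xi> * \<pi>x 1" for \<xi>
  proof -
    note cm = centered_moment[OF M Z1(1) P.X.meas_Z[of 1, unfolded X_def] N moments(1), folded X_def, of \<xi>]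
    show "integrable M (\<lambda>w. exp (\<xi> * X 1 w))" by (rule cm(1))
    show "P.X.cumulant \<xi> = \<pi>x \<xi> - \<xi> * \<pi>x 1"
      unfolding P.X.cumulant_def cm(2) laplace(1)[symmetric] by (rule refl)
  qed
  have mY: "integrable M (\<lambda>w. exp (\<xi> * Y 1 w))" "P.Y.cumulant \<xi> = \<pi>c \<xi> - \<xi> * \<pi>c 1" for \<xi>
  proof -
    note cm = centered_moment[OF M Z1(2) P.Y.meas_Z[of 1, unfolded Y_def] N moments(2), folded Y_def, of \<xi>]
    show "integrable M (\<lambda>w. exp (\<xi> * Y 1 w))" by (rule cm(1))
    show "P.Y.cumulant \<xi> = \<pi>c \<xi> - \<xi> * \<pi>c 1"
      unfolding P.Y.cumulant_def cm(2) laplace(2)[symmetric] by (rule refl)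
  qed
  have rates: "0 < r" "a * \<pi>x 1 < r" "a * \<pi>x 1 + \<pi>x (- (2 * a)) < r" "\<pi>hat2 + a * \<pi>x 1 < r"
    using rate by (auto simp: a_def)
  have qa: "2 * \<alpha> * \<beta> / ((1 - \<alpha>) * (1 - \<alpha> - \<beta>)) = 2 * q * a" by (simp add: q_def a_def mult_ac)
  have hat: "\<pi>hat2 = 2 * q * \<pi>c 1 + 2 * q * a * \<pi>x 1 + \<pi>c (- (2 * q)) + \<pi>x (- (2 * q * a))"
  proof -
    have "2 / (1 - \<alpha> - \<beta>) * (\<beta> * \<pi>c 1 + \<alpha> * \<beta> / (1 - \<alpha>) * \<pi>x 1) = 2 * q * \<pi>c 1 + 2 * q * a * \<pi>x 1"
      by (simp add: q_def a_def add_divide_distrib distrib_left mult_ac)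
    moreover have "2 * \<beta> / (1 - \<alpha> - \<beta>) = 2 * q" by (simp add: q_def)
    ultimately show ?thesis unfolding \<pi>hat2 qa by simp
  qed
  \<comment> \<open>The drifts removed from the two processes supply the linear terms of
    \<open>\<pi>hat2\<close>.\<close>
  have gc: "P.G.cumulant (- 2 * q) = \<pi>hat2"
    using P.g_cumulant(2)[of "- 2 * q", OF mY(1) mX(1)] by (simp add: hat mX(2) mY(2))
  \<comment> \<open>The rate is divided at \<open>(r + a * \<pi>x 1) / 2\<close>. Doubling the parts
    then turns the two cumulant conditions into the third and fourth bounds on \<open>r\<close>, and
    positivity of the second part into the second bound.\<close>
  have fin: "(\<integral>\<^sup>+w. (\<integral>\<^sup>+t\<in>{0..}. ennreal (exp (- r * t - a * X t w - q * P.low t w)) \<partial>lborel) \<partial>M) < \<infinity>"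
  proof (rule P.tracking_integral_finite[OF _ _ q])
    show "integrable M (\<lambda>w. exp (c * P.g 1 w))" for c by (rule P.g_cumulant(1)) (rule mX mY)+
    show "integrable M (\<lambda>w. exp (- 2 * a * X 1 w))" by (rule mX)
    show "(r + a * \<pi>x 1) / 2 + (r - a * \<pi>x 1) / 2 = r" by (simp add: field_simps)
    show "P.X.cumulant (- 2 * a) < 2 * ((r + a * \<pi>x 1) / 2)" using rates(3) by (simp add: mX)
    show "P.G.cumulant (- 2 * q) < 2 * ((r - a * \<pi>x 1) / 2)" unfolding gc using rates(4) by simp
    show "0 < (r - a * \<pi>x 1) / 2" using rates(2) by simp
  qed
  \<comment> \<open>The cumulant is in fact 0: after removal of the drift,
    \<open>exp (Y 1 w)\<close> has mean 1.\<close>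
  have "P.Y.cumulant 1 \<le> 0" by (simp add: mY)
  note fmb = P.future_mean_bounds[OF mY(1) this rates(1)]
  interpret E: economy M F X Y \<alpha> r \<beta> w\<^sub>o n
    using fmb fin space(2) ab n wealth P.levy_market_axioms
    by (intro economy.intro economy_axioms.intro) (auto simp: usual_conditions_def a_def q_def)
  have nice: "AE w in M. w \<in> space M \<and> w \<notin> N" using AE_not_in[OF N] AE_space by eventually_elim simp
  have path: "Ex t w = exp (X t w) \<and> Ec t w = exp (Y t w)" if "w \<in> space M \<and> w \<notin> N" "0 \<le> t" for t w
    using that reg[of w] unfolding X_def Y_def Ex Ec by (simp add: centered_eq)
  have EA_eq: "EA = ennreal E.A"
  proof -
    have \<delta>0: "\<delta> = \<beta> / \<alpha> * E.c0" by (simp add: \<delta> E.c0_def)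
    have d: "0 < \<delta>" unfolding \<delta>0 using ab E.c0 by simp
    let ?J = "\<lambda>w v. exp (running_inf (\<lambda>s. Y s w - \<alpha> / (1 - \<alpha>) * X (v - s) w) v)"
    have "EA = (\<integral>\<^sup>+w. ennreal \<delta> * (\<integral>\<^sup>+v\<in>{0..}. ennreal (exp (- r * v)) * ennreal (?J w v) \<partial>lborel) \<partial>M)"
      unfolding EA
    proof (rule nn_integral_cong_AE)
      show "AE w in M. (\<integral>\<^sup>+v\<in>{0..}. ennreal (\<delta> * exp (- r * v) * (INF s\<in>{0..v}. Ec s w * Ex (v - s) w powr (- (\<alpha> / (1 - \<alpha>))))) \<partial>lborel)
        = ennreal \<delta> * (\<integral>\<^sup>+v\<in>{0..}. ennreal (exp (- r * v)) * ennreal (?J w v) \<partial>lborel)"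
        using nice
      proof eventually_elim
        case (elim w)
        have "(INF s\<in>{0..v}. Ec s w * Ex (v - s) w powr (- (\<alpha> / (1 - \<alpha>)))) = ?J w v" if "0 \<le> v" for v
          by (rule E.reversed_path) (use elim that path[OF elim] in auto)
        then show ?case
          unfolding nn_integral_cmult_positive[OF d, symmetric]
          by (intro nn_integral_cong) (use d in \<open>simp add: ennreal_mult mult.assoc split: split_indicator\<close>)
      qed
    qed
    also have "\<dots> = ennreal \<delta> * ennreal E.E0"
      unfolding nn_integral_cmult_positive[OF d] E.reversed_future_mean E.E0(2) ..
    also have "\<dots> = ennreal E.A" using d E.E0(1) by (simp add: E.A_def \<delta>0 ennreal_mult[symmetric])
    finally show ?thesis .
  qed
  then have A_eq: "A = E.A" using E.A by (simp add: A)
  have ae: "AE w in M. \<forall>t\<ge>0. \<psi>x t w = E.xprice t w \<and> \<psi>c t w = E.price t w"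
    using nice by eventually_elim (simp add: \<psi>x \<psi>c path E.xprice_def E.price_def exp_add[symmetric])
  have gam: "\<gamma> t w = E.gam t w" and theta: "\<theta> t w = E.theta t w" if "w \<in> space M \<and> w \<notin> N" "0 \<le> t" for t w
  proof -
    have w: "w \<in> space M" using that by blast
    note p = path[OF that(1)]
    show "\<gamma> t w = E.gam t w" unfolding \<gamma> A_eq by (rule E.gam_path[OF w that(2) p])
    show "\<theta> t w = E.theta t w" unfolding \<theta> by (rule E.theta_path[OF w that(2) p])
  qed
  have El_eq: "El = ennreal E.El"
    unfolding El E.El_eq[symmetric]
  proof (rule nn_integral_cong_AE)
    show "AE w in M. (\<integral>\<^sup>+t\<in>{0..}. ennreal (\<psi>x t w * \<gamma> t w) \<partial>lborel) + (\<integral>\<^sup>+t\<in>{0..}. ennreal (\<psi>c t w) \<partial>stieltjes (\<lambda>t. \<theta> t w))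
      = (\<integral>\<^sup>+t\<in>{0..}. ennreal (E.xprice t w * E.gam t w) \<partial>lborel) + (\<integral>\<^sup>+t\<in>{0..}. ennreal (E.price t w) \<partial>stieltjes (\<lambda>t. E.theta t w))"
      using ae nice
    proof eventually_elim
      case (elim w)
      have "stieltjes (\<lambda>t. \<theta> t w) = stieltjes (\<lambda>t. E.theta t w)" by (rule stieltjes_cong) (rule theta[OF elim(2)])
      then show ?case
        using elim(1) gam[OF elim(2)]
        by (intro arg_cong2[where f="(+)"]) (auto intro!: nn_integral_cong split: split_indicator)
    qed
  qed
  have l0_eq: "l\<^sub>0 = E.l0" using E.El by (simp add: l0 El_eq E.l0_def)
  have lam_eq: "lam_opt = E.lam" by (simp add: lam_opt A_eq l0_eq E.lam_def)
  have u': "u = E.crra" and wt': "wt = E.weight" by (rule ext, rule u) (rule ext, rule wt)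
  have po: "planner_optimal M F n r u wt \<psi>x \<psi>c (real n * w\<^sub>o) x C \<longleftrightarrow>
      planner_optimal M F n r E.crra E.weight E.xprice E.price (real n * w\<^sub>o) x C" for x C
    unfolding u' wt' by (rule planner_optimal_cong[OF ae])
  show ?thesis
  proof (intro conjI allI impI ballI)
    show "0 < EA" "EA < \<infinity>" "0 < El" "El < \<infinity>" using E.A E.El by (simp_all add: EA_eq El_eq)
    show "\<exists>x C. planner_optimal M F n r u wt \<psi>x \<psi>c (real n * w\<^sub>o) x C"
      unfolding po using E.canonical_optimal by blast
  next
    fix x C assume "planner_optimal M F n r u wt \<psi>x \<psi>c (real n * w\<^sub>o) x C"
    then have opt: "planner_optimal M F n r E.crra E.weight E.xprice E.price (real n * w\<^sub>o) x C" unfolding po .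
    show "AE w in M. \<forall>t\<ge>0. aggregate n C t w = l\<^sub>0 * \<theta> t w"
      using E.optimum(4)[OF opt] nice by eventually_elim (simp add: theta l0_eq E.copt_def)
    show "AE (w, t) in M \<Otimes>\<^sub>M lborel. 0 \<le> t --> x i t w = 1 / real n * l\<^sub>0 * \<gamma> t w" if i: "i \<in> {1..n}" for i
    proof -
      have "AE z in M \<Otimes>\<^sub>M lborel. 0 \<le> snd z --> x i (snd z) (fst z) = 1 / real n * l\<^sub>0 * \<gamma> (snd z) (fst z)"
        using E.optimum(3)[OF opt] AE_pair_fst[OF nice]
      proof eventually_elim
        case (elim z)
        then show ?case using i gam[OF elim(2)] by (auto simp: l0_eq E.xopt_def)
      qed
      then show ?thesis by (simp add: case_prod_beta)
    qed
    show "first_order_conditions M F n r u wt \<psi>x \<psi>c (real n * w\<^sub>o) x C lam = (lam = lam_opt)" if "0 < lam" for lam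
      unfolding u' wt' first_order_conditions_cong[OF ae] lam_eq by (rule E.first_order_conditions_iff[OF opt])
  qed
qed

end
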